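(* Let $\mathbb T$ be a geometric first-order theory of signature $\Sigma$. Let $\Sigma_r$ be the relational signature associated with $\Sigma$ and $\mathbb T_r^\Sigma$ the cartesian theory of signature $\Sigma_r$ obtained by replacing each function symbol $f:A_1\cdots A_n\to B$ of $\Sigma$ by a relation symbol $R_f\rightarrowtail A_1\cdots A_n\,B$ of $\Sigma_r$ together with the two axioms $$R_f(x_1^{A_1},\dots,x_n^{A_n},x_B)\wedge R_f(x_1^{A_1},\dots,x_n^{A_n},x'_B)\vdash x_B=x'_B,$$ $$\top(x_1^{A_1},\dots,x_n^{A_n})\vdash(\exists x_B)\,R_f(x_1^{A_1},\dots,x_n^{A_n},x_B).$$ Let $\mathbb T_r$ be the geometric theory of signature $\Sigma_r$ obtained from $\mathbb T_r^\Sigma$ by adding the axioms $\varphi_i^r(\vec x_i)\vdash\psi_i^r(\vec x_i)$ deduced from the axioms $\varphi_i(\vec x_i)\vdash\psi_i(\vec x_i)$, $i\in I$, of $\mathbb T$ by replacing the formulas $\varphi_i,\psi_i$ by the geometric formulas of $\Sigma_r$ associated to them by the translation procedure from $\Sigma$ to $\mathbb T_r^\Sigma$. Then: (i) The translation procedure from $\Sigma$ to $\mathbb T_r^\Sigma$ defines a functor between syntactic categories $\mathcal C_{\mathbb T}\to\mathcal C_{\mathbb T_r}$ which is an equivalence of categories. (ii) If $\mathbb T$ is a coherent [resp. regular, resp. cartesian] theory, its relational translation $\mathbb T_r$ is also coherent [resp. regular, resp. cartesian], and the equivalence of (i) restricts to an equivalence $$\mathcal C_{\mathbb T}^{\rm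 coh}\to\mathcal C_{\mathbb T_r}^{\rm coh}\quad[\text{resp. }\mathcal C_{\mathbb T}^{\rm reg}\to\mathcal C_{\mathbb T_r}^{\rm reg},\ \text{resp. }\mathcal C_{\mathbb T}^{\rm car}\to\mathcal C_{\mathbb T_r}^{\rm car}].$$
   Context: A signature consists of sorts, function symbols and relation symbols. Geometric formulas are built from atomic formulas using $\top$, finite $\wedge$, $\exists$, $\bot$, arbitrary set-indexed $\bigvee$ (coherent: only finite $\vee$; regular: only $\top,\wedge,\exists$; Horn: only $\top,\wedge$). A theory is geometric/coherent/regular if its axioms are sequents between such formulas. A $\mathbb T$-cartesian formula is $(\exists\vec y)\varphi(\vec x,\vec y)$ with $\varphi$ Horn and $\varphi(\vec x,\vec y)\wedge\varphi(\vec x,\vec y\,')\vdash\vec y=\vec y\,'$ provable in $\mathbb T$; a theory is cartesian if it can be defined by axioms which are sequents between $\mathbb T$-cartesian formulas. The syntactic category $\mathcal C_{\mathbb T}$ has as objects geometric formulas $\varphi(\vec x)$ (up to renaming variables) and as morphisms $\varphi(\vec x)\to\psi(\vec y)$ the ($\mathbb T$-provable equivalence classes of) geometric formulas $\theta(\vec x,\vec y)$ that are $\mathbb T$-provably functional ($\theta\vdash\varphi\wedge\psi$, $\varphi\vdash(\exists\vec y)\theta$, $\theta(\vec x,\vec y)\wedge\theta(\vec x,\vec y\,')\vdash\vec y=\vec y\,'$); composition of $\theta(\vec x,\vec y)$ and $\theta'(\vec y,\vec z)$ is $(\exists\vec y)(\theta\wedge\theta')$. $\mathcal C^{\rm coh}_{\mathbb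 T}$, $\mathcal C^{\rm reg}_{\mathbb T}$, $\mathcal C^{\rm car}_{\mathbb T}$ are defined in the same way using only coherent, regular, $\mathbb T$-cartesian formulas respectively. The signature $\Sigma_r$ is obtained from $\Sigma$ by keeping its sorts and relation symbols and replacing every function symbol $f$ by $R_f$. Translation procedure: (1) for each term $g(\vec x)=f(g_1(\vec x),\dots,g_m(\vec x))$ with $f:B_1\cdots B_m\to B$, introduce variables $z_g^B,z_{g_1}^{B_1},\dots,z_{g_m}^{B_m}$ and the atomic formula $R_f(z_{g_1}^{B_1},\dots,z_{g_m}^{B_m},z_g^B)$, together with $z_{g_j}^{B_j}=x_i^{A_i}$ whenever $g_j(\vec x)$ is the variable $x_i^{A_i}$. (2) An atomic formula $g_1(\vec x)=g_2(\vec x)$ or $R(g_1(\vec x),\dots,g_n(\vec x))$ is translated by introducing a variable $z_g$ for each term $g$ appearing in the construction of the terms $g_i$, forming the conjunction of all formulas of (1) and of $z_{g_1}=z_{g_2}$, resp. $R(z_{g_1},\dots,z_{g_n})$, and existentially quantifying all the variables $z_g$; the result is a $\mathbb T_r^\Sigma$-cartesian formula in $\vec x$. (3) A general geometric formula $\varphi(\vec x)$ is translated to $\varphi^r(\vec x)$ by replacing each atomic formula entering in its construction by its translation, keeping the logical connectives and quantifiers. *)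

theory Defs
  imports Main
begin

section \<open>Signatures, terms, geometric formulas\<close>

text \<open>Carrier sets are explicit, so that a signature may have no sorts, no function symbols or no
  relation symbols.\<close>

record ('s, 'f, 'r) signature =
  sorts :: "'s set"
  funs :: "'f set"
  rels :: "'r set"
  fdom :: "'f \<Rightarrow> 's list"
  fcod :: "'f \<Rightarrow> 's"
  rdom :: "'r \<Rightarrow> 's list"

definition wf_signature :: "('s, 'f, 'r) signature \<Rightarrow> bool" where
  "wf_signature \<Sigma> \<longleftrightarrow>
     (\<forall>f \<in> funs \<Sigma>. set (fdom \<Sigma> f) \<subseteq> sorts \<Sigma> \<and> fcod \<Sigma> f \<in> sorts \<Sigma>) \<and>
     (\<forall>R \<in> rels \<Sigma>. set (rdom \<Sigma> R) \<subseteq> sorts \<Sigma>)"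

text \<open>Variables are de Bruijn indices: a context is the list of sorts of the variables
  \<open>0, 1, \<dots>\<close>, and \<open>Ex A \<phi>\<close> in context \<open>\<Gamma>\<close> has its body \<open>\<phi>\<close> in context
  \<open>A # \<Gamma>\<close>. A formula in context thus represents exactly one class of formulas
  \<open>\<phi>(x\<^sub>1, \<dots>, x\<^sub>n)\<close> up to renaming of variables, free or bound.

  \<open>Disj I F\<close> is the disjunction of the family \<open>(F i)\<close> for \<open>i \<in> I\<close> (values outside \<open>I\<close>
  are irrelevant). The type \<open>'i\<close>, of which all index sets are subsets, is arbitrary. Binary
  and empty disjunction are separate constructors, so that coherent formulas do not depend
  on \<open>'i\<close>.\<close>

datatype 'f trm = Var nat | Fn 'f "'f trm list"

datatype ('s, 'f, 'r, 'i) fm =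
    Eq "'f trm" "'f trm"
  | Rel 'r "'f trm list"
  | Top
  | And "('s, 'f, 'r, 'i) fm" "('s, 'f, 'r, 'i) fm"
  | Bot
  | Or "('s, 'f, 'r, 'i) fm" "('s, 'f, 'r, 'i) fm"
  | Disj "'i set" "'i \<Rightarrow> ('s, 'f, 'r, 'i) fm"
  | Ex 's "('s, 'f, 'r, 'i) fm"

inductive wt :: "('s, 'f, 'r) signature \<Rightarrow> 's list \<Rightarrow> 'f trm \<Rightarrow> 's \<Rightarrow> bool"
  for \<Sigma> :: "('s, 'f, 'r) signature" and \<Gamma> :: "'s list" where
  wt_Var: "i < length \<Gamma> \<Longrightarrow> wt \<Sigma> \<Gamma> (Var i) (\<Gamma> ! i)"
| wt_Fn: "f \<in> funs \<Sigma> \<Longrightarrow> list_all2 (wt \<Sigma> \<Gamma>) ts (fdom \<Sigma> f) \<Longrightarrow> wt \<Sigma> \<Gamma> (Fn f ts) (fcod \<Sigma> f)"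

definition wf_ctx :: "('s, 'f, 'r) signature \<Rightarrow> 's list \<Rightarrow> bool" where
  "wf_ctx \<Sigma> \<Gamma> \<longleftrightarrow> set \<Gamma> \<subseteq> sorts \<Sigma>"

primrec wff :: "('s, 'f, 'r) signature \<Rightarrow> 's list \<Rightarrow> ('s, 'f, 'r, 'i) fm \<Rightarrow> bool" where
  "wff \<Sigma> \<Gamma> (Eq s t) \<longleftrightarrow> (\<exists>A. wt \<Sigma> \<Gamma> s A \<and> wt \<Sigma> \<Gamma> t A)"
| "wff \<Sigma> \<Gamma> (Rel R ts) \<longleftrightarrow> R \<in> rels \<Sigma> \<and> list_all2 (wt \<Sigma> \<Gamma>) ts (rdom \<Sigma> R)"
| "wff \<Sigma> \<Gamma> Top \<longleftrightarrow> True"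
| "wff \<Sigma> \<Gamma> (And \<phi> \<psi>) \<longleftrightarrow> wff \<Sigma> \<Gamma> \<phi> \<and> wff \<Sigma> \<Gamma> \<psi>"
| "wff \<Sigma> \<Gamma> Bot \<longleftrightarrow> True"
| "wff \<Sigma> \<Gamma> (Or \<phi> \<psi>) \<longleftrightarrow> wff \<Sigma> \<Gamma> \<phi> \<and> wff \<Sigma> \<Gamma> \<psi>"
| "wff \<Sigma> \<Gamma> (Disj I F) \<longleftrightarrow> (\<forall>i\<in>I. wff \<Sigma> \<Gamma> (F i))"
| "wff \<Sigma> \<Gamma> (Ex A \<phi>) \<longleftrightarrow> A \<in> sorts \<Sigma> \<and> wff \<Sigma> (A # \<Gamma>) \<phi>"

primrec horn :: "('s, 'f, 'r, 'i) fm \<Rightarrow> bool" where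
  "horn (Eq s t) = True"
| "horn (Rel R ts) = True"
| "horn Top = True"
| "horn (And \<phi> \<psi>) = (horn \<phi> \<and> horn \<psi>)"
| "horn Bot = False"
| "horn (Or \<phi> \<psi>) = False"
| "horn (Disj I F) = False"
| "horn (Ex A \<phi>) = False"

primrec regular :: "('s, 'f, 'r, 'i) fm \<Rightarrow> bool" where
  "regular (Eq s t) = True"
| "regular (Rel R ts) = True"
| "regular Top = True"
| "regular (And \<phi> \<psi>) = (regular \<phi> \<and> regular \<psi>)"
| "regular Bot = False"
| "regular (Or \<phi> \<psi>) = False"
| "regular (Disj I F) = False"
| "regular (Ex A \<phi>) = regular \<phi>"

primrec coherent :: "('s, 'f, 'r, 'i) fm \<Rightarrow> bool" where
  "coherent (Eq s t) = True"
| "coherent (Rel R ts) = True"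
| "coherent Top = True"
| "coherent (And \<phi> \<psi>) = (coherent \<phi> \<and> coherent \<psi>)"
| "coherent Bot = True"
| "coherent (Or \<phi> \<psi>) = (coherent \<phi> \<and> coherent \<psi>)"
| "coherent (Disj I F) = False"
| "coherent (Ex A \<phi>) = coherent \<phi>"


section \<open>Substitution and blocks of variables\<close>

primrec tsubst :: "(nat \<Rightarrow> 'f trm) \<Rightarrow> 'f trm \<Rightarrow> 'f trm" where
  "tsubst \<sigma> (Var i) = \<sigma> i"
| "tsubst \<sigma> (Fn f ts) = Fn f (map (tsubst \<sigma>) ts)"

definition lift :: "(nat \<Rightarrow> 'f trm) \<Rightarrow> nat \<Rightarrow> 'f trm" where
  "lift \<sigma> i = (case i of 0 \<Rightarrow> Var 0 | Suc j \<Rightarrow> tsubst (\<lambda>k. Var (Suc k)) (\<sigma> j))"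

primrec fsubst :: "(nat \<Rightarrow> 'f trm) \<Rightarrow> ('s, 'f, 'r, 'i) fm \<Rightarrow> ('s, 'f, 'r, 'i) fm" where
  "fsubst \<sigma> (Eq s t) = Eq (tsubst \<sigma> s) (tsubst \<sigma> t)"
| "fsubst \<sigma> (Rel R ts) = Rel R (map (tsubst \<sigma>) ts)"
| "fsubst \<sigma> Top = Top"
| "fsubst \<sigma> (And \<phi> \<psi>) = And (fsubst \<sigma> \<phi>) (fsubst \<sigma> \<psi>)"
| "fsubst \<sigma> Bot = Bot"
| "fsubst \<sigma> (Or \<phi> \<psi>) = Or (fsubst \<sigma> \<phi>) (fsubst \<sigma> \<psi>)"
| "fsubst \<sigma> (Disj I F) = Disj I (\<lambda>i. fsubst \<sigma> (F i))"
| "fsubst \<sigma> (Ex A \<phi>) = Ex A (fsubst (lift \<sigma>) \<phi>)"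

text \<open>\<open>inst \<phi> ts\<close> is \<open>\<phi>(t\<^sub>0, \<dots>, t\<^sub>n\<^sub>-\<^sub>1)\<close>, for \<open>\<phi>\<close> in a context of length \<open>n\<close>.\<close>

definition inst :: "('s, 'f, 'r, 'i) fm \<Rightarrow> 'f trm list \<Rightarrow> ('s, 'f, 'r, 'i) fm" where
  "inst \<phi> ts = fsubst (\<lambda>i. ts ! i) \<phi>"

definition weaken :: "('s, 'f, 'r, 'i) fm \<Rightarrow> ('s, 'f, 'r, 'i) fm" where
  "weaken \<phi> = fsubst (\<lambda>i. Var (Suc i)) \<phi>"

text \<open>\<open>vars a n\<close> is the block of the \<open>n\<close> consecutive variables starting at position \<open>a\<close>.\<close>

definition vars :: "nat \<Rightarrow> nat \<Rightarrow> 'f trm list" where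
  "vars a n = map Var [a ..< a + n]"

definition conjs :: "('s, 'f, 'r, 'i) fm list \<Rightarrow> ('s, 'f, 'r, 'i) fm" where
  "conjs \<phi>s = foldr And \<phi>s Top"

definition eqs :: "'f trm list \<Rightarrow> 'f trm list \<Rightarrow> ('s, 'f, 'r, 'i) fm" where
  "eqs ts us = conjs (map2 Eq ts us)"

text \<open>If \<open>\<phi>\<close> is in context \<open>As @ \<Gamma>\<close>, then \<open>exs As \<phi>\<close> is in context \<open>\<Gamma>\<close>.\<close>

definition exs :: "'s list \<Rightarrow> ('s, 'f, 'r, 'i) fm \<Rightarrow> ('s, 'f, 'r, 'i) fm" where
  "exs As \<phi> = fold Ex As \<phi>"


section \<open>Theories and provability\<close>

text \<open>The sequent \<open>(\<Gamma>, \<phi>, \<psi>)\<close> is \<open>\<phi> \<turnstile> \<psi>\<close> in context \<open>\<Gamma>\<close>; a theory is given by its set of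
  axioms.\<close>

type_synonym ('s, 'f, 'r, 'i) sequent =
  "'s list \<times> ('s, 'f, 'r, 'i) fm \<times> ('s, 'f, 'r, 'i) fm"

definition geometric_theory ::
  "('s, 'f, 'r) signature \<Rightarrow> ('s, 'f, 'r, 'i) sequent set \<Rightarrow> bool" where
  "geometric_theory \<Sigma> T \<longleftrightarrow> (\<forall>(\<Gamma>, \<phi>, \<psi>) \<in> T. wf_ctx \<Sigma> \<Gamma> \<and> wff \<Sigma> \<Gamma> \<phi> \<and> wff \<Sigma> \<Gamma> \<psi>)"

definition coherent_theory ::
  "('s, 'f, 'r) signature \<Rightarrow> ('s, 'f, 'r, 'i) sequent set \<Rightarrow> bool" where
  "coherent_theory \<Sigma> T \<longleftrightarrow>
     geometric_theory \<Sigma> T \<and> (\<forall>(\<Gamma>, \<phi>, \<psi>) \<in> T. coherent \<phi> \<and> coherent \<psi>)"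

definition regular_theory ::
  "('s, 'f, 'r) signature \<Rightarrow> ('s, 'f, 'r, 'i) sequent set \<Rightarrow> bool" where
  "regular_theory \<Sigma> T \<longleftrightarrow>
     geometric_theory \<Sigma> T \<and> (\<forall>(\<Gamma>, \<phi>, \<psi>) \<in> T. regular \<phi> \<and> regular \<psi>)"

text \<open>The sequent calculus of geometric logic, as in Johnstone, Sketches of an Elephant, D1.3.1.
  Contexts are part of the sequents because sorts may be empty.\<close>

inductive provable ::
  "('s, 'f, 'r) signature \<Rightarrow> ('s, 'f, 'r, 'i) sequent set \<Rightarrow>
   's list \<Rightarrow> ('s, 'f, 'r, 'i) fm \<Rightarrow> ('s, 'f, 'r, 'i) fm \<Rightarrow> bool"
  for \<Sigma> :: "('s, 'f, 'r) signature" and T :: "('s, 'f, 'r, 'i) sequent set" where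
  Axiom: "(\<Gamma>, \<phi>, \<psi>) \<in> T \<Longrightarrow> provable \<Sigma> T \<Gamma> \<phi> \<psi>"
| Identity: "wf_ctx \<Sigma> \<Gamma> \<Longrightarrow> wff \<Sigma> \<Gamma> \<phi> \<Longrightarrow> provable \<Sigma> T \<Gamma> \<phi> \<phi>"
| Substitution:
    "provable \<Sigma> T \<Gamma> \<phi> \<psi> \<Longrightarrow> wf_ctx \<Sigma> \<Delta> \<Longrightarrow> list_all2 (wt \<Sigma> \<Delta>) ts \<Gamma> \<Longrightarrow>
     provable \<Sigma> T \<Delta> (inst \<phi> ts) (inst \<psi> ts)"
| Cut: "provable \<Sigma> T \<Gamma> \<phi> \<psi> \<Longrightarrow> provable \<Sigma> T \<Gamma> \<psi> \<chi> \<Longrightarrow> provable \<Sigma> T \<Gamma> \<phi> \<chi>"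
| EqRefl: "wf_ctx \<Sigma> \<Gamma> \<Longrightarrow> i < length \<Gamma> \<Longrightarrow> provable \<Sigma> T \<Gamma> Top (Eq (Var i) (Var i))"
| EqSubst:
    "wf_ctx \<Sigma> \<Gamma> \<Longrightarrow> i < length \<Gamma> \<Longrightarrow> j < length \<Gamma> \<Longrightarrow> \<Gamma> ! i = \<Gamma> ! j \<Longrightarrow> wff \<Sigma> \<Gamma> \<phi> \<Longrightarrow>
     provable \<Sigma> T \<Gamma> (And (Eq (Var i) (Var j)) \<phi>) (fsubst (Var(i := Var j)) \<phi>)"
| TopI: "wf_ctx \<Sigma> \<Gamma> \<Longrightarrow> wff \<Sigma> \<Gamma> \<phi> \<Longrightarrow> provable \<Sigma> T \<Gamma> \<phi> Top"
| AndE1: "wf_ctx \<Sigma> \<Gamma> \<Longrightarrow> wff \<Sigma> \<Gamma> \<phi> \<Longrightarrow> wff \<Sigma> \<Gamma> \<psi> \<Longrightarrow> provable \<Sigma> T \<Gamma> (And \<phi> \<psi>) \<phi>"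
| AndE2: "wf_ctx \<Sigma> \<Gamma> \<Longrightarrow> wff \<Sigma> \<Gamma> \<phi> \<Longrightarrow> wff \<Sigma> \<Gamma> \<psi> \<Longrightarrow> provable \<Sigma> T \<Gamma> (And \<phi> \<psi>) \<psi>"
| AndI: "provable \<Sigma> T \<Gamma> \<phi> \<psi> \<Longrightarrow> provable \<Sigma> T \<Gamma> \<phi> \<chi> \<Longrightarrow> provable \<Sigma> T \<Gamma> \<phi> (And \<psi> \<chi>)"
| BotE: "wf_ctx \<Sigma> \<Gamma> \<Longrightarrow> wff \<Sigma> \<Gamma> \<phi> \<Longrightarrow> provable \<Sigma> T \<Gamma> Bot \<phi>"
| OrI1: "wf_ctx \<Sigma> \<Gamma> \<Longrightarrow> wff \<Sigma> \<Gamma> \<phi> \<Longrightarrow> wff \<Sigma> \<Gamma> \<psi> \<Longrightarrow> provable \<Sigma> T \<Gamma> \<phi> (Or \<phi> \<psi>)"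
| OrI2: "wf_ctx \<Sigma> \<Gamma> \<Longrightarrow> wff \<Sigma> \<Gamma> \<phi> \<Longrightarrow> wff \<Sigma> \<Gamma> \<psi> \<Longrightarrow> provable \<Sigma> T \<Gamma> \<psi> (Or \<phi> \<psi>)"
| OrE: "provable \<Sigma> T \<Gamma> \<phi> \<chi> \<Longrightarrow> provable \<Sigma> T \<Gamma> \<psi> \<chi> \<Longrightarrow> provable \<Sigma> T \<Gamma> (Or \<phi> \<psi>) \<chi>"
| DisjI:
    "wf_ctx \<Sigma> \<Gamma> \<Longrightarrow> wff \<Sigma> \<Gamma> (Disj I F) \<Longrightarrow> i \<in> I \<Longrightarrow> provable \<Sigma> T \<Gamma> (F i) (Disj I F)"
| DisjE:
    "wf_ctx \<Sigma> \<Gamma> \<Longrightarrow> wff \<Sigma> \<Gamma> \<chi> \<Longrightarrow> (\<And>i. i \<in> I \<Longrightarrow> provable \<Sigma> T \<Gamma> (F i) \<chi>) \<Longrightarrow>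
     provable \<Sigma> T \<Gamma> (Disj I F) \<chi>"
| ExE:
    "wff \<Sigma> \<Gamma> \<psi> \<Longrightarrow> provable \<Sigma> T (A # \<Gamma>) \<phi> (weaken \<psi>) \<Longrightarrow> provable \<Sigma> T \<Gamma> (Ex A \<phi>) \<psi>"
| ExI:
    "provable \<Sigma> T \<Gamma> (Ex A \<phi>) \<psi> \<Longrightarrow> provable \<Sigma> T (A # \<Gamma>) \<phi> (weaken \<psi>)"
| DistribOr:
    "wf_ctx \<Sigma> \<Gamma> \<Longrightarrow> wff \<Sigma> \<Gamma> \<phi> \<Longrightarrow> wff \<Sigma> \<Gamma> \<psi> \<Longrightarrow> wff \<Sigma> \<Gamma> \<chi> \<Longrightarrow>
     provable \<Sigma> T \<Gamma> (And \<phi> (Or \<psi> \<chi>)) (Or (And \<phi> \<psi>) (And \<phi> \<chi>))"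
| DistribDisj:
    "wf_ctx \<Sigma> \<Gamma> \<Longrightarrow> wff \<Sigma> \<Gamma> \<phi> \<Longrightarrow> wff \<Sigma> \<Gamma> (Disj I F) \<Longrightarrow>
     provable \<Sigma> T \<Gamma> (And \<phi> (Disj I F)) (Disj I (\<lambda>i. And \<phi> (F i)))"
| Frobenius:
    "wf_ctx \<Sigma> \<Gamma> \<Longrightarrow> wff \<Sigma> \<Gamma> \<phi> \<Longrightarrow> wff \<Sigma> \<Gamma> (Ex A \<psi>) \<Longrightarrow>
     provable \<Sigma> T \<Gamma> (And \<phi> (Ex A \<psi>)) (Ex A (And (weaken \<phi>) \<psi>))"

definition equivalent ::
  "('s, 'f, 'r) signature \<Rightarrow> ('s, 'f, 'r, 'i) sequent set \<Rightarrow>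
   's list \<Rightarrow> ('s, 'f, 'r, 'i) fm \<Rightarrow> ('s, 'f, 'r, 'i) fm \<Rightarrow> bool" where
  "equivalent \<Sigma> T \<Gamma> \<phi> \<psi> \<longleftrightarrow> provable \<Sigma> T \<Gamma> \<phi> \<psi> \<and> provable \<Sigma> T \<Gamma> \<psi> \<phi>"

definition cartesian ::
  "('s, 'f, 'r) signature \<Rightarrow> ('s, 'f, 'r, 'i) sequent set \<Rightarrow>
   's list \<Rightarrow> ('s, 'f, 'r, 'i) fm \<Rightarrow> bool" where
  "cartesian \<Sigma> T \<Gamma> \<phi> \<longleftrightarrow> wff \<Sigma> \<Gamma> \<phi> \<and>
     (\<exists>ys \<chi>. \<phi> = exs ys \<chi> \<and> horn \<chi> \<and>
        (let k = length ys; y = vars 0 k; y' = vars k k; x = vars (2 * k) (length \<Gamma>)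
         in provable \<Sigma> T (ys @ ys @ \<Gamma>) (And (inst \<chi> (y @ x)) (inst \<chi> (y' @ x))) (eqs y y')))"

definition cartesian_theory ::
  "('s, 'f, 'r) signature \<Rightarrow> ('s, 'f, 'r, 'i) sequent set \<Rightarrow> bool" where
  "cartesian_theory \<Sigma> T \<longleftrightarrow> geometric_theory \<Sigma> T \<and>
     (\<exists>T'. geometric_theory \<Sigma> T' \<and>
        (\<forall>(\<Gamma>, \<phi>, \<psi>) \<in> T'. cartesian \<Sigma> T \<Gamma> \<phi> \<and> cartesian \<Sigma> T \<Gamma> \<psi>) \<and>
        (\<forall>\<Gamma> \<phi> \<psi>. provable \<Sigma> T' \<Gamma> \<phi> \<psi> \<longleftrightarrow> provable \<Sigma> T \<Gamma> \<phi> \<psi>))"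


section \<open>Categories, functors, equivalences\<close>

text \<open>Hom-sets need not be disjoint, so composition takes the three objects as arguments.
  \<open>Comp C X Y Z u v\<close> is \<open>u : X \<rightarrow> Y\<close> followed by \<open>v : Y \<rightarrow> Z\<close>.\<close>

record ('o, 'm) category =
  Ob :: "'o set"
  Hom :: "'o \<Rightarrow> 'o \<Rightarrow> 'm set"
  Ident :: "'o \<Rightarrow> 'm"
  Comp :: "'o \<Rightarrow> 'o \<Rightarrow> 'o \<Rightarrow> 'm \<Rightarrow> 'm \<Rightarrow> 'm"

definition is_category :: "('o, 'm) category \<Rightarrow> bool" where
  "is_category C \<longleftrightarrow>
     (\<forall>X \<in> Ob C. Ident C X \<in> Hom C X X) \<and>
     (\<forall>X \<in> Ob C. \<forall>Y \<in> Ob C. \<forall>Z \<in> Ob C. \<forall>u \<in> Hom C X Y. \<forall>v \<in> Hom C Y Z.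
        Comp C X Y Z u v \<in> Hom C X Z) \<and>
     (\<forall>X \<in> Ob C. \<forall>Y \<in> Ob C. \<forall>u \<in> Hom C X Y.
        Comp C X X Y (Ident C X) u = u \<and> Comp C X Y Y u (Ident C Y) = u) \<and>
     (\<forall>W \<in> Ob C. \<forall>X \<in> Ob C. \<forall>Y \<in> Ob C. \<forall>Z \<in> Ob C.
        \<forall>u \<in> Hom C W X. \<forall>v \<in> Hom C X Y. \<forall>w \<in> Hom C Y Z.
          Comp C W Y Z (Comp C W X Y u v) w = Comp C W X Z u (Comp C X Y Z v w))"

definition is_functor ::
  "('o, 'm) category \<Rightarrow> ('p, 'n) category \<Rightarrow> ('o \<Rightarrow> 'p) \<Rightarrow> ('o \<Rightarrow> 'o \<Rightarrow> 'm \<Rightarrow> 'n) \<Rightarrow> bool" where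
  "is_functor C D Fo Fm \<longleftrightarrow> is_category C \<and> is_category D \<and>
     (\<forall>X \<in> Ob C. Fo X \<in> Ob D) \<and>
     (\<forall>X \<in> Ob C. \<forall>Y \<in> Ob C. \<forall>u \<in> Hom C X Y. Fm X Y u \<in> Hom D (Fo X) (Fo Y)) \<and>
     (\<forall>X \<in> Ob C. Fm X X (Ident C X) = Ident D (Fo X)) \<and>
     (\<forall>X \<in> Ob C. \<forall>Y \<in> Ob C. \<forall>Z \<in> Ob C. \<forall>u \<in> Hom C X Y. \<forall>v \<in> Hom C Y Z.
        Fm X Z (Comp C X Y Z u v) = Comp D (Fo X) (Fo Y) (Fo Z) (Fm X Y u) (Fm Y Z v))"

definition is_iso :: "('o, 'm) category \<Rightarrow> 'o \<Rightarrow> 'o \<Rightarrow> 'm \<Rightarrow> bool" where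
  "is_iso C X Y u \<longleftrightarrow> u \<in> Hom C X Y \<and>
     (\<exists>v \<in> Hom C Y X. Comp C X Y X u v = Ident C X \<and> Comp C Y X Y v u = Ident C Y)"

definition is_natural_iso ::
  "('o, 'm) category \<Rightarrow> ('p, 'n) category \<Rightarrow>
   ('o \<Rightarrow> 'p) \<Rightarrow> ('o \<Rightarrow> 'o \<Rightarrow> 'm \<Rightarrow> 'n) \<Rightarrow> ('o \<Rightarrow> 'p) \<Rightarrow> ('o \<Rightarrow> 'o \<Rightarrow> 'm \<Rightarrow> 'n) \<Rightarrow>
   ('o \<Rightarrow> 'n) \<Rightarrow> bool" where
  "is_natural_iso C D Fo Fm Go Gm \<eta> \<longleftrightarrow>
     (\<forall>X \<in> Ob C. is_iso D (Fo X) (Go X) (\<eta> X)) \<and>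
     (\<forall>X \<in> Ob C. \<forall>Y \<in> Ob C. \<forall>u \<in> Hom C X Y.
        Comp D (Fo X) (Fo Y) (Go Y) (Fm X Y u) (\<eta> Y) =
        Comp D (Fo X) (Go X) (Go Y) (\<eta> X) (Gm X Y u))"

definition is_equivalence ::
  "('o, 'm) category \<Rightarrow> ('p, 'n) category \<Rightarrow> ('o \<Rightarrow> 'p) \<Rightarrow> ('o \<Rightarrow> 'o \<Rightarrow> 'm \<Rightarrow> 'n) \<Rightarrow> bool" where
  "is_equivalence C D Fo Fm \<longleftrightarrow> is_functor C D Fo Fm \<and>
     (\<exists>Go Gm \<eta> \<epsilon>. is_functor D C Go Gm \<and>
        is_natural_iso C C (\<lambda>X. X) (\<lambda>X Y u. u)
          (\<lambda>X. Go (Fo X)) (\<lambda>X Y u. Gm (Fo X) (Fo Y) (Fm X Y u)) \<eta> \<and>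
        is_natural_iso D D (\<lambda>X. Fo (Go X)) (\<lambda>X Y u. Fm (Go X) (Go Y) (Gm X Y u))
          (\<lambda>X. X) (\<lambda>X Y u. u) \<epsilon>)"


section \<open>Syntactic categories\<close>

type_synonym ('s, 'f, 'r, 'i) fm_in_ctx = "'s list \<times> ('s, 'f, 'r, 'i) fm"

definition prov_class ::
  "('s, 'f, 'r) signature \<Rightarrow> ('s, 'f, 'r, 'i) sequent set \<Rightarrow>
   's list \<Rightarrow> ('s, 'f, 'r, 'i) fm \<Rightarrow> ('s, 'f, 'r, 'i) fm set" where
  "prov_class \<Sigma> T \<Gamma> \<theta> = {\<theta>'. wff \<Sigma> \<Gamma> \<theta>' \<and> equivalent \<Sigma> T \<Gamma> \<theta> \<theta>'}"

text \<open>A formula \<open>\<theta>(x, y)\<close> from \<open>\<phi>(x)\<close> to \<open>\<psi>(y)\<close> lives in context \<open>\<Gamma> @ \<Delta>\<close>, with \<open>\<Gamma>\<close> the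
  context of \<open>\<phi>\<close> and \<open>\<Delta>\<close> that of \<open>\<psi>\<close>.\<close>

fun functional ::
  "('s, 'f, 'r) signature \<Rightarrow> ('s, 'f, 'r, 'i) sequent set \<Rightarrow>
   ('s, 'f, 'r, 'i) fm_in_ctx \<Rightarrow> ('s, 'f, 'r, 'i) fm_in_ctx \<Rightarrow> ('s, 'f, 'r, 'i) fm \<Rightarrow> bool" where
  "functional \<Sigma> T (\<Gamma>, \<phi>) (\<Delta>, \<psi>) \<theta> \<longleftrightarrow>
     (let m = length \<Gamma>; n = length \<Delta> in
        (let x = vars 0 m; y = vars m n in
           provable \<Sigma> T (\<Gamma> @ \<Delta>) \<theta> (And (inst \<phi> x) (inst \<psi> y))) \<and>
        (let y = vars 0 n; x = vars n m in
           provable \<Sigma> T \<Gamma> \<phi> (exs \<Delta> (inst \<theta> (x @ y)))) \<and>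
        (let x = vars 0 m; y = vars m n; y' = vars (m + n) n in
           provable \<Sigma> T (\<Gamma> @ \<Delta> @ \<Delta>) (And (inst \<theta> (x @ y)) (inst \<theta> (x @ y'))) (eqs y y')))"

fun id_fm :: "('s, 'f, 'r, 'i) fm_in_ctx \<Rightarrow> ('s, 'f, 'r, 'i) fm" where
  "id_fm (\<Gamma>, \<phi>) =
     (let m = length \<Gamma>; x = vars 0 m; x' = vars m m in And (inst \<phi> x) (eqs x x'))"

fun comp_fm ::
  "('s, 'f, 'r, 'i) fm_in_ctx \<Rightarrow> ('s, 'f, 'r, 'i) fm_in_ctx \<Rightarrow> ('s, 'f, 'r, 'i) fm_in_ctx \<Rightarrow>
   ('s, 'f, 'r, 'i) fm \<Rightarrow> ('s, 'f, 'r, 'i) fm \<Rightarrow> ('s, 'f, 'r, 'i) fm" where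
  "comp_fm (\<Gamma>, _) (\<Delta>, _) (\<Lambda>, _) \<theta> \<theta>' =
     (let m = length \<Gamma>; n = length \<Delta>; p = length \<Lambda>;
          y = vars 0 n; x = vars n m; z = vars (n + m) p
      in exs \<Delta> (And (inst \<theta> (x @ y)) (inst \<theta>' (y @ z))))"

text \<open>The syntactic category built from the formulas in context satisfying \<open>P\<close>. A morphism is the
  full class, among geometric formulas, of a functional formula satisfying \<open>P\<close>; classes then
  correspond bijectively to classes taken among the formulas satisfying \<open>P\<close>, the categories for
  smaller fragments are literally subcategories of the geometric one, and composition makes sense
  for cartesian formulas, where \<open>comp_fm\<close> is only provably equivalent to a cartesian formula.
  Composition is taken over all representatives, whose composites are all equivalent.\<close>

definition syn_cat ::
  "('s, 'f, 'r) signature \<Rightarrow> ('s, 'f, 'r, 'i) sequent set \<Rightarrow>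
   ('s list \<Rightarrow> ('s, 'f, 'r, 'i) fm \<Rightarrow> bool) \<Rightarrow>
   (('s, 'f, 'r, 'i) fm_in_ctx, ('s, 'f, 'r, 'i) fm set) category" where
  "syn_cat \<Sigma> T P =
     \<lparr>Ob = {(\<Gamma>, \<phi>). wf_ctx \<Sigma> \<Gamma> \<and> wff \<Sigma> \<Gamma> \<phi> \<and> P \<Gamma> \<phi>},
      Hom = (\<lambda>X Y. {prov_class \<Sigma> T (fst X @ fst Y) \<theta> |\<theta>.
               wff \<Sigma> (fst X @ fst Y) \<theta> \<and> P (fst X @ fst Y) \<theta> \<and> functional \<Sigma> T X Y \<theta>}),
      Ident = (\<lambda>X. prov_class \<Sigma> T (fst X @ fst X) (id_fm X)),
      Comp = (\<lambda>X Y Z u v. \<Union>\<theta>\<in>u. \<Union>\<theta>'\<in>v. prov_class \<Sigma> T (fst X @ fst Z) (comp_fm X Y Z \<theta> \<theta>'))\<rparr>"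

definition C_geo ::
  "('s, 'f, 'r) signature \<Rightarrow> ('s, 'f, 'r, 'i) sequent set \<Rightarrow>
   (('s, 'f, 'r, 'i) fm_in_ctx, ('s, 'f, 'r, 'i) fm set) category" where
  "C_geo \<Sigma> T = syn_cat \<Sigma> T (\<lambda>\<Gamma> \<phi>. True)"

definition C_coh ::
  "('s, 'f, 'r) signature \<Rightarrow> ('s, 'f, 'r, 'i) sequent set \<Rightarrow>
   (('s, 'f, 'r, 'i) fm_in_ctx, ('s, 'f, 'r, 'i) fm set) category" where
  "C_coh \<Sigma> T = syn_cat \<Sigma> T (\<lambda>\<Gamma> \<phi>. coherent \<phi>)"

definition C_reg ::
  "('s, 'f, 'r) signature \<Rightarrow> ('s, 'f, 'r, 'i) sequent set \<Rightarrow>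
   (('s, 'f, 'r, 'i) fm_in_ctx, ('s, 'f, 'r, 'i) fm set) category" where
  "C_reg \<Sigma> T = syn_cat \<Sigma> T (\<lambda>\<Gamma> \<phi>. regular \<phi>)"

definition C_car ::
  "('s, 'f, 'r) signature \<Rightarrow> ('s, 'f, 'r, 'i) sequent set \<Rightarrow>
   (('s, 'f, 'r, 'i) fm_in_ctx, ('s, 'f, 'r, 'i) fm set) category" where
  "C_car \<Sigma> T = syn_cat \<Sigma> T (cartesian \<Sigma> T)"


section \<open>Relational translation\<close>

text \<open>A relation symbol \<open>R\<close> of \<open>\<Sigma>\<close> becomes \<open>Inl R\<close>, and \<open>R\<^sub>f\<close> is \<open>Inr f\<close>.\<close>

definition rel_sig :: "('s, 'f, 'r) signature \<Rightarrow> ('s, 'f, 'r + 'f) signature" where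
  "rel_sig \<Sigma> =
     \<lparr>sorts = sorts \<Sigma>, funs = {}, rels = Inl ` rels \<Sigma> \<union> Inr ` funs \<Sigma>,
      fdom = fdom \<Sigma>, fcod = fcod \<Sigma>,
      rdom = case_sum (rdom \<Sigma>) (\<lambda>f. fdom \<Sigma> f @ [fcod \<Sigma> f])\<rparr>"

primrec subterms :: "'f trm \<Rightarrow> 'f trm list" where
  "subterms (Var i) = [Var i]"
| "subterms (Fn f ts) = concat (map subterms ts) @ [Fn f ts]"

fun sort_of :: "('s, 'f, 'r) signature \<Rightarrow> 's list \<Rightarrow> 'f trm \<Rightarrow> 's" where
  "sort_of \<Sigma> \<Gamma> (Var i) = \<Gamma> ! i"
| "sort_of \<Sigma> \<Gamma> (Fn f ts) = fcod \<Sigma> f"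

text \<open>Translation of an atomic formula built from the terms \<open>gs\<close>. The list \<open>us\<close> enumerates, without
  repetition, the terms \<open>g\<close> occurring in the construction of \<open>gs\<close>; the variable \<open>z g\<close> is the
  position of \<open>g\<close> in \<open>us\<close>. These variables come first in the context of the matrix, so the
  original variable \<open>x\<^sub>i\<close> has index \<open>length us + i\<close> there.\<close>

definition tr_atom ::
  "('s, 'f, 'r) signature \<Rightarrow> 's list \<Rightarrow> 'f trm list \<Rightarrow>
   ('f trm list \<Rightarrow> ('s, 'f, 'r + 'f, 'i) fm) \<Rightarrow> ('s, 'f, 'r + 'f, 'i) fm" where
  "tr_atom \<Sigma> \<Gamma> gs atom =
     (let us = remdups (concat (map subterms gs));
          z = (\<lambda>g. Var (length (takeWhile (\<lambda>u. u \<noteq> g) us)));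
          graph = (\<lambda>g. case g of
                         Var i \<Rightarrow> Eq (z g) (Var (length us + i))
                       | Fn f ts \<Rightarrow> Rel (Inr f) (map z ts @ [z g]))
      in exs (map (sort_of \<Sigma> \<Gamma>) us) (And (conjs (map graph us)) (atom (map z gs))))"

primrec tr ::
  "('s, 'f, 'r) signature \<Rightarrow> 's list \<Rightarrow> ('s, 'f, 'r, 'i) fm \<Rightarrow> ('s, 'f, 'r + 'f, 'i) fm" where
  "tr \<Sigma> \<Gamma> (Eq s t) = tr_atom \<Sigma> \<Gamma> [s, t] (\<lambda>zs. Eq (zs ! 0) (zs ! 1))"
| "tr \<Sigma> \<Gamma> (Rel R ts) = tr_atom \<Sigma> \<Gamma> ts (\<lambda>zs. Rel (Inl R) zs)"
| "tr \<Sigma> \<Gamma> Top = Top"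
| "tr \<Sigma> \<Gamma> (And \<phi> \<psi>) = And (tr \<Sigma> \<Gamma> \<phi>) (tr \<Sigma> \<Gamma> \<psi>)"
| "tr \<Sigma> \<Gamma> Bot = Bot"
| "tr \<Sigma> \<Gamma> (Or \<phi> \<psi>) = Or (tr \<Sigma> \<Gamma> \<phi>) (tr \<Sigma> \<Gamma> \<psi>)"
| "tr \<Sigma> \<Gamma> (Disj I F) = Disj I (\<lambda>i. tr \<Sigma> \<Gamma> (F i))"
| "tr \<Sigma> \<Gamma> (Ex A \<phi>) = Ex A (tr \<Sigma> (A # \<Gamma>) \<phi>)"

definition rel_theory0 ::
  "('s, 'f, 'r) signature \<Rightarrow> ('s, 'f, 'r + 'f, 'i) sequent set" where
  "rel_theory0 \<Sigma> =
     (\<Union>f \<in> funs \<Sigma>.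
        let As = fdom \<Sigma> f; B = fcod \<Sigma> f; n = length As in
          {(As @ [B, B],
            And (Rel (Inr f) (vars 0 n @ [Var n])) (Rel (Inr f) (vars 0 n @ [Var (n + 1)])),
            Eq (Var n) (Var (n + 1))),
           (As, Top, Ex B (Rel (Inr f) (vars 1 n @ [Var 0])))})"

definition rel_theory ::
  "('s, 'f, 'r) signature \<Rightarrow> ('s, 'f, 'r, 'i) sequent set \<Rightarrow>
   ('s, 'f, 'r + 'f, 'i) sequent set" where
  "rel_theory \<Sigma> T = rel_theory0 \<Sigma> \<union> {(\<Gamma>, tr \<Sigma> \<Gamma> \<phi>, tr \<Sigma> \<Gamma> \<psi>) |\<Gamma> \<phi> \<psi>. (\<Gamma>, \<phi>, \<psi>) \<in> T}"

definition tr_ob ::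
  "('s, 'f, 'r) signature \<Rightarrow> ('s, 'f, 'r, 'i) fm_in_ctx \<Rightarrow> ('s, 'f, 'r + 'f, 'i) fm_in_ctx" where
  "tr_ob \<Sigma> X = (fst X, tr \<Sigma> (fst X) (snd X))"

text \<open>The class of the translations of the representatives of a morphism \<open>u : X \<rightarrow> Y\<close>.\<close>

definition tr_mor ::
  "('s, 'f, 'r) signature \<Rightarrow> ('s, 'f, 'r, 'i) sequent set \<Rightarrow>
   ('s, 'f, 'r, 'i) fm_in_ctx \<Rightarrow> ('s, 'f, 'r, 'i) fm_in_ctx \<Rightarrow>
   ('s, 'f, 'r, 'i) fm set \<Rightarrow> ('s, 'f, 'r + 'f, 'i) fm set" where
  "tr_mor \<Sigma> T X Y u =
     (\<Union>\<theta>\<in>u. prov_class (rel_sig \<Sigma>) (rel_theory \<Sigma> T) (fst X @ fst Y) (tr \<Sigma> (fst X @ fst Y) \<theta>))"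

text \<open>For a cartesian formula \<open>\<exists>y. \<chi>\<close> with \<open>\<chi>\<close> Horn, the translation keeps the conjunctions of \<open>\<chi>\<close>
  outside the existential quantifiers introduced for its atoms, so it has the shape
  \<open>\<exists>y. \<chi>'\<close>, \<open>\<chi>'\<close> Horn, only up to provable equivalence. The restriction of the translation functor
  to cartesian syntactic categories therefore replaces the translation of an object by a provably
  equivalent cartesian formula in the same context; on morphisms, which are classes, it is the
  translation itself.\<close>

definition restricts_to_cartesian_equivalence ::
  "('s, 'f, 'r) signature \<Rightarrow> ('s, 'f, 'r, 'i) sequent set \<Rightarrow> bool" where
  "restricts_to_cartesian_equivalence \<Sigma> T \<longleftrightarrow>
     (\<exists>G. (\<forall>X \<in> Ob (C_car \<Sigma> T).
             fst (G X) = fst (tr_ob \<Sigma> X) \<and>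
             equivalent (rel_sig \<Sigma>) (rel_theory \<Sigma> T) (fst X) (snd (G X)) (snd (tr_ob \<Sigma> X))) \<and>
          is_equivalence (C_car \<Sigma> T) (C_car (rel_sig \<Sigma>) (rel_theory \<Sigma> T)) G (tr_mor \<Sigma> T))"

end

theory Submission
  imports Defs "HOL-Library.Countable_Set"
begin

text \<open>The translation does not change contexts and, up to provable equivalence, it has an inverse \<open>untr\<close>, which
  reads \<open>R\<^sub>f(x, y)\<close> as \<open>f(x) = y\<close>. Both translations preserve provability (\<open>tr_prv\<close>, \<open>untr_prv\<close>), and going
  back and forth leads to an equivalent formula (\<open>untr_tr\<close>, \<open>tr_untr\<close>). The morphisms of a syntactic
  category are classes of formulas modulo provable equivalence, and the Hom-sets depend on an object only
  through its context and the class of its formula. Therefore the functors induced by the two translations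
  are inverse to each other on morphisms, and identities serve as unit and counit of the equivalence
  (\<open>mutually_inverse_interps\<close>). For the coherent, regular and cartesian fragments it remains to see that both
  translations respect the fragment; everything else is common to all four cases.

  Many provable sequents are needed: the laws of the syntactic category, the compatibility of the translation
  with substitution, the reduction to cartesian form. They are obtained from a completeness theorem
  (\<open>complete\<close>): a sequent is provable if it holds in all models in which elements form sets, formulas are
  relations between them, all provable sequents hold, and a given countable set of formulas is decided, that
  is, its existential formulas have witnesses and its disjunctions have a true member. Such models are unions
  of Henkin chains. Decidedness of countably many formulas is as much as set-valued models of infinitary
  geometric logic can offer, and it is enough, because each single argument involves few quantifiers and
  disjunctions. In a model, functional formulas are graphs of functions and composition is
  composition of relations, and the relations \<open>R\<^sub>f\<close> are graphs of operations, by which terms obtain values; the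
  translation of an atomic formula then expresses the atom about these values (\<open>H_tr_atom\<close>).

  That the translation preserves provability comes down to the rule of substitution, that is, to
  compatibility of the translation with substitution (\<open>sub_ok_all\<close>). For infinitary disjunctions this has to be
  proved as a provable equivalence, by induction on formulas, with models used in each step.

  For cartesian theories, the variables introduced by the translation of an atom are determined by the free
  variables. So the translation of a Horn formula, and then that of a cartesian formula, is equivalent to a
  cartesian one, already on the basis of the axioms about the \<open>R\<^sub>f\<close> (\<open>cart_tr\<close>).\<close>

section \<open>Substitution\<close>

lemma tsubst_tsubst: "tsubst \<tau> (tsubst \<sigma> t) = tsubst (\<lambda>i. tsubst \<tau> (\<sigma> i)) t"
  by (induction t) auto

lemma tsubst_Var [simp]: "tsubst Var t = t"
  by (induction t) (auto simp: map_idI)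

lemma lift_lift: "(\<lambda>i. tsubst (lift \<tau>) (lift \<sigma> i)) = lift (\<lambda>i. tsubst \<tau> (\<sigma> i))"
  by (auto simp: lift_def tsubst_tsubst fun_eq_iff split: nat.split)

lemma fsubst_fsubst: "fsubst \<tau> (fsubst \<sigma> \<phi>) = fsubst (\<lambda>i. tsubst \<tau> (\<sigma> i)) \<phi>"
  by (induction \<phi> arbitrary: \<sigma> \<tau>) (auto simp: tsubst_tsubst lift_lift)

lemma lift_Var [simp]: "lift Var = Var"
  by (auto simp: lift_def fun_eq_iff split: nat.split)

lemma fsubst_Var [simp]: "fsubst Var \<phi> = \<phi>"
  by (induction \<phi>) (auto simp: map_idI)

lemma lift_simps [simp]: "lift \<sigma> 0 = Var 0" "lift \<sigma> (Suc j) = tsubst (\<lambda>k. Var (Suc k)) (\<sigma> j)"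
  by (auto simp: lift_def)

lemma wt_VarI: "i < length \<Gamma> \<Longrightarrow> \<Gamma> ! i = A \<Longrightarrow> wt \<Sigma> \<Gamma> (Var i) A"
  using wt_Var by metis

lemma wt_Var_iff [simp]: "wt \<Sigma> \<Gamma> (Var i) A \<longleftrightarrow> i < length \<Gamma> \<and> \<Gamma> ! i = A"
  by (auto elim: wt.cases intro: wt_VarI)

lemma wt_Fn_iff: "wt \<Sigma> \<Gamma> (Fn f ts) A \<longleftrightarrow>
    f \<in> funs \<Sigma> \<and> list_all2 (wt \<Sigma> \<Gamma>) ts (fdom \<Sigma> f) \<and> A = fcod \<Sigma> f"
  by (auto elim: wt.cases intro: wt_Fn)

lemma tsubst_cong:
  "wt \<Sigma> \<Gamma> t A \<Longrightarrow> (\<And>i. i < length \<Gamma> \<Longrightarrow> \<sigma> i = \<tau> i) \<Longrightarrow> tsubst \<sigma> t = tsubst \<tau> t"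
  by (induction rule: wt.induct) (auto simp: list_all2_conv_all_nth list_eq_iff_nth_eq)

lemma map_tsubst_cong:
  assumes "list_all2 (wt \<Sigma> \<Gamma>) ts As" "\<And>i. i < length \<Gamma> \<Longrightarrow> \<sigma> i = \<tau> i"
  shows "map (tsubst \<sigma>) ts = map (tsubst \<tau>) ts"
  using assms(1) by (auto simp: list_all2_conv_all_nth list_eq_iff_nth_eq intro!: tsubst_cong[OF _ assms(2)])

definition typed :: "('s, 'f, 'r) signature \<Rightarrow> 's list \<Rightarrow> (nat \<Rightarrow> 'f trm) \<Rightarrow> 's list \<Rightarrow> bool" where
  "typed \<Sigma> \<Delta> \<sigma> \<Gamma> \<longleftrightarrow> (\<forall>i < length \<Gamma>. wt \<Sigma> \<Delta> (\<sigma> i) (\<Gamma> ! i))"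

lemma wt_tsubst: "wt \<Sigma> \<Gamma> t A \<Longrightarrow> typed \<Sigma> \<Delta> \<sigma> \<Gamma> \<Longrightarrow> wt \<Sigma> \<Delta> (tsubst \<sigma> t) A"
  unfolding typed_def
  by (induction rule: wt.induct) (auto simp: list_all2_conv_all_nth intro!: wt.intros simp del: wt_Var_iff)

lemma wts_tsubst:
  "list_all2 (wt \<Sigma> \<Gamma>) ts As \<Longrightarrow> typed \<Sigma> \<Delta> \<sigma> \<Gamma> \<Longrightarrow> list_all2 (wt \<Sigma> \<Delta>) (map (tsubst \<sigma>) ts) As"
  by (auto simp: list_all2_conv_all_nth wt_tsubst)

lemma typed_Suc: "typed \<Sigma> (A # \<Gamma>) (\<lambda>k. Var (Suc k)) \<Gamma>"
  by (auto simp: typed_def)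

lemma typed_lift: "typed \<Sigma> \<Delta> \<sigma> \<Gamma> \<Longrightarrow> typed \<Sigma> (A # \<Delta>) (lift \<sigma>) (A # \<Gamma>)"
  unfolding typed_def
proof (intro allI impI)
  fix i assume *: "\<forall>i<length \<Gamma>. wt \<Sigma> \<Delta> (\<sigma> i) (\<Gamma> ! i)" "i < length (A # \<Gamma>)"
  show "wt \<Sigma> (A # \<Delta>) (lift \<sigma> i) ((A # \<Gamma>) ! i)"
    using * by (cases i) (auto intro: wt_tsubst[OF _ typed_Suc])
qed

lemma wff_fsubst: "wff \<Sigma> \<Gamma> \<phi> \<Longrightarrow> typed \<Sigma> \<Delta> \<sigma> \<Gamma> \<Longrightarrow> wff \<Sigma> \<Delta> (fsubst \<sigma> \<phi>)"
proof (induction \<phi> arbitrary: \<sigma> \<Gamma> \<Delta>)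
  case (Ex A \<phi>)
  then show ?case using typed_lift by fastforce
next
  case (Eq s t)
  then show ?case using wt_tsubst by fastforce
next
  case (Rel R ts)
  then show ?case using wts_tsubst by fastforce
next
  case (Disj I F)
  then show ?case by auto
qed auto

lemma typed_nth: "list_all2 (wt \<Sigma> \<Delta>) ts \<Gamma> \<Longrightarrow> typed \<Sigma> \<Delta> ((!) ts) \<Gamma>"
  by (auto simp: typed_def list_all2_conv_all_nth)

lemma wff_inst: "wff \<Sigma> \<Gamma> \<phi> \<Longrightarrow> list_all2 (wt \<Sigma> \<Delta>) ts \<Gamma> \<Longrightarrow> wff \<Sigma> \<Delta> (inst \<phi> ts)"
  unfolding inst_def by (rule wff_fsubst[OF _ typed_nth])

lemma wff_weaken: "wff \<Sigma> \<Gamma> \<phi> \<Longrightarrow> wff \<Sigma> (A # \<Gamma>) (weaken \<phi>)"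
  unfolding weaken_def by (rule wff_fsubst[OF _ typed_Suc])

lemma wf_ctx_simps [simp]:
  "wf_ctx \<Sigma> []"
  "wf_ctx \<Sigma> (A # \<Gamma>) \<longleftrightarrow> A \<in> sorts \<Sigma> \<and> wf_ctx \<Sigma> \<Gamma>"
  "wf_ctx \<Sigma> (\<Gamma> @ \<Delta>) \<longleftrightarrow> wf_ctx \<Sigma> \<Gamma> \<and> wf_ctx \<Sigma> \<Delta>"
  by (auto simp: wf_ctx_def)

lemma wt_sort: "wf_signature \<Sigma> \<Longrightarrow> wf_ctx \<Sigma> \<Gamma> \<Longrightarrow> wt \<Sigma> \<Gamma> t A \<Longrightarrow> A \<in> sorts \<Sigma>"
  by (cases t) (auto simp: wf_signature_def wf_ctx_def wt_Fn_iff)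

lemma typed_append: "typed \<Sigma> (\<Gamma> @ \<Delta>) Var \<Gamma>"
  by (auto simp: typed_def nth_append)

lemma wff_append: "wff \<Sigma> \<Gamma> \<phi> \<Longrightarrow> wff \<Sigma> (\<Gamma> @ \<Delta>) \<phi>"
proof (induction \<phi> arbitrary: \<Gamma> \<Delta>)
  case (Ex A \<phi>)
  then show ?case by (metis append_Cons wff.simps(8))
next
  case (Eq s t)
  then show ?case using wt_tsubst[OF _ typed_append] by (metis tsubst_Var wff.simps(1))
next
  case (Rel R ts)
  have "map (tsubst Var) ts = ts" by (simp add: map_idI)
  then show ?case using wts_tsubst[OF _ typed_append] Rel by (metis wff.simps(2))
qed auto

section \<open>Derived rules of the sequent calculus\<close>

locale geo =
  fixes \<Sigma> :: "('s, 'f, 'r) signature" and T :: "('s, 'f, 'r, 'i) sequent set"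
  assumes wf_sig: "wf_signature \<Sigma>" and geo: "geometric_theory \<Sigma> T"
begin

abbreviation prv :: "'s list \<Rightarrow> ('s, 'f, 'r, 'i) fm \<Rightarrow> ('s, 'f, 'r, 'i) fm \<Rightarrow> bool" where
  "prv \<equiv> provable \<Sigma> T"

lemma prvD:
  "prv \<Gamma> \<phi> \<psi> \<Longrightarrow> wf_ctx \<Sigma> \<Gamma> \<and> wff \<Sigma> \<Gamma> \<phi> \<and> wff \<Sigma> \<Gamma> \<psi>"
proof (induction rule: provable.induct)
  case (Axiom \<Gamma> \<phi> \<psi>)
  then show ?case using geo by (auto simp: geometric_theory_def)
next
  case (Substitution \<Gamma> \<phi> \<psi> \<Delta> ts)
  then show ?case by (auto intro: wff_inst)
next
  case (EqSubst \<Gamma> i j \<phi>)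
  have "typed \<Sigma> \<Gamma> (Var(i := Var j)) \<Gamma>" using EqSubst by (auto simp: typed_def)
  then show ?case using EqSubst by (auto intro: wff_fsubst)
next
  case (ExI \<Gamma> A \<phi> \<psi>)
  then show ?case by (auto intro: wff_weaken)
next
  case (Frobenius \<Gamma> \<phi> A \<psi>)
  then show ?case by (auto intro: wff_weaken)
qed auto

lemma prv_And_mono:
  assumes "prv \<Gamma> \<phi> \<phi>'" "prv \<Gamma> \<psi> \<psi>'"
  shows "prv \<Gamma> (And \<phi> \<psi>) (And \<phi>' \<psi>')"
proof -
  note w = prvD[OF assms(1)] prvD[OF assms(2)]
  have "prv \<Gamma> (And \<phi> \<psi>) \<phi>" "prv \<Gamma> (And \<phi> \<psi>) \<psi>"
    using w by (auto intro: provable.AndE1 provable.AndE2)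
  then show ?thesis using assms by (meson provable.AndI provable.Cut)
qed

lemma prv_Or_mono:
  assumes "prv \<Gamma> \<phi> \<phi>'" "prv \<Gamma> \<psi> \<psi>'"
  shows "prv \<Gamma> (Or \<phi> \<psi>) (Or \<phi>' \<psi>')"
proof -
  note w = prvD[OF assms(1)] prvD[OF assms(2)]
  have "prv \<Gamma> \<phi>' (Or \<phi>' \<psi>')" "prv \<Gamma> \<psi>' (Or \<phi>' \<psi>')"
    using w by (auto intro: provable.OrI1 provable.OrI2)
  then show ?thesis using assms by (meson provable.OrE provable.Cut)
qed

lemma prv_Disj_mono:
  assumes "wf_ctx \<Sigma> \<Gamma>" "\<And>i. i \<in> I \<Longrightarrow> prv \<Gamma> (F i) (G i)"
  shows "prv \<Gamma> (Disj I F) (Disj I G)"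
proof -
  have w: "wff \<Sigma> \<Gamma> (Disj I G)" using prvD[OF assms(2)] by auto
  have "prv \<Gamma> (G i) (Disj I G)" if "i \<in> I" for i
    by (rule provable.DisjI[OF assms(1) w that])
  then show ?thesis using assms w by (meson provable.DisjE provable.Cut)
qed

lemma prv_Ex_mono:
  assumes "prv (A # \<Gamma>) \<phi> \<psi>"
  shows "prv \<Gamma> (Ex A \<phi>) (Ex A \<psi>)"
proof -
  have w: "wf_ctx \<Sigma> \<Gamma>" "wff \<Sigma> \<Gamma> (Ex A \<psi>)" using prvD[OF assms] by auto
  then have "prv (A # \<Gamma>) \<psi> (weaken (Ex A \<psi>))"
    by (intro provable.ExI provable.Identity)
  then show ?thesis using assms w by (meson provable.Cut provable.ExE)
qed

lemma exs_mono: "prv (As @ \<Gamma>) \<phi> \<psi> \<Longrightarrow> prv \<Gamma> (exs As \<phi>) (exs As \<psi>)"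
proof (induction As arbitrary: \<phi> \<psi>)
  case (Cons A As)
  then show ?case using Cons.IH[OF prv_Ex_mono] by (simp add: exs_def)
qed (simp add: exs_def)

text \<open>Two substitutions that agree on the context need not give the same formula: the members
  \<open>F i\<close> of \<open>Disj I F\<close> with \<open>i\<close> outside \<open>I\<close> may contain any variables. Hence the results are in
  general only provably equivalent.\<close>
lemma fsubst_agree:
  assumes "wff \<Sigma> \<Gamma> \<phi>" "wf_ctx \<Sigma> \<Delta>" "typed \<Sigma> \<Delta> \<sigma> \<Gamma>" "\<And>i. i < length \<Gamma> \<Longrightarrow> \<sigma> i = \<tau> i"
  shows "prv \<Delta> (fsubst \<sigma> \<phi>) (fsubst \<tau> \<phi>)"
  using assms
proof (induction \<phi> arbitrary: \<Gamma> \<Delta> \<sigma> \<tau>)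
  case (Ex A \<phi>)
  have l: "lift \<sigma> i = lift \<tau> i" if "i < length (A # \<Gamma>)" for i
    using that Ex.prems(4) by (cases i) auto
  show ?case
    using Ex.IH[OF _ _ typed_lift[OF Ex.prems(3)] l] Ex.prems(1,2)
    by (auto intro: prv_Ex_mono)
next
  case (Eq s t)
  have "fsubst \<sigma> (Eq s t) = fsubst \<tau> (Eq s t)"
    using Eq.prems(1) by (auto intro!: tsubst_cong[OF _ Eq.prems(4)])
  then show ?case
    using provable.Identity[OF Eq.prems(2) wff_fsubst[OF Eq.prems(1,3)]] by metis
next
  case (Rel R ts)
  have "fsubst \<sigma> (Rel R ts) = fsubst \<tau> (Rel R ts)"
    using Rel.prems(1) by (auto dest!: map_tsubst_cong[OF _ Rel.prems(4)])
  then show ?case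
    using provable.Identity[OF Rel.prems(2) wff_fsubst[OF Rel.prems(1,3)]] by metis
next
  case (Disj I F)
  have "prv \<Delta> (fsubst \<sigma> (F i)) (fsubst \<tau> (F i))" if "i \<in> I" for i
    using Disj.IH[OF _ _ Disj.prems(2,3,4)] Disj.prems(1) that by auto
  then show ?case using prv_Disj_mono[OF Disj.prems(2)] by simp
next
  case (And \<phi> \<psi>)
  then show ?case using prv_And_mono by (metis fsubst.simps(4) wff.simps(4))
next
  case (Or \<phi> \<psi>)
  then show ?case using prv_Or_mono by (metis fsubst.simps(6) wff.simps(6))
qed (auto intro: provable.Identity)

lemma fsubst_agree':
  assumes "wff \<Sigma> \<Gamma> \<phi>" "wf_ctx \<Sigma> \<Delta>" "typed \<Sigma> \<Delta> \<sigma> \<Gamma>" "\<And>i. i < length \<Gamma> \<Longrightarrow> \<sigma> i = \<tau> i"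
  shows "prv \<Delta> (fsubst \<tau> \<phi>) (fsubst \<sigma> \<phi>)"
proof (rule fsubst_agree[OF assms(1,2)])
  show "typed \<Sigma> \<Delta> \<tau> \<Gamma>" using assms(3,4) by (simp add: typed_def)
qed (use assms(4) in simp)

lemma prv_fsubst:
  assumes "prv \<Gamma> \<phi> \<psi>" "wf_ctx \<Sigma> \<Delta>" "typed \<Sigma> \<Delta> \<sigma> \<Gamma>"
  shows "prv \<Delta> (fsubst \<sigma> \<phi>) (fsubst \<sigma> \<psi>)"
proof -
  note w = prvD[OF assms(1)]
  let ?ts = "map \<sigma> [0..<length \<Gamma>]"
  have l: "list_all2 (wt \<Sigma> \<Delta>) ?ts \<Gamma>"
    using assms(3) by (auto simp: typed_def list_all2_conv_all_nth)
  have *: "prv \<Delta> (inst \<phi> ?ts) (inst \<psi> ?ts)"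
    by (rule provable.Substitution[OF assms(1,2) l])
  have 1: "prv \<Delta> (fsubst \<sigma> \<phi>) (inst \<phi> ?ts)"
    unfolding inst_def by (rule fsubst_agree[OF _ assms(2,3)]) (use w in auto)
  have 2: "prv \<Delta> (inst \<psi> ?ts) (fsubst \<sigma> \<psi>)"
    unfolding inst_def by (rule fsubst_agree'[OF _ assms(2,3)]) (use w in auto)
  show ?thesis using 1 2 * by (meson provable.Cut)
qed

text \<open>New variables are added at the right end of a context, where they do not change the de Bruijn
  indices of the old ones. So formulas stay fixed while a context grows.\<close>
lemma prv_append:
  assumes "prv \<Gamma> \<phi> \<psi>" "wf_ctx \<Sigma> (\<Gamma> @ \<Delta>)"
  shows "prv (\<Gamma> @ \<Delta>) \<phi> \<psi>"
  using prv_fsubst[OF assms typed_append] by simp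

text \<open>The rule for equality replaces one variable by another one. Two fresh variables in front of
  \<open>\<Delta>\<close>, one for each of the two terms, reduce the replacement of terms to this case.\<close>
lemma eq_replace1:
  assumes w: "wff \<Sigma> \<Gamma> \<phi>" and t: "typed \<Sigma> \<Delta> \<sigma> \<Gamma>" "typed \<Sigma> \<Delta> \<tau> \<Gamma>" and k: "k < length \<Gamma>"
    and eq: "prv \<Delta> \<chi> (Eq (\<sigma> k) (\<tau> k))" and a: "\<And>i. i < length \<Gamma> \<Longrightarrow> i \<noteq> k \<Longrightarrow> \<sigma> i = \<tau> i"
    and p: "prv \<Delta> \<chi> (fsubst \<sigma> \<phi>)"
  shows "prv \<Delta> \<chi> (fsubst \<tau> \<phi>)"
proof -
  define A where "A = \<Gamma> ! k"
  define s2 where "s2 = tsubst (\<lambda>j. Var (Suc (Suc j)) :: 'f trm)"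
  define \<theta> where "\<theta> = (\<lambda>i. if i = k then Var 0 else s2 (\<sigma> i))"
  define \<rho> where "\<rho> = (\<lambda>i. if i = 0 then \<sigma> k else if i = 1 then \<tau> k else Var (i - 2))"
  have D: "wf_ctx \<Sigma> \<Delta>" using prvD[OF p] by simp
  have AS: "A \<in> sorts \<Sigma>" using wt_sort[OF wf_sig D] t k by (auto simp: A_def typed_def)
  have ty2: "typed \<Sigma> (A # A # \<Delta>) (\<lambda>j. Var (Suc (Suc j))) \<Delta>" by (auto simp: typed_def)
  have t\<theta>: "typed \<Sigma> (A # A # \<Delta>) \<theta> \<Gamma>"
    using t(1) wt_tsubst[OF _ ty2] by (auto simp: typed_def \<theta>_def A_def s2_def)
  have t\<rho>: "typed \<Sigma> \<Delta> \<rho> (A # A # \<Delta>)"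
    using t k by (auto simp: typed_def \<rho>_def A_def nth_Cons split: nat.splits)
  have "prv (A # A # \<Delta>) (And (Eq (Var 0) (Var 1)) (fsubst \<theta> \<phi>)) (fsubst (Var(0 := Var 1)) (fsubst \<theta> \<phi>))"
    by (rule provable.EqSubst) (use D AS wff_fsubst[OF w t\<theta>] in auto)
  from prv_fsubst[OF this D t\<rho>]
  have "prv \<Delta> (And (Eq (\<sigma> k) (\<tau> k)) (fsubst (\<lambda>i. tsubst \<rho> (\<theta> i)) \<phi>))
      (fsubst (\<lambda>i. tsubst \<rho> (tsubst (Var(0 := Var 1)) (\<theta> i))) \<phi>)"
    by (simp add: fsubst_fsubst \<rho>_def)
  moreover have "(\<lambda>i. tsubst \<rho> (\<theta> i)) = \<sigma>"
    by (auto simp: fun_eq_iff \<theta>_def \<rho>_def s2_def tsubst_tsubst)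
  moreover have "(\<lambda>i. tsubst \<rho> (tsubst (Var(0 := Var 1)) (\<theta> i))) = (\<lambda>i. if i = k then \<tau> k else \<sigma> i)"
    by (auto simp: fun_eq_iff \<theta>_def \<rho>_def s2_def tsubst_tsubst)
  ultimately have "prv \<Delta> \<chi> (fsubst (\<lambda>i. if i = k then \<tau> k else \<sigma> i) \<phi>)"
    using eq p by (metis provable.AndI provable.Cut)
  moreover have "prv \<Delta> (fsubst (\<lambda>i. if i = k then \<tau> k else \<sigma> i) \<phi>) (fsubst \<tau> \<phi>)"
    by (rule fsubst_agree'[OF w D t(2)]) (use a in auto)
  ultimately show ?thesis by (rule provable.Cut)
qed

lemma eq_replace:
  assumes w: "wff \<Sigma> \<Gamma> \<phi>" and t: "typed \<Sigma> \<Delta> \<sigma> \<Gamma>" "typed \<Sigma> \<Delta> \<tau> \<Gamma>"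
    and eq: "\<And>i. i < length \<Gamma> \<Longrightarrow> prv \<Delta> \<chi> (Eq (\<sigma> i) (\<tau> i))"
    and p: "prv \<Delta> \<chi> (fsubst \<sigma> \<phi>)"
  shows "prv \<Delta> \<chi> (fsubst \<tau> \<phi>)"
proof -
  have D: "wf_ctx \<Sigma> \<Delta>" using prvD[OF p] by simp
  have *: "k \<le> length \<Gamma> \<Longrightarrow> prv \<Delta> \<chi> (fsubst (\<lambda>i. if i < k then \<tau> i else \<sigma> i) \<phi>)" for k
  proof (induction k)
    case 0
    then show ?case using p by simp
  next
    case (Suc k)
    show ?case
      by (rule eq_replace1[OF w _ _ _ _ _ Suc.IH, where k = k])
        (use Suc.prems t eq in \<open>auto simp: typed_def less_Suc_eq\<close>)
  qed
  have "prv \<Delta> (fsubst (\<lambda>i. if i < length \<Gamma> then \<tau> i else \<sigma> i) \<phi>) (fsubst \<tau> \<phi>)"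
    by (rule fsubst_agree'[OF w D t(2)]) auto
  with * show ?thesis by (blast intro: provable.Cut)
qed

lemma eq_refl:
  assumes "wf_ctx \<Sigma> \<Delta>" "wt \<Sigma> \<Delta> t A" "wff \<Sigma> \<Delta> \<chi>"
  shows "prv \<Delta> \<chi> (Eq t t)"
proof -
  have "A \<in> sorts \<Sigma>" using wt_sort[OF wf_sig] assms by auto
  then have "prv [A] Top (Eq (Var 0) (Var 0))" by (intro provable.EqRefl) auto
  from prv_fsubst[OF this assms(1), of "\<lambda>_. t"] have "prv \<Delta> Top (Eq t t)"
    using assms by (auto simp: typed_def)
  then show ?thesis using provable.TopI[OF assms(1,3)] by (blast intro: provable.Cut)
qed

lemma eq_trans:
  assumes "prv \<Delta> \<chi> (Eq s t)" "prv \<Delta> \<chi> (Eq t u)"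
  shows "prv \<Delta> \<chi> (Eq s u)"
proof -
  have D: "wf_ctx \<Sigma> \<Delta>" "wff \<Sigma> \<Delta> \<chi>" using prvD[OF assms(1)] by auto
  obtain A where A: "wt \<Sigma> \<Delta> s A" "wt \<Sigma> \<Delta> t A" using prvD[OF assms(1)] by auto
  obtain B where B: "wt \<Sigma> \<Delta> t B" "wt \<Sigma> \<Delta> u B" using prvD[OF assms(2)] by auto
  have "A = B" using A B by (cases t) (auto simp: wt_Fn_iff)
  then have t: "typed \<Sigma> \<Delta> (\<lambda>i. if i = 0 then s else t) [A, A]"
      "typed \<Sigma> \<Delta> (\<lambda>i. if i = 0 then s else u) [A, A]"
    using A B by (auto simp: typed_def less_Suc_eq)
  have "prv \<Delta> \<chi> (fsubst (\<lambda>i. if i = 0 then s else u) (Eq (Var 0) (Var 1)))"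
    by (rule eq_replace[OF _ t]) (use assms A D in \<open>auto simp: less_Suc_eq intro: eq_refl\<close>)
  then show ?thesis by simp
qed

lemma eq_sym:
  assumes "prv \<Delta> \<chi> (Eq s t)"
  shows "prv \<Delta> \<chi> (Eq t s)"
proof -
  have D: "wf_ctx \<Sigma> \<Delta>" "wff \<Sigma> \<Delta> \<chi>" using prvD[OF assms(1)] by auto
  obtain A where A: "wt \<Sigma> \<Delta> s A" "wt \<Sigma> \<Delta> t A" using prvD[OF assms(1)] by auto
  have t: "typed \<Sigma> \<Delta> (\<lambda>i. s) [A, A]"
      "typed \<Sigma> \<Delta> (\<lambda>i. if i = 0 then t else s) [A, A]"
    using A by (auto simp: typed_def less_Suc_eq)
  have "prv \<Delta> \<chi> (fsubst (\<lambda>i. if i = 0 then t else s) (Eq (Var 0) (Var 1)))"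
    by (rule eq_replace[OF _ t]) (use assms A D in \<open>auto simp: less_Suc_eq intro: eq_refl\<close>)
  then show ?thesis by simp
qed

lemma ex_intro:
  assumes "wff \<Sigma> \<Gamma> (Ex A \<phi>)" "wf_ctx \<Sigma> \<Gamma>" "typed \<Sigma> \<Delta> \<sigma> \<Gamma>" "wt \<Sigma> \<Delta> t A"
    and p: "prv \<Delta> \<chi> (fsubst (case_nat t \<sigma>) \<phi>)"
  shows "prv \<Delta> \<chi> (fsubst \<sigma> (Ex A \<phi>))"
proof -
  have D: "wf_ctx \<Sigma> \<Delta>" using prvD[OF p] by simp
  have "prv (A # \<Gamma>) \<phi> (weaken (Ex A \<phi>))"
    by (intro provable.ExI provable.Identity assms)
  moreover have "typed \<Sigma> \<Delta> (case_nat t \<sigma>) (A # \<Gamma>)"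
    using assms by (auto simp: typed_def nth_Cons split: nat.split)
  ultimately have "prv \<Delta> (fsubst (case_nat t \<sigma>) \<phi>) (fsubst (case_nat t \<sigma>) (weaken (Ex A \<phi>)))"
    using D by (blast intro: prv_fsubst)
  moreover have "fsubst (case_nat t \<sigma>) (weaken (Ex A \<phi>)) = fsubst \<sigma> (Ex A \<phi>)"
    unfolding weaken_def fsubst_fsubst by simp
  ultimately show ?thesis using p by (metis provable.Cut)
qed

text \<open>The rule for \<open>Ex\<close> binds the first variable of a context; the conclusion is transported to a
  witness that is appended at the right end instead.\<close>
lemma ex_elim:
  assumes p: "prv \<Delta> \<chi> (fsubst \<sigma> (Ex A \<phi>))" and w: "wff \<Sigma> \<Gamma> (Ex A \<phi>)" and t: "typed \<Sigma> \<Delta> \<sigma> \<Gamma>"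
    and q: "prv (\<Delta> @ [A]) (And \<chi> (fsubst (case_nat (Var (length \<Delta>)) \<sigma>) \<phi>)) \<psi>"
    and wp: "wff \<Sigma> \<Delta> \<psi>"
  shows "prv \<Delta> \<chi> \<psi>"
proof -
  define \<rho> where "\<rho> = (\<lambda>i. if i < length \<Delta> then Var (Suc i) else Var 0 :: 'f trm)"
  have D: "wf_ctx \<Sigma> \<Delta>" "wff \<Sigma> \<Delta> \<chi>" using prvD[OF p] by auto
  have A: "A \<in> sorts \<Sigma>" using w by simp
  have t\<rho>: "typed \<Sigma> (A # \<Delta>) \<rho> (\<Delta> @ [A])" "typed \<Sigma> (A # \<Delta>) \<rho> \<Delta>"
    by (auto simp: typed_def \<rho>_def nth_append)
  have D': "wf_ctx \<Sigma> (A # \<Delta>)" using A D by simp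
  have l: "tsubst \<rho> (case_nat (Var (length \<Delta>)) \<sigma> i) = lift \<sigma> i" if "i < length (A # \<Gamma>)" for i
  proof (cases i)
    case (Suc j)
    then have "wt \<Sigma> \<Delta> (\<sigma> j) (\<Gamma> ! j)" using t that by (auto simp: typed_def)
    then show ?thesis using Suc by (auto intro!: tsubst_cong simp: \<rho>_def)
  qed (simp add: \<rho>_def)
  have 1: "prv (A # \<Delta>) (fsubst (lift \<sigma>) \<phi>) (fsubst \<rho> (fsubst (case_nat (Var (length \<Delta>)) \<sigma>) \<phi>))"
    unfolding fsubst_fsubst
    by (rule fsubst_agree[where \<Gamma> = "A # \<Gamma>"]) (use w D' typed_lift[OF t] l in auto)
  have 2: "prv (A # \<Delta>) (weaken \<chi>) (fsubst \<rho> \<chi>)"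
    unfolding weaken_def by (rule fsubst_agree[OF D(2) D' typed_Suc]) (simp add: \<rho>_def)
  have 3: "prv (A # \<Delta>) (fsubst \<rho> \<psi>) (weaken \<psi>)"
    unfolding weaken_def by (rule fsubst_agree'[OF wp D' typed_Suc]) (simp add: \<rho>_def)
  have "prv (A # \<Delta>) (And (weaken \<chi>) (fsubst (lift \<sigma>) \<phi>)) (weaken \<psi>)"
    using prv_And_mono[OF 2 1] prv_fsubst[OF q D' t\<rho>(1)] 3 by (simp) (meson provable.Cut)
  then have "prv \<Delta> (Ex A (And (weaken \<chi>) (fsubst (lift \<sigma>) \<phi>))) \<psi>"
    by (rule provable.ExE[OF wp])
  moreover have "prv \<Delta> (And \<chi> (Ex A (fsubst (lift \<sigma>) \<phi>))) (Ex A (And (weaken \<chi>) (fsubst (lift \<sigma>) \<phi>)))"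
    by (rule provable.Frobenius) (use D prvD[OF p] in auto)
  moreover have "prv \<Delta> \<chi> (And \<chi> (Ex A (fsubst (lift \<sigma>) \<phi>)))"
    using p D by (auto intro: provable.AndI provable.Identity)
  ultimately show ?thesis by (meson provable.Cut)
qed

end

section \<open>Set-valued models and completeness\<close>

definition tuple :: "('s \<Rightarrow> nat set) \<Rightarrow> 's list \<Rightarrow> nat list \<Rightarrow> bool" where
  "tuple D \<Gamma> xs \<longleftrightarrow> list_all2 (\<lambda>x A. x \<in> D A) xs \<Gamma>"

definition var_tuple :: "'s list \<Rightarrow> nat list \<Rightarrow> 's list \<Rightarrow> bool" where
  "var_tuple \<Delta> ks \<Gamma> \<longleftrightarrow> list_all2 (\<lambda>k A. k < length \<Delta> \<and> \<Delta> ! k = A) ks \<Gamma>"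

text \<open>The elements of a model are natural numbers, namely variables of a growing context taken up to
  provable equality, and \<open>H \<phi> xs\<close> says that \<open>\<phi>(xs)\<close> is forced. All provable sequents hold, but only
  the existential formulas and disjunctions in \<open>S\<close> are guaranteed a witness or a true disjunct:
  geometric logic has no completeness theorem for set-valued models that decide all formulas, whereas
  countably many formulas can be decided along a sequence of conditions. Terms are not interpreted,
  since there may be uncountably many of them; formulas are evaluated at variables only.\<close>
locale geo_model = geo \<Sigma> T
  for \<Sigma> :: "('s, 'f, 'r) signature" and T :: "('s, 'f, 'r, 'i) sequent set" +
  fixes S :: "('s, 'f, 'r, 'i) fm set" and D :: "'s \<Rightarrow> nat set"
    and H :: "('s, 'f, 'r, 'i) fm \<Rightarrow> nat list \<Rightarrow> bool"
  assumes D_sort: "a \<in> D A \<Longrightarrow> A \<in> sorts \<Sigma>"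
    and H_prv: "prv \<Gamma> \<phi> \<psi> \<Longrightarrow> tuple D \<Gamma> xs \<Longrightarrow> H \<phi> xs \<Longrightarrow> H \<psi> xs"
    and H_And: "wff \<Sigma> \<Gamma> \<phi> \<Longrightarrow> wff \<Sigma> \<Gamma> \<psi> \<Longrightarrow> tuple D \<Gamma> xs \<Longrightarrow> H (And \<phi> \<psi>) xs \<longleftrightarrow> H \<phi> xs \<and> H \<psi> xs"
    and H_Top: "tuple D \<Gamma> xs \<Longrightarrow> H Top xs"
    and H_Bot: "\<not> H Bot xs"
    and H_Eq: "tuple D \<Gamma> xs \<Longrightarrow> i < length \<Gamma> \<Longrightarrow> j < length \<Gamma> \<Longrightarrow> \<Gamma> ! i = \<Gamma> ! j \<Longrightarrow>
      H (Eq (Var i) (Var j)) xs \<longleftrightarrow> xs ! i = xs ! j"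
    and H_ren: "wff \<Sigma> \<Gamma> \<phi> \<Longrightarrow> var_tuple \<Delta> ks \<Gamma> \<Longrightarrow> tuple D \<Delta> xs \<Longrightarrow>
      H (inst \<phi> (map Var ks)) xs \<longleftrightarrow> H \<phi> (map ((!) xs) ks)"
    and H_Ex: "Ex A \<phi> \<in> S \<Longrightarrow> wff \<Sigma> \<Gamma> (Ex A \<phi>) \<Longrightarrow> tuple D \<Gamma> xs \<Longrightarrow> H (Ex A \<phi>) xs \<Longrightarrow>
      \<exists>a \<in> D A. H \<phi> (a # xs)"
    and H_Or: "Or \<phi> \<psi> \<in> S \<Longrightarrow> wff \<Sigma> \<Gamma> (Or \<phi> \<psi>) \<Longrightarrow> tuple D \<Gamma> xs \<Longrightarrow> H (Or \<phi> \<psi>) xs \<Longrightarrow>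
      H \<phi> xs \<or> H \<psi> xs"
    and H_Disj: "Disj I F \<in> S \<Longrightarrow> wff \<Sigma> \<Gamma> (Disj I F) \<Longrightarrow> tuple D \<Gamma> xs \<Longrightarrow> H (Disj I F) xs \<Longrightarrow>
      \<exists>i \<in> I. H (F i) xs"

type_synonym ('s, 'f, 'r, 'i) cond = "'s list \<times> ('s, 'f, 'r, 'i) fm"

definition vsub :: "nat list \<Rightarrow> nat \<Rightarrow> 'f trm" where
  "vsub xs i = Var (xs ! i)"

text \<open>A condition \<open>(\<Delta>, \<chi>)\<close> is a finite approximation to a model, which has elements \<open>\<Delta>\<close> that satisfy \<open>\<chi>\<close>.\<close>
definition extends where
  "extends \<Sigma> T c c' \<longleftrightarrow> (\<exists>As. fst c' = fst c @ As) \<and> provable \<Sigma> T (fst c') (snd c') (snd c)"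

text \<open>Only disjunctions and existential formulas ask for a decision; the truth of all other formulas in
  the limit is settled by what the conditions prove.\<close>
primrec decides :: "('s, 'f, 'r) signature \<Rightarrow> ('s, 'f, 'r, 'i) sequent set \<Rightarrow> nat list \<Rightarrow>
    ('s, 'f, 'r, 'i) cond \<Rightarrow> ('s, 'f, 'r, 'i) fm \<Rightarrow> bool" where
  "decides \<Sigma> T xs c (Eq s t) = True"
| "decides \<Sigma> T xs c (Rel R ts) = True"
| "decides \<Sigma> T xs c Top = True"
| "decides \<Sigma> T xs c (And \<phi> \<psi>) = True"
| "decides \<Sigma> T xs c Bot = True"
| "decides \<Sigma> T xs c (Or \<phi> \<psi>) =
    (provable \<Sigma> T (fst c) (snd c) (fsubst (vsub xs) \<phi>) \<or> provable \<Sigma> T (fst c) (snd c) (fsubst (vsub xs) \<psi>))"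
| "decides \<Sigma> T xs c (Disj I F) =
    (\<exists>i \<in> I. provable \<Sigma> T (fst c) (snd c) (fsubst (vsub xs) (F i)))"
| "decides \<Sigma> T xs c (Ex A \<phi>) =
    (\<exists>a < length (fst c). fst c ! a = A \<and> provable \<Sigma> T (fst c) (snd c) (fsubst (vsub (a # xs)) \<phi>))"

lemma case_nat_vsub: "case_nat (Var a) (vsub xs) = vsub (a # xs)"
  by (auto simp: fun_eq_iff vsub_def split: nat.split)

lemma typed_vsub: "var_tuple \<Delta> xs \<Gamma> \<Longrightarrow> typed \<Sigma> \<Delta> (vsub xs) \<Gamma>"
  by (auto simp: var_tuple_def typed_def vsub_def list_all2_conv_all_nth)

lemma var_tuple_append: "var_tuple \<Delta> xs \<Gamma> \<Longrightarrow> var_tuple (\<Delta> @ As) xs \<Gamma>"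
  by (auto simp: var_tuple_def list_all2_conv_all_nth nth_append)

context geo
begin

text \<open>Consistency is relative to the formula \<open>\<psi>\<close> that is to be refuted in the model.\<close>
definition consistent :: "('s, 'f, 'r, 'i) fm \<Rightarrow> ('s, 'f, 'r, 'i) cond \<Rightarrow> bool" where
  "consistent \<psi> c \<longleftrightarrow> wf_ctx \<Sigma> (fst c) \<and> wff \<Sigma> (fst c) (snd c) \<and> wff \<Sigma> (fst c) \<psi> \<and>
     \<not> prv (fst c) (snd c) \<psi>"

lemma extend_And:
  assumes "consistent \<psi> (\<Delta>, \<chi>)" "wff \<Sigma> \<Delta> \<beta>" "\<not> prv \<Delta> (And \<chi> \<beta>) \<psi>"
  shows "consistent \<psi> (\<Delta>, And \<chi> \<beta>) \<and> extends \<Sigma> T (\<Delta>, \<chi>) (\<Delta>, And \<chi> \<beta>) \<and> prv \<Delta> (And \<chi> \<beta>) \<beta>"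
  using assms by (auto simp: consistent_def extends_def intro: provable.AndE1 provable.AndE2)

text \<open>If every witness (or every disjunct) made \<open>\<psi>\<close> provable, then \<open>\<psi>\<close> would have been provable
  already, by the elimination rule combined with Frobenius or distributivity.\<close>
lemma decide_step:
  assumes c: "consistent \<psi> c" and w: "wff \<Sigma> \<Gamma> \<alpha>" and v: "var_tuple (fst c) xs \<Gamma>"
    and p: "prv (fst c) (snd c) (fsubst (vsub xs) \<alpha>)"
  shows "\<exists>c'. consistent \<psi> c' \<and> extends \<Sigma> T c c' \<and> decides \<Sigma> T xs c' \<alpha>"
proof -
  obtain \<Delta> \<chi> where cc: "c = (\<Delta>, \<chi>)" by (cases c)
  have v: "var_tuple \<Delta> xs \<Gamma>" and p: "prv \<Delta> \<chi> (fsubst (vsub xs) \<alpha>)"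
    and wD: "wf_ctx \<Sigma> \<Delta>" "wff \<Sigma> \<Delta> \<chi>" "wff \<Sigma> \<Delta> \<psi>" "\<not> prv \<Delta> \<chi> \<psi>"
    using v p c by (auto simp: cc consistent_def)
  note ty = typed_vsub[OF v]
  have I: "prv \<Delta> \<chi> \<chi>" using wD by (intro provable.Identity)
  have triv: "consistent \<psi> c \<and> extends \<Sigma> T c c"
    using c I by (auto simp: cc extends_def)
  show ?thesis
  proof (cases \<alpha>)
    case (Ex A \<phi>)
    let ?c = "(\<Delta> @ [A], And \<chi> (fsubst (vsub (length \<Delta> # xs)) \<phi>))"
    have "\<not> prv (fst ?c) (snd ?c) \<psi>"
      using ex_elim[OF p[unfolded Ex] w[unfolded Ex] ty _ wD(3)] wD(4) by (auto simp: case_nat_vsub)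
    moreover have "var_tuple (\<Delta> @ [A]) (length \<Delta> # xs) (A # \<Gamma>)"
      using var_tuple_append[OF v, of "[A]"] by (simp add: var_tuple_def)
    then have "wff \<Sigma> (\<Delta> @ [A]) (fsubst (vsub (length \<Delta> # xs)) \<phi>)"
      using w Ex by (auto intro: wff_fsubst[OF _ typed_vsub])
    ultimately have "consistent \<psi> ?c \<and> extends \<Sigma> T c ?c \<and> decides \<Sigma> T xs ?c \<alpha>"
      using wD w Ex unfolding cc
      by (auto simp: consistent_def extends_def wff_append intro!: provable.AndE1 provable.AndE2 exI[of _ "length \<Delta>"])
    then show ?thesis by blast
  next
    case (Or \<phi>1 \<phi>2)
    have w12: "wff \<Sigma> \<Delta> (fsubst (vsub xs) \<phi>1)" "wff \<Sigma> \<Delta> (fsubst (vsub xs) \<phi>2)"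
      using w Or ty by (auto intro: wff_fsubst)
    have "\<not> prv \<Delta> (And \<chi> (fsubst (vsub xs) \<phi>1)) \<psi> \<or> \<not> prv \<Delta> (And \<chi> (fsubst (vsub xs) \<phi>2)) \<psi>"
    proof (rule ccontr)
      assume "\<not> ?thesis"
      then have "prv \<Delta> (And \<chi> (Or (fsubst (vsub xs) \<phi>1) (fsubst (vsub xs) \<phi>2))) \<psi>"
        using provable.DistribOr[OF wD(1,2) w12] by (meson provable.Cut provable.OrE)
      then show False using I p wD unfolding Or by simp (meson provable.Cut provable.AndI)
    qed
    then show ?thesis
    proof
      assume "\<not> prv \<Delta> (And \<chi> (fsubst (vsub xs) \<phi>1)) \<psi>"
      then show ?thesis using extend_And[OF c[unfolded cc] w12(1)] unfolding cc Or by fastforce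
    next
      assume "\<not> prv \<Delta> (And \<chi> (fsubst (vsub xs) \<phi>2)) \<psi>"
      then show ?thesis using extend_And[OF c[unfolded cc] w12(2)] unfolding cc Or by fastforce
    qed
  next
    case (Disj J F)
    have wF: "wff \<Sigma> \<Delta> (fsubst (vsub xs) (F i))" if "i \<in> J" for i
      using w Disj ty that by (auto intro: wff_fsubst)
    have "\<exists>i \<in> J. \<not> prv \<Delta> (And \<chi> (fsubst (vsub xs) (F i))) \<psi>"
    proof (rule ccontr)
      assume *: "\<not> ?thesis"
      have "prv \<Delta> (Disj J (\<lambda>i. And \<chi> (fsubst (vsub xs) (F i)))) \<psi>"
        by (rule provable.DisjE[OF wD(1,3)]) (use * in auto)
      moreover have "prv \<Delta> (And \<chi> (Disj J (\<lambda>i. fsubst (vsub xs) (F i))))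
          (Disj J (\<lambda>i. And \<chi> (fsubst (vsub xs) (F i))))"
        by (rule provable.DistribDisj[OF wD(1,2)]) (use wF in auto)
      ultimately show False using I p wD unfolding Disj by simp (meson provable.Cut provable.AndI)
    qed
    then obtain i where i: "i \<in> J" "\<not> prv \<Delta> (And \<chi> (fsubst (vsub xs) (F i))) \<psi>" by blast
    then show ?thesis using extend_And[OF c[unfolded cc] wF[OF i(1)] i(2)] unfolding cc Disj by fastforce
  qed (rule exI[of _ c], use triv in simp)+
qed

lemma extends_trans: "extends \<Sigma> T c c' \<Longrightarrow> extends \<Sigma> T c' c'' \<Longrightarrow> wf_ctx \<Sigma> (fst c'') \<Longrightarrow> extends \<Sigma> T c c''"
  unfolding extends_def by (metis append.assoc prv_append provable.Cut)

lemma extends_prv: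
  assumes "extends \<Sigma> T c c'" "prv (fst c) (snd c) \<phi>" "wf_ctx \<Sigma> (fst c')"
  shows "prv (fst c') (snd c') \<phi>"
  using assms prv_append unfolding extends_def by (metis provable.Cut)

lemma henkin_chain:
  assumes S: "countable S" and c0: "consistent \<psi> c0"
  shows "\<exists>f. f (0::nat) = c0 \<and> (\<forall>n. consistent \<psi> (f n)) \<and> (\<forall>m n. m \<le> n \<longrightarrow> extends \<Sigma> T (f m) (f n)) \<and>
    (\<forall>\<alpha> \<Gamma> xs m. \<alpha> \<in> S \<longrightarrow> wff \<Sigma> \<Gamma> \<alpha> \<longrightarrow> var_tuple (fst (f m)) xs \<Gamma> \<longrightarrow>
       prv (fst (f m)) (snd (f m)) (fsubst (vsub xs) \<alpha>) \<longrightarrow> (\<exists>n. decides \<Sigma> T xs (f n) \<alpha>))"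
proof -
  \<comment> \<open>every pair of a formula and a tuple comes up infinitely often, so that formulas forced late are decided too\<close>
  define task where "task n = from_nat_into (insert Top S \<times> (UNIV :: nat list set)) (fst (prod_decode n))" for n
  define Q where "Q n c c' \<longleftrightarrow> extends \<Sigma> T c c' \<and>
    (\<forall>\<Gamma>. wff \<Sigma> \<Gamma> (fst (task n)) \<longrightarrow> var_tuple (fst c) (snd (task n)) \<Gamma> \<longrightarrow>
       prv (fst c) (snd c) (fsubst (vsub (snd (task n))) (fst (task n))) \<longrightarrow>
       decides \<Sigma> T (snd (task n)) c' (fst (task n)))" for n :: nat and c c'
  have "\<exists>f. \<forall>n. (consistent \<psi> (f n) \<and> (n = 0 \<longrightarrow> f n = c0)) \<and> Q n (f n) (f (Suc n))"
  proof (rule dependent_nat_choice)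
    fix c and n :: nat assume c: "consistent \<psi> c \<and> (n = 0 \<longrightarrow> c = c0)"
    show "\<exists>c'. (consistent \<psi> c' \<and> (Suc n = 0 \<longrightarrow> c' = c0)) \<and> Q n c c'"
    proof (cases "\<exists>\<Gamma>. wff \<Sigma> \<Gamma> (fst (task n)) \<and> var_tuple (fst c) (snd (task n)) \<Gamma> \<and>
       prv (fst c) (snd c) (fsubst (vsub (snd (task n))) (fst (task n)))")
      case True
      then show ?thesis using decide_step[of \<psi> c _ "fst (task n)" "snd (task n)"] c
        unfolding Q_def by (metis nat.distinct(1))
    next
      case False
      moreover have "extends \<Sigma> T c c"
        using c by (auto simp: extends_def consistent_def intro: provable.Identity)
      ultimately show ?thesis using c unfolding Q_def by blast
    qed
  qed (use c0 in blast)
  then obtain f where f: "\<And>n. consistent \<psi> (f n)" "f 0 = c0" "\<And>n. Q n (f n) (f (Suc n))" by blast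
  have ext: "extends \<Sigma> T (f m) (f n)" if "m \<le> n" for m n
    using that
  proof (induction rule: dec_induct)
    case base
    show ?case using f(1)[of m] by (auto simp: extends_def consistent_def intro: provable.Identity)
  next
    case (step n)
    then show ?case using f(3)[of n] f(1)[of "Suc n"] extends_trans by (auto simp: Q_def consistent_def)
  qed
  have dec: "\<exists>n. decides \<Sigma> T xs (f n) \<alpha>"
    if a: "\<alpha> \<in> S" "wff \<Sigma> \<Gamma> \<alpha>" "var_tuple (fst (f m)) xs \<Gamma>" "prv (fst (f m)) (snd (f m)) (fsubst (vsub xs) \<alpha>)"
    for \<alpha> \<Gamma> xs m
  proof -
    let ?U = "insert Top S \<times> (UNIV :: nat list set)"
    have "countable ?U" using S by auto
    then obtain k where k: "from_nat_into ?U k = (\<alpha>, xs)"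
      using from_nat_into_surj[of ?U "(\<alpha>, xs)"] a(1) by blast
    define n where "n = prod_encode (k, m)"
    have tn: "task n = (\<alpha>, xs)" by (simp add: task_def n_def k)
    have "m \<le> n" by (simp add: n_def le_prod_encode_2)
    note e = ext[OF this]
    have "prv (fst (f n)) (snd (f n)) (fsubst (vsub xs) \<alpha>)"
      using extends_prv[OF e a(4)] f(1)[of n] by (simp add: consistent_def)
    moreover have "var_tuple (fst (f n)) xs \<Gamma>"
      using e a(3) by (auto simp: extends_def var_tuple_append)
    ultimately have "decides \<Sigma> T xs (f (Suc n)) \<alpha>"
      using f(3)[of n] a(2) by (simp add: Q_def tn)
    then show ?thesis by blast
  qed
  show ?thesis
    by (rule exI[of _ f]) (use f(1,2) ext dec in blast)
qed

lemma uniform_bound: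
  fixes P :: "nat \<Rightarrow> nat \<Rightarrow> bool"
  assumes "\<And>i. i < k \<Longrightarrow> \<exists>n. P n i" "\<And>m n i. P m i \<Longrightarrow> m \<le> n \<Longrightarrow> P n i"
  shows "\<exists>n. \<forall>i<k. P n i"
  using assms(1)
proof (induction k)
  case (Suc k)
  then obtain n n' where "\<forall>i<k. P n i" "P n' k" by (metis less_Suc_eq)
  then have "\<forall>i<Suc k. P (max n n') i"
    using assms(2) by (metis less_Suc_eq max.cobounded1 max.cobounded2)
  then show ?case by blast
qed simp

text \<open>Suppose that the sequent is not provable. The Henkin chain starts from the generic condition
  \<open>(\<Gamma>, \<phi>)\<close>; its union is a model in which the variables of \<open>\<Gamma>\<close> satisfy \<open>\<phi>\<close> but not \<open>\<psi>\<close>.\<close>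
theorem complete:
  assumes S: "countable S" and wG: "wf_ctx \<Sigma> \<Gamma>" "wff \<Sigma> \<Gamma> \<phi>" "wff \<Sigma> \<Gamma> \<psi>"
    and valid: "\<And>D H xs. geo_model \<Sigma> T S D H \<Longrightarrow> tuple D \<Gamma> xs \<Longrightarrow> H \<phi> xs \<Longrightarrow> H \<psi> xs"
  shows "prv \<Gamma> \<phi> \<psi>"
proof (rule ccontr)
  assume np: "\<not> prv \<Gamma> \<phi> \<psi>"
  have con0: "consistent \<psi> (\<Gamma>, \<phi>)" using wG np by (simp add: consistent_def)
  obtain f where f: "f (0::nat) = (\<Gamma>, \<phi>) \<and> (\<forall>n. consistent \<psi> (f n)) \<and> (\<forall>m n. m \<le> n \<longrightarrow> extends \<Sigma> T (f m) (f n)) \<and>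
    (\<forall>\<alpha> \<Gamma> xs m. \<alpha> \<in> S \<longrightarrow> wff \<Sigma> \<Gamma> \<alpha> \<longrightarrow> var_tuple (fst (f m)) xs \<Gamma> \<longrightarrow>
       prv (fst (f m)) (snd (f m)) (fsubst (vsub xs) \<alpha>) \<longrightarrow> (\<exists>n. decides \<Sigma> T xs (f n) \<alpha>))"
    using henkin_chain[OF S con0] by (elim exE)
  have f0: "f 0 = (\<Gamma>, \<phi>)" and con: "\<And>n. consistent \<psi> (f n)"
    and ext: "\<And>m n. m \<le> n \<Longrightarrow> extends \<Sigma> T (f m) (f n)"
    and dec: "\<And>\<alpha> \<Gamma> xs m. \<alpha> \<in> S \<Longrightarrow> wff \<Sigma> \<Gamma> \<alpha> \<Longrightarrow> var_tuple (fst (f m)) xs \<Gamma> \<Longrightarrow>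
       prv (fst (f m)) (snd (f m)) (fsubst (vsub xs) \<alpha>) \<Longrightarrow> \<exists>n. decides \<Sigma> T xs (f n) \<alpha>"
    using f by simp_all
  define P where "P n = prv (fst (f n)) (snd (f n))" for n
  define sort where "sort n i A \<longleftrightarrow> i < length (fst (f n)) \<and> fst (f n) ! i = A" for n i A
  define eqv where "eqv i j \<longleftrightarrow> (\<exists>n. P n (Eq (Var i) (Var j)))" for i j
  \<comment> \<open>the least variable of a class of provably equal ones represents it, so that equality is interpreted by equality\<close>
  define rep where "rep i = (LEAST j. eqv i j)" for i
  define D where "D A = {rep i |i. \<exists>n. sort n i A}" for A
  define H where "H \<alpha> xs \<longleftrightarrow> (\<exists>n. P n (fsubst (vsub xs) \<alpha>))" for \<alpha> xs
  have wfc: "wf_ctx \<Sigma> (fst (f n))" "wff \<Sigma> (fst (f n)) (snd (f n))" for n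
    using con[of n] by (auto simp: consistent_def)
  have P_mono: "P n \<alpha>" if "P m \<alpha>" "m \<le> n" for m n \<alpha>
    using that extends_prv[OF ext] wfc unfolding P_def by blast
  have sort_mono: "sort n i A" if "sort m i A" "m \<le> n" for m n i A
    using that ext[of m n] by (auto simp: sort_def extends_def nth_append)
  have vt_mono: "var_tuple (fst (f n)) xs G" if "var_tuple (fst (f m)) xs G" "m \<le> n" for m n xs G
    using that ext[of m n] by (auto simp: extends_def var_tuple_append)
  have vt_iff: "var_tuple (fst (f n)) xs G \<longleftrightarrow> length xs = length G \<and> (\<forall>i<length G. sort n (xs ! i) (G ! i))"
    for n xs G by (auto simp: var_tuple_def sort_def list_all2_conv_all_nth)
  have cut: "P n \<beta>" if "P n \<alpha>" "prv (fst (f n)) \<alpha> \<beta>" for n \<alpha> \<beta>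
    using that provable.Cut unfolding P_def by blast
  have refl: "eqv i i" if "sort n i A" for n i A
    using that eq_refl[OF wfc(1) _ wfc(2), of n "Var i" A] unfolding eqv_def P_def sort_def by auto
  have sym: "eqv j i" if "eqv i j" for i j
    using that eq_sym unfolding eqv_def P_def by blast
  have trans: "eqv i k" if ij: "eqv i j" "eqv j k" for i j k
  proof -
    obtain m n where "P m (Eq (Var i) (Var j))" "P n (Eq (Var j) (Var k))"
      using ij by (auto simp: eqv_def)
    then have "P (max m n) (Eq (Var i) (Var j))" "P (max m n) (Eq (Var j) (Var k))"
      using P_mono max.cobounded1 max.cobounded2 by blast+
    then show ?thesis using eq_trans unfolding eqv_def P_def by blast
  qed
  have eqv_sort: "\<exists>n. sort n j A" if ij: "eqv i j" and n: "sort n i A" for i j n A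
  proof -
    obtain m where "P m (Eq (Var i) (Var j))" using ij by (auto simp: eqv_def)
    then have "P (max m n) (Eq (Var i) (Var j))" using P_mono max.cobounded1 by blast
    from prvD[OF this[unfolded P_def]] have "wff \<Sigma> (fst (f (max m n))) (Eq (Var i) (Var j) :: ('s, 'f, 'r, 'i) fm)"
      by (elim conjE)
    moreover have "sort (max m n) i A" using sort_mono[OF n] by simp
    ultimately show ?thesis by (auto simp: sort_def)
  qed
  have rep: "eqv i (rep i)" if "sort n i A" for n i A
    unfolding rep_def by (rule LeastI, rule refl[OF that])
  have rep_eq: "rep i = rep j" if "eqv i j" for i j
  proof -
    have "eqv i = eqv j" using that sym trans by blast
    then show ?thesis by (simp add: rep_def)
  qed
  have D_iff: "a \<in> D A \<longleftrightarrow> rep a = a \<and> (\<exists>n. sort n a A)" for a A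
  proof
    assume "a \<in> D A"
    then obtain i n where i: "a = rep i" "sort n i A" by (auto simp: D_def)
    then have "eqv i a" using rep by blast
    then show "rep a = a \<and> (\<exists>n. sort n a A)" using i rep_eq eqv_sort by metis
  next
    assume "rep a = a \<and> (\<exists>n. sort n a A)"
    then show "a \<in> D A" unfolding D_def by force
  qed
  have tup: "\<exists>n. var_tuple (fst (f n)) xs G" if "tuple D G xs" for G xs
  proof -
    have l: "length xs = length G" "\<And>i. i < length G \<Longrightarrow> xs ! i \<in> D (G ! i)"
      using that by (auto simp: tuple_def list_all2_conv_all_nth)
    have "\<exists>n. \<forall>i<length G. sort n (xs ! i) (G ! i)"
      by (rule uniform_bound) (use l(2) D_iff sort_mono in blast)+
    then show ?thesis using l(1) by (auto simp: vt_iff)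
  qed
  have tupP: "\<exists>n\<ge>m. var_tuple (fst (f n)) xs G \<and> P n \<alpha>" if a: "tuple D G xs" "P m \<alpha>" for G xs \<alpha> m
  proof -
    obtain n where "var_tuple (fst (f n)) xs G" using tup[OF a(1)] by blast
    then have "var_tuple (fst (f (max m n))) xs G \<and> P (max m n) \<alpha>"
      using a(2) vt_mono P_mono max.cobounded1 max.cobounded2 by blast
    then show ?thesis by (meson max.cobounded1)
  qed
  have replace: "\<exists>n. P n (fsubst (vsub ys) \<alpha>)"
    if "wff \<Sigma> G \<alpha>" "P m (fsubst (vsub xs) \<alpha>)" and v: "var_tuple (fst (f k)) xs G" and ly: "length ys = length G"
      and e: "\<And>i. i < length G \<Longrightarrow> eqv (xs ! i) (ys ! i)"
    for G \<alpha> m k xs ys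
  proof -
    have "\<exists>n. \<forall>i<length G. P n (Eq (Var (xs ! i)) (Var (ys ! i)))"
      by (rule uniform_bound) (use e P_mono in \<open>auto simp: eqv_def\<close>)
    then obtain n where n: "\<forall>i<length G. P n (Eq (Var (xs ! i)) (Var (ys ! i)))" by blast
    have "\<exists>n. \<forall>i<length G. sort n (ys ! i) (G ! i)"
    proof (rule uniform_bound)
      show "\<exists>n. sort n (ys ! i) (G ! i)" if "i < length G" for i
        using eqv_sort[OF e[OF that]] v that by (auto simp: vt_iff)
    qed (rule sort_mono)
    then obtain l where l: "var_tuple (fst (f l)) ys G" using ly by (auto simp: vt_iff)
    define N where "N = max (max m k) (max n l)"
    have "m \<le> N" "k \<le> N" "n \<le> N" "l \<le> N" by (auto simp: N_def)
    then have "P N (fsubst (vsub xs) \<alpha>)" "var_tuple (fst (f N)) xs G" "var_tuple (fst (f N)) ys G"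
      "\<forall>i<length G. P N (Eq (Var (xs ! i)) (Var (ys ! i)))"
      using n l that(2) v P_mono vt_mono by blast+
    then have "P N (fsubst (vsub ys) \<alpha>)"
      unfolding P_def using eq_replace[OF that(1) typed_vsub typed_vsub] by (auto simp: vsub_def)
    then show ?thesis by blast
  qed
  interpret geo_model \<Sigma> T S D H
  proof unfold_locales
    fix a A assume "a \<in> D A"
    then obtain n where "sort n a A" by (auto simp: D_iff)
    then show "A \<in> sorts \<Sigma>" using wfc(1)[of n] by (auto simp: sort_def wf_ctx_def)
  next
    fix G \<alpha> \<beta> xs assume p: "prv G \<alpha> \<beta>" and t: "tuple D G xs" and h: "H \<alpha> xs"
    obtain n where n: "var_tuple (fst (f n)) xs G" "P n (fsubst (vsub xs) \<alpha>)"
      using h tupP[OF t] by (auto simp: H_def)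
    show "H \<beta> xs" using cut[OF n(2) prv_fsubst[OF p wfc(1) typed_vsub[OF n(1)]]] by (auto simp: H_def)
  next
    fix \<alpha> \<beta> :: "('s, 'f, 'r, 'i) fm" and G xs assume w: "wff \<Sigma> G \<alpha>" "wff \<Sigma> G \<beta>" and t: "tuple D G xs"
    show "H (And \<alpha> \<beta>) xs = (H \<alpha> xs \<and> H \<beta> xs)"
    proof
      assume "H (And \<alpha> \<beta>) xs"
      then obtain n where n: "var_tuple (fst (f n)) xs G" "P n (And (fsubst (vsub xs) \<alpha>) (fsubst (vsub xs) \<beta>))"
        using tupP[OF t] by (auto simp: H_def)
      note ws = wff_fsubst[OF w(1) typed_vsub[OF n(1)]] wff_fsubst[OF w(2) typed_vsub[OF n(1)]]
      show "H \<alpha> xs \<and> H \<beta> xs"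
        using cut[OF n(2) provable.AndE1[OF wfc(1) ws]] cut[OF n(2) provable.AndE2[OF wfc(1) ws]]
        by (auto simp: H_def)
    next
      assume "H \<alpha> xs \<and> H \<beta> xs"
      then obtain m n where "P m (fsubst (vsub xs) \<alpha>)" "P n (fsubst (vsub xs) \<beta>)" by (auto simp: H_def)
      then have "P (max m n) (fsubst (vsub xs) \<alpha>)" "P (max m n) (fsubst (vsub xs) \<beta>)"
        using P_mono max.cobounded1 max.cobounded2 by blast+
      then show "H (And \<alpha> \<beta>) xs" unfolding H_def P_def by (auto intro: provable.AndI)
    qed
  next
    fix G xs
    show "H Top xs" using provable.TopI[OF wfc(1)[of 0] wfc(2)[of 0]] by (auto simp: H_def P_def)
  next
    fix xs
    have "\<not> P n Bot" for n
      using con[of n] provable.BotE[OF wfc(1)] provable.Cut unfolding P_def consistent_def by blast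
    then show "\<not> H Bot xs" by (auto simp: H_def)
  next
    fix G xs i j assume t: "tuple D G xs" and ij: "i < length G" "j < length G" "G ! i = G ! j"
    then have "xs ! i \<in> D (G ! i)" "xs ! j \<in> D (G ! j)" by (auto simp: tuple_def list_all2_conv_all_nth)
    then show "H (Eq (Var i) (Var j)) xs \<longleftrightarrow> xs ! i = xs ! j"
      using rep_eq[of "xs ! i" "xs ! j"] refl by (auto simp: D_iff H_def vsub_def eqv_def)
  next
    fix \<alpha> :: "('s, 'f, 'r, 'i) fm" and G \<Delta> ks xs assume w: "wff \<Sigma> G \<alpha>" and k: "var_tuple \<Delta> ks G" and t: "tuple D \<Delta> xs"
    obtain n0 where n0: "var_tuple (fst (f n0)) xs \<Delta>" using tup[OF t] by blast
    have "P n (fsubst (vsub xs) (inst \<alpha> (map Var ks))) \<longleftrightarrow> P n (fsubst (vsub (map ((!) xs) ks)) \<alpha>)"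
      if "n0 \<le> n" for n
    proof -
      note v = vt_mono[OF n0 that]
      have "var_tuple (fst (f n)) (map ((!) xs) ks) G"
        using v k by (auto simp: var_tuple_def list_all2_conv_all_nth)
      note ty = typed_vsub[OF this]
      have ag: "vsub (map ((!) xs) ks) i = tsubst (vsub xs) (map Var ks ! i)" if "i < length G" for i
        using that k by (auto simp: var_tuple_def list_all2_conv_all_nth vsub_def)
      show ?thesis unfolding inst_def fsubst_fsubst
        using cut fsubst_agree[OF w wfc(1) ty ag] fsubst_agree'[OF w wfc(1) ty ag] by blast
    qed
    then show "H (inst \<alpha> (map Var ks)) xs = H \<alpha> (map ((!) xs) ks)"
      unfolding H_def using P_mono[OF _ max.cobounded1] max.cobounded2 by blast
  next
    fix A \<alpha> G xs assume a: "Ex A \<alpha> \<in> S" "wff \<Sigma> G (Ex A \<alpha>)" "tuple D G xs" "H (Ex A \<alpha>) xs"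
    obtain n where n: "var_tuple (fst (f n)) xs G" "P n (fsubst (vsub xs) (Ex A \<alpha>))"
      using a(4) tupP[OF a(3)] unfolding H_def by blast
    obtain m b where mb: "sort m b A" "P m (fsubst (vsub (b # xs)) \<alpha>)"
      using dec[OF a(1,2) n(1)] n(2) by (auto simp: P_def sort_def)
    have v: "var_tuple (fst (f (max m n))) (b # xs) (A # G)"
      using sort_mono[OF mb(1), of "max m n"] vt_mono[OF n(1), of "max m n"]
      by (auto simp: vt_iff nth_Cons split: nat.split)
    have "\<exists>n. P n (fsubst (vsub (rep b # xs)) \<alpha>)"
    proof (rule replace[OF _ mb(2) v])
      show "wff \<Sigma> (A # G) \<alpha>" using a(2) by simp
      show "length (rep b # xs) = length (A # G)" using n(1) by (simp add: vt_iff)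
      show "eqv ((b # xs) ! i) ((rep b # xs) ! i)" if "i < length (A # G)" for i
      proof (cases i)
        case 0
        then show ?thesis using rep[OF mb(1)] by simp
      next
        case (Suc j)
        then have "sort n (xs ! j) (G ! j)" using that n(1) by (simp add: vt_iff)
        then show ?thesis using Suc refl by simp
      qed
    qed
    moreover have "rep b \<in> D A" using mb(1) by (auto simp: D_def)
    ultimately show "\<exists>a\<in>D A. H \<alpha> (a # xs)" by (auto simp: H_def)
  next
    fix \<alpha> \<beta> G xs assume a: "Or \<alpha> \<beta> \<in> S" "wff \<Sigma> G (Or \<alpha> \<beta>)" "tuple D G xs" "H (Or \<alpha> \<beta>) xs"
    obtain n where n: "var_tuple (fst (f n)) xs G" "P n (fsubst (vsub xs) (Or \<alpha> \<beta>))"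
      using a(4) tupP[OF a(3)] unfolding H_def by blast
    show "H \<alpha> xs \<or> H \<beta> xs"
      using dec[OF a(1,2) n(1)] n(2) by (auto simp: P_def H_def)
  next
    fix I F G xs assume a: "Disj I F \<in> S" "wff \<Sigma> G (Disj I F)" "tuple D G xs" "H (Disj I F) xs"
    obtain n where n: "var_tuple (fst (f n)) xs G" "P n (fsubst (vsub xs) (Disj I F))"
      using a(4) tupP[OF a(3)] unfolding H_def by blast
    show "\<exists>i\<in>I. H (F i) xs"
      using dec[OF a(1,2) n(1)] n(2) by (auto simp: P_def H_def)
  qed
  define xs where "xs = map rep [0..<length \<Gamma>]"
  have s0: "sort 0 i (\<Gamma> ! i)" if "i < length \<Gamma>" for i using that by (simp add: sort_def f0)
  have tx: "tuple D \<Gamma> xs"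
    using s0 by (auto simp: tuple_def xs_def list_all2_conv_all_nth D_def)
  define us where "us = [0..<length \<Gamma>]"
  have us: "var_tuple (fst (f 0)) us \<Gamma>" using s0 by (simp add: vt_iff us_def)
  have ag: "vsub us i = Var i" if "i < length \<Gamma>" for i using that by (simp add: vsub_def us_def)
  have "P 0 \<phi>" using wG by (simp add: P_def f0 provable.Identity)
  moreover have "prv (fst (f 0)) \<phi> (fsubst (vsub us) \<phi>)"
    using fsubst_agree'[OF wG(2,1) typed_vsub[OF us[unfolded f0 fst_conv]] ag] by (simp add: f0)
  ultimately have "P 0 (fsubst (vsub us) \<phi>)" using cut by blast
  then have "H \<phi> xs" unfolding H_def
    by (rule replace[OF wG(2) _ us]) (use s0 rep in \<open>auto simp: xs_def us_def\<close>)
  from valid[OF geo_model_axioms tx this] obtain m where m: "P m (fsubst (vsub xs) \<psi>)"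
    by (auto simp: H_def)
  obtain k where k: "var_tuple (fst (f k)) xs \<Gamma>" using tup[OF tx] by blast
  have undo: "eqv (xs ! i) (us ! i)" if "i < length \<Gamma>" for i
    using sym[OF rep[OF s0[OF that]]] that by (simp add: xs_def us_def)
  obtain n where n: "P n (fsubst (vsub us) \<psi>)"
    using replace[OF wG(3) m k _ undo] by (auto simp: us_def)
  have "prv (fst (f n)) (fsubst (vsub us) \<psi>) \<psi>"
    using fsubst_agree[OF wG(3) wfc(1)[of n] typed_vsub[OF vt_mono[OF us]] ag] by simp
  then have "P n \<psi>" using n cut by blast
  then show False using con[of n] by (simp add: P_def consistent_def)
qed

end

section \<open>Truth in models\<close>

lemma tuple_simps [simp]:
  "tuple D [] xs \<longleftrightarrow> xs = []"
  "tuple D \<Gamma> [] \<longleftrightarrow> \<Gamma> = []"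
  "tuple D (A # \<Gamma>) (x # xs) \<longleftrightarrow> x \<in> D A \<and> tuple D \<Gamma> xs"
  by (auto simp: tuple_def)

lemma tuple_length: "tuple D \<Gamma> xs \<Longrightarrow> length xs = length \<Gamma>"
  by (auto simp: tuple_def dest: list_all2_lengthD)

lemma tuple_append [simp]:
  "tuple D \<Gamma> xs \<Longrightarrow> tuple D (\<Gamma> @ \<Delta>) (xs @ ys) \<longleftrightarrow> tuple D \<Delta> ys"
  unfolding tuple_def by (simp add: list_all2_append list_all2_lengthD)

lemma tuple_appendE:
  assumes "tuple D (\<Gamma> @ \<Delta>) zs"
  obtains xs ys where "zs = xs @ ys" "tuple D \<Gamma> xs" "tuple D \<Delta> ys"
  using assms by (auto simp: tuple_def list_all2_append2)

lemma tuple_ConsE: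
  assumes "tuple D (A # \<Gamma>) zs"
  obtains x xs where "zs = x # xs" "x \<in> D A" "tuple D \<Gamma> xs"
  using assms by (auto simp: tuple_def list_all2_Cons2)

lemma map_nth_upt: "a + n \<le> length xs \<Longrightarrow> map ((!) xs) [a..<a + n] = take n (drop a xs)"
  by (auto simp: list_eq_iff_nth_eq)

lemma var_tuple_upt: "a + n \<le> length \<Delta> \<Longrightarrow> take n (drop a \<Delta>) = \<Gamma> \<Longrightarrow> var_tuple \<Delta> [a..<a + n] \<Gamma>"
  by (auto simp: var_tuple_def list_all2_conv_all_nth)

lemma var_tuple_app: "var_tuple \<Delta> ks \<Gamma> \<Longrightarrow> var_tuple \<Delta> ls \<Lambda> \<Longrightarrow> var_tuple \<Delta> (ks @ ls) (\<Gamma> @ \<Lambda>)"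
  by (auto simp: var_tuple_def list_all2_appendI)

lemma var_tuple_wt: "var_tuple \<Delta> ks \<Gamma> \<Longrightarrow> list_all2 (wt \<Sigma> \<Delta>) (map Var ks) \<Gamma>"
  by (auto simp: var_tuple_def list_all2_conv_all_nth)

lemma wff_ren: "wff \<Sigma> \<Gamma> \<phi> \<Longrightarrow> var_tuple \<Delta> ks \<Gamma> \<Longrightarrow> wff \<Sigma> \<Delta> (inst \<phi> (map Var ks))"
  by (rule wff_inst[OF _ var_tuple_wt])

lemma wff_conjs [simp]: "wff \<Sigma> \<Gamma> (conjs \<phi>s) \<longleftrightarrow> (\<forall>\<phi> \<in> set \<phi>s. wff \<Sigma> \<Gamma> \<phi>)"
  by (induction \<phi>s) (auto simp: conjs_def)

lemma wff_exs [simp]: "wff \<Sigma> \<Gamma> (exs As \<phi>) \<longleftrightarrow> set As \<subseteq> sorts \<Sigma> \<and> wff \<Sigma> (As @ \<Gamma>) \<phi>"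
proof (induction As arbitrary: \<phi>)
  case (Cons A As)
  show ?case using Cons[of "Ex A \<phi>"] by (auto simp: exs_def)
qed (simp add: exs_def)

lemma wff_eqs:
  "list_all2 (wt \<Sigma> \<Gamma>) ts As \<Longrightarrow> list_all2 (wt \<Sigma> \<Gamma>) us As \<Longrightarrow> wff \<Sigma> \<Gamma> (eqs ts us)"
  unfolding eqs_def wff_conjs by (auto simp: list_all2_conv_all_nth set_zip) blast

lemma wff_eqs_ren: "var_tuple \<Delta> ks \<Gamma> \<Longrightarrow> var_tuple \<Delta> ls \<Gamma> \<Longrightarrow> wff \<Sigma> \<Delta> (eqs (map Var ks) (map Var ls))"
  by (intro wff_eqs var_tuple_wt)

text \<open>A block \<open>exs As \<phi>\<close> has witnesses if each of the existential formulas of which it is built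
  has one.\<close>
fun ex_tasks :: "'s list \<Rightarrow> ('s, 'f, 'r, 'i) fm \<Rightarrow> ('s, 'f, 'r, 'i) fm set" where
  "ex_tasks [] \<phi> = {}"
| "ex_tasks (A # As) \<phi> = insert (Ex A \<phi>) (ex_tasks As (Ex A \<phi>))"

lemma countable_ex_tasks [simp]: "countable (ex_tasks As \<phi>)"
  by (induction As \<phi> rule: ex_tasks.induct) auto

context geo_model
begin

lemma tuple_wf: "tuple D \<Gamma> xs \<Longrightarrow> wf_ctx \<Sigma> \<Gamma>"
  unfolding tuple_def wf_ctx_def list_all2_conv_all_nth by (metis D_sort in_set_conv_nth subsetI)

lemma H_weaken:
  assumes "wff \<Sigma> \<Gamma> \<phi>" "tuple D \<Gamma> xs" "a \<in> D A"
  shows "H (weaken \<phi>) (a # xs) \<longleftrightarrow> H \<phi> xs"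
proof -
  have l: "length xs = length \<Gamma>" using tuple_length[OF assms(2)] .
  let ?ks = "[1..<1 + length \<Gamma>]"
  have v: "var_tuple (A # \<Gamma>) ?ks \<Gamma>" by (rule var_tuple_upt) auto
  have t: "tuple D (A # \<Gamma>) (a # xs)" using assms by simp
  have "prv (A # \<Gamma>) (weaken \<phi>) (inst \<phi> (map Var ?ks))" "prv (A # \<Gamma>) (inst \<phi> (map Var ?ks)) (weaken \<phi>)"
    unfolding weaken_def inst_def
    by (rule fsubst_agree[OF assms(1) tuple_wf[OF t] typed_Suc] fsubst_agree'[OF assms(1) tuple_wf[OF t] typed_Suc];
        simp del: upt_Suc)+
  then have "H (weaken \<phi>) (a # xs) \<longleftrightarrow> H (inst \<phi> (map Var ?ks)) (a # xs)"
    using H_prv[OF _ t] by blast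
  also have "\<dots> \<longleftrightarrow> H \<phi> (map ((!) (a # xs)) ?ks)" by (rule H_ren[OF assms(1) v t])
  also have "map ((!) (a # xs)) ?ks = xs" by (subst map_nth_upt) (auto simp: l)
  finally show ?thesis .
qed

lemma H_ExI:
  assumes "wff \<Sigma> \<Gamma> (Ex A \<phi>)" "tuple D \<Gamma> xs" "a \<in> D A" "H \<phi> (a # xs)"
  shows "H (Ex A \<phi>) xs"
proof -
  have "prv (A # \<Gamma>) \<phi> (weaken (Ex A \<phi>))"
    by (rule provable.ExI[OF provable.Identity[OF tuple_wf[OF assms(2)] assms(1)]])
  then have "H (weaken (Ex A \<phi>)) (a # xs)" using H_prv assms by (metis tuple_simps(3))
  then show ?thesis using H_weaken[OF assms(1-3)] by simp
qed

lemma H_Ex_iff: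
  assumes "Ex A \<phi> \<in> S" "wff \<Sigma> \<Gamma> (Ex A \<phi>)" "tuple D \<Gamma> xs"
  shows "H (Ex A \<phi>) xs \<longleftrightarrow> (\<exists>a \<in> D A. H \<phi> (a # xs))"
  using H_ExI[OF assms(2,3)] H_Ex[OF assms] by blast

lemma H_Or_iff:
  assumes "Or \<phi> \<psi> \<in> S" "wff \<Sigma> \<Gamma> \<phi>" "wff \<Sigma> \<Gamma> \<psi>" "tuple D \<Gamma> xs"
  shows "H (Or \<phi> \<psi>) xs \<longleftrightarrow> H \<phi> xs \<or> H \<psi> xs"
  using H_Or[OF assms(1) _ assms(4)] H_prv[OF provable.OrI1[OF tuple_wf assms(2,3)] assms(4)]
    H_prv[OF provable.OrI2[OF tuple_wf assms(2,3)] assms(4)] assms by auto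

lemma H_Disj_iff:
  assumes "Disj I F \<in> S" "wff \<Sigma> \<Gamma> (Disj I F)" "tuple D \<Gamma> xs"
  shows "H (Disj I F) xs \<longleftrightarrow> (\<exists>i \<in> I. H (F i) xs)"
  using H_Disj[OF assms] H_prv[OF provable.DisjI[OF tuple_wf assms(2)] assms(3)] assms(3) by blast

lemma H_exsI:
  assumes "wff \<Sigma> \<Gamma> (exs As \<phi>)" "tuple D \<Gamma> xs" "tuple D As as" "H \<phi> (as @ xs)"
  shows "H (exs As \<phi>) xs"
  using assms
proof (induction As arbitrary: \<phi> as)
  case (Cons A As)
  then obtain a bs where as: "as = a # bs" "a \<in> D A" "tuple D As bs" by (auto elim: tuple_ConsE)
  have "H (Ex A \<phi>) (bs @ xs)"
    by (rule H_ExI[where \<Gamma> = "As @ \<Gamma>" and a = a]) (use Cons.prems as in \<open>auto\<close>)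
  then show ?case using Cons.IH[of "Ex A \<phi>" bs] Cons.prems as by (auto simp: exs_def)
qed (simp add: exs_def)

lemma H_exsE:
  assumes "wff \<Sigma> \<Gamma> (exs As \<phi>)" "tuple D \<Gamma> xs" "ex_tasks As \<phi> \<subseteq> S" "H (exs As \<phi>) xs"
  shows "\<exists>as. tuple D As as \<and> H \<phi> (as @ xs)"
  using assms
proof (induction As arbitrary: \<phi>)
  case (Cons A As)
  have "exs As (Ex A \<phi>) = exs (A # As) \<phi>" by (simp add: exs_def)
  with Cons obtain bs where bs: "tuple D As bs" "H (Ex A \<phi>) (bs @ xs)"
    by (metis ex_tasks.simps(2) insert_subset)
  have "\<exists>a \<in> D A. H \<phi> (a # bs @ xs)"
    by (rule H_Ex[where \<Gamma> = "As @ \<Gamma>"]) (use Cons.prems bs in auto)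
  then show ?case using bs by (metis append_Cons tuple_simps(3))
qed (simp add: exs_def)

lemma H_exs:
  assumes "wff \<Sigma> \<Gamma> (exs As \<phi>)" "tuple D \<Gamma> xs" "ex_tasks As \<phi> \<subseteq> S"
  shows "H (exs As \<phi>) xs \<longleftrightarrow> (\<exists>as. tuple D As as \<and> H \<phi> (as @ xs))"
  using H_exsI[OF assms(1,2)] H_exsE[OF assms] by blast

lemma H_conjs:
  assumes "\<And>\<phi>. \<phi> \<in> set \<phi>s \<Longrightarrow> wff \<Sigma> \<Gamma> \<phi>" "tuple D \<Gamma> xs"
  shows "H (conjs \<phi>s) xs \<longleftrightarrow> (\<forall>\<phi> \<in> set \<phi>s. H \<phi> xs)"
  using assms(1)
proof (induction \<phi>s)
  case Nil
  then show ?case using H_Top[OF assms(2)] by (simp add: conjs_def)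
next
  case (Cons \<phi> \<phi>s)
  have "wff \<Sigma> \<Gamma> (conjs \<phi>s)" using Cons.prems by simp
  then show ?case using Cons H_And[OF _ _ assms(2), of \<phi> "conjs \<phi>s"] by (simp add: conjs_def)
qed

lemma H_eqs:
  assumes "var_tuple \<Gamma> ks \<Delta>" "var_tuple \<Gamma> ls \<Delta>" "tuple D \<Gamma> xs"
  shows "H (eqs (map Var ks) (map Var ls)) xs \<longleftrightarrow> map ((!) xs) ks = map ((!) xs) ls"
proof -
  have l: "length ks = length \<Delta>" "length ls = length \<Delta>"
    and n: "\<And>i. i < length \<Delta> \<Longrightarrow> ks ! i < length \<Gamma> \<and> ls ! i < length \<Gamma> \<and> \<Gamma> ! (ks ! i) = \<Gamma> ! (ls ! i)"
    using assms by (auto simp: var_tuple_def list_all2_conv_all_nth)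
  have "H (eqs (map Var ks) (map Var ls)) xs \<longleftrightarrow>
      (\<forall>\<phi> \<in> set (map2 Eq (map Var ks) (map Var ls)). H \<phi> xs)"
    unfolding eqs_def by (rule H_conjs[OF _ assms(3)]) (use n l in \<open>auto simp: set_zip\<close>)
  also have "\<dots> \<longleftrightarrow> (\<forall>i < length \<Delta>. H (Eq (Var (ks ! i)) (Var (ls ! i))) xs)"
  proof -
    have m: "map2 Eq (map Var ks) (map Var ls) = map (\<lambda>i. Eq (Var (ks ! i)) (Var (ls ! i))) [0..<length \<Delta>]"
      by (rule nth_equalityI) (use l in simp_all)
    show ?thesis unfolding m by auto
  qed
  also have "\<dots> \<longleftrightarrow> (\<forall>i < length \<Delta>. xs ! (ks ! i) = xs ! (ls ! i))"
    using n H_Eq[OF assms(3)] by auto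
  also have "\<dots> \<longleftrightarrow> map ((!) xs) ks = map ((!) xs) ls"
    using l by (auto simp: list_eq_iff_nth_eq)
  finally show ?thesis .
qed

lemma H_equivalent: "equivalent \<Sigma> T \<Gamma> \<phi> \<psi> \<Longrightarrow> tuple D \<Gamma> xs \<Longrightarrow> H \<phi> xs \<longleftrightarrow> H \<psi> xs"
  using H_prv by (auto simp: equivalent_def)

end

context geo
begin

lemma equivalent_complete:
  assumes "countable S" "wf_ctx \<Sigma> \<Gamma>" "wff \<Sigma> \<Gamma> \<phi>" "wff \<Sigma> \<Gamma> \<psi>"
    and "\<And>D H xs. geo_model \<Sigma> T S D H \<Longrightarrow> tuple D \<Gamma> xs \<Longrightarrow> H \<phi> xs \<longleftrightarrow> H \<psi> xs"
  shows "equivalent \<Sigma> T \<Gamma> \<phi> \<psi>"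
  unfolding equivalent_def using complete[OF assms(1,2)] assms(3-5) by blast

lemma equivalentD:
  "equivalent \<Sigma> T \<Gamma> \<phi> \<psi> \<Longrightarrow> wf_ctx \<Sigma> \<Gamma> \<and> wff \<Sigma> \<Gamma> \<phi> \<and> wff \<Sigma> \<Gamma> \<psi>"
  using prvD by (auto simp: equivalent_def)

lemma equivalent_sym: "equivalent \<Sigma> T \<Gamma> \<phi> \<psi> \<Longrightarrow> equivalent \<Sigma> T \<Gamma> \<psi> \<phi>"
  by (auto simp: equivalent_def)

lemma equivalent_trans: "equivalent \<Sigma> T \<Gamma> \<phi> \<psi> \<Longrightarrow> equivalent \<Sigma> T \<Gamma> \<psi> \<chi> \<Longrightarrow> equivalent \<Sigma> T \<Gamma> \<phi> \<chi>"
  unfolding equivalent_def by (meson provable.Cut)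

lemma equivalent_refl: "wf_ctx \<Sigma> \<Gamma> \<Longrightarrow> wff \<Sigma> \<Gamma> \<phi> \<Longrightarrow> equivalent \<Sigma> T \<Gamma> \<phi> \<phi>"
  by (auto simp: equivalent_def intro: provable.Identity)

lemma prov_class_eq: "equivalent \<Sigma> T \<Gamma> \<phi> \<psi> \<Longrightarrow> prov_class \<Sigma> T \<Gamma> \<phi> = prov_class \<Sigma> T \<Gamma> \<psi>"
  unfolding prov_class_def using equivalent_sym equivalent_trans by blast

lemma mem_prov_class: "wf_ctx \<Sigma> \<Gamma> \<Longrightarrow> wff \<Sigma> \<Gamma> \<phi> \<Longrightarrow> \<phi> \<in> prov_class \<Sigma> T \<Gamma> \<phi>"
  unfolding prov_class_def using equivalent_refl by blast

end

section \<open>Functional formulas in models\<close>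

text \<open>The matrices of the block quantifiers that occur in \<open>functional\<close> and \<open>comp_fm\<close>. Intervals have the
  form \<open>[a..<a + n]\<close> throughout, also for \<open>a = 0\<close>, so that the lemmas on blocks of variables apply to
  them by unification.\<close>
definition total_fm :: "nat \<Rightarrow> nat \<Rightarrow> ('s, 'f, 'r, 'i) fm \<Rightarrow> ('s, 'f, 'r, 'i) fm" where
  "total_fm m n \<theta> = inst \<theta> (map Var ([n..<n + m] @ [0..<0 + n]))"

definition comp_body :: "nat \<Rightarrow> nat \<Rightarrow> nat \<Rightarrow> ('s, 'f, 'r, 'i) fm \<Rightarrow> ('s, 'f, 'r, 'i) fm \<Rightarrow> ('s, 'f, 'r, 'i) fm" where
  "comp_body m n p \<theta> \<theta>' = And (inst \<theta> (map Var ([n..<n + m] @ [0..<0 + n])))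
     (inst \<theta>' (map Var ([0..<0 + n] @ [n + m..<(n + m) + p])))"

lemma functional_iff:
  "functional \<Sigma> T (\<Gamma>, \<phi>) (\<Delta>, \<psi>) \<theta> \<longleftrightarrow>
     (let m = length \<Gamma>; n = length \<Delta> in
      provable \<Sigma> T (\<Gamma> @ \<Delta>) \<theta> (And (inst \<phi> (map Var [0..<0 + m])) (inst \<psi> (map Var [m..<m + n]))) \<and>
      provable \<Sigma> T \<Gamma> \<phi> (exs \<Delta> (total_fm m n \<theta>)) \<and>
      provable \<Sigma> T (\<Gamma> @ \<Delta> @ \<Delta>)
        (And (inst \<theta> (map Var ([0..<0 + m] @ [m..<m + n]))) (inst \<theta> (map Var ([0..<0 + m] @ [m + n..<m + n + n]))))
        (eqs (map Var [m..<m + n]) (map Var [m + n..<m + n + n])))"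
  by (simp only: functional.simps vars_def total_fm_def map_append Let_def)

lemma comp_fm_eq:
  "comp_fm (\<Gamma>, \<phi>) (\<Delta>, \<psi>) (\<Lambda>, \<chi>) \<theta> \<theta>' =
     exs \<Delta> (comp_body (length \<Gamma>) (length \<Delta>) (length \<Lambda>) \<theta> \<theta>')"
  by (simp only: comp_fm.simps vars_def comp_body_def map_append Let_def)

lemma id_fm_eq:
  "id_fm (\<Gamma>, \<phi>) = And (inst \<phi> (map Var [0..<0 + length \<Gamma>]))
     (eqs (map Var [0..<0 + length \<Gamma>]) (map Var [length \<Gamma>..<length \<Gamma> + length \<Gamma>]))"
  by (simp only: id_fm.simps vars_def Let_def)

lemmas vt_simps = var_tuple_upt var_tuple_app

lemma wff_total: "wff \<Sigma> (\<Gamma> @ \<Delta>) \<theta> \<Longrightarrow> wff \<Sigma> (\<Delta> @ \<Gamma>) (total_fm (length \<Gamma>) (length \<Delta>) \<theta>)"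
  unfolding total_fm_def by (erule wff_ren) (intro vt_simps; simp)

lemma wff_comp_body:
  "wff \<Sigma> (\<Gamma> @ \<Delta>) \<theta> \<Longrightarrow> wff \<Sigma> (\<Delta> @ \<Lambda>) \<theta>' \<Longrightarrow>
   wff \<Sigma> (\<Delta> @ \<Gamma> @ \<Lambda>) (comp_body (length \<Gamma>) (length \<Delta>) (length \<Lambda>) \<theta> \<theta>')"
  unfolding comp_body_def
  by (simp only: wff.simps, intro conjI; erule wff_ren; intro vt_simps; simp)

lemma wff_comp:
  "wff \<Sigma> (\<Gamma> @ \<Delta>) \<theta> \<Longrightarrow> wff \<Sigma> (\<Delta> @ \<Lambda>) \<theta>' \<Longrightarrow> wf_ctx \<Sigma> \<Delta> \<Longrightarrow>
   wff \<Sigma> (\<Gamma> @ \<Lambda>) (comp_fm (\<Gamma>, \<phi>) (\<Delta>, \<psi>) (\<Lambda>, \<chi>) \<theta> \<theta>')"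
  unfolding comp_fm_eq by (simp add: wff_comp_body wf_ctx_def)

lemma wff_id: "wff \<Sigma> \<Gamma> \<phi> \<Longrightarrow> wff \<Sigma> (\<Gamma> @ \<Gamma>) (id_fm (\<Gamma>, \<phi>))"
  unfolding id_fm_eq
  by (simp only: wff.simps, intro conjI wff_eqs_ren wff_ren; (assumption | intro vt_simps; simp))

context geo_model
begin

lemma H_inst_upt:
  assumes "wff \<Sigma> \<Gamma> \<phi>" "tuple D \<Delta> xs" "a + n \<le> length \<Delta>" "take n (drop a \<Delta>) = \<Gamma>"
  shows "H (inst \<phi> (map Var [a..<a + n])) xs \<longleftrightarrow> H \<phi> (take n (drop a xs))"
  using H_ren[OF assms(1) var_tuple_upt[OF assms(3,4)] assms(2)] assms(3) tuple_length[OF assms(2)]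
  by (simp add: map_nth_upt)

lemma H_inst_upt2:
  assumes "wff \<Sigma> (take n (drop a \<Delta>) @ take m (drop b \<Delta>)) \<phi>" "tuple D \<Delta> xs" "a + n \<le> length \<Delta>" "b + m \<le> length \<Delta>"
  shows "H (inst \<phi> (map Var ([a..<a + n] @ [b..<b + m]))) xs \<longleftrightarrow> H \<phi> (take n (drop a xs) @ take m (drop b xs))"
  using H_ren[OF assms(1) var_tuple_app[OF var_tuple_upt[OF assms(3)] var_tuple_upt[OF assms(4)]] assms(2)]
    assms(3,4) tuple_length[OF assms(2)]
  by (simp add: map_nth_upt del: map_append) (simp add: map_nth_upt)

lemma H_eqs_upt:
  assumes "tuple D \<Delta> xs" "a + n \<le> length \<Delta>" "b + n \<le> length \<Delta>" "take n (drop a \<Delta>) = take n (drop b \<Delta>)"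
  shows "H (eqs (map Var [a..<a + n]) (map Var [b..<b + n])) xs \<longleftrightarrow> take n (drop a xs) = take n (drop b xs)"
  using H_eqs[OF var_tuple_upt[OF assms(2) refl] var_tuple_upt[OF assms(3) assms(4)[symmetric]] assms(1)]
    assms(2,3) tuple_length[OF assms(1)] by (simp add: map_nth_upt)

lemma H_total:
  assumes "wff \<Sigma> (\<Gamma> @ \<Delta>) \<theta>" "tuple D \<Gamma> xs" "tuple D \<Delta> ys"
  shows "H (total_fm (length \<Gamma>) (length \<Delta>) \<theta>) (ys @ xs) \<longleftrightarrow> H \<theta> (xs @ ys)"
  unfolding total_fm_def using assms tuple_length[OF assms(2)] tuple_length[OF assms(3)]
  by (subst H_inst_upt2[where \<Delta> = "\<Delta> @ \<Gamma>"]) auto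

text \<open>In a model a functional formula is the graph of a function between the sets defined by
  \<open>\<phi>\<close> and \<open>\<psi>\<close>; totality needs the witnesses of its quantifier block.\<close>
lemma functional_model:
  assumes f: "functional \<Sigma> T (\<Gamma>, \<phi>) (\<Delta>, \<psi>) \<theta>" and x: "tuple D \<Gamma> xs" and w: "wff \<Sigma> \<Delta> \<psi>"
  shows "tuple D \<Delta> ys \<Longrightarrow> H \<theta> (xs @ ys) \<Longrightarrow> H \<phi> xs \<and> H \<psi> ys"
    and "tuple D \<Delta> ys \<Longrightarrow> tuple D \<Delta> ys' \<Longrightarrow> H \<theta> (xs @ ys) \<Longrightarrow> H \<theta> (xs @ ys') \<Longrightarrow> ys = ys'"
    and "ex_tasks \<Delta> (total_fm (length \<Gamma>) (length \<Delta>) \<theta>) \<subseteq> S \<Longrightarrow> H \<phi> xs \<Longrightarrow>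
      \<exists>ys. tuple D \<Delta> ys \<and> H \<theta> (xs @ ys)"
proof -
  note f = f[unfolded functional_iff Let_def]
  note lx = tuple_length[OF x]
  have wf: "wff \<Sigma> (\<Gamma> @ \<Delta>) \<theta>" "wff \<Sigma> \<Gamma> \<phi>" using f prvD by blast+
  show "H \<phi> xs \<and> H \<psi> ys" if y: "tuple D \<Delta> ys" "H \<theta> (xs @ ys)"
  proof -
    have t: "tuple D (\<Gamma> @ \<Delta>) (xs @ ys)" using x y by simp
    have "H (And (inst \<phi> (map Var [0..<0 + length \<Gamma>])) (inst \<psi> (map Var [length \<Gamma>..<length \<Gamma> + length \<Delta>]))) (xs @ ys)"
      using H_prv[OF conjunct1[OF f] t y(2)] .
    moreover have "wff \<Sigma> (\<Gamma> @ \<Delta>) (inst \<phi> (map Var [0..<0 + length \<Gamma>]))"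
      "wff \<Sigma> (\<Gamma> @ \<Delta>) (inst \<psi> (map Var [length \<Gamma>..<length \<Gamma> + length \<Delta>]))"
      using prvD[OF conjunct1[OF f]] by (simp_all only: wff.simps)
    ultimately show ?thesis
      using H_And[OF _ _ t] H_inst_upt[OF wf(2) t, of 0] H_inst_upt[OF w t, of "length \<Gamma>" "length \<Delta>"]
        lx tuple_length[OF y(1)] by auto
  qed
  show "ys = ys'" if y: "tuple D \<Delta> ys" "tuple D \<Delta> ys'" "H \<theta> (xs @ ys)" "H \<theta> (xs @ ys')"
  proof -
    let ?m = "length \<Gamma>" let ?n = "length \<Delta>"
    have t: "tuple D (\<Gamma> @ \<Delta> @ \<Delta>) (xs @ ys @ ys')" using x y by simp
    let ?a = "inst \<theta> (map Var ([0..<0 + ?m] @ [?m..<?m + ?n]))"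
    let ?b = "inst \<theta> (map Var ([0..<0 + ?m] @ [?m + ?n..<?m + ?n + ?n]))"
    have p: "prv (\<Gamma> @ \<Delta> @ \<Delta>) (And ?a ?b) (eqs (map Var [?m..<?m + ?n]) (map Var [?m + ?n..<?m + ?n + ?n]))"
      using f by blast
    have "wff \<Sigma> (\<Gamma> @ \<Delta> @ \<Delta>) ?a" "wff \<Sigma> (\<Gamma> @ \<Delta> @ \<Delta>) ?b" using prvD[OF p] by (simp_all only: wff.simps)
    moreover have "H ?a (xs @ ys @ ys')" "H ?b (xs @ ys @ ys')"
      using H_inst_upt2[OF _ t, of ?m 0 ?n ?m \<theta>] H_inst_upt2[OF _ t, of ?m 0 ?n "?m + ?n" \<theta>] wf y
        lx tuple_length[OF y(1)] tuple_length[OF y(2)] by auto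
    ultimately have "H (And ?a ?b) (xs @ ys @ ys')" using H_And[OF _ _ t] by blast
    from H_prv[OF p t this] show ?thesis
      using H_eqs_upt[OF t, of ?m ?n "?m + ?n"] lx tuple_length[OF y(1)] tuple_length[OF y(2)] by auto
  qed
  show "\<exists>ys. tuple D \<Delta> ys \<and> H \<theta> (xs @ ys)"
    if y: "ex_tasks \<Delta> (total_fm (length \<Gamma>) (length \<Delta>) \<theta>) \<subseteq> S" "H \<phi> xs"
  proof -
    have p: "prv \<Gamma> \<phi> (exs \<Delta> (total_fm (length \<Gamma>) (length \<Delta>) \<theta>))" using f by blast
    have w: "wff \<Sigma> \<Gamma> (exs \<Delta> (total_fm (length \<Gamma>) (length \<Delta>) \<theta>))" using prvD[OF p] by blast
    show ?thesis using H_exsE[OF w x y(1) H_prv[OF p x y(2)]] H_total[OF wf(1) x] by blast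
  qed
qed

lemma H_comp:
  assumes "wff \<Sigma> (\<Gamma> @ \<Delta>) \<theta>" "wff \<Sigma> (\<Delta> @ \<Lambda>) \<theta>'" "wf_ctx \<Sigma> \<Delta>" "tuple D \<Gamma> xs" "tuple D \<Lambda> zs"
    "ex_tasks \<Delta> (comp_body (length \<Gamma>) (length \<Delta>) (length \<Lambda>) \<theta> \<theta>') \<subseteq> S"
  shows "H (comp_fm (\<Gamma>, \<phi>) (\<Delta>, \<psi>) (\<Lambda>, \<chi>) \<theta> \<theta>') (xs @ zs) \<longleftrightarrow>
    (\<exists>ys. tuple D \<Delta> ys \<and> H \<theta> (xs @ ys) \<and> H \<theta>' (ys @ zs))"
proof -
  have t: "tuple D (\<Gamma> @ \<Lambda>) (xs @ zs)" using assms by simp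
  have *: "H (comp_body (length \<Gamma>) (length \<Delta>) (length \<Lambda>) \<theta> \<theta>') (ys @ xs @ zs) \<longleftrightarrow> H \<theta> (xs @ ys) \<and> H \<theta>' (ys @ zs)"
    if y: "tuple D \<Delta> ys" for ys
  proof -
    have t': "tuple D (\<Delta> @ \<Gamma> @ \<Lambda>) (ys @ xs @ zs)" using assms y by simp
    note wb = wff_comp_body[OF assms(1,2), unfolded comp_body_def wff.simps]
    show ?thesis unfolding comp_body_def
      using H_And[OF conjunct1[OF wb] conjunct2[OF wb] t'] assms(1,2) H_inst_upt2[OF _ t', of "length \<Gamma>" "length \<Delta>" "length \<Delta>" 0 \<theta>]
        H_inst_upt2[OF _ t', of "length \<Delta>" 0 "length \<Lambda>" "length \<Delta> + length \<Gamma>" \<theta>']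
        tuple_length[OF assms(4)] tuple_length[OF assms(5)] tuple_length[OF y] by auto
  qed
  show ?thesis unfolding comp_fm_eq
    using H_exs[OF wff_comp[OF assms(1-3), unfolded comp_fm_eq] t assms(6)] * by auto
qed

lemma H_id:
  assumes "wff \<Sigma> \<Gamma> \<phi>" "tuple D \<Gamma> xs" "tuple D \<Gamma> ys"
  shows "H (id_fm (\<Gamma>, \<phi>)) (xs @ ys) \<longleftrightarrow> H \<phi> xs \<and> xs = ys"
proof -
  have t: "tuple D (\<Gamma> @ \<Gamma>) (xs @ ys)" using assms by simp
  note w = wff_id[OF assms(1), unfolded id_fm_eq wff.simps]
  show ?thesis unfolding id_fm_eq
    using H_And[OF conjunct1[OF w] conjunct2[OF w] t] H_inst_upt[OF assms(1) t, of 0 "length \<Gamma>"]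
      H_eqs_upt[OF t, of 0 "length \<Gamma>" "length \<Gamma>"] tuple_length[OF assms(2)] tuple_length[OF assms(3)] by auto
qed

end

context geo
begin

text \<open>Conversely, it suffices to check the three conditions on functional formulas in models. As a
  consequence, the laws of the syntactic category become those of composition of relations.\<close>
lemma functionalI:
  assumes S: "countable S" and w: "wf_ctx \<Sigma> \<Gamma>" "wf_ctx \<Sigma> \<Delta>" "wff \<Sigma> \<Gamma> \<phi>" "wff \<Sigma> \<Delta> \<psi>" "wff \<Sigma> (\<Gamma> @ \<Delta>) \<theta>"
    and 1: "\<And>D H xs ys. geo_model \<Sigma> T S D H \<Longrightarrow> tuple D \<Gamma> xs \<Longrightarrow> tuple D \<Delta> ys \<Longrightarrow> H \<theta> (xs @ ys) \<Longrightarrow> H \<phi> xs \<and> H \<psi> ys"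
    and 2: "\<And>D H xs. geo_model \<Sigma> T S D H \<Longrightarrow> tuple D \<Gamma> xs \<Longrightarrow> H \<phi> xs \<Longrightarrow> \<exists>ys. tuple D \<Delta> ys \<and> H \<theta> (xs @ ys)"
    and 3: "\<And>D H xs ys ys'. geo_model \<Sigma> T S D H \<Longrightarrow> tuple D \<Gamma> xs \<Longrightarrow> tuple D \<Delta> ys \<Longrightarrow> tuple D \<Delta> ys' \<Longrightarrow>
      H \<theta> (xs @ ys) \<Longrightarrow> H \<theta> (xs @ ys') \<Longrightarrow> ys = ys'"
  shows "functional \<Sigma> T (\<Gamma>, \<phi>) (\<Delta>, \<psi>) \<theta>"
proof -
  let ?m = "length \<Gamma>" let ?n = "length \<Delta>"
  have w1: "wff \<Sigma> (\<Gamma> @ \<Delta>) (inst \<phi> (map Var [0..<0 + ?m]))" "wff \<Sigma> (\<Gamma> @ \<Delta>) (inst \<psi> (map Var [?m..<?m + ?n]))"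
    by (rule wff_ren[OF w(3)] wff_ren[OF w(4)]; intro vt_simps; simp)+
  have "prv (\<Gamma> @ \<Delta>) \<theta> (And (inst \<phi> (map Var [0..<0 + ?m])) (inst \<psi> (map Var [?m..<?m + ?n])))"
  proof (rule complete[OF S _ w(5)])
    fix D H zs assume m: "geo_model \<Sigma> T S D H" and t: "tuple D (\<Gamma> @ \<Delta>) zs" and h: "H \<theta> zs"
    interpret m: geo_model \<Sigma> T S D H by (rule m)
    obtain xs ys where z: "zs = xs @ ys" "tuple D \<Gamma> xs" "tuple D \<Delta> ys" using t by (rule tuple_appendE)
    show "H (And (inst \<phi> (map Var [0..<0 + ?m])) (inst \<psi> (map Var [?m..<?m + ?n]))) zs"
      using m.H_And[OF w1 t] m.H_inst_upt[OF w(3) t, of 0 ?m] m.H_inst_upt[OF w(4) t, of ?m ?n]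
        1[OF m z(2,3)] h tuple_length[OF z(2)] tuple_length[OF z(3)] z(1) by auto
  qed (use w w1 in auto)
  moreover have w2: "wff \<Sigma> \<Gamma> (exs \<Delta> (total_fm ?m ?n \<theta>))"
    using wff_total[OF w(5)] w(2) by (simp add: wf_ctx_def)
  have "prv \<Gamma> \<phi> (exs \<Delta> (total_fm ?m ?n \<theta>))"
  proof (rule complete[OF S w(1,3) w2])
    fix D H xs assume m: "geo_model \<Sigma> T S D H" and t: "tuple D \<Gamma> xs" and h: "H \<phi> xs"
    interpret m: geo_model \<Sigma> T S D H by (rule m)
    obtain ys where "tuple D \<Delta> ys" "H \<theta> (xs @ ys)" using 2[OF m t h] by blast
    then show "H (exs \<Delta> (total_fm ?m ?n \<theta>)) xs"
      using m.H_exsI[OF w2 t] m.H_total[OF w(5) t] by blast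
  qed
  moreover
  let ?a = "inst \<theta> (map Var ([0..<0 + ?m] @ [?m..<?m + ?n]))"
  let ?b = "inst \<theta> (map Var ([0..<0 + ?m] @ [?m + ?n..<?m + ?n + ?n]))"
  have w3: "wff \<Sigma> (\<Gamma> @ \<Delta> @ \<Delta>) ?a" "wff \<Sigma> (\<Gamma> @ \<Delta> @ \<Delta>) ?b"
    by (rule wff_ren[OF w(5)]; intro vt_simps; simp)+
  have "prv (\<Gamma> @ \<Delta> @ \<Delta>) (And ?a ?b) (eqs (map Var [?m..<?m + ?n]) (map Var [?m + ?n..<?m + ?n + ?n]))"
  proof (rule complete[OF S])
    show "wff \<Sigma> (\<Gamma> @ \<Delta> @ \<Delta>) (eqs (map Var [?m..<?m + ?n]) (map Var [?m + ?n..<?m + ?n + ?n]))"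
      by (rule wff_eqs_ren[where \<Gamma> = \<Delta>]; intro vt_simps; simp)
    fix D H zs assume m: "geo_model \<Sigma> T S D H" and t: "tuple D (\<Gamma> @ \<Delta> @ \<Delta>) zs" and h: "H (And ?a ?b) zs"
    interpret m: geo_model \<Sigma> T S D H by (rule m)
    obtain xs us where z1: "zs = xs @ us" "tuple D \<Gamma> xs" "tuple D (\<Delta> @ \<Delta>) us" using t by (rule tuple_appendE)
    obtain ys ys' where z2: "us = ys @ ys'" "tuple D \<Delta> ys" "tuple D \<Delta> ys'" using z1(3) by (rule tuple_appendE)
    have "H ?a zs" "H ?b zs" using m.H_And[OF w3 t] h by auto
    then have "H \<theta> (xs @ ys)" "H \<theta> (xs @ ys')"
      using m.H_inst_upt2[OF _ t, of ?m 0 ?n ?m \<theta>] m.H_inst_upt2[OF _ t, of ?m 0 ?n "?m + ?n" \<theta>] w(5)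
        z1(1) z2(1) tuple_length[OF z1(2)] tuple_length[OF z2(2)] tuple_length[OF z2(3)] by auto
    then have "ys = ys'" using 3[OF m z1(2) z2(2,3)] by blast
    then show "H (eqs (map Var [?m..<?m + ?n]) (map Var [?m + ?n..<?m + ?n + ?n])) zs"
      using m.H_eqs_upt[OF t, of ?m ?n "?m + ?n"] z1(1) z2(1) tuple_length[OF z1(2)]
        tuple_length[OF z2(2)] tuple_length[OF z2(3)] by auto
  qed (use w w3 in auto)
  ultimately show ?thesis unfolding functional_iff Let_def by blast
qed

end

section \<open>Syntactic categories\<close>

context geo
begin

lemma functional_equivalent:
  assumes f: "functional \<Sigma> T (\<Gamma>, \<phi>) (\<Delta>, \<psi>) \<theta>" and e: "equivalent \<Sigma> T \<Gamma> \<phi> \<phi>'" "equivalent \<Sigma> T \<Delta> \<psi> \<psi>'"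
    "equivalent \<Sigma> T (\<Gamma> @ \<Delta>) \<theta> \<theta>'"
  shows "functional \<Sigma> T (\<Gamma>, \<phi>') (\<Delta>, \<psi>') \<theta>'"
proof (rule functionalI[where S = "ex_tasks \<Delta> (total_fm (length \<Gamma>) (length \<Delta>) \<theta>)"])
  fix D H assume m: "geo_model \<Sigma> T (ex_tasks \<Delta> (total_fm (length \<Gamma>) (length \<Delta>) \<theta>)) D H"
  interpret m: geo_model \<Sigma> T "ex_tasks \<Delta> (total_fm (length \<Gamma>) (length \<Delta>) \<theta>)" D H by (rule m)
  note fm = m.functional_model[OF f _ conjunct1[OF conjunct2[OF equivalentD[OF e(2)]]]]
  have h: "H \<phi> xs \<longleftrightarrow> H \<phi>' xs" if "tuple D \<Gamma> xs" for xs using m.H_equivalent[OF e(1) that] .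
  have h2: "H \<psi> xs \<longleftrightarrow> H \<psi>' xs" if "tuple D \<Delta> xs" for xs using m.H_equivalent[OF e(2) that] .
  have h3: "H \<theta> (xs @ ys) \<longleftrightarrow> H \<theta>' (xs @ ys)" if "tuple D \<Gamma> xs" "tuple D \<Delta> ys" for xs ys
    using m.H_equivalent[OF e(3), of "xs @ ys"] that by simp
  show "H \<phi>' xs \<and> H \<psi>' ys" if "tuple D \<Gamma> xs" "tuple D \<Delta> ys" "H \<theta>' (xs @ ys)" for xs ys
    using that h h2 h3 fm(1) by blast
  show "\<exists>ys. tuple D \<Delta> ys \<and> H \<theta>' (xs @ ys)" if "tuple D \<Gamma> xs" "H \<phi>' xs" for xs
    using that h h3 fm(3) by blast
  show "ys = ys'" if "tuple D \<Gamma> xs" "tuple D \<Delta> ys" "tuple D \<Delta> ys'" "H \<theta>' (xs @ ys)" "H \<theta>' (xs @ ys')" for xs ys ys'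
    using that h3 fm(2) by blast
qed (use equivalentD e in auto)

lemma comp_equivalent:
  assumes e: "equivalent \<Sigma> T (\<Gamma> @ \<Delta>) \<theta>1 \<theta>2" "equivalent \<Sigma> T (\<Delta> @ \<Lambda>) \<theta>1' \<theta>2'"
  shows "equivalent \<Sigma> T (\<Gamma> @ \<Lambda>) (comp_fm (\<Gamma>, \<phi>) (\<Delta>, \<psi>) (\<Lambda>, \<chi>) \<theta>1 \<theta>1') (comp_fm (\<Gamma>, \<phi>') (\<Delta>, \<psi>') (\<Lambda>, \<chi>') \<theta>2 \<theta>2')"
proof -
  let ?b = "comp_body (length \<Gamma>) (length \<Delta>) (length \<Lambda>)"
  have w: "wf_ctx \<Sigma> \<Gamma>" "wf_ctx \<Sigma> \<Delta>" "wf_ctx \<Sigma> \<Lambda>" "wff \<Sigma> (\<Gamma> @ \<Delta>) \<theta>1" "wff \<Sigma> (\<Gamma> @ \<Delta>) \<theta>2"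
    "wff \<Sigma> (\<Delta> @ \<Lambda>) \<theta>1'" "wff \<Sigma> (\<Delta> @ \<Lambda>) \<theta>2'"
    using e[THEN equivalentD] by auto
  show ?thesis
  proof (rule equivalent_complete[where S = "ex_tasks \<Delta> (?b \<theta>1 \<theta>1') \<union> ex_tasks \<Delta> (?b \<theta>2 \<theta>2')"])
    fix D H us assume m: "geo_model \<Sigma> T (ex_tasks \<Delta> (?b \<theta>1 \<theta>1') \<union> ex_tasks \<Delta> (?b \<theta>2 \<theta>2')) D H"
      and t: "tuple D (\<Gamma> @ \<Lambda>) us"
    interpret m: geo_model \<Sigma> T "ex_tasks \<Delta> (?b \<theta>1 \<theta>1') \<union> ex_tasks \<Delta> (?b \<theta>2 \<theta>2')" D H by (rule m)
    obtain xs zs where us: "us = xs @ zs" "tuple D \<Gamma> xs" "tuple D \<Lambda> zs" using t by (rule tuple_appendE)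
    have h1: "H \<theta>1 (xs @ ys) \<longleftrightarrow> H \<theta>2 (xs @ ys)" if "tuple D \<Delta> ys" for ys
      using m.H_equivalent[OF e(1), of "xs @ ys"] that us by simp
    have h2: "H \<theta>1' (ys @ zs) \<longleftrightarrow> H \<theta>2' (ys @ zs)" if "tuple D \<Delta> ys" for ys
      using m.H_equivalent[OF e(2), of "ys @ zs"] that us by simp
    show "H (comp_fm (\<Gamma>, \<phi>) (\<Delta>, \<psi>) (\<Lambda>, \<chi>) \<theta>1 \<theta>1') us \<longleftrightarrow> H (comp_fm (\<Gamma>, \<phi>') (\<Delta>, \<psi>') (\<Lambda>, \<chi>') \<theta>2 \<theta>2') us"
      unfolding us(1)
      by (subst (1 2) m.H_comp) (use w us h1 h2 in auto)
  qed (use w in \<open>auto intro!: wff_comp simp del: comp_fm.simps\<close>)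
qed

lemma functional_id:
  assumes w: "wf_ctx \<Sigma> \<Gamma>" "wff \<Sigma> \<Gamma> \<phi>"
  shows "functional \<Sigma> T (\<Gamma>, \<phi>) (\<Gamma>, \<phi>) (id_fm (\<Gamma>, \<phi>))"
proof (rule functionalI[where S = "{}"])
  fix D H assume m: "geo_model \<Sigma> T {} D H"
  interpret m: geo_model \<Sigma> T "{}" D H by (rule m)
  note h = m.H_id[OF w(2)]
  show "H \<phi> xs \<and> H \<phi> ys" if "tuple D \<Gamma> xs" "tuple D \<Gamma> ys" "H (id_fm (\<Gamma>, \<phi>)) (xs @ ys)" for xs ys
    using that h by blast
  show "\<exists>ys. tuple D \<Gamma> ys \<and> H (id_fm (\<Gamma>, \<phi>)) (xs @ ys)" if "tuple D \<Gamma> xs" "H \<phi> xs" for xs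
    using that h by blast
  show "ys = ys'" if "tuple D \<Gamma> xs" "tuple D \<Gamma> ys" "tuple D \<Gamma> ys'" "H (id_fm (\<Gamma>, \<phi>)) (xs @ ys)" "H (id_fm (\<Gamma>, \<phi>)) (xs @ ys')" for xs ys ys'
    using that h by blast
qed (use w wff_id in auto)

lemma functional_comp:
  assumes f: "functional \<Sigma> T (\<Gamma>, \<phi>) (\<Delta>, \<psi>) \<theta>" "functional \<Sigma> T (\<Delta>, \<psi>) (\<Lambda>, \<chi>) \<theta>'"
    and w: "wf_ctx \<Sigma> \<Gamma>" "wf_ctx \<Sigma> \<Delta>" "wf_ctx \<Sigma> \<Lambda>" "wff \<Sigma> \<Gamma> \<phi>" "wff \<Sigma> \<Delta> \<psi>" "wff \<Sigma> \<Lambda> \<chi>"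
      "wff \<Sigma> (\<Gamma> @ \<Delta>) \<theta>" "wff \<Sigma> (\<Delta> @ \<Lambda>) \<theta>'"
  shows "functional \<Sigma> T (\<Gamma>, \<phi>) (\<Lambda>, \<chi>) (comp_fm (\<Gamma>, \<phi>) (\<Delta>, \<psi>) (\<Lambda>, \<chi>) \<theta> \<theta>')"
proof -
  define S where "S = ex_tasks \<Delta> (comp_body (length \<Gamma>) (length \<Delta>) (length \<Lambda>) \<theta> \<theta>') \<union>
    ex_tasks \<Delta> (total_fm (length \<Gamma>) (length \<Delta>) \<theta>) \<union> ex_tasks \<Lambda> (total_fm (length \<Delta>) (length \<Lambda>) \<theta>')"
  let ?k = "comp_fm (\<Gamma>, \<phi>) (\<Delta>, \<psi>) (\<Lambda>, \<chi>) \<theta> \<theta>'"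
  show ?thesis
  proof (rule functionalI[where S = S])
    fix D H assume m: "geo_model \<Sigma> T S D H"
    interpret m: geo_model \<Sigma> T S D H by (rule m)
    note f1 = m.functional_model[OF f(1) _ w(5)] and f2 = m.functional_model[OF f(2) _ w(6)]
    have h: "H ?k (xs @ zs) \<longleftrightarrow> (\<exists>ys. tuple D \<Delta> ys \<and> H \<theta> (xs @ ys) \<and> H \<theta>' (ys @ zs))"
      if "tuple D \<Gamma> xs" "tuple D \<Lambda> zs" for xs zs
      by (rule m.H_comp[OF w(7,8,2) that]) (auto simp: S_def)
    have S1: "ex_tasks \<Delta> (total_fm (length \<Gamma>) (length \<Delta>) \<theta>) \<subseteq> S" "ex_tasks \<Lambda> (total_fm (length \<Delta>) (length \<Lambda>) \<theta>') \<subseteq> S"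
      by (auto simp: S_def)
    show "H \<phi> xs \<and> H \<chi> ys" if "tuple D \<Gamma> xs" "tuple D \<Lambda> ys" "H ?k (xs @ ys)" for xs ys
      using that h f1(1) f2(1) by blast
    show "\<exists>ys. tuple D \<Lambda> ys \<and> H ?k (xs @ ys)" if x: "tuple D \<Gamma> xs" "H \<phi> xs" for xs
    proof -
      obtain ys where ys: "tuple D \<Delta> ys" "H \<theta> (xs @ ys)" using f1(3)[OF x(1) S1(1) x(2)] by blast
      then have "H \<psi> ys" using f1(1) x by blast
      then obtain zs where "tuple D \<Lambda> zs" "H \<theta>' (ys @ zs)" using f2(3)[OF ys(1) S1(2)] by blast
      then show ?thesis using h x ys by blast
    qed
    show "zs = zs'" if x: "tuple D \<Gamma> xs" "tuple D \<Lambda> zs" "tuple D \<Lambda> zs'" "H ?k (xs @ zs)" "H ?k (xs @ zs')" for xs zs zs'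
    proof -
      obtain ys ys' where "tuple D \<Delta> ys" "H \<theta> (xs @ ys)" "H \<theta>' (ys @ zs)" "tuple D \<Delta> ys'" "H \<theta> (xs @ ys')" "H \<theta>' (ys' @ zs')"
        using h x by blast
      then show ?thesis using f1(2) f2(2) x by metis
    qed
  qed (use w in \<open>auto intro!: wff_comp simp: S_def simp del: comp_fm.simps\<close>)
qed

lemma comp_id_left:
  assumes f: "functional \<Sigma> T (\<Gamma>, \<phi>) (\<Delta>, \<psi>) \<theta>"
    and w: "wf_ctx \<Sigma> \<Gamma>" "wf_ctx \<Sigma> \<Delta>" "wff \<Sigma> \<Gamma> \<phi>" "wff \<Sigma> \<Delta> \<psi>" "wff \<Sigma> (\<Gamma> @ \<Delta>) \<theta>"
  shows "equivalent \<Sigma> T (\<Gamma> @ \<Delta>) (comp_fm (\<Gamma>, \<alpha>) (\<Gamma>, \<beta>) (\<Delta>, \<gamma>) (id_fm (\<Gamma>, \<phi>)) \<theta>) \<theta>"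
proof (rule equivalent_complete)
  let ?S = "ex_tasks \<Gamma> (comp_body (length \<Gamma>) (length \<Gamma>) (length \<Delta>) (id_fm (\<Gamma>, \<phi>)) \<theta>)"
  show "countable ?S" by simp
  fix D H us assume m: "geo_model \<Sigma> T ?S D H" and t: "tuple D (\<Gamma> @ \<Delta>) us"
  interpret m: geo_model \<Sigma> T ?S D H by (rule m)
  obtain xs ys where us: "us = xs @ ys" "tuple D \<Gamma> xs" "tuple D \<Delta> ys" using t by (rule tuple_appendE)
  note f1 = m.functional_model[OF f us(2) w(4)]
  show "H (comp_fm (\<Gamma>, \<alpha>) (\<Gamma>, \<beta>) (\<Delta>, \<gamma>) (id_fm (\<Gamma>, \<phi>)) \<theta>) us \<longleftrightarrow> H \<theta> us"
    unfolding us(1)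
    using m.H_comp[OF wff_id[OF w(3)] w(5,1) us(2,3) order_refl] m.H_id[OF w(3) us(2)] f1(1) us by blast
qed (use w wff_comp[OF wff_id] in \<open>auto simp del: comp_fm.simps id_fm.simps\<close>)

lemma comp_id_right:
  assumes f: "functional \<Sigma> T (\<Gamma>, \<phi>) (\<Delta>, \<psi>) \<theta>"
    and w: "wf_ctx \<Sigma> \<Gamma>" "wf_ctx \<Sigma> \<Delta>" "wff \<Sigma> \<Gamma> \<phi>" "wff \<Sigma> \<Delta> \<psi>" "wff \<Sigma> (\<Gamma> @ \<Delta>) \<theta>"
  shows "equivalent \<Sigma> T (\<Gamma> @ \<Delta>) (comp_fm (\<Gamma>, \<alpha>) (\<Delta>, \<beta>) (\<Delta>, \<gamma>) \<theta> (id_fm (\<Delta>, \<psi>))) \<theta>"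
proof (rule equivalent_complete)
  let ?S = "ex_tasks \<Delta> (comp_body (length \<Gamma>) (length \<Delta>) (length \<Delta>) \<theta> (id_fm (\<Delta>, \<psi>)))"
  show "countable ?S" by simp
  fix D H us assume m: "geo_model \<Sigma> T ?S D H" and t: "tuple D (\<Gamma> @ \<Delta>) us"
  interpret m: geo_model \<Sigma> T ?S D H by (rule m)
  obtain xs ys where us: "us = xs @ ys" "tuple D \<Gamma> xs" "tuple D \<Delta> ys" using t by (rule tuple_appendE)
  note f1 = m.functional_model[OF f us(2) w(4)]
  show "H (comp_fm (\<Gamma>, \<alpha>) (\<Delta>, \<beta>) (\<Delta>, \<gamma>) \<theta> (id_fm (\<Delta>, \<psi>))) us \<longleftrightarrow> H \<theta> us"
    unfolding us(1)
    using m.H_comp[OF w(5) wff_id[OF w(4)] w(2) us(2,3) order_refl] m.H_id[OF w(4) _ us(3)] f1(1) us by blast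
qed (use w wff_comp[OF _ wff_id] in \<open>auto simp del: comp_fm.simps id_fm.simps\<close>)

lemma comp_assoc:
  assumes w: "wf_ctx \<Sigma> \<Gamma>" "wf_ctx \<Sigma> \<Delta>" "wf_ctx \<Sigma> \<Lambda>" "wf_ctx \<Sigma> \<Xi>"
    and t: "wff \<Sigma> (\<Gamma> @ \<Delta>) \<theta>1" "wff \<Sigma> (\<Delta> @ \<Lambda>) \<theta>2" "wff \<Sigma> (\<Lambda> @ \<Xi>) \<theta>3"
  shows "equivalent \<Sigma> T (\<Gamma> @ \<Xi>)
    (comp_fm (\<Gamma>, \<alpha>) (\<Lambda>, \<gamma>) (\<Xi>, \<delta>) (comp_fm (\<Gamma>, \<alpha>) (\<Delta>, \<beta>) (\<Lambda>, \<gamma>) \<theta>1 \<theta>2) \<theta>3)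
    (comp_fm (\<Gamma>, \<alpha>) (\<Delta>, \<beta>) (\<Xi>, \<delta>) \<theta>1 (comp_fm (\<Delta>, \<beta>) (\<Lambda>, \<gamma>) (\<Xi>, \<delta>) \<theta>2 \<theta>3))"
proof -
  let ?k12 = "comp_fm (\<Gamma>, \<alpha>) (\<Delta>, \<beta>) (\<Lambda>, \<gamma>) \<theta>1 \<theta>2"
  let ?k23 = "comp_fm (\<Delta>, \<beta>) (\<Lambda>, \<gamma>) (\<Xi>, \<delta>) \<theta>2 \<theta>3"
  have t': "wff \<Sigma> (\<Gamma> @ \<Lambda>) ?k12" "wff \<Sigma> (\<Delta> @ \<Xi>) ?k23" using wff_comp w t by blast+
  define S where "S = ex_tasks \<Delta> (comp_body (length \<Gamma>) (length \<Delta>) (length \<Lambda>) \<theta>1 \<theta>2) \<union>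
    ex_tasks \<Lambda> (comp_body (length \<Delta>) (length \<Lambda>) (length \<Xi>) \<theta>2 \<theta>3) \<union>
    ex_tasks \<Delta> (comp_body (length \<Gamma>) (length \<Delta>) (length \<Xi>) \<theta>1 ?k23) \<union>
    ex_tasks \<Lambda> (comp_body (length \<Gamma>) (length \<Lambda>) (length \<Xi>) ?k12 \<theta>3)"
  show ?thesis
  proof (rule equivalent_complete[where S = S])
    fix D H us assume m: "geo_model \<Sigma> T S D H" and tu: "tuple D (\<Gamma> @ \<Xi>) us"
    interpret m: geo_model \<Sigma> T S D H by (rule m)
    obtain xs vs where us: "us = xs @ vs" "tuple D \<Gamma> xs" "tuple D \<Xi> vs" using tu by (rule tuple_appendE)
    have h12: "H ?k12 (xs @ zs) \<longleftrightarrow> (\<exists>ys. tuple D \<Delta> ys \<and> H \<theta>1 (xs @ ys) \<and> H \<theta>2 (ys @ zs))" if "tuple D \<Lambda> zs" for zs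
      by (rule m.H_comp[OF t(1,2) w(2) us(2) that]) (auto simp: S_def)
    have h23: "H ?k23 (ys @ vs) \<longleftrightarrow> (\<exists>zs. tuple D \<Lambda> zs \<and> H \<theta>2 (ys @ zs) \<and> H \<theta>3 (zs @ vs))" if "tuple D \<Delta> ys" for ys
      by (rule m.H_comp[OF t(2,3) w(3) that us(3)]) (auto simp: S_def)
    have h1: "H (comp_fm (\<Gamma>, \<alpha>) (\<Lambda>, \<gamma>) (\<Xi>, \<delta>) ?k12 \<theta>3) (xs @ vs) \<longleftrightarrow>
        (\<exists>zs. tuple D \<Lambda> zs \<and> H ?k12 (xs @ zs) \<and> H \<theta>3 (zs @ vs))"
      by (rule m.H_comp[OF t'(1) t(3) w(3) us(2,3)]) (auto simp: S_def)
    have h2: "H (comp_fm (\<Gamma>, \<alpha>) (\<Delta>, \<beta>) (\<Xi>, \<delta>) \<theta>1 ?k23) (xs @ vs) \<longleftrightarrow>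
        (\<exists>ys. tuple D \<Delta> ys \<and> H \<theta>1 (xs @ ys) \<and> H ?k23 (ys @ vs))"
      by (rule m.H_comp[OF t(1) t'(2) w(2) us(2,3)]) (auto simp: S_def)
    show "H (comp_fm (\<Gamma>, \<alpha>) (\<Lambda>, \<gamma>) (\<Xi>, \<delta>) ?k12 \<theta>3) us \<longleftrightarrow> H (comp_fm (\<Gamma>, \<alpha>) (\<Delta>, \<beta>) (\<Xi>, \<delta>) \<theta>1 ?k23) us"
      unfolding us(1) h1 h2 using h12 h23 by blast
  qed (use w t t' wff_comp in \<open>auto simp: S_def simp del: comp_fm.simps\<close>)
qed

end

text \<open>Closure is required up to provable equivalence only: the composite of cartesian formulas is not
  literally cartesian.\<close>
locale fragment = geo \<Sigma> T
  for \<Sigma> :: "('s, 'f, 'r) signature" and T :: "('s, 'f, 'r, 'i) sequent set" +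
  fixes P :: "'s list \<Rightarrow> ('s, 'f, 'r, 'i) fm \<Rightarrow> bool"
  assumes P_id: "wf_ctx \<Sigma> \<Gamma> \<Longrightarrow> wff \<Sigma> \<Gamma> \<phi> \<Longrightarrow> P \<Gamma> \<phi> \<Longrightarrow>
      \<exists>\<kappa>. P (\<Gamma> @ \<Gamma>) \<kappa> \<and> equivalent \<Sigma> T (\<Gamma> @ \<Gamma>) (id_fm (\<Gamma>, \<phi>)) \<kappa>"
    and P_comp: "wf_ctx \<Sigma> \<Gamma> \<Longrightarrow> wf_ctx \<Sigma> \<Delta> \<Longrightarrow> wf_ctx \<Sigma> \<Lambda> \<Longrightarrow> wff \<Sigma> \<Delta> \<psi> \<Longrightarrow> wff \<Sigma> \<Lambda> \<chi> \<Longrightarrow>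
      wff \<Sigma> (\<Gamma> @ \<Delta>) \<theta> \<Longrightarrow> wff \<Sigma> (\<Delta> @ \<Lambda>) \<theta>' \<Longrightarrow> P (\<Gamma> @ \<Delta>) \<theta> \<Longrightarrow> P (\<Delta> @ \<Lambda>) \<theta>' \<Longrightarrow>
      functional \<Sigma> T (\<Gamma>, \<phi>) (\<Delta>, \<psi>) \<theta> \<Longrightarrow> functional \<Sigma> T (\<Delta>, \<psi>) (\<Lambda>, \<chi>) \<theta>' \<Longrightarrow>
      \<exists>\<kappa>. P (\<Gamma> @ \<Lambda>) \<kappa> \<and> equivalent \<Sigma> T (\<Gamma> @ \<Lambda>) (comp_fm (\<Gamma>, \<phi>) (\<Delta>, \<psi>) (\<Lambda>, \<chi>) \<theta> \<theta>') \<kappa>"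
begin

abbreviation "\<C> \<equiv> syn_cat \<Sigma> T P"

lemma Ob_iff: "(\<Gamma>, \<phi>) \<in> Ob \<C> \<longleftrightarrow> wf_ctx \<Sigma> \<Gamma> \<and> wff \<Sigma> \<Gamma> \<phi> \<and> P \<Gamma> \<phi>"
  by (simp add: syn_cat_def)

lemma HomI:
  assumes "functional \<Sigma> T (\<Gamma>, \<phi>) (\<Delta>, \<psi>) \<theta>" "P (\<Gamma> @ \<Delta>) \<kappa>" "equivalent \<Sigma> T (\<Gamma> @ \<Delta>) \<theta> \<kappa>"
    "wf_ctx \<Sigma> \<Gamma>" "wf_ctx \<Sigma> \<Delta>" "wff \<Sigma> \<Gamma> \<phi>" "wff \<Sigma> \<Delta> \<psi>"
  shows "prov_class \<Sigma> T (\<Gamma> @ \<Delta>) \<theta> \<in> Hom \<C> (\<Gamma>, \<phi>) (\<Delta>, \<psi>)"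
  using prov_class_eq[OF assms(3)] functional_equivalent[OF assms(1) equivalent_refl[OF assms(4,6)]
    equivalent_refl[OF assms(5,7)] assms(3)] assms(2) equivalentD[OF assms(3)]
  by (auto simp: syn_cat_def)

lemma HomE:
  assumes "u \<in> Hom \<C> (\<Gamma>, \<phi>) (\<Delta>, \<psi>)"
  obtains \<theta> where "u = prov_class \<Sigma> T (\<Gamma> @ \<Delta>) \<theta>" "wff \<Sigma> (\<Gamma> @ \<Delta>) \<theta>" "P (\<Gamma> @ \<Delta>) \<theta>" "functional \<Sigma> T (\<Gamma>, \<phi>) (\<Delta>, \<psi>) \<theta>"
  using assms by (auto simp: syn_cat_def)

lemma Ident_eq: "Ident \<C> (\<Gamma>, \<phi>) = prov_class \<Sigma> T (\<Gamma> @ \<Gamma>) (id_fm (\<Gamma>, \<phi>))"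
  by (simp add: syn_cat_def del: id_fm.simps)

lemma Comp_eq:
  assumes "wf_ctx \<Sigma> (\<Gamma> @ \<Delta> @ \<Lambda>)" "wff \<Sigma> (\<Gamma> @ \<Delta>) \<theta>" "wff \<Sigma> (\<Delta> @ \<Lambda>) \<theta>'"
  shows "Comp \<C> (\<Gamma>, \<phi>) (\<Delta>, \<psi>) (\<Lambda>, \<chi>) (prov_class \<Sigma> T (\<Gamma> @ \<Delta>) \<theta>) (prov_class \<Sigma> T (\<Delta> @ \<Lambda>) \<theta>') =
    prov_class \<Sigma> T (\<Gamma> @ \<Lambda>) (comp_fm (\<Gamma>, \<phi>) (\<Delta>, \<psi>) (\<Lambda>, \<chi>) \<theta> \<theta>')"
proof -
  have "prov_class \<Sigma> T (\<Gamma> @ \<Lambda>) (comp_fm (\<Gamma>, \<phi>) (\<Delta>, \<psi>) (\<Lambda>, \<chi>) \<theta>1 \<theta>1') =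
      prov_class \<Sigma> T (\<Gamma> @ \<Lambda>) (comp_fm (\<Gamma>, \<phi>) (\<Delta>, \<psi>) (\<Lambda>, \<chi>) \<theta> \<theta>')"
    if "\<theta>1 \<in> prov_class \<Sigma> T (\<Gamma> @ \<Delta>) \<theta>" "\<theta>1' \<in> prov_class \<Sigma> T (\<Delta> @ \<Lambda>) \<theta>'" for \<theta>1 \<theta>1'
    using that by (intro prov_class_eq[OF equivalent_sym] comp_equivalent) (auto simp: prov_class_def)
  moreover have "\<theta> \<in> prov_class \<Sigma> T (\<Gamma> @ \<Delta>) \<theta>" "\<theta>' \<in> prov_class \<Sigma> T (\<Delta> @ \<Lambda>) \<theta>'"
    using assms by (auto intro!: mem_prov_class)
  ultimately have "(\<Union>\<theta>\<in>prov_class \<Sigma> T (\<Gamma> @ \<Delta>) \<theta>. \<Union>\<theta>'\<in>prov_class \<Sigma> T (\<Delta> @ \<Lambda>) \<theta>'.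
      prov_class \<Sigma> T (\<Gamma> @ \<Lambda>) (comp_fm (\<Gamma>, \<phi>) (\<Delta>, \<psi>) (\<Lambda>, \<chi>) \<theta> \<theta>')) =
    prov_class \<Sigma> T (\<Gamma> @ \<Lambda>) (comp_fm (\<Gamma>, \<phi>) (\<Delta>, \<psi>) (\<Lambda>, \<chi>) \<theta> \<theta>')"
    by blast
  then show ?thesis by (simp add: syn_cat_def del: comp_fm.simps)
qed

text \<open>The identity formula of \<open>\<phi>\<close> also represents a morphism between any two objects whose formulas
  are equivalent to \<open>\<phi>\<close>.\<close>
lemma id_Hom:
  assumes "(\<Gamma>, \<phi>) \<in> Ob \<C>" "equivalent \<Sigma> T \<Gamma> \<phi> \<phi>1" "equivalent \<Sigma> T \<Gamma> \<phi> \<phi>2"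
  shows "prov_class \<Sigma> T (\<Gamma> @ \<Gamma>) (id_fm (\<Gamma>, \<phi>)) \<in> Hom \<C> (\<Gamma>, \<phi>1) (\<Gamma>, \<phi>2)"
proof -
  have w: "wf_ctx \<Sigma> \<Gamma>" "wff \<Sigma> \<Gamma> \<phi>" "P \<Gamma> \<phi>" using assms(1) by (simp_all add: Ob_iff)
  then obtain \<kappa> where k: "P (\<Gamma> @ \<Gamma>) \<kappa>" "equivalent \<Sigma> T (\<Gamma> @ \<Gamma>) (id_fm (\<Gamma>, \<phi>)) \<kappa>" using P_id by blast
  have "functional \<Sigma> T (\<Gamma>, \<phi>1) (\<Gamma>, \<phi>2) (id_fm (\<Gamma>, \<phi>))"
    using functional_equivalent[OF functional_id[OF w(1,2)] assms(2,3)] equivalent_refl w wff_id[OF w(2)]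
    by (simp del: id_fm.simps functional.simps)
  then show ?thesis using HomI k w equivalentD assms by blast
qed

lemma comp_Hom:
  assumes "u \<in> Hom \<C> (\<Gamma>, \<phi>) (\<Delta>, \<psi>)" "v \<in> Hom \<C> (\<Delta>, \<psi>) (\<Lambda>, \<chi>)" "(\<Gamma>, \<phi>) \<in> Ob \<C>" "(\<Delta>, \<psi>) \<in> Ob \<C>" "(\<Lambda>, \<chi>) \<in> Ob \<C>"
  shows "Comp \<C> (\<Gamma>, \<phi>) (\<Delta>, \<psi>) (\<Lambda>, \<chi>) u v \<in> Hom \<C> (\<Gamma>, \<phi>) (\<Lambda>, \<chi>)"
proof -
  note w = assms(3-5)[unfolded Ob_iff]
  obtain \<theta> where u: "u = prov_class \<Sigma> T (\<Gamma> @ \<Delta>) \<theta>" "wff \<Sigma> (\<Gamma> @ \<Delta>) \<theta>" "P (\<Gamma> @ \<Delta>) \<theta>" "functional \<Sigma> T (\<Gamma>, \<phi>) (\<Delta>, \<psi>) \<theta>"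
    using HomE[OF assms(1)] .
  obtain \<theta>' where v: "v = prov_class \<Sigma> T (\<Delta> @ \<Lambda>) \<theta>'" "wff \<Sigma> (\<Delta> @ \<Lambda>) \<theta>'" "P (\<Delta> @ \<Lambda>) \<theta>'" "functional \<Sigma> T (\<Delta>, \<psi>) (\<Lambda>, \<chi>) \<theta>'"
    using HomE[OF assms(2)] .
  obtain \<kappa> where k: "P (\<Gamma> @ \<Lambda>) \<kappa>" "equivalent \<Sigma> T (\<Gamma> @ \<Lambda>) (comp_fm (\<Gamma>, \<phi>) (\<Delta>, \<psi>) (\<Lambda>, \<chi>) \<theta> \<theta>') \<kappa>"
    using P_comp[OF _ _ _ _ _ u(2) v(2) u(3) v(3) u(4) v(4)] w by blast
  have f: "functional \<Sigma> T (\<Gamma>, \<phi>) (\<Lambda>, \<chi>) (comp_fm (\<Gamma>, \<phi>) (\<Delta>, \<psi>) (\<Lambda>, \<chi>) \<theta> \<theta>')"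
    using functional_comp[OF u(4) v(4)] w u(2) v(2) by blast
  have "Comp \<C> (\<Gamma>, \<phi>) (\<Delta>, \<psi>) (\<Lambda>, \<chi>) u v = prov_class \<Sigma> T (\<Gamma> @ \<Lambda>) (comp_fm (\<Gamma>, \<phi>) (\<Delta>, \<psi>) (\<Lambda>, \<chi>) \<theta> \<theta>')"
    unfolding u(1) v(1) by (rule Comp_eq) (use w u v in auto)
  then show ?thesis using HomI[OF f k] w by simp
qed

text \<open>The formulas \<open>\<alpha>\<close>, \<open>\<beta>\<close>, \<open>\<gamma>\<close> are arbitrary because composition depends on objects only through
  their contexts.\<close>
lemma comp_ident:
  assumes "u \<in> Hom \<C> (\<Gamma>, \<phi>) (\<Delta>, \<psi>)" "(\<Gamma>, \<phi>) \<in> Ob \<C>" "(\<Delta>, \<psi>) \<in> Ob \<C>"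
  shows "Comp \<C> (\<Gamma>, \<alpha>) (\<Gamma>, \<beta>) (\<Delta>, \<gamma>) (Ident \<C> (\<Gamma>, \<phi>)) u = u"
    and "Comp \<C> (\<Gamma>, \<alpha>) (\<Delta>, \<beta>) (\<Delta>, \<gamma>) u (Ident \<C> (\<Delta>, \<psi>)) = u"
proof -
  note w = assms(2-3)[unfolded Ob_iff]
  obtain \<theta> where u: "u = prov_class \<Sigma> T (\<Gamma> @ \<Delta>) \<theta>" "wff \<Sigma> (\<Gamma> @ \<Delta>) \<theta>" "P (\<Gamma> @ \<Delta>) \<theta>" "functional \<Sigma> T (\<Gamma>, \<phi>) (\<Delta>, \<psi>) \<theta>"
    using HomE[OF assms(1)] .
  show "Comp \<C> (\<Gamma>, \<alpha>) (\<Gamma>, \<beta>) (\<Delta>, \<gamma>) (Ident \<C> (\<Gamma>, \<phi>)) u = u"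
    using Comp_eq[of \<Gamma> \<Gamma> \<Delta> "id_fm (\<Gamma>, \<phi>)" \<theta>] prov_class_eq[OF comp_id_left[OF u(4)]] w u(1,2) wff_id[of \<Sigma> \<Gamma> \<phi>]
    by (simp add: Ident_eq del: id_fm.simps comp_fm.simps)
  show "Comp \<C> (\<Gamma>, \<alpha>) (\<Delta>, \<beta>) (\<Delta>, \<gamma>) u (Ident \<C> (\<Delta>, \<psi>)) = u"
    using Comp_eq[of \<Gamma> \<Delta> \<Delta> \<theta> "id_fm (\<Delta>, \<psi>)"] prov_class_eq[OF comp_id_right[OF u(4)]] w u(1,2) wff_id[of \<Sigma> \<Delta> \<psi>]
    by (simp add: Ident_eq del: id_fm.simps comp_fm.simps)
qed

theorem syn_cat_category: "is_category \<C>"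
  unfolding is_category_def
proof (intro conjI ballI)
  fix X assume "X \<in> Ob \<C>"
  then show "Ident \<C> X \<in> Hom \<C> X X"
    by (cases X) (auto simp: Ob_iff Ident_eq intro!: id_Hom equivalent_refl simp del: id_fm.simps)
next
  fix X Y Z u v
  assume "X \<in> Ob \<C>" "Y \<in> Ob \<C>" "Z \<in> Ob \<C>" "u \<in> Hom \<C> X Y" "v \<in> Hom \<C> Y Z"
  then show "Comp \<C> X Y Z u v \<in> Hom \<C> X Z" by (cases X; cases Y; cases Z) (auto intro: comp_Hom)
next
  fix X Y u assume o: "X \<in> Ob \<C>" "Y \<in> Ob \<C>" and u: "u \<in> Hom \<C> X Y"
  obtain \<Gamma> \<alpha> where X: "X = (\<Gamma>, \<alpha>)" by (cases X)
  obtain \<Delta> \<beta> where Y: "Y = (\<Delta>, \<beta>)" by (cases Y)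
  show "Comp \<C> X X Y (Ident \<C> X) u = u" "Comp \<C> X Y Y u (Ident \<C> Y) = u"
    unfolding X Y by (rule comp_ident[OF u[unfolded X Y] o[unfolded X Y]])+
next
  fix W X Y Z u v w
  assume o: "W \<in> Ob \<C>" "X \<in> Ob \<C>" "Y \<in> Ob \<C>" "Z \<in> Ob \<C>"
    and h: "u \<in> Hom \<C> W X" "v \<in> Hom \<C> X Y" "w \<in> Hom \<C> Y Z"
  obtain \<Gamma> \<alpha> where W: "W = (\<Gamma>, \<alpha>)" by (cases W)
  obtain \<Delta> \<beta> where X: "X = (\<Delta>, \<beta>)" by (cases X)
  obtain \<Lambda> \<gamma> where Y: "Y = (\<Lambda>, \<gamma>)" by (cases Y)
  obtain \<Xi> \<delta> where Z: "Z = (\<Xi>, \<delta>)" by (cases Z)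
  note e = W X Y Z
  obtain \<theta>1 where 1: "u = prov_class \<Sigma> T (\<Gamma> @ \<Delta>) \<theta>1" "wff \<Sigma> (\<Gamma> @ \<Delta>) \<theta>1" using h(1) unfolding e by (rule HomE)
  obtain \<theta>2 where 2: "v = prov_class \<Sigma> T (\<Delta> @ \<Lambda>) \<theta>2" "wff \<Sigma> (\<Delta> @ \<Lambda>) \<theta>2" using h(2) unfolding e by (rule HomE)
  obtain \<theta>3 where 3: "w = prov_class \<Sigma> T (\<Lambda> @ \<Xi>) \<theta>3" "wff \<Sigma> (\<Lambda> @ \<Xi>) \<theta>3" using h(3) unfolding e by (rule HomE)
  note t = 1 2 3
  have w: "wf_ctx \<Sigma> \<Gamma>" "wf_ctx \<Sigma> \<Delta>" "wf_ctx \<Sigma> \<Lambda>" "wf_ctx \<Sigma> \<Xi>" using o by (auto simp: e Ob_iff)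
  have c: "wff \<Sigma> (\<Gamma> @ \<Lambda>) (comp_fm (\<Gamma>, \<alpha>) (\<Delta>, \<beta>) (\<Lambda>, \<gamma>) \<theta>1 \<theta>2)"
    "wff \<Sigma> (\<Delta> @ \<Xi>) (comp_fm (\<Delta>, \<beta>) (\<Lambda>, \<gamma>) (\<Xi>, \<delta>) \<theta>2 \<theta>3)"
    using t w by (auto intro!: wff_comp simp del: comp_fm.simps)
  show "Comp \<C> W Y Z (Comp \<C> W X Y u v) w = Comp \<C> W X Z u (Comp \<C> X Y Z v w)"
    using prov_class_eq[OF comp_assoc[OF w t(2,4,6), of \<alpha> \<gamma> \<delta> \<beta>]] w t c
    by (simp add: e Comp_eq del: comp_fm.simps)
qed

end

section \<open>Interpretations and equivalences of syntactic categories\<close>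

text \<open>Replacing the formula of an object by an equivalent one in the same context changes neither
  the Hom-sets nor composition. So identities are natural isomorphisms between any two functors which
  are the identity on morphisms and replace objects in this way.\<close>
lemma (in fragment) natural_iso_equivalent:
  assumes K: "\<And>X. X \<in> Ob \<C> \<Longrightarrow> Ko X \<in> Ob \<C> \<and> fst (Ko X) = fst X \<and> equivalent \<Sigma> T (fst X) (snd X) (snd (Ko X))"
    and L: "\<And>X. X \<in> Ob \<C> \<Longrightarrow> Lo X \<in> Ob \<C> \<and> fst (Lo X) = fst X \<and> equivalent \<Sigma> T (fst X) (snd X) (snd (Lo X))"
    and M: "\<And>X Y u. X \<in> Ob \<C> \<Longrightarrow> Y \<in> Ob \<C> \<Longrightarrow> u \<in> Hom \<C> X Y \<Longrightarrow> Km X Y u = u \<and> Lm X Y u = u"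
  shows "is_natural_iso \<C> \<C> Ko Km Lo Lm (Ident \<C>)"
  unfolding is_natural_iso_def
proof (intro conjI ballI)
  fix X assume o: "X \<in> Ob \<C>"
  obtain \<Gamma> \<phi> where X: "X = (\<Gamma>, \<phi>)" by (cases X)
  obtain \<kappa> where k: "Ko X = (\<Gamma>, \<kappa>)" "equivalent \<Sigma> T \<Gamma> \<phi> \<kappa>" "Ko X \<in> Ob \<C>" using K[OF o] X by (cases "Ko X") auto
  obtain \<mu> where l: "Lo X = (\<Gamma>, \<mu>)" "equivalent \<Sigma> T \<Gamma> \<phi> \<mu>" "Lo X \<in> Ob \<C>" using L[OF o] X by (cases "Lo X") auto
  have id: "Ident \<C> (\<Gamma>, \<phi>) = Ident \<C> (\<Gamma>, \<psi>)" if "equivalent \<Sigma> T \<Gamma> \<phi> \<psi>" for \<psi>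
    unfolding Ident_eq
  proof (rule prov_class_eq, rule equivalent_complete[where S = "{}"])
    note w = equivalentD[OF that]
    show "wff \<Sigma> (\<Gamma> @ \<Gamma>) (id_fm (\<Gamma>, \<phi>))" "wff \<Sigma> (\<Gamma> @ \<Gamma>) (id_fm (\<Gamma>, \<psi>))" "wf_ctx \<Sigma> (\<Gamma> @ \<Gamma>)"
      using w wff_id by auto
    fix D H us assume m: "geo_model \<Sigma> T {} D H" and t: "tuple D (\<Gamma> @ \<Gamma>) us"
    interpret m: geo_model \<Sigma> T "{}" D H by (rule m)
    obtain xs ys where "us = xs @ ys" "tuple D \<Gamma> xs" "tuple D \<Gamma> ys" using t by (rule tuple_appendE)
    then show "H (id_fm (\<Gamma>, \<phi>)) us = H (id_fm (\<Gamma>, \<psi>)) us"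
      using m.H_id w m.H_equivalent[OF that] by blast
  qed simp
  have h: "Ident \<C> X \<in> Hom \<C> (Ko X) (Lo X)" "Ident \<C> X \<in> Hom \<C> (Lo X) (Ko X)"
    using id_Hom[OF o[unfolded X]] k l unfolding X by (simp_all add: Ident_eq del: id_fm.simps)
  have hk: "Ident \<C> X \<in> Hom \<C> X (Ko X)" "Ident \<C> X \<in> Hom \<C> X (Lo X)"
    using id_Hom[OF o[unfolded X] equivalent_refl] o k l unfolding X by (simp_all add: Ident_eq Ob_iff del: id_fm.simps)
  show "is_iso \<C> (Ko X) (Lo X) (Ident \<C> X)"
    unfolding is_iso_def
  proof (intro conjI bexI[of _ "Ident \<C> X"])
    show "Comp \<C> (Ko X) (Lo X) (Ko X) (Ident \<C> X) (Ident \<C> X) = Ident \<C> (Ko X)"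
      using comp_ident(1)[OF hk(1)[unfolded X k(1)[unfolded X]] o[unfolded X] k(3)[unfolded k(1)]] id[OF k(2)] unfolding X k(1)[unfolded X] l(1)[unfolded X] by simp
    show "Comp \<C> (Lo X) (Ko X) (Lo X) (Ident \<C> X) (Ident \<C> X) = Ident \<C> (Lo X)"
      using comp_ident(1)[OF hk(2)[unfolded X l(1)[unfolded X]] o[unfolded X] l(3)[unfolded l(1)]] id[OF l(2)] unfolding X k(1)[unfolded X] l(1)[unfolded X] by simp
  qed (rule h)+
next
  fix X Y u assume o: "X \<in> Ob \<C>" "Y \<in> Ob \<C>" and u: "u \<in> Hom \<C> X Y"
  obtain \<Gamma> \<phi> where X: "X = (\<Gamma>, \<phi>)" by (cases X)
  obtain \<Delta> \<psi> where Y: "Y = (\<Delta>, \<psi>)" by (cases Y)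
  obtain \<kappa> \<mu> \<kappa>' \<mu>' where k: "Ko X = (\<Gamma>, \<kappa>)" "Lo X = (\<Gamma>, \<mu>)" "Ko Y = (\<Delta>, \<kappa>')" "Lo Y = (\<Delta>, \<mu>')"
    using K[OF o(1)] L[OF o(1)] K[OF o(2)] L[OF o(2)] X Y
    by (cases "Ko X"; cases "Lo X"; cases "Ko Y"; cases "Lo Y") auto
  show "Comp \<C> (Ko X) (Ko Y) (Lo Y) (Km X Y u) (Ident \<C> Y) = Comp \<C> (Ko X) (Lo X) (Lo Y) (Ident \<C> X) (Lm X Y u)"
    using M[OF o u] comp_ident[OF u[unfolded X Y] o[unfolded X Y]] unfolding X Y k[unfolded X Y] by simp
qed

definition class_map ::
  "('s, 'f, 'r) signature \<Rightarrow> ('s, 'f, 'r, 'i) sequent set \<Rightarrow> ('s list \<Rightarrow> 'a \<Rightarrow> ('s, 'f, 'r, 'i) fm) \<Rightarrow>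
   's list \<times> 'b \<Rightarrow> 's list \<times> 'b \<Rightarrow> 'a set \<Rightarrow> ('s, 'f, 'r, 'i) fm set" where
  "class_map \<Sigma> T F X Y u = (\<Union>\<theta>\<in>u. prov_class \<Sigma> T (fst X @ fst Y) (F (fst X @ fst Y) \<theta>))"

text \<open>The properties of a translation of formulas from which a functor between syntactic categories is
  obtained. Instances of formulas at variables are enough, since \<open>functional\<close>, \<open>id_fm\<close> and \<open>comp_fm\<close>
  involve no other terms.\<close>
locale interp = A: geo \<Sigma> T + B: geo \<Sigma>' T'
  for \<Sigma> :: "('s, 'f, 'r) signature" and T :: "('s, 'f, 'r, 'i) sequent set"
    and \<Sigma>' :: "('s, 'g, 'q) signature" and T' :: "('s, 'g, 'q, 'i) sequent set" +
  fixes F :: "'s list \<Rightarrow> ('s, 'f, 'r, 'i) fm \<Rightarrow> ('s, 'g, 'q, 'i) fm"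
  assumes sorts_eq: "sorts \<Sigma>' = sorts \<Sigma>"
    and F_wff: "wf_ctx \<Sigma> \<Gamma> \<Longrightarrow> wff \<Sigma> \<Gamma> \<phi> \<Longrightarrow> wff \<Sigma>' \<Gamma> (F \<Gamma> \<phi>)"
    and F_prv: "A.prv \<Gamma> \<phi> \<psi> \<Longrightarrow> B.prv \<Gamma> (F \<Gamma> \<phi>) (F \<Gamma> \<psi>)"
    and F_And: "F \<Gamma> (And \<phi> \<psi>) = And (F \<Gamma> \<phi>) (F \<Gamma> \<psi>)"
    and F_Ex: "F \<Gamma> (Ex A \<phi>) = Ex A (F (A # \<Gamma>) \<phi>)"
    and F_eqs: "wf_ctx \<Sigma> \<Gamma> \<Longrightarrow> var_tuple \<Gamma> ks \<Delta> \<Longrightarrow> var_tuple \<Gamma> ls \<Delta> \<Longrightarrow>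
      equivalent \<Sigma>' T' \<Gamma> (F \<Gamma> (eqs (map Var ks) (map Var ls))) (eqs (map Var ks) (map Var ls))"
    and F_ren: "wf_ctx \<Sigma> \<Delta> \<Longrightarrow> wf_ctx \<Sigma> \<Gamma> \<Longrightarrow> wff \<Sigma> \<Gamma> \<phi> \<Longrightarrow> var_tuple \<Delta> ks \<Gamma> \<Longrightarrow>
      equivalent \<Sigma>' T' \<Delta> (F \<Delta> (inst \<phi> (map Var ks))) (inst (F \<Gamma> \<phi>) (map Var ks))"
begin

lemma wf_ctx_eq: "wf_ctx \<Sigma>' = wf_ctx \<Sigma>"
  by (auto simp: wf_ctx_def sorts_eq fun_eq_iff)

lemma F_exs: "F \<Gamma> (exs As \<phi>) = exs As (F (As @ \<Gamma>) \<phi>)"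
proof (induction As arbitrary: \<phi>)
  case (Cons A As)
  then show ?case using Cons[of "Ex A \<phi>"] by (simp add: exs_def F_Ex)
qed (simp add: exs_def)

lemma exs_equivalent:
  "equivalent \<Sigma>' T' (As @ \<Gamma>) \<phi> \<psi> \<Longrightarrow> equivalent \<Sigma>' T' \<Gamma> (exs As \<phi>) (exs As \<psi>)"
  by (auto simp: equivalent_def B.exs_mono)

lemma And_equivalent:
  "equivalent \<Sigma>' T' \<Gamma> \<phi> \<phi>' \<Longrightarrow> equivalent \<Sigma>' T' \<Gamma> \<psi> \<psi>' \<Longrightarrow> equivalent \<Sigma>' T' \<Gamma> (And \<phi> \<psi>) (And \<phi>' \<psi>')"
  by (auto simp: equivalent_def B.prv_And_mono)

lemma prv_equivalent:
  "B.prv \<Gamma> \<phi> \<psi> \<Longrightarrow> equivalent \<Sigma>' T' \<Gamma> \<phi> \<phi>' \<Longrightarrow> equivalent \<Sigma>' T' \<Gamma> \<psi> \<psi>' \<Longrightarrow> B.prv \<Gamma> \<phi>' \<psi>'"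
  unfolding equivalent_def by (meson provable.Cut)

lemma F_equivalent: "equivalent \<Sigma> T \<Gamma> \<phi> \<psi> \<Longrightarrow> equivalent \<Sigma>' T' \<Gamma> (F \<Gamma> \<phi>) (F \<Gamma> \<psi>)"
  using F_prv by (auto simp: equivalent_def)

lemma F_functional:
  assumes f: "functional \<Sigma> T (\<Gamma>, \<phi>) (\<Delta>, \<psi>) \<theta>" and w: "wff \<Sigma> \<Delta> \<psi>"
  shows "functional \<Sigma>' T' (\<Gamma>, F \<Gamma> \<phi>) (\<Delta>, F \<Delta> \<psi>) (F (\<Gamma> @ \<Delta>) \<theta>)"
proof -
  let ?m = "length \<Gamma>" let ?n = "length \<Delta>"
  note f = f[unfolded functional_iff Let_def]
  note f1 = conjunct1[OF f] and f2 = conjunct1[OF conjunct2[OF f]] and f3 = conjunct2[OF conjunct2[OF f]]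
  have wc: "wf_ctx \<Sigma> \<Gamma>" "wf_ctx \<Sigma> \<Delta>" "wff \<Sigma> \<Gamma> \<phi>" "wff \<Sigma> (\<Gamma> @ \<Delta>) \<theta>"
    using A.prvD[OF f1] A.prvD[OF f2] by auto
  have rf: "equivalent \<Sigma>' T' \<Gamma> (F \<Gamma> \<phi>) (F \<Gamma> \<phi>)" "equivalent \<Sigma>' T' (\<Gamma> @ \<Delta>) (F (\<Gamma> @ \<Delta>) \<theta>) (F (\<Gamma> @ \<Delta>) \<theta>)"
    by (rule B.equivalent_refl; use wc F_wff in \<open>simp add: wf_ctx_eq\<close>)+
  have "B.prv (\<Gamma> @ \<Delta>) (F (\<Gamma> @ \<Delta>) \<theta>)
      (And (inst (F \<Gamma> \<phi>) (map Var [0..<0 + ?m])) (inst (F \<Delta> \<psi>) (map Var [?m..<?m + ?n])))"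
    by (rule prv_equivalent[OF F_prv[OF f1] rf(2)], unfold F_And, rule And_equivalent;
        rule F_ren; (intro vt_simps)?; use wc w in \<open>simp add: wf_ctx_eq\<close>)
  moreover have "B.prv \<Gamma> (F \<Gamma> \<phi>) (exs \<Delta> (total_fm ?m ?n (F (\<Gamma> @ \<Delta>) \<theta>)))"
    by (rule prv_equivalent[OF F_prv[OF f2] rf(1)], unfold F_exs total_fm_def, rule exs_equivalent, rule F_ren;
        (intro vt_simps)?; use wc in \<open>simp add: wf_ctx_eq\<close>)
  moreover have "B.prv (\<Gamma> @ \<Delta> @ \<Delta>)
        (And (inst (F (\<Gamma> @ \<Delta>) \<theta>) (map Var ([0..<0 + ?m] @ [?m..<?m + ?n])))
          (inst (F (\<Gamma> @ \<Delta>) \<theta>) (map Var ([0..<0 + ?m] @ [?m + ?n..<?m + ?n + ?n]))))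
        (eqs (map Var [?m..<?m + ?n]) (map Var [?m + ?n..<?m + ?n + ?n]))"
  proof (rule prv_equivalent[OF F_prv[OF f3]])
    show "equivalent \<Sigma>' T' (\<Gamma> @ \<Delta> @ \<Delta>) (F (\<Gamma> @ \<Delta> @ \<Delta>) (eqs (map Var [?m..<?m + ?n]) (map Var [?m + ?n..<?m + ?n + ?n])))
        (eqs (map Var [?m..<?m + ?n]) (map Var [?m + ?n..<?m + ?n + ?n]))"
      by (rule F_eqs[where \<Delta> = \<Delta>]; (intro vt_simps)?; use wc in \<open>simp add: wf_ctx_eq\<close>)
  qed (unfold F_And, rule And_equivalent; rule F_ren; (intro vt_simps)?; use wc in \<open>simp add: wf_ctx_eq\<close>)
  ultimately show ?thesis unfolding functional_iff Let_def by blast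
qed

lemma F_id:
  assumes "wf_ctx \<Sigma> \<Gamma>" "wff \<Sigma> \<Gamma> \<phi>"
  shows "equivalent \<Sigma>' T' (\<Gamma> @ \<Gamma>) (F (\<Gamma> @ \<Gamma>) (id_fm (\<Gamma>, \<phi>))) (id_fm (\<Gamma>, F \<Gamma> \<phi>))"
  unfolding id_fm_eq F_And
proof (rule And_equivalent)
  show "equivalent \<Sigma>' T' (\<Gamma> @ \<Gamma>) (F (\<Gamma> @ \<Gamma>) (eqs (map Var [0..<0 + length \<Gamma>]) (map Var [length \<Gamma>..<length \<Gamma> + length \<Gamma>])))
      (eqs (map Var [0..<0 + length \<Gamma>]) (map Var [length \<Gamma>..<length \<Gamma> + length \<Gamma>]))"
    by (rule F_eqs[where \<Delta> = \<Gamma>]; (intro vt_simps)?; use assms in \<open>simp add: wf_ctx_eq\<close>)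
qed (rule F_ren; (intro vt_simps)?; use assms in \<open>simp add: wf_ctx_eq\<close>)

lemma F_comp:
  assumes "wf_ctx \<Sigma> \<Gamma>" "wf_ctx \<Sigma> \<Delta>" "wf_ctx \<Sigma> \<Lambda>" "wff \<Sigma> (\<Gamma> @ \<Delta>) \<theta>" "wff \<Sigma> (\<Delta> @ \<Lambda>) \<theta>'"
  shows "equivalent \<Sigma>' T' (\<Gamma> @ \<Lambda>) (F (\<Gamma> @ \<Lambda>) (comp_fm (\<Gamma>, \<phi>) (\<Delta>, \<psi>) (\<Lambda>, \<chi>) \<theta> \<theta>'))
    (comp_fm (\<Gamma>, \<phi>') (\<Delta>, \<psi>') (\<Lambda>, \<chi>') (F (\<Gamma> @ \<Delta>) \<theta>) (F (\<Delta> @ \<Lambda>) \<theta>'))"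
  unfolding comp_fm_eq comp_body_def F_exs F_And
  by (rule exs_equivalent, rule And_equivalent; rule F_ren; (intro vt_simps)?; use assms in \<open>simp add: wf_ctx_eq\<close>)

lemma class_map_class:
  assumes "wf_ctx \<Sigma> (\<Gamma> @ \<Delta>)" "wff \<Sigma> (\<Gamma> @ \<Delta>) \<theta>"
  shows "class_map \<Sigma>' T' F (\<Gamma>, \<phi>) (\<Delta>, \<psi>) (prov_class \<Sigma> T (\<Gamma> @ \<Delta>) \<theta>) = prov_class \<Sigma>' T' (\<Gamma> @ \<Delta>) (F (\<Gamma> @ \<Delta>) \<theta>)"
proof -
  have "prov_class \<Sigma>' T' (\<Gamma> @ \<Delta>) (F (\<Gamma> @ \<Delta>) \<theta>') = prov_class \<Sigma>' T' (\<Gamma> @ \<Delta>) (F (\<Gamma> @ \<Delta>) \<theta>)"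
    if "\<theta>' \<in> prov_class \<Sigma> T (\<Gamma> @ \<Delta>) \<theta>" for \<theta>'
    by (rule B.prov_class_eq[OF F_equivalent[OF A.equivalent_sym]]) (use that in \<open>simp add: prov_class_def\<close>)
  then show ?thesis unfolding class_map_def fst_conv using A.mem_prov_class[OF assms] by blast
qed

end

text \<open>The functor sends an object to any formula of the target fragment that is equivalent to its
  translation. This freedom is used for cartesian formulas, whose translations are cartesian only up to
  equivalence.\<close>
locale interp_fragments = interp \<Sigma> T \<Sigma>' T' F + PA: fragment \<Sigma> T P + PB: fragment \<Sigma>' T' P'
  for \<Sigma> :: "('s, 'f, 'r) signature" and T :: "('s, 'f, 'r, 'i) sequent set"
    and \<Sigma>' :: "('s, 'g, 'q) signature" and T' :: "('s, 'g, 'q, 'i) sequent set"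
    and F P P' +
  fixes Fo :: "'s list \<times> ('s, 'f, 'r, 'i) fm \<Rightarrow> 's list \<times> ('s, 'g, 'q, 'i) fm"
  assumes F_P: "wf_ctx \<Sigma> \<Gamma> \<Longrightarrow> wff \<Sigma> \<Gamma> \<phi> \<Longrightarrow> P \<Gamma> \<phi> \<Longrightarrow> \<exists>\<phi>'. P' \<Gamma> \<phi>' \<and> equivalent \<Sigma>' T' \<Gamma> (F \<Gamma> \<phi>) \<phi>'"
    and Fo: "X \<in> Ob PA.\<C> \<Longrightarrow> fst (Fo X) = fst X \<and> P' (fst X) (snd (Fo X)) \<and>
      equivalent \<Sigma>' T' (fst X) (F (fst X) (snd X)) (snd (Fo X))"
begin

abbreviation "Fm \<equiv> class_map \<Sigma>' T' F"

lemma FoE: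
  assumes "(\<Gamma>, \<phi>) \<in> Ob PA.\<C>"
  obtains \<phi>' where "Fo (\<Gamma>, \<phi>) = (\<Gamma>, \<phi>')" "P' \<Gamma> \<phi>'" "equivalent \<Sigma>' T' \<Gamma> (F \<Gamma> \<phi>) \<phi>'"
    "(\<Gamma>, \<phi>') \<in> Ob PB.\<C>"
proof -
  obtain \<phi>' where f: "Fo (\<Gamma>, \<phi>) = (\<Gamma>, \<phi>')" using Fo[OF assms] by (cases "Fo (\<Gamma>, \<phi>)") simp
  have e: "P' \<Gamma> \<phi>'" "equivalent \<Sigma>' T' \<Gamma> (F \<Gamma> \<phi>) \<phi>'" using Fo[OF assms] by (simp_all add: f)
  then have "(\<Gamma>, \<phi>') \<in> Ob PB.\<C>" using B.equivalentD[OF e(2)] by (simp add: PB.Ob_iff)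
  with f e show ?thesis by (rule that)
qed

lemma Fm_Hom:
  assumes o: "(\<Gamma>, \<phi>) \<in> Ob PA.\<C>" "(\<Delta>, \<psi>) \<in> Ob PA.\<C>" and u: "u \<in> Hom PA.\<C> (\<Gamma>, \<phi>) (\<Delta>, \<psi>)"
  shows "Fm (\<Gamma>, \<phi>) (\<Delta>, \<psi>) u \<in> Hom PB.\<C> (Fo (\<Gamma>, \<phi>)) (Fo (\<Delta>, \<psi>))"
proof -
  note w = o[unfolded PA.Ob_iff]
  obtain \<theta> where t: "u = prov_class \<Sigma> T (\<Gamma> @ \<Delta>) \<theta>" "wff \<Sigma> (\<Gamma> @ \<Delta>) \<theta>" "P (\<Gamma> @ \<Delta>) \<theta>" "functional \<Sigma> T (\<Gamma>, \<phi>) (\<Delta>, \<psi>) \<theta>"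
    using PA.HomE[OF u] .
  have wt: "wf_ctx \<Sigma> (\<Gamma> @ \<Delta>)" using w by simp
  obtain \<phi>' where p: "Fo (\<Gamma>, \<phi>) = (\<Gamma>, \<phi>')" "equivalent \<Sigma>' T' \<Gamma> (F \<Gamma> \<phi>) \<phi>'" by (rule FoE[OF o(1)])
  obtain \<psi>' where q: "Fo (\<Delta>, \<psi>) = (\<Delta>, \<psi>')" "equivalent \<Sigma>' T' \<Delta> (F \<Delta> \<psi>) \<psi>'" by (rule FoE[OF o(2)])
  obtain \<kappa> where k: "P' (\<Gamma> @ \<Delta>) \<kappa>" "equivalent \<Sigma>' T' (\<Gamma> @ \<Delta>) (F (\<Gamma> @ \<Delta>) \<theta>) \<kappa>" using F_P[OF wt t(2,3)] by blast
  have "functional \<Sigma>' T' (\<Gamma>, \<phi>') (\<Delta>, \<psi>') (F (\<Gamma> @ \<Delta>) \<theta>)"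
    using B.functional_equivalent[OF F_functional[OF t(4)] p(2) q(2) B.equivalent_refl] w wt t(2) F_wff by (simp add: wf_ctx_eq)
  from PB.HomI[OF this k] show ?thesis
    unfolding t(1) class_map_class[OF wt t(2)] p(1) q(1) using B.equivalentD[OF p(2)] B.equivalentD[OF q(2)] by blast
qed

theorem class_map_functor: "is_functor PA.\<C> PB.\<C> Fo Fm"
  unfolding is_functor_def
proof (intro conjI ballI)
  show "is_category PA.\<C>" "is_category PB.\<C>" by (rule PA.syn_cat_category PB.syn_cat_category)+
next
  fix X assume o: "X \<in> Ob PA.\<C>"
  obtain \<Gamma> \<phi> where X: "X = (\<Gamma>, \<phi>)" by (cases X)
  note w = o[unfolded X PA.Ob_iff]
  obtain \<phi>' where p: "Fo (\<Gamma>, \<phi>) = (\<Gamma>, \<phi>')" "equivalent \<Sigma>' T' \<Gamma> (F \<Gamma> \<phi>) \<phi>'" "(\<Gamma>, \<phi>') \<in> Ob PB.\<C>"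
    by (rule FoE[OF o[unfolded X]])
  show "Fo X \<in> Ob PB.\<C>" using p X by simp
  have "Fm X X (Ident PA.\<C> X) = prov_class \<Sigma>' T' (\<Gamma> @ \<Gamma>) (F (\<Gamma> @ \<Gamma>) (id_fm (\<Gamma>, \<phi>)))"
    unfolding X PA.Ident_eq by (rule class_map_class) (use w wff_id in \<open>auto simp: wf_ctx_eq\<close>)
  also have "\<dots> = prov_class \<Sigma>' T' (\<Gamma> @ \<Gamma>) (id_fm (\<Gamma>, F \<Gamma> \<phi>))"
    using w by (intro B.prov_class_eq F_id) (auto simp: wf_ctx_eq)
  also have "\<dots> = Ident PB.\<C> (Fo X)"
    unfolding X p(1) PB.Ident_eq
  proof (rule B.prov_class_eq, unfold id_fm_eq, rule And_equivalent)
    have v: "var_tuple (\<Gamma> @ \<Gamma>) [0..<0 + length \<Gamma>] \<Gamma>" "var_tuple (\<Gamma> @ \<Gamma>) [length \<Gamma>..<length \<Gamma> + length \<Gamma>] \<Gamma>"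
      by (intro vt_simps; simp)+
    show "equivalent \<Sigma>' T' (\<Gamma> @ \<Gamma>) (eqs (map Var [0..<0 + length \<Gamma>]) (map Var [length \<Gamma>..<length \<Gamma> + length \<Gamma>]))
        (eqs (map Var [0..<0 + length \<Gamma>]) (map Var [length \<Gamma>..<length \<Gamma> + length \<Gamma>]))"
      by (rule B.equivalent_refl[OF _ wff_eqs_ren[OF v]]) (use w in \<open>simp add: wf_ctx_eq\<close>)
    show "equivalent \<Sigma>' T' (\<Gamma> @ \<Gamma>) (inst (F \<Gamma> \<phi>) (map Var [0..<0 + length \<Gamma>])) (inst \<phi>' (map Var [0..<0 + length \<Gamma>]))"
      using p(2) w var_tuple_wt[OF v(1)] unfolding equivalent_def by (auto intro!: provable.Substitution simp: wf_ctx_eq)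
  qed
  finally show "Fm X X (Ident PA.\<C> X) = Ident PB.\<C> (Fo X)" .
next
  fix X Y u assume "X \<in> Ob PA.\<C>" "Y \<in> Ob PA.\<C>" "u \<in> Hom PA.\<C> X Y"
  then show "Fm X Y u \<in> Hom PB.\<C> (Fo X) (Fo Y)" using Fm_Hom by (cases X; cases Y) blast
next
  fix X Y Z u v assume o: "X \<in> Ob PA.\<C>" "Y \<in> Ob PA.\<C>" "Z \<in> Ob PA.\<C>"
    and u: "u \<in> Hom PA.\<C> X Y" and v: "v \<in> Hom PA.\<C> Y Z"
  obtain \<Gamma> \<phi> where X: "X = (\<Gamma>, \<phi>)" by (cases X)
  obtain \<Delta> \<psi> where Y: "Y = (\<Delta>, \<psi>)" by (cases Y)
  obtain \<Lambda> \<chi> where Z: "Z = (\<Lambda>, \<chi>)" by (cases Z)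
  note w = o[unfolded X Y Z PA.Ob_iff]
  obtain \<theta> where t: "u = prov_class \<Sigma> T (\<Gamma> @ \<Delta>) \<theta>" "wff \<Sigma> (\<Gamma> @ \<Delta>) \<theta>"
    using u unfolding X Y by (rule PA.HomE)
  obtain \<theta>' where t': "v = prov_class \<Sigma> T (\<Delta> @ \<Lambda>) \<theta>'" "wff \<Sigma> (\<Delta> @ \<Lambda>) \<theta>'"
    using v unfolding Z Y by (rule PA.HomE)
  let ?c = "comp_fm (\<Gamma>, \<phi>) (\<Delta>, \<psi>) (\<Lambda>, \<chi>) \<theta> \<theta>'"
  obtain \<phi>' where p1: "Fo (\<Gamma>, \<phi>) = (\<Gamma>, \<phi>')" by (rule FoE[OF o(1)[unfolded X]])
  obtain \<psi>' where p2: "Fo (\<Delta>, \<psi>) = (\<Delta>, \<psi>')" by (rule FoE[OF o(2)[unfolded Y]])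
  obtain \<chi>' where p3: "Fo (\<Lambda>, \<chi>) = (\<Lambda>, \<chi>')" by (rule FoE[OF o(3)[unfolded Z]])
  note p = p1 p2 p3
  have wc: "wff \<Sigma> (\<Gamma> @ \<Lambda>) ?c" using wff_comp t t' w by blast
  have "Fm X Z (Comp PA.\<C> X Y Z u v) = Fm (\<Gamma>, \<phi>) (\<Lambda>, \<chi>) (prov_class \<Sigma> T (\<Gamma> @ \<Lambda>) ?c)"
    unfolding X Y Z t(1) t'(1) by (subst PA.Comp_eq) (use w t t' in \<open>auto simp: wf_ctx_eq\<close>)
  also have "\<dots> = prov_class \<Sigma>' T' (\<Gamma> @ \<Lambda>) (F (\<Gamma> @ \<Lambda>) ?c)"
    by (rule class_map_class[OF _ wc]) (use w in \<open>simp add: wf_ctx_eq\<close>)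
  also have "\<dots> = prov_class \<Sigma>' T' (\<Gamma> @ \<Lambda>) (comp_fm (\<Gamma>, \<phi>') (\<Delta>, \<psi>') (\<Lambda>, \<chi>') (F (\<Gamma> @ \<Delta>) \<theta>) (F (\<Delta> @ \<Lambda>) \<theta>'))"
    by (rule B.prov_class_eq[OF F_comp]) (use w t t' in \<open>auto simp: wf_ctx_eq\<close>)
  also have "\<dots> = Comp PB.\<C> (Fo X) (Fo Y) (Fo Z) (Fm X Y u) (Fm Y Z v)"
  proof -
    have wd: "wf_ctx \<Sigma> (\<Gamma> @ \<Delta>)" "wf_ctx \<Sigma> (\<Delta> @ \<Lambda>)" "wf_ctx \<Sigma>' (\<Gamma> @ \<Delta> @ \<Lambda>)" using w by (simp_all add: wf_ctx_eq)
    show ?thesis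
      unfolding X Y Z p t(1) t'(1) class_map_class[OF wd(1) t(2)] class_map_class[OF wd(2) t'(2)]
      by (rule PB.Comp_eq[OF wd(3) F_wff[OF wd(1) t(2)] F_wff[OF wd(2) t'(2)], symmetric])
  qed
  finally show "Fm X Z (Comp PA.\<C> X Y Z u v) = Comp PB.\<C> (Fo X) (Fo Y) (Fo Z) (Fm X Y u) (Fm Y Z v)" .
qed

end

text \<open>If translating back and forth gives equivalent formulas, then both composite functors are the
  identity on morphisms, which are classes of formulas, and replace objects by equivalent ones.\<close>
theorem mutually_inverse_interps:
  fixes F :: "'s list \<Rightarrow> ('s, 'f, 'r, 'i) fm \<Rightarrow> ('s, 'g, 'q, 'i) fm"
  assumes "interp_fragments \<Sigma> T \<Sigma>' T' F P P' Fo" "interp_fragments \<Sigma>' T' \<Sigma> T G P' P Go"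
    and GF: "\<And>\<Gamma> \<phi>. wf_ctx \<Sigma> \<Gamma> \<Longrightarrow> wff \<Sigma> \<Gamma> \<phi> \<Longrightarrow> equivalent \<Sigma> T \<Gamma> (G \<Gamma> (F \<Gamma> \<phi>)) \<phi>"
    and FG: "\<And>\<Gamma> \<phi>. wf_ctx \<Sigma> \<Gamma> \<Longrightarrow> wff \<Sigma>' \<Gamma> \<phi> \<Longrightarrow> equivalent \<Sigma>' T' \<Gamma> (F \<Gamma> (G \<Gamma> \<phi>)) \<phi>"
  shows "is_equivalence (syn_cat \<Sigma> T P) (syn_cat \<Sigma>' T' P') Fo (class_map \<Sigma>' T' F)"
proof -
  interpret F: interp_fragments \<Sigma> T \<Sigma>' T' F P P' Fo by fact
  interpret G: interp_fragments \<Sigma>' T' \<Sigma> T G P' P Go by fact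
  have wf': "wf_ctx \<Sigma>' \<Gamma> \<longleftrightarrow> wf_ctx \<Sigma> \<Gamma>" for \<Gamma> by (simp only: F.wf_ctx_eq)
  have GFo: "Go (Fo X) \<in> Ob F.PA.\<C> \<and> fst (Go (Fo X)) = fst X \<and> equivalent \<Sigma> T (fst X) (snd X) (snd (Go (Fo X)))"
    if o: "X \<in> Ob F.PA.\<C>" for X
  proof -
    obtain \<Gamma> \<phi> where X: "X = (\<Gamma>, \<phi>)" by (cases X)
    have w: "wf_ctx \<Sigma> \<Gamma>" "wff \<Sigma> \<Gamma> \<phi>" using o by (simp_all add: X F.PA.Ob_iff)
    obtain \<phi>1 where 1: "Fo (\<Gamma>, \<phi>) = (\<Gamma>, \<phi>1)" "equivalent \<Sigma>' T' (\<Gamma>) (F \<Gamma> \<phi>) \<phi>1" "(\<Gamma>, \<phi>1) \<in> Ob F.PB.\<C>"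
      by (rule F.FoE[OF o[unfolded X]])
    obtain \<phi>2 where 2: "Go (\<Gamma>, \<phi>1) = (\<Gamma>, \<phi>2)" "equivalent \<Sigma> T \<Gamma> (G \<Gamma> \<phi>1) \<phi>2" "(\<Gamma>, \<phi>2) \<in> Ob F.PA.\<C>"
      by (rule G.FoE[OF 1(3)])
    have "equivalent \<Sigma> T \<Gamma> \<phi> \<phi>2"
      by (rule F.A.equivalent_trans[OF F.A.equivalent_sym[OF GF[OF w]]
            F.A.equivalent_trans[OF G.F_equivalent[OF 1(2)] 2(2)]])
    then show ?thesis using 2 by (simp add: X 1(1))
  qed
  have FGo: "Fo (Go X) \<in> Ob F.PB.\<C> \<and> fst (Fo (Go X)) = fst X \<and> equivalent \<Sigma>' T' (fst X) (snd X) (snd (Fo (Go X)))"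
    if o: "X \<in> Ob F.PB.\<C>" for X
  proof -
    obtain \<Gamma> \<phi> where X: "X = (\<Gamma>, \<phi>)" by (cases X)
    have w: "wf_ctx \<Sigma> \<Gamma>" "wff \<Sigma>' \<Gamma> \<phi>" using o by (simp_all add: X F.PB.Ob_iff wf')
    obtain \<phi>1 where 1: "Go (\<Gamma>, \<phi>) = (\<Gamma>, \<phi>1)" "equivalent \<Sigma> T (\<Gamma>) (G \<Gamma> \<phi>) \<phi>1" "(\<Gamma>, \<phi>1) \<in> Ob F.PA.\<C>"
      by (rule G.FoE[OF o[unfolded X]])
    obtain \<phi>2 where 2: "Fo (\<Gamma>, \<phi>1) = (\<Gamma>, \<phi>2)" "equivalent \<Sigma>' T' \<Gamma> (F \<Gamma> \<phi>1) \<phi>2" "(\<Gamma>, \<phi>2) \<in> Ob F.PB.\<C>"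
      by (rule F.FoE[OF 1(3)])
    have "equivalent \<Sigma>' T' \<Gamma> \<phi> \<phi>2"
      by (rule F.B.equivalent_trans[OF F.B.equivalent_sym[OF FG[OF w]]
            F.B.equivalent_trans[OF F.F_equivalent[OF 1(2)] 2(2)]])
    then show ?thesis using 2 by (simp add: X 1(1))
  qed
  have GFm: "class_map \<Sigma> T G (Fo X) (Fo Y) (class_map \<Sigma>' T' F X Y u) = u"
    if o: "X \<in> Ob F.PA.\<C>" "Y \<in> Ob F.PA.\<C>" and u: "u \<in> Hom F.PA.\<C> X Y" for X Y u
  proof -
    obtain \<Gamma> \<phi> where X: "X = (\<Gamma>, \<phi>)" by (cases X)
    obtain \<Delta> \<psi> where Y: "Y = (\<Delta>, \<psi>)" by (cases Y)
    obtain \<phi>' where p: "Fo X = (\<Gamma>, \<phi>')" unfolding X by (rule F.FoE[OF o(1)[unfolded X]])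
    obtain \<psi>' where q: "Fo Y = (\<Delta>, \<psi>')" unfolding Y by (rule F.FoE[OF o(2)[unfolded Y]])
    have w: "wf_ctx \<Sigma> (\<Gamma> @ \<Delta>)" using o by (simp add: X Y F.PA.Ob_iff)
    obtain \<theta> where t: "u = prov_class \<Sigma> T (\<Gamma> @ \<Delta>) \<theta>" "wff \<Sigma> (\<Gamma> @ \<Delta>) \<theta>"
      using u unfolding X Y by (rule F.PA.HomE)
    have w': "wf_ctx \<Sigma>' (\<Gamma> @ \<Delta>)" using w by (simp add: wf')
    show ?thesis
      unfolding t(1) p q unfolding X Y F.class_map_class[OF w t(2)] G.class_map_class[OF w' F.F_wff[OF w t(2)]]
      by (rule F.A.prov_class_eq[OF GF[OF w t(2)]])
  qed
  have FGm: "class_map \<Sigma>' T' F (Go X) (Go Y) (class_map \<Sigma> T G X Y u) = u"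
    if o: "X \<in> Ob F.PB.\<C>" "Y \<in> Ob F.PB.\<C>" and u: "u \<in> Hom F.PB.\<C> X Y" for X Y u
  proof -
    obtain \<Gamma> \<phi> where X: "X = (\<Gamma>, \<phi>)" by (cases X)
    obtain \<Delta> \<psi> where Y: "Y = (\<Delta>, \<psi>)" by (cases Y)
    obtain \<phi>' where p: "Go X = (\<Gamma>, \<phi>')" unfolding X by (rule G.FoE[OF o(1)[unfolded X]])
    obtain \<psi>' where q: "Go Y = (\<Delta>, \<psi>')" unfolding Y by (rule G.FoE[OF o(2)[unfolded Y]])
    have w: "wf_ctx \<Sigma> (\<Gamma> @ \<Delta>)" using o by (simp add: X Y F.PB.Ob_iff wf')
    obtain \<theta> where t: "u = prov_class \<Sigma>' T' (\<Gamma> @ \<Delta>) \<theta>" "wff \<Sigma>' (\<Gamma> @ \<Delta>) \<theta>"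
      using u unfolding X Y by (rule F.PB.HomE)
    have w': "wf_ctx \<Sigma>' (\<Gamma> @ \<Delta>)" using w by (simp add: wf')
    show ?thesis
      unfolding t(1) p q unfolding X Y G.class_map_class[OF w' t(2)] F.class_map_class[OF w G.F_wff[OF w' t(2)]]
      by (rule F.B.prov_class_eq[OF FG[OF w t(2)]])
  qed
  have idA: "X \<in> Ob F.PA.\<C> \<and> fst X = fst X \<and> equivalent \<Sigma> T (fst X) (snd X) (snd X)" if o: "X \<in> Ob F.PA.\<C>" for X
  proof -
    obtain \<Gamma> \<phi> where X: "X = (\<Gamma>, \<phi>)" by (cases X)
    show ?thesis using o F.A.equivalent_refl[of \<Gamma> \<phi>] by (simp add: X F.PA.Ob_iff)
  qed
  have idB: "X \<in> Ob F.PB.\<C> \<and> fst X = fst X \<and> equivalent \<Sigma>' T' (fst X) (snd X) (snd X)" if o: "X \<in> Ob F.PB.\<C>" for X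
  proof -
    obtain \<Gamma> \<phi> where X: "X = (\<Gamma>, \<phi>)" by (cases X)
    show ?thesis using o F.B.equivalent_refl[of \<Gamma> \<phi>] by (simp add: X F.PB.Ob_iff)
  qed
  have 1: "is_natural_iso F.PA.\<C> F.PA.\<C> (\<lambda>X. X) (\<lambda>X Y u. u) (\<lambda>X. Go (Fo X))
      (\<lambda>X Y u. class_map \<Sigma> T G (Fo X) (Fo Y) (class_map \<Sigma>' T' F X Y u)) (Ident F.PA.\<C>)"
    by (rule F.PA.natural_iso_equivalent[OF idA GFo]) (assumption, assumption, rule conjI[OF refl GFm], assumption+)
  have 2: "is_natural_iso F.PB.\<C> F.PB.\<C> (\<lambda>X. Fo (Go X))
      (\<lambda>X Y u. class_map \<Sigma>' T' F (Go X) (Go Y) (class_map \<Sigma> T G X Y u)) (\<lambda>X. X) (\<lambda>X Y u. u) (Ident F.PB.\<C>)"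
    by (rule F.PB.natural_iso_equivalent[OF FGo idB]) (assumption, assumption, rule conjI[OF FGm refl], assumption+)
  show ?thesis unfolding is_equivalence_def using F.class_map_functor G.class_map_functor 1 2 by blast
qed

section \<open>The relational translation in models\<close>

lemma rel_sig_simps [simp]:
  "sorts (rel_sig \<Sigma>) = sorts \<Sigma>" "funs (rel_sig \<Sigma>) = {}"
  "Inl R \<in> rels (rel_sig \<Sigma>) \<longleftrightarrow> R \<in> rels \<Sigma>" "Inr f \<in> rels (rel_sig \<Sigma>) \<longleftrightarrow> f \<in> funs \<Sigma>"
  "rdom (rel_sig \<Sigma>) (Inl R) = rdom \<Sigma> R" "rdom (rel_sig \<Sigma>) (Inr f) = fdom \<Sigma> f @ [fcod \<Sigma> f]"
  by (auto simp: rel_sig_def)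

lemma wf_ctx_rel_sig [simp]: "wf_ctx (rel_sig \<Sigma>) = wf_ctx \<Sigma>"
  by (auto simp: wf_ctx_def fun_eq_iff)

lemma wf_rel_sig: "wf_signature \<Sigma> \<Longrightarrow> wf_signature (rel_sig \<Sigma>)"
  unfolding wf_signature_def rel_sig_def by (auto; blast)

text \<open>The parts of \<open>tr_atom\<close>: the list of subterms, the position of a term in it, the atomic formula
  that ties the variable of a term to the variables of its arguments, the matrix, and the sorts of the
  quantified variables.\<close>

definition uterms :: "'f trm list \<Rightarrow> 'f trm list" where
  "uterms gs = remdups (concat (map subterms gs))"

definition upos :: "'f trm list \<Rightarrow> 'f trm \<Rightarrow> nat" where
  "upos gs g = length (takeWhile (\<lambda>u. u \<noteq> g) (uterms gs))"

definition ugraph :: "'f trm list \<Rightarrow> 'f trm \<Rightarrow> ('s, 'f, 'r + 'f, 'i) fm" where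
  "ugraph gs g = (case g of Var i \<Rightarrow> Eq (Var (upos gs g)) (Var (length (uterms gs) + i))
     | Fn f ts \<Rightarrow> Rel (Inr f) (map Var (map (upos gs) ts @ [upos gs g])))"

definition ubody :: "'f trm list \<Rightarrow> ('f trm list \<Rightarrow> ('s, 'f, 'r + 'f, 'i) fm) \<Rightarrow> ('s, 'f, 'r + 'f, 'i) fm" where
  "ubody gs atom = And (conjs (map (ugraph gs) (uterms gs))) (atom (map Var (map (upos gs) gs)))"

definition usorts :: "('s, 'f, 'r) signature \<Rightarrow> 's list \<Rightarrow> 'f trm list \<Rightarrow> 's list" where
  "usorts \<Sigma> \<Gamma> gs = map (sort_of \<Sigma> \<Gamma>) (uterms gs)"

lemma tr_atom_eq: "tr_atom \<Sigma> \<Gamma> gs atom = exs (usorts \<Sigma> \<Gamma> gs) (ubody gs atom)"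
proof -
  have g: "(\<lambda>g. case g of Var i \<Rightarrow> Eq (Var (upos gs g)) (Var (length (uterms gs) + i))
      | Fn f ts \<Rightarrow> Rel (Inr f) (map (\<lambda>g. Var (upos gs g)) ts @ [Var (upos gs g)])) = ugraph gs"
    by (auto simp: fun_eq_iff ugraph_def comp_def split: trm.split)
  show ?thesis
    unfolding tr_atom_def Let_def usorts_def ubody_def map_map comp_def
    unfolding uterms_def[symmetric] upos_def[symmetric] by (simp only: g)
qed

lemma subterms_self: "t \<in> set (subterms t)"
  by (cases t) auto

lemma subterms_closed: "Fn f ts \<in> set (subterms t) \<Longrightarrow> s \<in> set ts \<Longrightarrow> s \<in> set (subterms t)"
  by (induction t) (auto intro: subterms_self)

lemma wt_sort_of: "wt \<Sigma> \<Gamma> t A \<Longrightarrow> sort_of \<Sigma> \<Gamma> t = A"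
  by (cases t) (auto simp: wt_Fn_iff)

lemma subterms_wt: "wt \<Sigma> \<Gamma> t A \<Longrightarrow> g \<in> set (subterms t) \<Longrightarrow> wt \<Sigma> \<Gamma> g (sort_of \<Sigma> \<Gamma> g)"
proof (induction rule: wt.induct)
  case (wt_Fn f ts)
  then have *: "list_all2 (wt \<Sigma> \<Gamma>) ts (fdom \<Sigma> f)"
    by (auto simp: list_all2_conv_all_nth)
  show ?case
  proof (cases "g = Fn f ts")
    case True
    then show ?thesis using * wt_Fn by (auto simp: wt_Fn_iff)
  next
    case False
    then obtain s where s: "s \<in> set ts" "g \<in> set (subterms s)" using wt_Fn.prems by auto
    then obtain i where "i < length ts" "s = ts ! i" by (auto simp: in_set_conv_nth)
    then show ?thesis using s wt_Fn.hyps wt_Fn.IH by (auto simp: list_all2_conv_all_nth)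
  qed
qed simp

lemma subterms_set_trm: "g \<in> set (subterms t) \<Longrightarrow> set_trm g \<subseteq> set_trm t"
  by (induction t) fastforce+

lemma set_uterms: "set (uterms gs) = (\<Union>g\<in>set gs. set (subterms g))"
  by (auto simp: uterms_def)

lemma uterms_self: "g \<in> set gs \<Longrightarrow> g \<in> set (uterms gs)"
  by (auto simp: set_uterms intro: subterms_self)

lemma uterms_closed: "Fn f ts \<in> set (uterms gs) \<Longrightarrow> s \<in> set ts \<Longrightarrow> s \<in> set (uterms gs)"
  by (auto simp: set_uterms intro: subterms_closed)

lemma takeWhile_pos: "g \<in> set us \<Longrightarrow> length (takeWhile (\<lambda>u. u \<noteq> g) us) < length us \<and> us ! length (takeWhile (\<lambda>u. u \<noteq> g) us) = g"
  by (induction us) auto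

lemma upos: "g \<in> set (uterms gs) \<Longrightarrow> upos gs g < length (uterms gs) \<and> uterms gs ! upos gs g = g"
  unfolding upos_def by (rule takeWhile_pos)

lemma uterms_wt:
  assumes "list_all2 (wt \<Sigma> \<Gamma>) gs As" "g \<in> set (uterms gs)"
  shows "wt \<Sigma> \<Gamma> g (sort_of \<Sigma> \<Gamma> g)"
proof -
  obtain h where h: "h \<in> set gs" "g \<in> set (subterms h)" using assms(2) by (auto simp: set_uterms)
  then obtain A where "wt \<Sigma> \<Gamma> h A" using assms(1) by (auto simp: list_all2_conv_all_nth in_set_conv_nth)
  then show ?thesis using h by (auto intro: subterms_wt)
qed

lemma upos_var_tuple:
  assumes "set ts \<subseteq> set (uterms gs)" "list_all2 (wt \<Sigma> \<Gamma>) ts As"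
  shows "var_tuple (usorts \<Sigma> \<Gamma> gs @ \<Gamma>) (map (upos gs) ts) As"
  unfolding var_tuple_def list_all2_conv_all_nth
proof (intro conjI allI impI)
  show "length (map (upos gs) ts) = length As" using assms(2) by (simp add: list_all2_lengthD)
  fix i assume "i < length (map (upos gs) ts)"
  then have "ts ! i \<in> set (uterms gs)" "wt \<Sigma> \<Gamma> (ts ! i) (As ! i)" and i: "i < length ts"
    using assms by (auto simp: list_all2_conv_all_nth)
  then show "map (upos gs) ts ! i < length (usorts \<Sigma> \<Gamma> gs @ \<Gamma>)"
    "(usorts \<Sigma> \<Gamma> gs @ \<Gamma>) ! (map (upos gs) ts ! i) = As ! i"
    using upos[of "ts ! i" gs] by (auto simp: usorts_def nth_append wt_sort_of)
qed

lemma ugraph_wff: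
  assumes gs: "list_all2 (wt \<Sigma> \<Gamma>) gs As" and g: "g \<in> set (uterms gs)"
  shows "wff (rel_sig \<Sigma>) (usorts \<Sigma> \<Gamma> gs @ \<Gamma>) (ugraph gs g)"
proof (cases g)
  case (Var i)
  have "wt \<Sigma> \<Gamma> (Var i) (\<Gamma> ! i)" using uterms_wt[OF gs g] Var by simp
  then show ?thesis using upos[OF g] Var
    by (auto simp: ugraph_def nth_append usorts_def)
next
  case (Fn f ts)
  then have w: "list_all2 (wt \<Sigma> \<Gamma>) (ts @ [g]) (fdom \<Sigma> f @ [fcod \<Sigma> f])" and f: "f \<in> funs \<Sigma>"
    using uterms_wt[OF gs g] by (auto simp: wt_Fn_iff list_all2_appendI)
  have "set (ts @ [g]) \<subseteq> set (uterms gs)" using uterms_closed g Fn by auto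
  from var_tuple_wt[OF upos_var_tuple[OF this w], of "rel_sig \<Sigma>"] f
  show ?thesis by (simp add: ugraph_def Fn del: map_map)
qed

lemma usorts_sorts:
  assumes "wf_signature \<Sigma>" "wf_ctx \<Sigma> \<Gamma>" "list_all2 (wt \<Sigma> \<Gamma>) gs As"
  shows "set (usorts \<Sigma> \<Gamma> gs) \<subseteq> sorts \<Sigma>"
  using wt_sort[OF assms(1,2)] uterms_wt[OF assms(3)] by (auto simp: usorts_def)

lemma wff_tr_atom:
  assumes "wf_signature \<Sigma>" "wf_ctx \<Sigma> \<Gamma>" and gs: "list_all2 (wt \<Sigma> \<Gamma>) gs As"
    and a: "\<And>\<Delta> ks. var_tuple \<Delta> ks As \<Longrightarrow> wff (rel_sig \<Sigma>) \<Delta> (atom (map Var ks))"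
  shows "wff (rel_sig \<Sigma>) (usorts \<Sigma> \<Gamma> gs @ \<Gamma>) (ubody gs atom)" "wff (rel_sig \<Sigma>) \<Gamma> (tr_atom \<Sigma> \<Gamma> gs atom)"
proof -
  have "set gs \<subseteq> set (uterms gs)" using uterms_self by auto
  from a[OF upos_var_tuple[OF this gs]]
  show "wff (rel_sig \<Sigma>) (usorts \<Sigma> \<Gamma> gs @ \<Gamma>) (ubody gs atom)"
    unfolding ubody_def wff.simps wff_conjs using ugraph_wff[OF gs] by auto
  then show "wff (rel_sig \<Sigma>) \<Gamma> (tr_atom \<Sigma> \<Gamma> gs atom)"
    using usorts_sorts[OF assms(1-3)] by (simp add: tr_atom_eq)
qed

lemma wff_Eq_ren: "var_tuple \<Delta> ks [A, A] \<Longrightarrow> wff \<Sigma> \<Delta> (Eq (map Var ks ! 0) (map Var ks ! 1))"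
  by (auto simp: var_tuple_def list_all2_Cons2)

lemma wff_Rel_ren: "R \<in> rels \<Sigma> \<Longrightarrow> var_tuple \<Delta> ks (rdom \<Sigma> R) \<Longrightarrow> wff \<Sigma> \<Delta> (Rel R (map Var ks))"
  using var_tuple_wt by auto

lemma wff_tr: "wf_signature \<Sigma> \<Longrightarrow> wf_ctx \<Sigma> \<Gamma> \<Longrightarrow> wff \<Sigma> \<Gamma> \<phi> \<Longrightarrow> wff (rel_sig \<Sigma>) \<Gamma> (tr \<Sigma> \<Gamma> \<phi>)"
proof (induction \<phi> arbitrary: \<Gamma>)
  case (Eq s t)
  then obtain A where A: "list_all2 (wt \<Sigma> \<Gamma>) [s, t] [A, A]" by auto
  show ?case unfolding tr.simps
    by (rule wff_tr_atom(2)[OF Eq.prems(1,2) A]) (erule wff_Eq_ren)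
next
  case (Rel R ts)
  then have R: "R \<in> rels \<Sigma>" "list_all2 (wt \<Sigma> \<Gamma>) ts (rdom \<Sigma> R)" by auto
  show ?case unfolding tr.simps
    by (rule wff_tr_atom(2)[OF Rel.prems(1,2) R(2)]) (use R in \<open>auto intro!: wff_Rel_ren simp del: wff.simps\<close>)
qed auto

text \<open>The value of a term at \<open>xs\<close>, for an interpretation \<open>F\<close> of the function symbols.\<close>
primrec tval :: "('f \<Rightarrow> nat list \<Rightarrow> nat) \<Rightarrow> nat list \<Rightarrow> 'f trm \<Rightarrow> nat" where
  "tval F xs (Var i) = xs ! i"
| "tval F xs (Fn f ts) = F f (map (tval F xs) ts)"

lemma tval_tsubst:
  "wt \<Sigma> \<Gamma> t A \<Longrightarrow> tval F ys (tsubst \<sigma> t) = tval F (map (\<lambda>i. tval F ys (\<sigma> i)) [0..<length \<Gamma>]) t"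
proof (induction rule: wt.induct)
  case (wt_Fn f ts)
  then show ?case
    by (auto simp: list_all2_conv_all_nth intro!: arg_cong[of _ _ "F f"] nth_equalityI)
qed simp

text \<open>The conclusion of the totality axiom of \<open>f\<close>. A model that has witnesses for it interprets \<open>f\<close> by a
  function; only the symbols that occur in the given terms are required to have one.\<close>
definition total_task :: "('s, 'f, 'r) signature \<Rightarrow> 'f \<Rightarrow> ('s, 'f, 'r + 'f, 'i) fm" where
  "total_task \<Sigma> f = Ex (fcod \<Sigma> f) (Rel (Inr f) (map Var ([1..<1 + length (fdom \<Sigma> f)] @ [0])))"

definition atom_tasks :: "('s, 'f, 'r) signature \<Rightarrow> 's list \<Rightarrow> 'f trm list \<Rightarrow>
    ('f trm list \<Rightarrow> ('s, 'f, 'r + 'f, 'i) fm) \<Rightarrow> ('s, 'f, 'r + 'f, 'i) fm set" where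
  "atom_tasks \<Sigma> \<Gamma> gs atom = ex_tasks (usorts \<Sigma> \<Gamma> gs) (ubody gs atom) \<union> total_task \<Sigma> ` (\<Union>g\<in>set gs. set_trm g)"

lemma countable_atom_tasks [simp]: "countable (atom_tasks \<Sigma> \<Gamma> gs atom)"
  unfolding atom_tasks_def by (auto intro!: countable_finite)

locale rel_model = geo_model "rel_sig \<Sigma>" U S D H
  for \<Sigma> :: "('s, 'f, 'r) signature" and U :: "('s, 'f, 'r + 'f, 'i) sequent set" and S D H +
  assumes wf: "wf_signature \<Sigma>" and axs: "rel_theory0 \<Sigma> \<subseteq> U"
begin

definition R where "R q as \<longleftrightarrow> H (Rel q (map Var [0..<length as])) as"

definition app where "app f as = (THE b. b \<in> D (fcod \<Sigma> f) \<and> R (Inr f) (as @ [b]))"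

abbreviation "val \<equiv> tval app"

lemma H_Rel:
  assumes "q \<in> rels (rel_sig \<Sigma>)" "var_tuple \<Gamma> ks (rdom (rel_sig \<Sigma>) q)" "tuple D \<Gamma> xs"
  shows "H (Rel q (map Var ks)) xs \<longleftrightarrow> R q (map ((!) xs) ks)"
proof -
  let ?n = "length ks"
  have n: "?n = length (rdom (rel_sig \<Sigma>) q)" using assms(2) by (auto simp: var_tuple_def dest: list_all2_lengthD)
  have "map (tsubst ((!) (map Var ks))) (map Var [0..<?n]) = (map Var ks :: 'f trm list)"
    by (rule nth_equalityI) simp_all
  then have "inst (Rel q (map Var [0..<?n])) (map Var ks) = (Rel q (map Var ks) :: ('s, 'f, 'r + 'f, 'i) fm)"
    by (simp only: inst_def fsubst.simps)
  moreover have "wff (rel_sig \<Sigma>) (rdom (rel_sig \<Sigma>) q) (Rel q (map Var [0..<?n]))"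
    using assms(1) n by (auto simp: list_all2_conv_all_nth)
  ultimately show ?thesis using H_ren[OF _ assms(2,3)] unfolding R_def by (metis length_map)
qed

lemma app_unique:
  assumes f: "f \<in> funs \<Sigma>" "tuple D (fdom \<Sigma> f) as" and b: "b \<in> D (fcod \<Sigma> f)" "c \<in> D (fcod \<Sigma> f)"
    and r: "R (Inr f) (as @ [b])" "R (Inr f) (as @ [c])"
  shows "b = c"
proof -
  let ?n = "length (fdom \<Sigma> f)" and ?\<Gamma> = "fdom \<Sigma> f @ [fcod \<Sigma> f, fcod \<Sigma> f]"
  let ?\<phi> = "Rel (Inr f) (map Var ([0..<0 + ?n] @ [?n]))" and ?\<psi> = "Rel (Inr f) (map Var ([0..<0 + ?n] @ [?n + 1]))"
  have ax: "(?\<Gamma>, And ?\<phi> ?\<psi>, Eq (Var ?n) (Var (?n + 1))) \<in> U"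
    using axs f(1) unfolding rel_theory0_def Let_def vars_def by fastforce
  have t: "tuple D ?\<Gamma> (as @ [b, c])" using f b by simp
  have l: "length as = ?n" using tuple_length[OF f(2)] .
  have v1: "var_tuple ?\<Gamma> ([0..<0 + ?n] @ [?n]) (rdom (rel_sig \<Sigma>) (Inr f))"
    and v2: "var_tuple ?\<Gamma> ([0..<0 + ?n] @ [?n + 1]) (rdom (rel_sig \<Sigma>) (Inr f))"
    unfolding rel_sig_simps by (rule var_tuple_app[OF var_tuple_upt]; simp add: var_tuple_def nth_append)+
  have r': "Inr f \<in> rels (rel_sig \<Sigma>)" using f by simp
  have "H ?\<phi> (as @ [b, c])" unfolding H_Rel[OF r' v1 t] using r(1) l by (simp add: map_nth_upt[of 0, simplified] nth_append)
  moreover have "H ?\<psi> (as @ [b, c])" unfolding H_Rel[OF r' v2 t] using r(2) l by (simp add: map_nth_upt[of 0, simplified] nth_append)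
  ultimately have "H (And ?\<phi> ?\<psi>) (as @ [b, c])"
    using H_And[OF wff_Rel_ren[OF r' v1] wff_Rel_ren[OF r' v2] t] by blast
  from H_prv[OF provable.Axiom[OF ax] t this] have "H (Eq (Var ?n) (Var (?n + 1))) (as @ [b, c])" .
  then show ?thesis using H_Eq[OF t, of ?n "?n + 1"] l by (simp add: nth_append)
qed

lemma app_exists:
  assumes f: "f \<in> funs \<Sigma>" "tuple D (fdom \<Sigma> f) as" and s: "total_task \<Sigma> f \<in> S"
  shows "\<exists>b \<in> D (fcod \<Sigma> f). R (Inr f) (as @ [b])"
proof -
  let ?n = "length (fdom \<Sigma> f)"
  have ax: "(fdom \<Sigma> f, Top, total_task \<Sigma> f) \<in> U"
    using axs f(1) unfolding rel_theory0_def Let_def vars_def total_task_def by fastforce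
  have r': "Inr f \<in> rels (rel_sig \<Sigma>)" using f by simp
  have v: "var_tuple (fcod \<Sigma> f # fdom \<Sigma> f) ([1..<1 + ?n] @ [0]) (rdom (rel_sig \<Sigma>) (Inr f))"
    unfolding rel_sig_simps by (rule var_tuple_app[OF var_tuple_upt]; simp add: var_tuple_def)
  have w: "wff (rel_sig \<Sigma>) (fdom \<Sigma> f) (total_task \<Sigma> f :: ('s, 'f, 'r + 'f, 'i) fm)"
    using prvD[OF provable.Axiom[OF ax]] by (elim conjE)
  have "H (total_task \<Sigma> f) as" by (rule H_prv[OF provable.Axiom[OF ax] f(2) H_Top[OF f(2)]])
  then obtain b where b: "b \<in> D (fcod \<Sigma> f)" "H (Rel (Inr f) (map Var ([1..<1 + ?n] @ [0]))) (b # as)"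
    using H_Ex[OF s[unfolded total_task_def] w[unfolded total_task_def] f(2)] unfolding total_task_def by blast
  have t: "tuple D (fcod \<Sigma> f # fdom \<Sigma> f) (b # as)" using f b by simp
  have "R (Inr f) (map ((!) (b # as)) ([1..<1 + ?n] @ [0]))" using b(2) H_Rel[OF r' v t] by blast
  also have "map ((!) (b # as)) ([1..<1 + ?n] @ [0]) = as @ [b]"
    unfolding map_append using tuple_length[OF f(2)] by (subst map_nth_upt) auto
  finally show ?thesis using b by blast
qed

lemma app:
  assumes "f \<in> funs \<Sigma>" "tuple D (fdom \<Sigma> f) as" "total_task \<Sigma> f \<in> S"
  shows "app f as \<in> D (fcod \<Sigma> f)" "b \<in> D (fcod \<Sigma> f) \<Longrightarrow> R (Inr f) (as @ [b]) \<longleftrightarrow> b = app f as"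
proof -
  obtain c where c: "c \<in> D (fcod \<Sigma> f)" "R (Inr f) (as @ [c])" using app_exists[OF assms] by blast
  have "app f as = c" unfolding app_def using app_unique[OF assms(1,2)] c by blast
  then show "app f as \<in> D (fcod \<Sigma> f)" "b \<in> D (fcod \<Sigma> f) \<Longrightarrow> R (Inr f) (as @ [b]) \<longleftrightarrow> b = app f as"
    using app_unique[OF assms(1,2)] c by blast+
qed

lemma val_in:
  "wt \<Sigma> \<Gamma> t A \<Longrightarrow> tuple D \<Gamma> xs \<Longrightarrow> total_task \<Sigma> ` set_trm t \<subseteq> S \<Longrightarrow> val xs t \<in> D A"
proof (induction rule: wt.induct)
  case (wt_Var i)
  then show ?case by (auto simp: tuple_def list_all2_conv_all_nth)
next
  case (wt_Fn f ts)
  have "tuple D (fdom \<Sigma> f) (map (val xs) ts)"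
    unfolding tuple_def list_all2_conv_all_nth
  proof (intro conjI allI impI)
    show "length (map (val xs) ts) = length (fdom \<Sigma> f)" using wt_Fn by (auto dest: list_all2_lengthD)
    fix i assume i: "i < length (map (val xs) ts)"
    then have "set_trm (ts ! i) \<subseteq> set_trm (Fn f ts)" using nth_mem[of i ts] by auto
    then have "total_task \<Sigma> ` set_trm (ts ! i) \<subseteq> S" using wt_Fn.prems by blast
    then show "map (val xs) ts ! i \<in> D (fdom \<Sigma> f ! i)"
      using wt_Fn i by (simp add: list_all2_conv_all_nth)
  qed
  then show ?case using app(1) wt_Fn by auto
qed

lemma vals_in:
  assumes "list_all2 (wt \<Sigma> \<Gamma>) ts As" "tuple D \<Gamma> xs" "total_task \<Sigma> ` (\<Union>t\<in>set ts. set_trm t) \<subseteq> S"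
  shows "tuple D As (map (val xs) ts)"
  unfolding tuple_def list_all2_conv_all_nth
proof (intro conjI allI impI)
  show "length (map (val xs) ts) = length As" using assms by (auto dest: list_all2_lengthD)
  fix i assume i: "i < length (map (val xs) ts)"
  then have "ts ! i \<in> set ts" by simp
  then have "set_trm (ts ! i) \<subseteq> (\<Union>t\<in>set ts. set_trm t)" by blast
  then have "total_task \<Sigma> ` set_trm (ts ! i) \<subseteq> S" using assms(3) by blast
  then have "val xs (ts ! i) \<in> D (As ! i)"
    using assms i by (intro val_in[OF _ assms(2)]) (simp_all add: list_all2_conv_all_nth)
  then show "map (val xs) ts ! i \<in> D (As ! i)" using i by simp
qed

text \<open>By induction on subterms, the graph conditions hold exactly if each variable of the block is the
  value of its term. In particular the block is determined by \<open>xs\<close>, which is why translations of atomic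
  formulas are cartesian.\<close>
lemma H_ugraphs:
  assumes gs: "list_all2 (wt \<Sigma> \<Gamma>) gs As" and x: "tuple D \<Gamma> xs" and z: "tuple D (usorts \<Sigma> \<Gamma> gs) zs"
    and S: "total_task \<Sigma> ` (\<Union>t\<in>set gs. set_trm t) \<subseteq> S"
  shows "(\<forall>g \<in> set (uterms gs). H (ugraph gs g) (zs @ xs)) \<longleftrightarrow> zs = map (val xs) (uterms gs)"
proof -
  have t: "tuple D (usorts \<Sigma> \<Gamma> gs @ \<Gamma>) (zs @ xs)" using x z by simp
  have lz: "length zs = length (uterms gs)" using tuple_length[OF z] by (simp add: usorts_def)
  have zpos: "zs ! upos gs g \<in> D (sort_of \<Sigma> \<Gamma> g)" if "g \<in> set (uterms gs)" for g
    using z upos[OF that] lz by (auto simp: tuple_def list_all2_conv_all_nth usorts_def)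
  have tot: "total_task \<Sigma> f \<in> S" if "Fn f ts \<in> set (uterms gs)" for f ts
    using that S subterms_set_trm by (fastforce simp: set_uterms)
  have V: "H (ugraph gs (Var i)) (zs @ xs) \<longleftrightarrow> zs ! upos gs (Var i) = xs ! i" if "Var i \<in> set (uterms gs)" for i
  proof -
    have "i < length \<Gamma>" using uterms_wt[OF gs that] by simp
    then show ?thesis using upos[OF that] lz H_Eq[OF t, of "upos gs (Var i)" "length (uterms gs) + i"]
      by (simp add: ugraph_def nth_append usorts_def)
  qed
  have HFn: "H (ugraph gs (Fn f ts)) (zs @ xs) \<longleftrightarrow> zs ! upos gs (Fn f ts) = app f (map (\<lambda>t. zs ! upos gs t) ts)"
    if g: "Fn f ts \<in> set (uterms gs)" for f ts
  proof -
    have w: "list_all2 (wt \<Sigma> \<Gamma>) ts (fdom \<Sigma> f)" and f: "f \<in> funs \<Sigma>" using uterms_wt[OF gs g] by (auto simp: wt_Fn_iff)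
    have sub: "set ts \<subseteq> set (uterms gs)" using uterms_closed[OF g] by auto
    have w': "list_all2 (wt \<Sigma> \<Gamma>) (ts @ [Fn f ts]) (rdom (rel_sig \<Sigma>) (Inr f))"
      using w f by (simp add: wt_Fn_iff list_all2_appendI)
    have v: "var_tuple (usorts \<Sigma> \<Gamma> gs @ \<Gamma>) (map (upos gs) (ts @ [Fn f ts])) (rdom (rel_sig \<Sigma>) (Inr f))"
      by (rule upos_var_tuple[OF _ w']) (use sub g in auto)
    have pz: "(zs @ xs) ! upos gs g = zs ! upos gs g" if "g \<in> set (uterms gs)" for g
      using upos[OF that] lz by (simp add: nth_append)
    have m: "map ((!) (zs @ xs)) (map (upos gs) (ts @ [Fn f ts])) = map (\<lambda>t. zs ! upos gs t) ts @ [zs ! upos gs (Fn f ts)]"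
      using pz sub g by auto
    have "H (ugraph gs (Fn f ts)) (zs @ xs) \<longleftrightarrow> H (Rel (Inr f) (map Var (map (upos gs) (ts @ [Fn f ts])))) (zs @ xs)"
      by (simp add: ugraph_def)
    also have "\<dots> \<longleftrightarrow> R (Inr f) (map (\<lambda>t. zs ! upos gs t) ts @ [zs ! upos gs (Fn f ts)])"
      unfolding m[symmetric] by (rule H_Rel[OF _ v t]) (use f in simp)
    also have "\<dots> \<longleftrightarrow> zs ! upos gs (Fn f ts) = app f (map (\<lambda>t. zs ! upos gs t) ts)"
    proof (rule app(2)[OF f _ tot[OF g]])
      show "zs ! upos gs (Fn f ts) \<in> D (fcod \<Sigma> f)" using zpos[OF g] by simp
      show "tuple D (fdom \<Sigma> f) (map (\<lambda>t. zs ! upos gs t) ts)"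
        unfolding tuple_def list_all2_conv_all_nth
      proof (intro conjI allI impI)
        show "length (map (\<lambda>t. zs ! upos gs t) ts) = length (fdom \<Sigma> f)" using w by (auto dest: list_all2_lengthD)
        fix i assume i: "i < length (map (\<lambda>t. zs ! upos gs t) ts)"
        then have "sort_of \<Sigma> \<Gamma> (ts ! i) = fdom \<Sigma> f ! i" using w by (auto simp: list_all2_conv_all_nth intro: wt_sort_of)
        then show "map (\<lambda>t. zs ! upos gs t) ts ! i \<in> D (fdom \<Sigma> f ! i)" using zpos[OF subsetD[OF sub nth_mem[of i ts]]] i by simp
      qed
    qed
    finally show ?thesis .
  qed
  have "(\<forall>g \<in> set (uterms gs). H (ugraph gs g) (zs @ xs)) \<longleftrightarrow> (\<forall>g \<in> set (uterms gs). zs ! upos gs g = val xs g)"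
  proof
    assume a: "\<forall>g \<in> set (uterms gs). H (ugraph gs g) (zs @ xs)"
    have "g \<in> set (uterms gs) \<Longrightarrow> zs ! upos gs g = val xs g" for g
    proof (induction g)
      case (Var i)
      then show ?case using a V by simp
    next
      case (Fn f ts)
      have m: "map (\<lambda>t. zs ! upos gs t) ts = map (val xs) ts"
        using Fn.IH uterms_closed[OF Fn.prems] by auto
      show ?case unfolding tval.simps using a Fn.prems HFn[OF Fn.prems, unfolded m] by blast
    qed
    then show "\<forall>g \<in> set (uterms gs). zs ! upos gs g = val xs g" by blast
  next
    assume a: "\<forall>g \<in> set (uterms gs). zs ! upos gs g = val xs g"
    show "\<forall>g \<in> set (uterms gs). H (ugraph gs g) (zs @ xs)"
    proof
      fix g assume g: "g \<in> set (uterms gs)"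
      show "H (ugraph gs g) (zs @ xs)"
      proof (cases g)
        case (Var i)
        then show ?thesis using a g V by simp
      next
        case (Fn f ts)
        have m: "map (\<lambda>t. zs ! upos gs t) ts = map (val xs) ts"
          using a uterms_closed[of f ts gs] g Fn by simp
        have "zs ! upos gs (Fn f ts) = app f (map (val xs) ts)"
          using a[rule_format, OF g] Fn by (simp only: tval.simps)
        then show ?thesis using g Fn HFn[of f ts, unfolded m] by blast
      qed
    qed
  qed
  also have "\<dots> \<longleftrightarrow> zs = map (val xs) (uterms gs)"
  proof
    assume a: "\<forall>g \<in> set (uterms gs). zs ! upos gs g = val xs g"
    show "zs = map (val xs) (uterms gs)"
    proof (rule nth_equalityI)
      fix i assume i: "i < length zs"
      have "distinct (uterms gs)" by (simp add: uterms_def)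
      then have "upos gs (uterms gs ! i) = i" using upos[of "uterms gs ! i" gs] i lz
        nth_eq_iff_index_eq[of "uterms gs" "upos gs (uterms gs ! i)" i] by simp
      then show "zs ! i = map (val xs) (uterms gs) ! i" using a i lz by (metis nth_map nth_mem)
    qed (simp add: lz)
  next
    assume "zs = map (val xs) (uterms gs)"
    then show "\<forall>g \<in> set (uterms gs). zs ! upos gs g = val xs g" using upos[of _ gs] by simp
  qed
  finally show ?thesis .
qed

lemma H_ubody:
  assumes gs: "list_all2 (wt \<Sigma> \<Gamma>) gs As" and x: "tuple D \<Gamma> xs" and z: "tuple D (usorts \<Sigma> \<Gamma> gs) zs"
    and S: "total_task \<Sigma> ` (\<Union>t\<in>set gs. set_trm t) \<subseteq> S"
    and w: "\<And>\<Delta> ks. var_tuple \<Delta> ks As \<Longrightarrow> wff (rel_sig \<Sigma>) \<Delta> (atom (map Var ks))"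
    and Q: "\<And>\<Delta> ks ys. var_tuple \<Delta> ks As \<Longrightarrow> tuple D \<Delta> ys \<Longrightarrow> H (atom (map Var ks)) ys \<longleftrightarrow> Q (map ((!) ys) ks)"
  shows "H (ubody gs atom) (zs @ xs) \<longleftrightarrow> zs = map (val xs) (uterms gs) \<and> Q (map (val xs) gs)"
proof -
  have t: "tuple D (usorts \<Sigma> \<Gamma> gs @ \<Gamma>) (zs @ xs)" using x z by simp
  have lz: "length zs = length (uterms gs)" using tuple_length[OF z] by (simp add: usorts_def)
  have v: "var_tuple (usorts \<Sigma> \<Gamma> gs @ \<Gamma>) (map (upos gs) gs) As"
    using upos_var_tuple[OF _ gs] uterms_self by auto
  have wg: "wff (rel_sig \<Sigma>) (usorts \<Sigma> \<Gamma> gs @ \<Gamma>) \<phi>" if "\<phi> \<in> set (map (ugraph gs) (uterms gs))" for \<phi>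
    using that ugraph_wff[OF gs] by auto
  have "H (ubody gs atom) (zs @ xs) \<longleftrightarrow> (\<forall>g \<in> set (uterms gs). H (ugraph gs g) (zs @ xs)) \<and>
      Q (map ((!) (zs @ xs)) (map (upos gs) gs))"
  proof -
    have "H (conjs (map (ugraph gs) (uterms gs))) (zs @ xs) \<longleftrightarrow> (\<forall>g \<in> set (uterms gs). H (ugraph gs g) (zs @ xs))"
      by (subst H_conjs[OF wg t]) auto
    moreover have "wff (rel_sig \<Sigma>) (usorts \<Sigma> \<Gamma> gs @ \<Gamma>) (conjs (map (ugraph gs) (uterms gs)))"
      unfolding wff_conjs using wg by blast
    ultimately show ?thesis
      unfolding ubody_def using H_And[OF _ w[OF v] t] Q[OF v t] by blast
  qed
  also have "\<dots> \<longleftrightarrow> zs = map (val xs) (uterms gs) \<and> Q (map ((!) (zs @ xs)) (map (upos gs) gs))"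
    using H_ugraphs[OF gs x z S] by simp
  also have "\<dots> \<longleftrightarrow> zs = map (val xs) (uterms gs) \<and> Q (map (val xs) gs)"
  proof (rule conj_cong[OF refl])
    assume z: "zs = map (val xs) (uterms gs)"
    have "map ((!) (zs @ xs)) (map (upos gs) gs) = map (val xs) gs"
      using upos[OF uterms_self, of _ gs] by (simp add: nth_append z)
    then show "Q (map ((!) (zs @ xs)) (map (upos gs) gs)) \<longleftrightarrow> Q (map (val xs) gs)" by (rule arg_cong[of _ _ Q])
  qed
  finally show ?thesis .
qed

text \<open>The translation of an atomic formula expresses the atom about the values of the terms. The
  assumption on \<open>Q\<close> says what the atom expresses when its arguments are variables.\<close>
lemma H_tr_atom:
  assumes gs: "list_all2 (wt \<Sigma> \<Gamma>) gs As" and x: "tuple D \<Gamma> xs"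
    and S: "atom_tasks \<Sigma> \<Gamma> gs atom \<subseteq> S"
    and w: "\<And>\<Delta> ks. var_tuple \<Delta> ks As \<Longrightarrow> wff (rel_sig \<Sigma>) \<Delta> (atom (map Var ks))"
    and Q: "\<And>\<Delta> ks ys. var_tuple \<Delta> ks As \<Longrightarrow> tuple D \<Delta> ys \<Longrightarrow> H (atom (map Var ks)) ys \<longleftrightarrow> Q (map ((!) ys) ks)"
  shows "H (tr_atom \<Sigma> \<Gamma> gs atom) xs \<longleftrightarrow> Q (map (val xs) gs)"
proof -
  have S1: "ex_tasks (usorts \<Sigma> \<Gamma> gs) (ubody gs atom) \<subseteq> S" and S2: "total_task \<Sigma> ` (\<Union>t\<in>set gs. set_trm t) \<subseteq> S"
    using S by (auto simp: atom_tasks_def)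
  have wc: "wf_ctx \<Sigma> \<Gamma>" using tuple_wf[OF x] by simp
  have u: "tuple D (usorts \<Sigma> \<Gamma> gs) (map (val xs) (uterms gs))"
    unfolding usorts_def
  proof (rule vals_in[OF _ x])
    show "list_all2 (wt \<Sigma> \<Gamma>) (uterms gs) (map (sort_of \<Sigma> \<Gamma>) (uterms gs))"
      using uterms_wt[OF gs] by (auto simp: list_all2_conv_all_nth)
    show "total_task \<Sigma> ` (\<Union>t\<in>set (uterms gs). set_trm t) \<subseteq> S"
      using S2 subterms_set_trm by (fastforce simp: set_uterms)
  qed
  have "wff (rel_sig \<Sigma>) \<Gamma> (exs (usorts \<Sigma> \<Gamma> gs) (ubody gs atom))"
    unfolding tr_atom_eq[symmetric] by (rule wff_tr_atom(2)[OF wf wc gs]) (erule w)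
  note ex = H_exs[OF this x S1]
  have "H (ubody gs atom) (zs @ xs) \<longleftrightarrow> zs = map (val xs) (uterms gs) \<and> Q (map (val xs) gs)"
    if "tuple D (usorts \<Sigma> \<Gamma> gs) zs" for zs
    by (rule H_ubody[OF gs x that S2]) (erule w, erule (1) Q)
  then show ?thesis unfolding tr_atom_eq ex using u by blast
qed

lemma H_tr_Eq:
  assumes "wff \<Sigma> \<Gamma> (Eq s t)" "tuple D \<Gamma> xs" "atom_tasks \<Sigma> \<Gamma> [s, t] (\<lambda>zs. Eq (zs ! 0) (zs ! 1)) \<subseteq> S"
  shows "H (tr \<Sigma> \<Gamma> (Eq s t)) xs \<longleftrightarrow> val xs s = val xs t"
proof -
  obtain A where A: "list_all2 (wt \<Sigma> \<Gamma>) [s, t] [A, A]" using assms(1) by auto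
  have "H (Eq (map Var ks ! 0) (map Var ks ! 1)) ys \<longleftrightarrow> (map ((!) ys) ks ! 0 = map ((!) ys) ks ! 1)"
    if v: "var_tuple \<Delta> ks [A, A]" and y: "tuple D \<Delta> ys" for \<Delta> ks ys
  proof -
    obtain i j where "ks = [i, j]" "i < length \<Delta>" "j < length \<Delta>" "\<Delta> ! i = A" "\<Delta> ! j = A"
      using v by (auto simp: var_tuple_def list_all2_Cons2)
    then show ?thesis using H_Eq[OF y, of i j] by simp
  qed
  from H_tr_atom[OF A assms(2,3), where Q = "\<lambda>as. as ! 0 = as ! 1"] wff_Eq_ren[where \<Sigma> = "rel_sig \<Sigma>"] this
  show ?thesis by simp
qed

lemma H_tr_Rel:
  assumes "wff \<Sigma> \<Gamma> (Rel q ts)" "tuple D \<Gamma> xs" "atom_tasks \<Sigma> \<Gamma> ts (\<lambda>zs. Rel (Inl q) zs) \<subseteq> S"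
  shows "H (tr \<Sigma> \<Gamma> (Rel q ts)) xs \<longleftrightarrow> R (Inl q) (map (val xs) ts)"
proof -
  have A: "list_all2 (wt \<Sigma> \<Gamma>) ts (rdom \<Sigma> q)" and q: "Inl q \<in> rels (rel_sig \<Sigma>)" using assms(1) by auto
  show ?thesis unfolding tr.simps
    by (rule H_tr_atom[OF A assms(2,3)]) (use H_Rel[OF q] wff_Rel_ren[OF q] in simp_all)
qed

lemma svals_in:
  assumes "typed \<Sigma> \<Delta> \<sigma> \<Gamma>" "tuple D \<Delta> ys" "\<And>i. i < length \<Gamma> \<Longrightarrow> total_task \<Sigma> ` set_trm (\<sigma> i) \<subseteq> S"
  shows "tuple D \<Gamma> (map (\<lambda>i. val ys (\<sigma> i)) [0..<length \<Gamma>])"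
  using assms val_in[OF _ assms(2)] by (auto simp: typed_def tuple_def list_all2_conv_all_nth)

end

section \<open>The translation commutes with substitution\<close>

lemma set_trm_ren [simp]: "set_trm (tsubst (\<lambda>j. Var (g j)) t) = set_trm t"
  by (induction t) auto

definition shift :: "nat \<Rightarrow> 'f trm \<Rightarrow> 'f trm" where
  "shift m = tsubst (\<lambda>j. Var (j + m))"

text \<open>The formula \<open>x\<^sub>k = \<sigma>(k)\<close> for all variables of \<open>\<Gamma>\<close>, translated, in the context \<open>\<Gamma> @ \<Delta>\<close>.\<close>
definition sub_graph :: "('s, 'f, 'r) signature \<Rightarrow> 's list \<Rightarrow> 's list \<Rightarrow> (nat \<Rightarrow> 'f trm) \<Rightarrow> ('s, 'f, 'r + 'f, 'i) fm" where
  "sub_graph \<Sigma> \<Gamma> \<Delta> \<sigma> = conjs (map (\<lambda>k. tr \<Sigma> (\<Gamma> @ \<Delta>) (Eq (Var k) (shift (length \<Gamma>) (\<sigma> k)))) [0..<length \<Gamma>])"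

definition eq_tasks :: "('s, 'f, 'r) signature \<Rightarrow> 's list \<Rightarrow> 'f trm \<Rightarrow> 'f trm \<Rightarrow> ('s, 'f, 'r + 'f, 'i) fm set" where
  "eq_tasks \<Sigma> \<Gamma> s t = atom_tasks \<Sigma> \<Gamma> [s, t] (\<lambda>zs. Eq (zs ! 0) (zs ! 1))"

definition sub_tasks :: "('s, 'f, 'r) signature \<Rightarrow> 's list \<Rightarrow> 's list \<Rightarrow> (nat \<Rightarrow> 'f trm) \<Rightarrow> ('s, 'f, 'r + 'f, 'i) fm set" where
  "sub_tasks \<Sigma> \<Gamma> \<Delta> \<sigma> = (\<Union>k\<in>{..<length \<Gamma>}. eq_tasks \<Sigma> (\<Gamma> @ \<Delta>) (Var k) (shift (length \<Gamma>) (\<sigma> k)))"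

lemma countable_eq_tasks [simp]: "countable (eq_tasks \<Sigma> \<Gamma> s t)"
  by (simp add: eq_tasks_def)

lemma countable_sub_tasks [simp]: "countable (sub_tasks \<Sigma> \<Gamma> \<Delta> \<sigma>)"
  by (simp add: sub_tasks_def)

lemma wt_shift: "wt \<Sigma> \<Delta> t A \<Longrightarrow> wt \<Sigma> (\<Gamma> @ \<Delta>) (shift (length \<Gamma>) t) A"
  unfolding shift_def by (erule wt_tsubst) (simp add: typed_def nth_append)

lemma sub_graph_eqs_wff:
  "typed \<Sigma> \<Delta> \<sigma> \<Gamma> \<Longrightarrow> k < length \<Gamma> \<Longrightarrow> wff \<Sigma> (\<Gamma> @ \<Delta>) (Eq (Var k) (shift (length \<Gamma>) (\<sigma> k)))"
  by (auto simp: typed_def nth_append intro!: wt_shift)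

lemma sub_graph_wff:
  "wf_signature \<Sigma> \<Longrightarrow> wf_ctx \<Sigma> (\<Gamma> @ \<Delta>) \<Longrightarrow> typed \<Sigma> \<Delta> \<sigma> \<Gamma> \<Longrightarrow> wff (rel_sig \<Sigma>) (\<Gamma> @ \<Delta>) (sub_graph \<Sigma> \<Gamma> \<Delta> \<sigma>)"
  unfolding sub_graph_def wff_conjs
  using wff_tr[OF _ _ sub_graph_eqs_wff] by (auto simp del: tr.simps wf_ctx_simps)

context rel_model
begin

abbreviation "sval ys \<sigma> \<Gamma> \<equiv> map (\<lambda>i. val ys (\<sigma> i)) [0..<length \<Gamma>]"

lemma H_sub_graph:
  assumes ty: "typed \<Sigma> \<Delta> \<sigma> \<Gamma>" and x: "tuple D \<Gamma> xs" and y: "tuple D \<Delta> ys" and S: "sub_tasks \<Sigma> \<Gamma> \<Delta> \<sigma> \<subseteq> S"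
  shows "H (sub_graph \<Sigma> \<Gamma> \<Delta> \<sigma>) (xs @ ys) \<longleftrightarrow> xs = sval ys \<sigma> \<Gamma>"
proof -
  have t: "tuple D (\<Gamma> @ \<Delta>) (xs @ ys)" using x y by simp
  have wc: "wf_ctx \<Sigma> (\<Gamma> @ \<Delta>)" using tuple_wf[OF t] by simp
  have l: "length xs = length \<Gamma>" "length ys = length \<Delta>" using tuple_length x y by auto
  have sh: "val (xs @ ys) (shift (length \<Gamma>) t) = val ys t" if w: "wt \<Sigma> \<Delta> t A" for t A
  proof -
    have "map (\<lambda>i. val (xs @ ys) (Var (i + length \<Gamma>))) [0..<length \<Delta>] = ys"
      by (rule nth_equalityI) (simp_all add: l nth_append)
    then show ?thesis unfolding shift_def tval_tsubst[OF w] by simp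
  qed
  have e: "H (tr \<Sigma> (\<Gamma> @ \<Delta>) (Eq (Var k) (shift (length \<Gamma>) (\<sigma> k)))) (xs @ ys) \<longleftrightarrow> xs ! k = val ys (\<sigma> k)"
    if k: "k < length \<Gamma>" for k
  proof -
    have "H (tr \<Sigma> (\<Gamma> @ \<Delta>) (Eq (Var k) (shift (length \<Gamma>) (\<sigma> k)))) (xs @ ys) \<longleftrightarrow>
        val (xs @ ys) (Var k) = val (xs @ ys) (shift (length \<Gamma>) (\<sigma> k))"
      by (rule H_tr_Eq[OF sub_graph_eqs_wff[OF ty k] t]) (use S k in \<open>auto simp: sub_tasks_def eq_tasks_def\<close>)
    then show ?thesis using sh ty k l by (auto simp: typed_def nth_append)
  qed
  have "H (sub_graph \<Sigma> \<Gamma> \<Delta> \<sigma>) (xs @ ys) \<longleftrightarrow>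
      (\<forall>k < length \<Gamma>. H (tr \<Sigma> (\<Gamma> @ \<Delta>) (Eq (Var k) (shift (length \<Gamma>) (\<sigma> k)))) (xs @ ys))"
    unfolding sub_graph_def
    by (subst H_conjs[OF _ t]) (use wff_tr[OF wf wc sub_graph_eqs_wff[OF ty]] in \<open>auto simp del: tr.simps\<close>)
  also have "\<dots> \<longleftrightarrow> (\<forall>k < length \<Gamma>. xs ! k = val ys (\<sigma> k))" using e by auto
  also have "\<dots> \<longleftrightarrow> xs = sval ys \<sigma> \<Gamma>" by (subst list_eq_iff_nth_eq) (simp add: l)
  finally show ?thesis .
qed

lemma sval_tuple:
  assumes ty: "typed \<Sigma> \<Delta> \<sigma> \<Gamma>" and y: "tuple D \<Delta> ys" and S: "sub_tasks \<Sigma> \<Gamma> \<Delta> \<sigma> \<subseteq> S"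
  shows "tuple D \<Gamma> (sval ys \<sigma> \<Gamma>)"
proof (rule svals_in[OF ty y])
  fix i assume i: "i < length \<Gamma>"
  have "total_task \<Sigma> ` set_trm (shift (length \<Gamma>) (\<sigma> i)) \<subseteq> sub_tasks \<Sigma> \<Gamma> \<Delta> \<sigma>"
    using i by (auto simp: sub_tasks_def eq_tasks_def atom_tasks_def)
  then show "total_task \<Sigma> ` set_trm (\<sigma> i) \<subseteq> S" using S by (auto simp: shift_def)
qed

end

locale rel_geo = geo "rel_sig \<Sigma>" U
  for \<Sigma> :: "('s, 'f, 'r) signature" and U :: "('s, 'f, 'r + 'f, 'i) sequent set" +
  assumes wf: "wf_signature \<Sigma>" and axs: "rel_theory0 \<Sigma> \<subseteq> U"
begin

lemma rel_modelI: "geo_model (rel_sig \<Sigma>) U S D H \<Longrightarrow> rel_model \<Sigma> U S D H"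
  by (intro rel_model.intro rel_model_axioms.intro wf axs)

text \<open>Translation commutes with the substitution \<open>\<sigma>\<close>. This is stated as a provable equivalence
  rather than as a property of models, because in the induction over a disjunction of uncountably many
  formulas no model decides enough to treat all disjuncts; provable sequents hold in every model.\<close>
definition sub_ok :: "'s list \<Rightarrow> 's list \<Rightarrow> (nat \<Rightarrow> 'f trm) \<Rightarrow> ('s, 'f, 'r, 'i) fm \<Rightarrow> bool" where
  "sub_ok \<Gamma> \<Delta> \<sigma> \<phi> \<longleftrightarrow> (let m = length \<Gamma>; n = length \<Delta> in equivalent (rel_sig \<Sigma>) U (\<Gamma> @ \<Delta>)
     (And (sub_graph \<Sigma> \<Gamma> \<Delta> \<sigma>) (inst (tr \<Sigma> \<Gamma> \<phi>) (map Var [0..<0 + m])))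
     (And (sub_graph \<Sigma> \<Gamma> \<Delta> \<sigma>) (inst (tr \<Sigma> \<Delta> (fsubst \<sigma> \<phi>)) (map Var [m..<m + n]))))"

context
  fixes \<Gamma> \<Delta> :: "'s list" and \<sigma> :: "nat \<Rightarrow> 'f trm" and \<phi> :: "('s, 'f, 'r, 'i) fm"
  assumes wc: "wf_ctx \<Sigma> (\<Gamma> @ \<Delta>)" and w: "wff \<Sigma> \<Gamma> \<phi>" and ty: "typed \<Sigma> \<Delta> \<sigma> \<Gamma>"
begin

lemma sub_wffs:
  "wff (rel_sig \<Sigma>) \<Gamma> (tr \<Sigma> \<Gamma> \<phi>)" "wff (rel_sig \<Sigma>) \<Delta> (tr \<Sigma> \<Delta> (fsubst \<sigma> \<phi>))"
  "wff (rel_sig \<Sigma>) (\<Gamma> @ \<Delta>) (sub_graph \<Sigma> \<Gamma> \<Delta> \<sigma>)"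
  "wff (rel_sig \<Sigma>) (\<Gamma> @ \<Delta>) (inst (tr \<Sigma> \<Gamma> \<phi>) (map Var [0..<0 + length \<Gamma>]))"
  "wff (rel_sig \<Sigma>) (\<Gamma> @ \<Delta>) (inst (tr \<Sigma> \<Delta> (fsubst \<sigma> \<phi>)) (map Var [length \<Gamma>..<length \<Gamma> + length \<Delta>]))"
proof -
  show 1: "wff (rel_sig \<Sigma>) \<Gamma> (tr \<Sigma> \<Gamma> \<phi>)" using wff_tr[OF wf _ w] wc by simp
  show 2: "wff (rel_sig \<Sigma>) \<Delta> (tr \<Sigma> \<Delta> (fsubst \<sigma> \<phi>))" using wff_tr[OF wf _ wff_fsubst[OF w ty]] wc by simp
  show "wff (rel_sig \<Sigma>) (\<Gamma> @ \<Delta>) (sub_graph \<Sigma> \<Gamma> \<Delta> \<sigma>)" by (rule sub_graph_wff[OF wf wc ty])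
  show "wff (rel_sig \<Sigma>) (\<Gamma> @ \<Delta>) (inst (tr \<Sigma> \<Gamma> \<phi>) (map Var [0..<0 + length \<Gamma>]))"
    by (rule wff_ren[OF 1]; intro vt_simps; simp)
  show "wff (rel_sig \<Sigma>) (\<Gamma> @ \<Delta>) (inst (tr \<Sigma> \<Delta> (fsubst \<sigma> \<phi>)) (map Var [length \<Gamma>..<length \<Gamma> + length \<Delta>]))"
    by (rule wff_ren[OF 2]; intro vt_simps; simp)
qed

lemma sub_ok_sides:
  assumes "rel_model \<Sigma> U S D H" "tuple D \<Gamma> xs" "tuple D \<Delta> ys" "sub_tasks \<Sigma> \<Gamma> \<Delta> \<sigma> \<subseteq> S"
  shows "H (And (sub_graph \<Sigma> \<Gamma> \<Delta> \<sigma>) (inst (tr \<Sigma> \<Gamma> \<phi>) (map Var [0..<0 + length \<Gamma>]))) (xs @ ys) \<longleftrightarrow>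
      xs = map (\<lambda>i. tval (rel_model.app \<Sigma> D H) ys (\<sigma> i)) [0..<length \<Gamma>] \<and> H (tr \<Sigma> \<Gamma> \<phi>) xs"
    and "H (And (sub_graph \<Sigma> \<Gamma> \<Delta> \<sigma>) (inst (tr \<Sigma> \<Delta> (fsubst \<sigma> \<phi>)) (map Var [length \<Gamma>..<length \<Gamma> + length \<Delta>]))) (xs @ ys) \<longleftrightarrow>
      xs = map (\<lambda>i. tval (rel_model.app \<Sigma> D H) ys (\<sigma> i)) [0..<length \<Gamma>] \<and> H (tr \<Sigma> \<Delta> (fsubst \<sigma> \<phi>)) ys"
proof -
  interpret m: rel_model \<Sigma> U S D H by fact
  have t: "tuple D (\<Gamma> @ \<Delta>) (xs @ ys)" using assms by simp
  have l: "length xs = length \<Gamma>" "length ys = length \<Delta>" using tuple_length assms by auto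
  note g = m.H_sub_graph[OF ty assms(2-4)]
  show "H (And (sub_graph \<Sigma> \<Gamma> \<Delta> \<sigma>) (inst (tr \<Sigma> \<Gamma> \<phi>) (map Var [0..<0 + length \<Gamma>]))) (xs @ ys) \<longleftrightarrow>
      xs = map (\<lambda>i. tval (rel_model.app \<Sigma> D H) ys (\<sigma> i)) [0..<length \<Gamma>] \<and> H (tr \<Sigma> \<Gamma> \<phi>) xs"
    using m.H_And[OF sub_wffs(3,4) t] g m.H_inst_upt[OF sub_wffs(1) t, of 0 "length \<Gamma>"] l by simp
  show "H (And (sub_graph \<Sigma> \<Gamma> \<Delta> \<sigma>) (inst (tr \<Sigma> \<Delta> (fsubst \<sigma> \<phi>)) (map Var [length \<Gamma>..<length \<Gamma> + length \<Delta>]))) (xs @ ys) \<longleftrightarrow>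
      xs = map (\<lambda>i. tval (rel_model.app \<Sigma> D H) ys (\<sigma> i)) [0..<length \<Gamma>] \<and> H (tr \<Sigma> \<Delta> (fsubst \<sigma> \<phi>)) ys"
    using m.H_And[OF sub_wffs(3,5) t] g m.H_inst_upt[OF sub_wffs(2) t, of "length \<Gamma>" "length \<Delta>"] l by simp
qed

text \<open>Passage between the provable equivalence and models: the graph of \<open>\<sigma>\<close> forces the variables of
  \<open>\<Gamma>\<close> to be the values of the terms \<open>\<sigma>(k)\<close>.\<close>
lemma sub_okI:
  assumes S: "countable S" "sub_tasks \<Sigma> \<Gamma> \<Delta> \<sigma> \<subseteq> S"
    and h: "\<And>D H ys. rel_model \<Sigma> U S D H \<Longrightarrow> tuple D \<Delta> ys \<Longrightarrow>
      H (tr \<Sigma> \<Delta> (fsubst \<sigma> \<phi>)) ys \<longleftrightarrow> H (tr \<Sigma> \<Gamma> \<phi>) (map (\<lambda>i. tval (rel_model.app \<Sigma> D H) ys (\<sigma> i)) [0..<length \<Gamma>])"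
  shows "sub_ok \<Gamma> \<Delta> \<sigma> \<phi>"
  unfolding sub_ok_def Let_def
proof (rule equivalent_complete[OF S(1)])
  fix D H zs assume m: "geo_model (rel_sig \<Sigma>) U S D H" and t: "tuple D (\<Gamma> @ \<Delta>) zs"
  obtain xs ys where z: "zs = xs @ ys" "tuple D \<Gamma> xs" "tuple D \<Delta> ys" using t by (rule tuple_appendE)
  show "H (And (sub_graph \<Sigma> \<Gamma> \<Delta> \<sigma>) (inst (tr \<Sigma> \<Gamma> \<phi>) (map Var [0..<0 + length \<Gamma>]))) zs \<longleftrightarrow>
     H (And (sub_graph \<Sigma> \<Gamma> \<Delta> \<sigma>) (inst (tr \<Sigma> \<Delta> (fsubst \<sigma> \<phi>)) (map Var [length \<Gamma>..<length \<Gamma> + length \<Delta>]))) zs"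
    unfolding z(1) sub_ok_sides[OF rel_modelI[OF m] z(2,3) S(2)] using h[OF rel_modelI[OF m] z(3)] by blast
qed (use wc sub_wffs in simp_all)

lemma sub_okE:
  assumes ok: "sub_ok \<Gamma> \<Delta> \<sigma> \<phi>" and m: "rel_model \<Sigma> U S D H" and y: "tuple D \<Delta> ys" and S: "sub_tasks \<Sigma> \<Gamma> \<Delta> \<sigma> \<subseteq> S"
  shows "H (tr \<Sigma> \<Delta> (fsubst \<sigma> \<phi>)) ys \<longleftrightarrow> H (tr \<Sigma> \<Gamma> \<phi>) (map (\<lambda>i. tval (rel_model.app \<Sigma> D H) ys (\<sigma> i)) [0..<length \<Gamma>])"
proof -
  interpret m: rel_model \<Sigma> U S D H by fact
  let ?xs = "map (\<lambda>i. tval (rel_model.app \<Sigma> D H) ys (\<sigma> i)) [0..<length \<Gamma>]"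
  have x: "tuple D \<Gamma> ?xs" by (rule m.sval_tuple[OF ty y S])
  have "tuple D (\<Gamma> @ \<Delta>) (?xs @ ys)" using x y by simp
  from m.H_equivalent[OF ok[unfolded sub_ok_def Let_def] this] show ?thesis
    unfolding sub_ok_sides[OF m x y S] by blast
qed

end

text \<open>For an existential formula, \<open>lift \<sigma>\<close> at \<open>a # ys\<close> has the values of \<open>\<sigma>\<close> at \<open>ys\<close>, preceded by \<open>a\<close>.\<close>
lemma sub_ok_all:
  "wf_ctx \<Sigma> (\<Gamma> @ \<Delta>) \<Longrightarrow> wff \<Sigma> \<Gamma> \<phi> \<Longrightarrow> typed \<Sigma> \<Delta> \<sigma> \<Gamma> \<Longrightarrow> sub_ok \<Gamma> \<Delta> \<sigma> \<phi>"
proof (induction \<phi> arbitrary: \<Gamma> \<Delta> \<sigma>)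
  case (Eq s t)
  let ?S = "sub_tasks \<Sigma> \<Gamma> \<Delta> \<sigma> \<union> eq_tasks \<Sigma> \<Gamma> s t \<union> eq_tasks \<Sigma> \<Delta> (tsubst \<sigma> s) (tsubst \<sigma> t)"
  show ?case
  proof (rule sub_okI[OF Eq.prems, where S = ?S])
    fix D H ys assume m: "rel_model \<Sigma> U ?S D H" and y: "tuple D \<Delta> ys"
    interpret m: rel_model \<Sigma> U ?S D H by fact
    note x = m.sval_tuple[OF Eq.prems(3) y]
    obtain A where A: "wt \<Sigma> \<Gamma> s A" "wt \<Sigma> \<Gamma> t A" using Eq.prems by auto
    have "H (tr \<Sigma> \<Delta> (fsubst \<sigma> (Eq s t))) ys \<longleftrightarrow> m.val ys (tsubst \<sigma> s) = m.val ys (tsubst \<sigma> t)"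
      unfolding fsubst.simps
      by (rule m.H_tr_Eq[OF _ y]) (use A Eq.prems in \<open>auto intro: wt_tsubst simp: eq_tasks_def\<close>)
    also have "\<dots> \<longleftrightarrow> m.val (m.sval ys \<sigma> \<Gamma>) s = m.val (m.sval ys \<sigma> \<Gamma>) t"
      using tval_tsubst[OF A(1)] tval_tsubst[OF A(2)] by metis
    also have "\<dots> \<longleftrightarrow> H (tr \<Sigma> \<Gamma> (Eq s t)) (m.sval ys \<sigma> \<Gamma>)"
      by (rule m.H_tr_Eq[OF Eq.prems(2) x, symmetric]) (auto simp: eq_tasks_def)
    finally show "H (tr \<Sigma> \<Delta> (fsubst \<sigma> (Eq s t))) ys \<longleftrightarrow> H (tr \<Sigma> \<Gamma> (Eq s t)) (m.sval ys \<sigma> \<Gamma>)" .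
  qed auto
next
  case (Rel q ts)
  let ?S = "sub_tasks \<Sigma> \<Gamma> \<Delta> \<sigma> \<union> atom_tasks \<Sigma> \<Gamma> ts (\<lambda>zs. Rel (Inl q) zs) \<union>
    atom_tasks \<Sigma> \<Delta> (map (tsubst \<sigma>) ts) (\<lambda>zs. Rel (Inl q) zs)"
  show ?case
  proof (rule sub_okI[OF Rel.prems, where S = ?S])
    fix D H ys assume m: "rel_model \<Sigma> U ?S D H" and y: "tuple D \<Delta> ys"
    interpret m: rel_model \<Sigma> U ?S D H by fact
    note x = m.sval_tuple[OF Rel.prems(3) y]
    have A: "list_all2 (wt \<Sigma> \<Gamma>) ts (rdom \<Sigma> q)" using Rel.prems by auto
    have "H (tr \<Sigma> \<Delta> (fsubst \<sigma> (Rel q ts))) ys \<longleftrightarrow> m.R (Inl q) (map (m.val ys) (map (tsubst \<sigma>) ts))"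
      unfolding fsubst.simps
      by (rule m.H_tr_Rel[OF wff_fsubst[OF Rel.prems(2,3), unfolded fsubst.simps] y]) auto
    also have "map (m.val ys) (map (tsubst \<sigma>) ts) = map (m.val (m.sval ys \<sigma> \<Gamma>)) ts"
      using A tval_tsubst by (intro nth_equalityI) (force simp: list_all2_conv_all_nth)+
    also have "m.R (Inl q) \<dots> \<longleftrightarrow> H (tr \<Sigma> \<Gamma> (Rel q ts)) (m.sval ys \<sigma> \<Gamma>)"
      by (rule m.H_tr_Rel[OF Rel.prems(2) x, symmetric]) auto
    finally show "H (tr \<Sigma> \<Delta> (fsubst \<sigma> (Rel q ts))) ys \<longleftrightarrow> H (tr \<Sigma> \<Gamma> (Rel q ts)) (m.sval ys \<sigma> \<Gamma>)" .
  qed auto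
next
  case Top
  let ?S = "sub_tasks \<Sigma> \<Gamma> \<Delta> \<sigma>"
  show ?case
  proof (rule sub_okI[OF Top.prems, where S = ?S])
    fix D H ys assume m: "rel_model \<Sigma> U ?S D H" and y: "tuple D \<Delta> ys"
    interpret m: rel_model \<Sigma> U ?S D H by fact
    show "H (tr \<Sigma> \<Delta> (fsubst \<sigma> Top)) ys \<longleftrightarrow> H (tr \<Sigma> \<Gamma> Top) (m.sval ys \<sigma> \<Gamma>)"
      using m.H_Top[OF y] m.H_Top[OF m.sval_tuple[OF Top.prems(3) y]] by simp
  qed auto
next
  case Bot
  let ?S = "sub_tasks \<Sigma> \<Gamma> \<Delta> \<sigma>"
  show ?case
  proof (rule sub_okI[OF Bot.prems, where S = ?S])
    fix D H ys assume m: "rel_model \<Sigma> U ?S D H" and y: "tuple D \<Delta> ys"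
    interpret m: rel_model \<Sigma> U ?S D H by fact
    show "H (tr \<Sigma> \<Delta> (fsubst \<sigma> Bot)) ys \<longleftrightarrow> H (tr \<Sigma> \<Gamma> Bot) (m.sval ys \<sigma> \<Gamma>)"
      using m.H_Bot by simp
  qed auto
next
  case (And \<phi> \<psi>)
  let ?S = "sub_tasks \<Sigma> \<Gamma> \<Delta> \<sigma>"
  have w: "wff \<Sigma> \<Gamma> \<phi>" "wff \<Sigma> \<Gamma> \<psi>" using And.prems by auto
  show ?case
  proof (rule sub_okI[OF And.prems, where S = ?S])
    fix D H ys assume m: "rel_model \<Sigma> U ?S D H" and y: "tuple D \<Delta> ys"
    interpret m: rel_model \<Sigma> U ?S D H by fact
    note x = m.sval_tuple[OF And.prems(3) y order_refl]
    note i1 = sub_okE[OF And.prems(1) w(1) And.prems(3) And.IH(1)[OF And.prems(1) w(1) And.prems(3)] m y order_refl]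
    note i2 = sub_okE[OF And.prems(1) w(2) And.prems(3) And.IH(2)[OF And.prems(1) w(2) And.prems(3)] m y order_refl]
    note w1 = sub_wffs[OF And.prems(1) w(1) And.prems(3)] and w2 = sub_wffs[OF And.prems(1) w(2) And.prems(3)]
    show "H (tr \<Sigma> \<Delta> (fsubst \<sigma> (And \<phi> \<psi>))) ys \<longleftrightarrow> H (tr \<Sigma> \<Gamma> (And \<phi> \<psi>)) (m.sval ys \<sigma> \<Gamma>)"
      unfolding fsubst.simps tr.simps m.H_And[OF w1(1) w2(1) x] m.H_And[OF w1(2) w2(2) y] using i1 i2 by blast
  qed auto
next
  case (Or \<phi> \<psi>)
  let ?S = "sub_tasks \<Sigma> \<Gamma> \<Delta> \<sigma> \<union> {Or (tr \<Sigma> \<Gamma> \<phi>) (tr \<Sigma> \<Gamma> \<psi>), Or (tr \<Sigma> \<Delta> (fsubst \<sigma> \<phi>)) (tr \<Sigma> \<Delta> (fsubst \<sigma> \<psi>))}"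
  have w: "wff \<Sigma> \<Gamma> \<phi>" "wff \<Sigma> \<Gamma> \<psi>" using Or.prems by auto
  show ?case
  proof (rule sub_okI[OF Or.prems, where S = ?S])
    fix D H ys assume m: "rel_model \<Sigma> U ?S D H" and y: "tuple D \<Delta> ys"
    interpret m: rel_model \<Sigma> U ?S D H by fact
    have S: "sub_tasks \<Sigma> \<Gamma> \<Delta> \<sigma> \<subseteq> ?S" by blast
    note x = m.sval_tuple[OF Or.prems(3) y S]
    note i1 = sub_okE[OF Or.prems(1) w(1) Or.prems(3) Or.IH(1)[OF Or.prems(1) w(1) Or.prems(3)] m y S]
    note i2 = sub_okE[OF Or.prems(1) w(2) Or.prems(3) Or.IH(2)[OF Or.prems(1) w(2) Or.prems(3)] m y S]
    note w1 = sub_wffs[OF Or.prems(1) w(1) Or.prems(3)] and w2 = sub_wffs[OF Or.prems(1) w(2) Or.prems(3)]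
    have a: "H (Or (tr \<Sigma> \<Gamma> \<phi>) (tr \<Sigma> \<Gamma> \<psi>)) (m.sval ys \<sigma> \<Gamma>) \<longleftrightarrow> H (tr \<Sigma> \<Gamma> \<phi>) (m.sval ys \<sigma> \<Gamma>) \<or> H (tr \<Sigma> \<Gamma> \<psi>) (m.sval ys \<sigma> \<Gamma>)"
      by (rule m.H_Or_iff[OF _ w1(1) w2(1) x]) simp
    have b: "H (Or (tr \<Sigma> \<Delta> (fsubst \<sigma> \<phi>)) (tr \<Sigma> \<Delta> (fsubst \<sigma> \<psi>))) ys \<longleftrightarrow> H (tr \<Sigma> \<Delta> (fsubst \<sigma> \<phi>)) ys \<or> H (tr \<Sigma> \<Delta> (fsubst \<sigma> \<psi>)) ys"
      by (rule m.H_Or_iff[OF _ w1(2) w2(2) y]) simp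
    show "H (tr \<Sigma> \<Delta> (fsubst \<sigma> (Or \<phi> \<psi>))) ys \<longleftrightarrow> H (tr \<Sigma> \<Gamma> (Or \<phi> \<psi>)) (m.sval ys \<sigma> \<Gamma>)"
      unfolding fsubst.simps tr.simps a b using i1 i2 by blast
  qed auto
next
  case (Disj I F)
  let ?S = "sub_tasks \<Sigma> \<Gamma> \<Delta> \<sigma> \<union> {Disj I (\<lambda>i. tr \<Sigma> \<Gamma> (F i)), Disj I (\<lambda>i. tr \<Sigma> \<Delta> (fsubst \<sigma> (F i)))}"
  have w: "wff \<Sigma> \<Gamma> (F i)" if "i \<in> I" for i using Disj.prems that by auto
  show ?case
  proof (rule sub_okI[OF Disj.prems, where S = ?S])
    fix D H ys assume m: "rel_model \<Sigma> U ?S D H" and y: "tuple D \<Delta> ys"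
    interpret m: rel_model \<Sigma> U ?S D H by fact
    have S: "sub_tasks \<Sigma> \<Gamma> \<Delta> \<sigma> \<subseteq> ?S" by blast
    note x = m.sval_tuple[OF Disj.prems(3) y S]
    have i1: "H (tr \<Sigma> \<Delta> (fsubst \<sigma> (F i))) ys \<longleftrightarrow> H (tr \<Sigma> \<Gamma> (F i)) (m.sval ys \<sigma> \<Gamma>)" if "i \<in> I" for i
      by (rule sub_okE[OF Disj.prems(1) w[OF that] Disj.prems(3) Disj.IH[OF rangeI Disj.prems(1) w[OF that] Disj.prems(3)] m y S])
    note w1 = sub_wffs[OF Disj.prems(1) w Disj.prems(3)]
    have a: "H (Disj I (\<lambda>i. tr \<Sigma> \<Gamma> (F i))) (m.sval ys \<sigma> \<Gamma>) \<longleftrightarrow> (\<exists>i\<in>I. H (tr \<Sigma> \<Gamma> (F i)) (m.sval ys \<sigma> \<Gamma>))"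
      by (rule m.H_Disj_iff[OF _ _ x]) (use w1(1) in simp_all)
    have b: "H (Disj I (\<lambda>i. tr \<Sigma> \<Delta> (fsubst \<sigma> (F i)))) ys \<longleftrightarrow> (\<exists>i\<in>I. H (tr \<Sigma> \<Delta> (fsubst \<sigma> (F i))) ys)"
      by (rule m.H_Disj_iff[OF _ _ y]) (use w1(2) in simp_all)
    show "H (tr \<Sigma> \<Delta> (fsubst \<sigma> (Disj I F))) ys \<longleftrightarrow> H (tr \<Sigma> \<Gamma> (Disj I F)) (m.sval ys \<sigma> \<Gamma>)"
      unfolding fsubst.simps tr.simps a b using i1 by blast
  qed auto
next
  case (Ex A \<phi>)
  let ?S = "sub_tasks \<Sigma> \<Gamma> \<Delta> \<sigma> \<union> sub_tasks \<Sigma> (A # \<Gamma>) (A # \<Delta>) (lift \<sigma>) \<union>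
    {Ex A (tr \<Sigma> (A # \<Gamma>) \<phi>), Ex A (tr \<Sigma> (A # \<Delta>) (fsubst (lift \<sigma>) \<phi>))}"
  have w: "wff \<Sigma> (A # \<Gamma>) \<phi>" "wf_ctx \<Sigma> ((A # \<Gamma>) @ (A # \<Delta>))" "A \<in> sorts \<Sigma>" using Ex.prems by auto
  have ty: "typed \<Sigma> (A # \<Delta>) (lift \<sigma>) (A # \<Gamma>)" by (rule typed_lift[OF Ex.prems(3)])
  show ?case
  proof (rule sub_okI[OF Ex.prems, where S = ?S])
    fix D H ys assume m: "rel_model \<Sigma> U ?S D H" and y: "tuple D \<Delta> ys"
    interpret m: rel_model \<Sigma> U ?S D H by fact
    have S: "sub_tasks \<Sigma> \<Gamma> \<Delta> \<sigma> \<subseteq> ?S" "sub_tasks \<Sigma> (A # \<Gamma>) (A # \<Delta>) (lift \<sigma>) \<subseteq> ?S" by blast+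
    note x = m.sval_tuple[OF Ex.prems(3) y S(1)]
    have i1: "H (tr \<Sigma> (A # \<Delta>) (fsubst (lift \<sigma>) \<phi>)) (a # ys) \<longleftrightarrow> H (tr \<Sigma> (A # \<Gamma>) \<phi>) (a # m.sval ys \<sigma> \<Gamma>)" if a: "a \<in> D A" for a
    proof -
      have ty': "tuple D (A # \<Delta>) (a # ys)" using a y by simp
      have l: "length ys = length \<Delta>" using tuple_length[OF y] .
      have v: "m.val (a # ys) (tsubst (\<lambda>k. Var (Suc k)) (\<sigma> i)) = m.val ys (\<sigma> i)" if i: "i < length \<Gamma>" for i
      proof -
        have "wt \<Sigma> \<Delta> (\<sigma> i) (\<Gamma> ! i)" using Ex.prems(3) i by (simp add: typed_def)
        moreover have "map (\<lambda>i. m.val (a # ys) (Var (Suc i))) [0..<length \<Delta>] = ys"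
          by (rule nth_equalityI) (simp_all add: l)
        ultimately show ?thesis using tval_tsubst by metis
      qed
      have "m.sval (a # ys) (lift \<sigma>) (A # \<Gamma>) = a # m.sval ys \<sigma> \<Gamma>"
        by (rule nth_equalityI) (auto simp: nth_Cons v simp del: upt_Suc split: nat.splits)
      then show ?thesis using sub_okE[OF w(2,1) ty Ex.IH[OF w(2,1) ty] m ty' S(2)] by simp
    qed
    note w1 = sub_wffs[OF w(2,1) ty]
    have a: "H (Ex A (tr \<Sigma> (A # \<Gamma>) \<phi>)) (m.sval ys \<sigma> \<Gamma>) \<longleftrightarrow> (\<exists>a\<in>D A. H (tr \<Sigma> (A # \<Gamma>) \<phi>) (a # m.sval ys \<sigma> \<Gamma>))"
      by (rule m.H_Ex_iff[OF _ _ x]) (use w1(1) w(3) in simp_all)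
    have b: "H (Ex A (tr \<Sigma> (A # \<Delta>) (fsubst (lift \<sigma>) \<phi>))) ys \<longleftrightarrow> (\<exists>a\<in>D A. H (tr \<Sigma> (A # \<Delta>) (fsubst (lift \<sigma>) \<phi>)) (a # ys))"
      by (rule m.H_Ex_iff[OF _ _ y]) (use w1(2) w(3) in simp_all)
    show "H (tr \<Sigma> \<Delta> (fsubst \<sigma> (Ex A \<phi>))) ys \<longleftrightarrow> H (tr \<Sigma> \<Gamma> (Ex A \<phi>)) (m.sval ys \<sigma> \<Gamma>)"
      unfolding fsubst.simps tr.simps a b using i1 by blast
  qed auto
qed

lemma H_tr_fsubst:
  assumes "wf_ctx \<Sigma> \<Gamma>" "wff \<Sigma> \<Gamma> \<phi>" "typed \<Sigma> \<Delta> \<sigma> \<Gamma>" "rel_model \<Sigma> U S D H" "tuple D \<Delta> ys" "sub_tasks \<Sigma> \<Gamma> \<Delta> \<sigma> \<subseteq> S"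
  shows "H (tr \<Sigma> \<Delta> (fsubst \<sigma> \<phi>)) ys \<longleftrightarrow> H (tr \<Sigma> \<Gamma> \<phi>) (map (\<lambda>i. tval (rel_model.app \<Sigma> D H) ys (\<sigma> i)) [0..<length \<Gamma>])"
proof -
  interpret m: rel_model \<Sigma> U S D H by fact
  have wc: "wf_ctx \<Sigma> (\<Gamma> @ \<Delta>)" using assms(1) m.tuple_wf[OF assms(5)] by simp
  show ?thesis by (rule sub_okE[OF wc assms(2,3) sub_ok_all[OF wc assms(2,3)] assms(4-6)])
qed

lemma tr_ren:
  assumes "wf_ctx \<Sigma> \<Delta>" "wf_ctx \<Sigma> \<Gamma>" "wff \<Sigma> \<Gamma> \<phi>" and v: "var_tuple \<Delta> ks \<Gamma>"
  shows "equivalent (rel_sig \<Sigma>) U \<Delta> (tr \<Sigma> \<Delta> (inst \<phi> (map Var ks))) (inst (tr \<Sigma> \<Gamma> \<phi>) (map Var ks))"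
proof -
  let ?\<sigma> = "(!) (map Var ks)"
  have ty: "typed \<Sigma> \<Delta> ?\<sigma> \<Gamma>" by (rule typed_nth[OF var_tuple_wt[OF v]])
  have w1: "wff (rel_sig \<Sigma>) \<Gamma> (tr \<Sigma> \<Gamma> \<phi>)" by (rule wff_tr[OF wf assms(2,3)])
  show ?thesis
  proof (rule equivalent_complete[where S = "sub_tasks \<Sigma> \<Gamma> \<Delta> ?\<sigma>"])
    show "wff (rel_sig \<Sigma>) \<Delta> (tr \<Sigma> \<Delta> (inst \<phi> (map Var ks)))" by (rule wff_tr[OF wf assms(1) wff_ren[OF assms(3) v]])
    show "wff (rel_sig \<Sigma>) \<Delta> (inst (tr \<Sigma> \<Gamma> \<phi>) (map Var ks))" by (rule wff_ren[OF w1 v])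
    fix D H ys assume m: "geo_model (rel_sig \<Sigma>) U (sub_tasks \<Sigma> \<Gamma> \<Delta> ?\<sigma>) D H" and y: "tuple D \<Delta> ys"
    interpret m: rel_model \<Sigma> U "sub_tasks \<Sigma> \<Gamma> \<Delta> ?\<sigma>" D H by (rule rel_modelI[OF m])
    have "length ks = length \<Gamma>" using v by (auto simp: var_tuple_def dest: list_all2_lengthD)
    then have "m.sval ys ?\<sigma> \<Gamma> = map ((!) ys) ks" by (intro nth_equalityI) simp_all
    then show "H (tr \<Sigma> \<Delta> (inst \<phi> (map Var ks))) ys \<longleftrightarrow> H (inst (tr \<Sigma> \<Gamma> \<phi>) (map Var ks)) ys"
      using H_tr_fsubst[OF assms(2,3) ty m.rel_model_axioms y order_refl] m.H_ren[OF w1 v y] by (simp add: inst_def)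
  qed (use assms in simp_all)
qed

lemma tr_weaken:
  assumes "wf_ctx \<Sigma> (A # \<Gamma>)" "wff \<Sigma> \<Gamma> \<phi>"
  shows "equivalent (rel_sig \<Sigma>) U (A # \<Gamma>) (tr \<Sigma> (A # \<Gamma>) (weaken \<phi>)) (weaken (tr \<Sigma> \<Gamma> \<phi>))"
proof -
  let ?\<sigma> = "\<lambda>i. Var (Suc i)"
  have ty: "typed \<Sigma> (A # \<Gamma>) ?\<sigma> \<Gamma>" by (rule typed_Suc)
  have wc: "wf_ctx \<Sigma> \<Gamma>" using assms by simp
  have w1: "wff (rel_sig \<Sigma>) \<Gamma> (tr \<Sigma> \<Gamma> \<phi>)" by (rule wff_tr[OF wf wc assms(2)])
  show ?thesis
  proof (rule equivalent_complete[where S = "sub_tasks \<Sigma> \<Gamma> (A # \<Gamma>) ?\<sigma>"])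
    show "wff (rel_sig \<Sigma>) (A # \<Gamma>) (tr \<Sigma> (A # \<Gamma>) (weaken \<phi>))" by (rule wff_tr[OF wf assms(1) wff_weaken[OF assms(2)]])
    show "wff (rel_sig \<Sigma>) (A # \<Gamma>) (weaken (tr \<Sigma> \<Gamma> \<phi>))" by (rule wff_weaken[OF w1])
    fix D H zs assume m: "geo_model (rel_sig \<Sigma>) U (sub_tasks \<Sigma> \<Gamma> (A # \<Gamma>) ?\<sigma>) D H" and z: "tuple D (A # \<Gamma>) zs"
    interpret m: rel_model \<Sigma> U "sub_tasks \<Sigma> \<Gamma> (A # \<Gamma>) ?\<sigma>" D H by (rule rel_modelI[OF m])
    obtain a xs where zs: "zs = a # xs" "a \<in> D A" "tuple D \<Gamma> xs" using z by (rule tuple_ConsE)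
    have "m.sval zs ?\<sigma> \<Gamma> = xs" using tuple_length[OF zs(3)] zs(1) by (intro nth_equalityI) simp_all
    then show "H (tr \<Sigma> (A # \<Gamma>) (weaken \<phi>)) zs \<longleftrightarrow> H (weaken (tr \<Sigma> \<Gamma> \<phi>)) zs"
      using H_tr_fsubst[OF wc assms(2) ty m.rel_model_axioms z order_refl] m.H_weaken[OF w1 zs(3,2)]
      by (simp add: weaken_def zs(1))
  qed (use assms in simp_all)
qed

lemma tr_conjs: "tr \<Sigma> \<Gamma> (conjs \<phi>s) = conjs (map (tr \<Sigma> \<Gamma>) \<phi>s)"
  by (induction \<phi>s) (simp_all add: conjs_def)

lemma tr_eqs:
  assumes wc: "wf_ctx \<Sigma> \<Gamma>" and v: "var_tuple \<Gamma> ks \<Delta>" "var_tuple \<Gamma> ls \<Delta>"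
  shows "equivalent (rel_sig \<Sigma>) U \<Gamma> (tr \<Sigma> \<Gamma> (eqs (map Var ks) (map Var ls))) (eqs (map Var ks) (map Var ls))"
proof -
  let ?n = "length \<Delta>"
  let ?e = "\<lambda>i. Eq (Var (ks ! i)) (Var (ls ! i))"
  have l: "length ks = ?n" "length ls = ?n"
    and n: "\<And>i. i < ?n \<Longrightarrow> ks ! i < length \<Gamma> \<and> ls ! i < length \<Gamma> \<and> \<Gamma> ! (ks ! i) = \<Gamma> ! (ls ! i)"
    using v by (auto simp: var_tuple_def list_all2_conv_all_nth)
  have e: "map2 Eq (map Var ks) (map Var ls) = map ?e [0..<?n]"
    by (rule nth_equalityI) (use l in simp_all)
  let ?S = "\<Union>i\<in>{..<?n}. eq_tasks \<Sigma> \<Gamma> (Var (ks ! i)) (Var (ls ! i))"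
  have w: "wff \<Sigma> \<Gamma> (?e i)" if "i < ?n" for i using n[OF that] by simp
  show ?thesis
  proof (rule equivalent_complete[where S = ?S])
    show w1: "wff (rel_sig \<Sigma>) \<Gamma> (tr \<Sigma> \<Gamma> (eqs (map Var ks) (map Var ls)))"
      by (rule wff_tr[OF wf wc wff_eqs_ren[OF v]])
    show "wff (rel_sig \<Sigma>) \<Gamma> (eqs (map Var ks) (map Var ls))" by (rule wff_eqs_ren[OF v])
    fix D H xs assume m: "geo_model (rel_sig \<Sigma>) U ?S D H" and x: "tuple D \<Gamma> xs"
    interpret m: rel_model \<Sigma> U ?S D H by (rule rel_modelI[OF m])
    have "H (tr \<Sigma> \<Gamma> (eqs (map Var ks) (map Var ls))) xs \<longleftrightarrow> (\<forall>i < ?n. H (tr \<Sigma> \<Gamma> (?e i)) xs)"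
      unfolding eqs_def tr_conjs e
      by (subst m.H_conjs[OF _ x]) (use wff_tr[OF wf wc w] in \<open>auto simp del: tr.simps\<close>)
    also have "\<dots> \<longleftrightarrow> (\<forall>i < ?n. xs ! (ks ! i) = xs ! (ls ! i))"
    proof -
      have "H (tr \<Sigma> \<Gamma> (?e i)) xs \<longleftrightarrow> xs ! (ks ! i) = xs ! (ls ! i)" if "i < ?n" for i
      proof -
        have "atom_tasks \<Sigma> \<Gamma> [Var (ks ! i), Var (ls ! i)] (\<lambda>zs. Eq (zs ! 0) (zs ! 1)) \<subseteq> ?S"
          using that by (auto simp: eq_tasks_def)
        from m.H_tr_Eq[OF w[OF that] x this] show ?thesis by (simp only: tval.simps)
      qed
      then show ?thesis by blast
    qed
    also have "\<dots> \<longleftrightarrow> map ((!) xs) ks = map ((!) xs) ls" using l by (subst list_eq_iff_nth_eq) simp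
    also have "\<dots> \<longleftrightarrow> H (eqs (map Var ks) (map Var ls)) xs" using m.H_eqs[OF v x] by blast
    finally show "H (tr \<Sigma> \<Gamma> (eqs (map Var ks) (map Var ls))) xs \<longleftrightarrow> H (eqs (map Var ks) (map Var ls)) xs" .
  qed (use wc in simp_all)
qed

end

section \<open>The translation preserves provability\<close>

text \<open>The target theory \<open>U\<close> is kept general: besides \<open>rel_theory \<Sigma> T\<close>, a cartesian axiomatization of the
  latter is used as a target.\<close>
locale tr_sound = rel_geo \<Sigma> U + A: geo \<Sigma> T
  for \<Sigma> :: "('s, 'f, 'r) signature" and T :: "('s, 'f, 'r, 'i) sequent set" and U :: "('s, 'f, 'r + 'f, 'i) sequent set" +
  assumes tr_axiom: "(\<Gamma>, \<phi>, \<psi>) \<in> T \<Longrightarrow> prv \<Gamma> (tr \<Sigma> \<Gamma> \<phi>) (tr \<Sigma> \<Gamma> \<psi>)"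
begin

lemma tr_EqSubst:
  assumes wc: "wf_ctx \<Sigma> \<Gamma>" and ij: "i < length \<Gamma>" "j < length \<Gamma>" "\<Gamma> ! i = \<Gamma> ! j" and w: "wff \<Sigma> \<Gamma> \<phi>"
  shows "prv \<Gamma> (And (tr \<Sigma> \<Gamma> (Eq (Var i) (Var j))) (tr \<Sigma> \<Gamma> \<phi>)) (tr \<Sigma> \<Gamma> (fsubst (Var(i := Var j)) \<phi>))"
proof -
  let ?\<sigma> = "Var(i := Var j)"
  let ?S = "sub_tasks \<Sigma> \<Gamma> \<Gamma> ?\<sigma> \<union> eq_tasks \<Sigma> \<Gamma> (Var i) (Var j)"
  have ty: "typed \<Sigma> \<Gamma> ?\<sigma> \<Gamma>" using ij by (auto simp: typed_def)
  have we: "wff \<Sigma> \<Gamma> (Eq (Var i) (Var j))" using ij by simp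
  show ?thesis
  proof (rule complete[where S = ?S])
    show w2: "wff (rel_sig \<Sigma>) \<Gamma> (And (tr \<Sigma> \<Gamma> (Eq (Var i) (Var j))) (tr \<Sigma> \<Gamma> \<phi>))"
      unfolding wff.simps using wff_tr[OF wf wc we] wff_tr[OF wf wc w] by blast
    show "wff (rel_sig \<Sigma>) \<Gamma> (tr \<Sigma> \<Gamma> (fsubst ?\<sigma> \<phi>))" by (rule wff_tr[OF wf wc wff_fsubst[OF w ty]])
    fix D H xs assume m: "geo_model (rel_sig \<Sigma>) U ?S D H" and x: "tuple D \<Gamma> xs"
      and h: "H (And (tr \<Sigma> \<Gamma> (Eq (Var i) (Var j))) (tr \<Sigma> \<Gamma> \<phi>)) xs"
    interpret m: rel_model \<Sigma> U ?S D H by (rule rel_modelI[OF m])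
    have h: "H (tr \<Sigma> \<Gamma> (Eq (Var i) (Var j))) xs" "H (tr \<Sigma> \<Gamma> \<phi>) xs"
      using h m.H_And[OF wff_tr[OF wf wc we] wff_tr[OF wf wc w] x] by blast+
    have "atom_tasks \<Sigma> \<Gamma> [Var i, Var j] (\<lambda>zs. Eq (zs ! 0) (zs ! 1)) \<subseteq> ?S" by (simp add: eq_tasks_def)
    from m.H_tr_Eq[OF we x this] h(1) have "xs ! i = xs ! j" by simp
    then have "m.sval xs ?\<sigma> \<Gamma> = xs" using tuple_length[OF x] by (intro nth_equalityI) auto
    then show "H (tr \<Sigma> \<Gamma> (fsubst ?\<sigma> \<phi>)) xs"
      using H_tr_fsubst[OF wc w ty m.rel_model_axioms x] h(2) by simp
  qed (use wc in simp_all)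
qed

lemma tr_EqRefl:
  assumes wc: "wf_ctx \<Sigma> \<Gamma>" and i: "i < length \<Gamma>"
  shows "prv \<Gamma> Top (tr \<Sigma> \<Gamma> (Eq (Var i) (Var i)))"
proof (rule complete[where S = "eq_tasks \<Sigma> \<Gamma> (Var i) (Var i)"])
  have we: "wff \<Sigma> \<Gamma> (Eq (Var i) (Var i))" using i by simp
  show "wff (rel_sig \<Sigma>) \<Gamma> (tr \<Sigma> \<Gamma> (Eq (Var i) (Var i)))" by (rule wff_tr[OF wf wc we])
  fix D H xs assume m: "geo_model (rel_sig \<Sigma>) U (eq_tasks \<Sigma> \<Gamma> (Var i) (Var i)) D H" and x: "tuple D \<Gamma> xs"
  interpret m: rel_model \<Sigma> U "eq_tasks \<Sigma> \<Gamma> (Var i) (Var i)" D H by (rule rel_modelI[OF m])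
  show "H (tr \<Sigma> \<Gamma> (Eq (Var i) (Var i))) xs"
    using m.H_tr_Eq[OF we x] by (simp only: eq_tasks_def order_refl)
qed (use wc in simp_all)

text \<open>Translation preserves all connectives literally, so most rules translate to themselves. The rules
  that substitute or weaken use that translation commutes with substitution, and the equality rules use
  the meaning of translated equations.\<close>
theorem tr_prv: "A.prv \<Gamma> \<phi> \<psi> \<Longrightarrow> prv \<Gamma> (tr \<Sigma> \<Gamma> \<phi>) (tr \<Sigma> \<Gamma> \<psi>)"
proof (induction rule: provable.induct)
  case (Axiom \<Gamma> \<phi> \<psi>)
  then show ?case by (rule tr_axiom)
next
  case (Identity \<Gamma> \<phi>)
  then show ?case by (intro provable.Identity) (auto intro: wff_tr[OF wf])
next
  case (Substitution \<Gamma> \<phi> \<psi> \<Delta> ts)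
  note w = A.prvD[OF Substitution.hyps(1)]
  let ?S = "sub_tasks \<Sigma> \<Gamma> \<Delta> ((!) ts)"
  have ty: "typed \<Sigma> \<Delta> ((!) ts) \<Gamma>" by (rule typed_nth[OF Substitution.hyps(3)])
  show ?case
  proof (rule complete[where S = ?S])
    show "wff (rel_sig \<Sigma>) \<Delta> (tr \<Sigma> \<Delta> (inst \<phi> ts))" "wff (rel_sig \<Sigma>) \<Delta> (tr \<Sigma> \<Delta> (inst \<psi> ts))"
      using w Substitution.hyps by (auto intro!: wff_tr[OF wf] wff_inst)
    fix D H ys assume m: "geo_model (rel_sig \<Sigma>) U ?S D H" and y: "tuple D \<Delta> ys" and h: "H (tr \<Sigma> \<Delta> (inst \<phi> ts)) ys"
    interpret m: rel_model \<Sigma> U ?S D H by (rule rel_modelI[OF m])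
    have "H (tr \<Sigma> \<Gamma> \<phi>) (m.sval ys ((!) ts) \<Gamma>)"
      using h H_tr_fsubst[OF _ _ ty m.rel_model_axioms y order_refl, of \<phi>] w by (simp add: inst_def)
    then have "H (tr \<Sigma> \<Gamma> \<psi>) (m.sval ys ((!) ts) \<Gamma>)"
      using m.H_prv[OF Substitution.IH m.sval_tuple[OF ty y order_refl]] by blast
    then show "H (tr \<Sigma> \<Delta> (inst \<psi> ts)) ys"
      using H_tr_fsubst[OF _ _ ty m.rel_model_axioms y order_refl, of \<psi>] w by (simp add: inst_def)
  qed (use Substitution.hyps in simp_all)
next
  case (Cut \<Gamma> \<phi> \<psi> \<chi>)
  then show ?case by (blast intro: provable.Cut)
next
  case (EqRefl \<Gamma> i)
  then show ?case unfolding tr.simps(3) by (rule tr_EqRefl)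
next
  case (EqSubst \<Gamma> i j \<phi>)
  then show ?case unfolding tr.simps(4) by (rule tr_EqSubst)
next
  case (TopI \<Gamma> \<phi>)
  then show ?case by (auto intro: provable.TopI wff_tr[OF wf])
next
  case (AndE1 \<Gamma> \<phi> \<psi>)
  then show ?case by (auto intro: provable.AndE1 wff_tr[OF wf])
next
  case (AndE2 \<Gamma> \<phi> \<psi>)
  then show ?case by (auto intro: provable.AndE2 wff_tr[OF wf])
next
  case (AndI \<Gamma> \<phi> \<psi> \<chi>)
  then show ?case by (auto intro: provable.AndI)
next
  case (BotE \<Gamma> \<phi>)
  then show ?case by (auto intro: provable.BotE wff_tr[OF wf])
next
  case (OrI1 \<Gamma> \<phi> \<psi>)
  then show ?case by (auto intro: provable.OrI1 wff_tr[OF wf])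
next
  case (OrI2 \<Gamma> \<phi> \<psi>)
  then show ?case by (auto intro: provable.OrI2 wff_tr[OF wf])
next
  case (OrE \<Gamma> \<phi> \<chi> \<psi>)
  then show ?case by (auto intro: provable.OrE)
next
  case (DisjI \<Gamma> I F i)
  then have "wff (rel_sig \<Sigma>) \<Gamma> (Disj I (\<lambda>i. tr \<Sigma> \<Gamma> (F i)))" by (auto intro: wff_tr[OF wf])
  with DisjI show ?case unfolding tr.simps by (intro provable.DisjI[where F = "\<lambda>i. tr \<Sigma> \<Gamma> (F i)"]) simp_all
next
  case (DisjE \<Gamma> \<chi> I F)
  then show ?case unfolding tr.simps by (intro provable.DisjE) (auto intro: wff_tr[OF wf])
next
  case (ExE \<Gamma> \<psi> A \<phi>)
  have wc: "wf_ctx \<Sigma> (A # \<Gamma>)" using A.prvD[OF ExE.hyps(2)] by blast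
  have "prv (A # \<Gamma>) (tr \<Sigma> (A # \<Gamma>) \<phi>) (weaken (tr \<Sigma> \<Gamma> \<psi>))"
    using ExE.IH tr_weaken[OF wc ExE.hyps(1)] unfolding equivalent_def by (blast intro: provable.Cut)
  then show ?case unfolding tr.simps using wc ExE.hyps(1) by (intro provable.ExE) (auto intro: wff_tr[OF wf])
next
  case (ExI \<Gamma> A \<phi> \<psi>)
  have wc: "wf_ctx \<Sigma> (A # \<Gamma>)" "wff \<Sigma> \<Gamma> \<psi>" using A.prvD[OF ExI.hyps] by auto
  have "prv (A # \<Gamma>) (tr \<Sigma> (A # \<Gamma>) \<phi>) (weaken (tr \<Sigma> \<Gamma> \<psi>))"
    by (rule provable.ExI) (use ExI.IH in simp)
  then show ?case using tr_weaken[OF wc] unfolding equivalent_def by (blast intro: provable.Cut)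
next
  case (DistribOr \<Gamma> \<phi> \<psi> \<chi>)
  then show ?case by (auto intro!: provable.DistribOr wff_tr[OF wf])
next
  case (DistribDisj \<Gamma> \<phi> I F)
  then show ?case unfolding tr.simps by (intro provable.DistribDisj) (auto intro: wff_tr[OF wf])
next
  case (Frobenius \<Gamma> \<phi> A \<psi>)
  then have wc: "wf_ctx \<Sigma> (A # \<Gamma>)" by simp
  have w: "wff (rel_sig \<Sigma>) \<Gamma> (tr \<Sigma> \<Gamma> \<phi>)" "wff (rel_sig \<Sigma>) (A # \<Gamma>) (tr \<Sigma> (A # \<Gamma>) \<psi>)"
    using Frobenius wc by (auto intro!: wff_tr[OF wf] simp del: wf_ctx_simps)
  have "prv \<Gamma> (And (tr \<Sigma> \<Gamma> \<phi>) (Ex A (tr \<Sigma> (A # \<Gamma>) \<psi>))) (Ex A (And (weaken (tr \<Sigma> \<Gamma> \<phi>)) (tr \<Sigma> (A # \<Gamma>) \<psi>)))"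
    by (rule provable.Frobenius) (use wc w in simp_all)
  moreover have "prv \<Gamma> (Ex A (And (weaken (tr \<Sigma> \<Gamma> \<phi>)) (tr \<Sigma> (A # \<Gamma>) \<psi>)))
      (Ex A (And (tr \<Sigma> (A # \<Gamma>) (weaken \<phi>)) (tr \<Sigma> (A # \<Gamma>) \<psi>)))"
    using tr_weaken[OF wc Frobenius(2)] wc w(2) unfolding equivalent_def
    by (intro prv_Ex_mono prv_And_mono provable.Identity) simp_all
  ultimately show ?case unfolding tr.simps by (rule provable.Cut)
qed

sublocale tr: interp \<Sigma> T "rel_sig \<Sigma>" U "tr \<Sigma>"
proof unfold_locales
  show "equivalent (rel_sig \<Sigma>) U \<Gamma> (tr \<Sigma> \<Gamma> (eqs (map Var ks) (map Var ls))) (eqs (map Var ks) (map Var ls))"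
    if "wf_ctx \<Sigma> \<Gamma>" "var_tuple \<Gamma> ks \<Delta>" "var_tuple \<Gamma> ls \<Delta>" for \<Gamma> ks \<Delta> ls
    by (rule tr_eqs[OF that])
  show "equivalent (rel_sig \<Sigma>) U \<Delta> (tr \<Sigma> \<Delta> (inst \<phi> (map Var ks))) (inst (tr \<Sigma> \<Gamma> \<phi>) (map Var ks))"
    if "wf_ctx \<Sigma> \<Delta>" "wf_ctx \<Sigma> \<Gamma>" "wff \<Sigma> \<Gamma> \<phi>" "var_tuple \<Delta> ks \<Gamma>" for \<Delta> \<Gamma> \<phi> ks
    by (rule tr_ren[OF that])
qed (use wff_tr[OF wf] tr_prv in simp_all)

end

section \<open>The translation back to the original signature\<close>

text \<open>The inverse translation reads \<open>R\<^sub>f\<close> as the graph of \<open>f\<close>. It commutes strictly with substitution,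
  also for ill-formed arguments of \<open>R\<^sub>f\<close>, which may occur outside the index set of a disjunction; for this
  reason the empty list of arguments is sent to \<open>Bot\<close>, as \<open>last []\<close> is unspecified.\<close>
fun untr_rel :: "'r + 'f \<Rightarrow> 'f trm list \<Rightarrow> ('s, 'f, 'r, 'i) fm" where
  "untr_rel (Inl q) ts = Rel q ts"
| "untr_rel (Inr f) ts = (if ts = [] then Bot else Eq (Fn f (butlast ts)) (last ts))"

primrec untr :: "('s, 'f, 'r + 'f, 'i) fm \<Rightarrow> ('s, 'f, 'r, 'i) fm" where
  "untr (Eq s t) = Eq s t"
| "untr (Rel q ts) = untr_rel q ts"
| "untr Top = Top"
| "untr (And \<phi> \<psi>) = And (untr \<phi>) (untr \<psi>)"
| "untr Bot = Bot"
| "untr (Or \<phi> \<psi>) = Or (untr \<phi>) (untr \<psi>)"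
| "untr (Disj I F) = Disj I (\<lambda>i. untr (F i))"
| "untr (Ex A \<phi>) = Ex A (untr \<phi>)"

lemma untr_fsubst [simp]: "untr (fsubst \<sigma> \<phi>) = fsubst \<sigma> (untr \<phi>)"
proof (induction \<phi> arbitrary: \<sigma>)
  case (Rel q ts)
  then show ?case by (cases q) (auto simp: map_butlast last_map)
qed auto

lemma untr_inst: "untr (inst \<phi> ts) = inst (untr \<phi>) ts"
  by (simp add: inst_def)

lemma untr_weaken: "untr (weaken \<phi>) = weaken (untr \<phi>)"
  by (simp add: weaken_def)

lemma untr_conjs: "untr (conjs \<phi>s) = conjs (map untr \<phi>s)"
  by (induction \<phi>s) (simp_all add: conjs_def)

lemma untr_eqs: "untr (eqs ts us) = eqs ts us"
  unfolding eqs_def untr_conjs by (rule arg_cong[of _ _ conjs]) (simp add: case_prod_beta)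

lemma untr_exs: "untr (exs As \<phi>) = exs As (untr \<phi>)"
proof (induction As arbitrary: \<phi>)
  case (Cons A As)
  then show ?case using Cons[of "Ex A \<phi>"] by (simp add: exs_def)
qed (simp add: exs_def)

lemma wt_rel_sig: "wt (rel_sig \<Sigma>) \<Gamma> t A \<longleftrightarrow> (\<exists>i. t = Var i \<and> i < length \<Gamma> \<and> \<Gamma> ! i = A)"
  by (cases t) (auto simp: wt_Fn_iff)

lemma wts_rel_sig:
  "list_all2 (wt (rel_sig \<Sigma>) \<Gamma>) ts As \<longleftrightarrow> (\<exists>ks. ts = map Var ks \<and> var_tuple \<Gamma> ks As)"
proof
  assume a: "list_all2 (wt (rel_sig \<Sigma>) \<Gamma>) ts As"
  define ks where "ks = map (\<lambda>t. case t of Var i \<Rightarrow> i | Fn f us \<Rightarrow> 0) ts"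
  have "ts = map Var ks \<and> var_tuple \<Gamma> ks As"
    using a unfolding ks_def var_tuple_def wt_rel_sig list_all2_conv_all_nth
    by (auto intro!: nth_equalityI simp: wt_rel_sig split: trm.split)
  then show "\<exists>ks. ts = map Var ks \<and> var_tuple \<Gamma> ks As" by blast
qed (auto intro: var_tuple_wt)

lemma wts_Fn_iff:
  "list_all2 (wt \<Sigma> \<Gamma>) ts (fdom \<Sigma> f @ [fcod \<Sigma> f]) \<longleftrightarrow>
     ts \<noteq> [] \<and> list_all2 (wt \<Sigma> \<Gamma>) (butlast ts) (fdom \<Sigma> f) \<and> wt \<Sigma> \<Gamma> (last ts) (fcod \<Sigma> f)"
proof (cases ts rule: rev_cases)
  case (snoc ys y)
  then show ?thesis
    using list_all2_rev[of "wt \<Sigma> \<Gamma>" "ys @ [y]" "fdom \<Sigma> f @ [fcod \<Sigma> f]"]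
      list_all2_rev[of "wt \<Sigma> \<Gamma>" ys "fdom \<Sigma> f"] by auto
qed simp

lemma wff_untr: "wff (rel_sig \<Sigma>) \<Gamma> \<phi> \<Longrightarrow> wff \<Sigma> \<Gamma> (untr \<phi>)"
proof (induction \<phi> arbitrary: \<Gamma>)
  case (Eq s t)
  then show ?case by (auto simp: wt_rel_sig)
next
  case (Rel q ts)
  then obtain ks where k: "ts = map Var ks" "var_tuple \<Gamma> ks (rdom (rel_sig \<Sigma>) q)" by (auto simp: wts_rel_sig)
  from var_tuple_wt[OF k(2), of \<Sigma>] show ?case
    using Rel by (cases q) (auto simp: k(1)[symmetric] wts_Fn_iff wt_Fn_iff)
qed auto

context geo
begin

lemma exs_intro:
  assumes "wff \<Sigma> \<Gamma> (exs As \<phi>)" "wf_ctx \<Sigma> \<Gamma>" "typed \<Sigma> \<Delta> \<sigma> \<Gamma>" "list_all2 (wt \<Sigma> \<Delta>) ts As"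
    and "prv \<Delta> \<chi> (fsubst (\<lambda>i. if i < length ts then ts ! i else \<sigma> (i - length ts)) \<phi>)"
  shows "prv \<Delta> \<chi> (fsubst \<sigma> (exs As \<phi>))"
  using assms
proof (induction As arbitrary: \<phi> ts)
  case (Cons A As)
  then obtain t us where ts: "ts = t # us" "wt \<Sigma> \<Delta> t A" "list_all2 (wt \<Sigma> \<Delta>) us As" by (auto simp: list_all2_Cons2)
  let ?\<tau> = "\<lambda>i. if i < length us then us ! i else \<sigma> (i - length us)"
  have w: "wff \<Sigma> (As @ \<Gamma>) (Ex A \<phi>)" "wf_ctx \<Sigma> (As @ \<Gamma>)" using Cons.prems(1,2) by (auto simp: wf_ctx_def)
  have ty: "typed \<Sigma> \<Delta> ?\<tau> (As @ \<Gamma>)"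
    using ts(3) Cons.prems(3) by (auto simp: typed_def list_all2_conv_all_nth nth_append)
  have "(\<lambda>i. if i < length ts then ts ! i else \<sigma> (i - length ts)) = case_nat t ?\<tau>"
    by (auto simp: ts(1) fun_eq_iff split: nat.split)
  then have "prv \<Delta> \<chi> (fsubst ?\<tau> (Ex A \<phi>))"
    using Cons.prems(5) by (intro ex_intro[OF w ty ts(2)]) simp
  moreover have "wff \<Sigma> \<Gamma> (exs As (Ex A \<phi>))" using w Cons.prems(1) by auto
  ultimately show ?case using Cons.IH[OF _ Cons.prems(2,3) ts(3)] by (simp add: exs_def)
qed (simp add: exs_def)

lemma exs_elim:
  assumes "wff \<Sigma> \<Gamma> \<psi>" "prv (As @ \<Gamma>) \<phi> (fsubst (\<lambda>i. Var (i + length As)) \<psi>)"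
  shows "prv \<Gamma> (exs As \<phi>) \<psi>"
  using assms(2)
proof (induction As arbitrary: \<phi>)
  case (Cons A As)
  have ty: "typed \<Sigma> (As @ \<Gamma>) (\<lambda>i. Var (i + length As)) \<Gamma>" by (auto simp: typed_def nth_append)
  have "weaken (fsubst (\<lambda>i. Var (i + length As)) \<psi>) = fsubst (\<lambda>i. Var (i + length (A # As))) \<psi>"
    by (simp add: weaken_def fsubst_fsubst)
  then have "prv (As @ \<Gamma>) (Ex A \<phi>) (fsubst (\<lambda>i. Var (i + length As)) \<psi>)"
    using Cons.prems by (intro provable.ExE wff_fsubst[OF assms(1) ty]) simp
  from Cons.IH[OF this] show ?case by (simp add: exs_def)
qed (simp add: exs_def)

lemma conjs_elim:
  assumes "wf_ctx \<Sigma> \<Gamma>" "\<And>\<phi>. \<phi> \<in> set \<phi>s \<Longrightarrow> wff \<Sigma> \<Gamma> \<phi>" "\<phi> \<in> set \<phi>s"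
  shows "prv \<Gamma> (conjs \<phi>s) \<phi>"
  using assms(2,3)
proof (induction \<phi>s)
  case (Cons \<psi> \<psi>s)
  have w: "wff \<Sigma> \<Gamma> \<psi>" "wff \<Sigma> \<Gamma> (conjs \<psi>s)" using Cons.prems by auto
  show ?case
  proof (cases "\<phi> = \<psi>")
    case True
    then show ?thesis using provable.AndE1[OF assms(1) w] by (simp add: conjs_def)
  next
    case False
    then show ?thesis using provable.AndE2[OF assms(1) w] Cons by (auto simp: conjs_def intro: provable.Cut)
  qed
qed simp

lemma conjs_intro:
  assumes "wf_ctx \<Sigma> \<Gamma>" "wff \<Sigma> \<Gamma> \<chi>" "\<And>\<phi>. \<phi> \<in> set \<phi>s \<Longrightarrow> prv \<Gamma> \<chi> \<phi>"
  shows "prv \<Gamma> \<chi> (conjs \<phi>s)"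
  using assms(3)
  by (induction \<phi>s) (auto simp: conjs_def intro: provable.TopI[OF assms(1,2)] provable.AndI)

lemma fsubst_conjs: "fsubst \<sigma> (conjs \<phi>s) = conjs (map (fsubst \<sigma>) \<phi>s)"
  by (induction \<phi>s) (simp_all add: conjs_def)

text \<open>From the terms themselves one obtains the quantified variables, as the graph conditions become
  \<open>g = g\<close>; conversely the graph conditions force, by induction on subterms, each variable to be equal to
  its term. The argument is carried out in the calculus, since models do not interpret terms of \<open>\<Sigma>\<close>.\<close>
lemma untr_tr_atom:
  assumes wc: "wf_ctx \<Sigma> \<Gamma>" and gs: "list_all2 (wt \<Sigma> \<Gamma>) gs As" and wa: "wff \<Sigma> As \<alpha>"
    and a: "\<And>zs. length zs = length As \<Longrightarrow> untr (atom zs) = inst \<alpha> zs"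
    and w: "\<And>\<Delta> ks. var_tuple \<Delta> ks As \<Longrightarrow> wff (rel_sig \<Sigma>) \<Delta> (atom (map Var ks))"
  shows "equivalent \<Sigma> T \<Gamma> (untr (tr_atom \<Sigma> \<Gamma> gs atom)) (inst \<alpha> gs)"
proof -
  let ?us = "uterms gs" let ?n = "length (uterms gs)" let ?Bs = "usorts \<Sigma> \<Gamma> gs"
  have lB: "length ?Bs = ?n" by (simp add: usorts_def)
  have lg: "length gs = length As" using gs by (rule list_all2_lengthD)
  let ?body = "And (conjs (map (\<lambda>g. untr (ugraph gs g)) ?us)) (inst \<alpha> (map Var (map (upos gs) gs)))"
  have body: "untr (ubody gs atom) = ?body"
    unfolding ubody_def untr.simps untr_conjs map_map comp_def by (subst a) (simp_all add: lg comp_def)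
  have wb: "wff \<Sigma> (?Bs @ \<Gamma>) ?body"
    unfolding body[symmetric] by (rule wff_untr, rule wff_tr_atom(1)[OF wf_sig wc gs], erule w)
  have wcB: "wf_ctx \<Sigma> (?Bs @ \<Gamma>)" using wc usorts_sorts[OF wf_sig wc gs] by (simp add: wf_ctx_def)
  have wex: "wff \<Sigma> \<Gamma> (exs ?Bs ?body)" using wb usorts_sorts[OF wf_sig wc gs] by simp
  have wag: "wff \<Sigma> \<Gamma> (inst \<alpha> gs)" by (rule wff_inst[OF wa gs])
  let ?\<chi> = "inst \<alpha> gs"
  have gself: "untr (ugraph gs g) = (case g of Var i \<Rightarrow> Eq (Var (upos gs g)) (Var (?n + i))
     | Fn f ts \<Rightarrow> Eq (Fn f (map Var (map (upos gs) ts))) (Var (upos gs g)))" for g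
    by (cases g) (simp_all add: ugraph_def)
  have "prv \<Gamma> ?\<chi> (exs ?Bs ?body)"
  proof -
    define \<tau> where "\<tau> = (\<lambda>i. if i < length ?us then ?us ! i else Var (i - length ?us))"
    have tp: "\<tau> (upos gs g) = g" if "g \<in> set ?us" for g using upos[OF that] by (simp add: \<tau>_def)
    have tyB: "list_all2 (wt \<Sigma> \<Gamma>) ?us ?Bs"
      using uterms_wt[OF gs] by (auto simp: usorts_def list_all2_conv_all_nth)
    have ty: "typed \<Sigma> \<Gamma> \<tau> (?Bs @ \<Gamma>)"
      using tyB lB by (auto simp: typed_def list_all2_conv_all_nth nth_append \<tau>_def)
    have e: "fsubst \<tau> (untr (ugraph gs g)) = (Eq g g :: ('s, 'f, 'r, 'i) fm)" if g: "g \<in> set ?us" for g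
    proof (cases g)
      case (Var i)
      then show ?thesis using upos[OF g] by (simp add: gself \<tau>_def)
    next
      case (Fn f ts)
      have m: "map (\<lambda>t. \<tau> (upos gs t)) ts = ts"
        by (rule map_idI, rule tp, rule uterms_closed[OF g[unfolded Fn]])
      show ?thesis
        unfolding gself Fn trm.case fsubst.simps tsubst.simps map_map comp_def m tp[OF g, unfolded Fn] ..
    qed
    have "prv \<Gamma> ?\<chi> (conjs (map (\<lambda>g. Eq g g) ?us))"
      by (rule conjs_intro[OF wc wag]) (use uterms_wt[OF gs] eq_refl[OF wc _ wag] in auto)
    moreover have "map (fsubst \<tau>) (map (\<lambda>g. untr (ugraph gs g)) ?us) = map (\<lambda>g. Eq g g :: ('s, 'f, 'r, 'i) fm) ?us"
      using e by simp
    ultimately have 1: "prv \<Gamma> ?\<chi> (fsubst \<tau> (conjs (map (\<lambda>g. untr (ugraph gs g)) ?us)))"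
      unfolding fsubst_conjs by (simp only:)
    have "prv \<Gamma> (inst \<alpha> gs) (fsubst \<tau> (inst \<alpha> (map Var (map (upos gs) gs))))"
      unfolding inst_def fsubst_fsubst
    proof (rule fsubst_agree[OF wa wc typed_nth[OF gs]])
      fix i assume i: "i < length As"
      then have "\<tau> (upos gs (gs ! i)) = gs ! i" using tp[OF uterms_self] lg by simp
      then show "gs ! i = tsubst \<tau> (map Var (map (upos gs) gs) ! i)" using i lg by simp
    qed
    with 1 have "prv \<Gamma> ?\<chi> (fsubst \<tau> ?body)" unfolding fsubst.simps by (intro provable.AndI)
    then have "prv \<Gamma> ?\<chi> (fsubst Var (exs ?Bs ?body))"
      by (intro exs_intro[OF wex wc _ tyB]) (simp_all add: typed_def \<tau>_def)
    then show ?thesis by simp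
  qed
  moreover have "prv \<Gamma> (exs ?Bs ?body) ?\<chi>"
  proof (rule exs_elim[OF wag])
    let ?sh = "tsubst (\<lambda>i. Var (i + length ?Bs)) :: 'f trm \<Rightarrow> 'f trm"
    have tsh: "typed \<Sigma> (?Bs @ \<Gamma>) (\<lambda>i. Var (i + length ?Bs)) \<Gamma>" by (auto simp: typed_def nth_append)
    have I: "prv (?Bs @ \<Gamma>) ?body ?body" by (rule provable.Identity[OF wcB wb])
    have wgr: "wff \<Sigma> (?Bs @ \<Gamma>) (untr (ugraph gs g))" if "g \<in> set ?us" for g
      by (rule wff_untr[OF ugraph_wff[OF gs that]])
    have c: "prv (?Bs @ \<Gamma>) ?body (untr (ugraph gs g))" if g: "g \<in> set ?us" for g
    proof -
      have "prv (?Bs @ \<Gamma>) (conjs (map (\<lambda>g. untr (ugraph gs g)) ?us)) (untr (ugraph gs g))"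
        by (rule conjs_elim[OF wcB]) (use g wgr in auto)
      moreover have "prv (?Bs @ \<Gamma>) ?body (conjs (map (\<lambda>g. untr (ugraph gs g)) ?us))"
        by (rule provable.AndE1[OF wcB]) (use wb in \<open>simp_all only: wff.simps\<close>)
      ultimately show ?thesis by (blast intro: provable.Cut)
    qed
    have eq: "g \<in> set ?us \<Longrightarrow> prv (?Bs @ \<Gamma>) ?body (Eq (Var (upos gs g)) (?sh g))" for g
    proof (induction g)
      case (Var i)
      then show ?case using c[OF Var] lB by (simp add: gself add.commute)
    next
      case (Fn f ts)
      let ?As = "fdom \<Sigma> f @ [fcod \<Sigma> f]" let ?m = "length ts"
      have wg: "list_all2 (wt \<Sigma> \<Gamma>) ts (fdom \<Sigma> f)" "f \<in> funs \<Sigma>" using uterms_wt[OF gs Fn.prems] by (auto simp: wt_Fn_iff)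
      have m: "?m = length (fdom \<Sigma> f)" using wg(1) by (rule list_all2_lengthD)
      have sub: "t \<in> set ?us" if "t \<in> set ts" for t using uterms_closed[OF Fn.prems that] .
      let ?\<phi> = "Eq (Fn f (map Var [0..<?m])) (Var ?m) :: ('s, 'f, 'r, 'i) fm"
      let ?g = "Fn f ts"
      define ps :: "'f trm list" where "ps = map Var (map (upos gs) (ts @ [?g]))"
      define qs where "qs = map ?sh ts @ [Var (upos gs ?g)]"
      have w\<phi>: "wff \<Sigma> ?As ?\<phi>" using wg m by (auto simp: wt_Fn_iff list_all2_conv_all_nth nth_append)
      have "list_all2 (wt \<Sigma> \<Gamma>) (ts @ [?g]) ?As"
        using wg by (auto simp: wt_Fn_iff intro!: list_all2_appendI)
      from upos_var_tuple[OF _ this] have vt: "var_tuple (?Bs @ \<Gamma>) (map (upos gs) (ts @ [?g])) ?As"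
        using sub Fn.prems by auto
      have lp: "list_all2 (wt \<Sigma> (?Bs @ \<Gamma>)) ps ?As" unfolding ps_def by (rule var_tuple_wt[OF vt])
      then have "list_all2 (wt \<Sigma> (?Bs @ \<Gamma>)) (map Var (map (upos gs) ts) @ [Var (upos gs ?g)]) ?As"
        by (simp add: ps_def)
      then have wl: "wt \<Sigma> (?Bs @ \<Gamma>) (Var (upos gs ?g)) (fcod \<Sigma> f)" by (simp only: wts_Fn_iff last_snoc)
      have lq: "list_all2 (wt \<Sigma> (?Bs @ \<Gamma>)) qs ?As"
        unfolding wts_Fn_iff using wts_tsubst[OF wg(1) tsh] wl by (simp add: qs_def del: wt_Var_iff)
      have sub_nth: "map (tsubst ((!) (us @ [u]))) (map Var [0..<length us]) = us" for us :: "'f trm list" and u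
        by (rule nth_equalityI) (simp_all add: nth_append)
      have "fsubst ((!) ps) ?\<phi> = untr (ugraph gs ?g)"
        unfolding gself ps_def using sub_nth[of "map Var (map (upos gs) ts)" "Var (upos gs ?g)"] by (simp add: nth_append)
      then have p: "prv (?Bs @ \<Gamma>) ?body (fsubst ((!) ps) ?\<phi>)" using c[OF Fn.prems] by simp
      have "prv (?Bs @ \<Gamma>) ?body (fsubst ((!) qs) ?\<phi>)"
      proof (rule eq_replace[OF w\<phi> typed_nth[OF lp] typed_nth[OF lq] _ p])
        fix i assume i: "i < length ?As"
        show "prv (?Bs @ \<Gamma>) ?body (Eq (ps ! i) (qs ! i))"
        proof (cases "i < ?m")
          case True
          then show ?thesis using Fn.IH[of "ts ! i"] sub[of "ts ! i"] by (simp add: ps_def qs_def nth_append)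
        next
          case False
          then have "i = ?m" using i m by simp
          then have "ps ! i = Var (upos gs ?g)" "qs ! i = Var (upos gs ?g)" by (simp_all add: ps_def qs_def nth_append)
          then show ?thesis using eq_refl[OF wcB wl wb] by simp
        qed
      qed
      moreover have "fsubst ((!) qs) ?\<phi> = Eq (Fn f (map ?sh ts)) (Var (upos gs ?g))"
        unfolding qs_def using sub_nth[of "map ?sh ts" "Var (upos gs ?g)"] by (simp add: nth_append)
      ultimately have "prv (?Bs @ \<Gamma>) ?body (Eq (Fn f (map ?sh ts)) (Var (upos gs ?g)))" by simp
      then show ?case unfolding tsubst.simps by (rule eq_sym)
    qed
    have sub: "set gs \<subseteq> set ?us" using uterms_self by auto
    have p: "prv (?Bs @ \<Gamma>) ?body (fsubst ((!) (map Var (map (upos gs) gs))) \<alpha>)"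
      unfolding inst_def[symmetric]
      by (rule provable.AndE2[OF wcB]) (use wb in \<open>simp_all only: wff.simps\<close>)
    show "prv (?Bs @ \<Gamma>) ?body (fsubst (\<lambda>i. Var (i + length ?Bs)) (inst \<alpha> gs))"
      unfolding inst_def[of \<alpha> gs] fsubst_fsubst
    proof (rule eq_replace[OF wa _ _ _ p])
      show "typed \<Sigma> (?Bs @ \<Gamma>) ((!) (map Var (map (upos gs) gs))) As"
        by (rule typed_nth[OF var_tuple_wt[OF upos_var_tuple[OF sub gs]]])
      show "typed \<Sigma> (?Bs @ \<Gamma>) (\<lambda>i. ?sh (gs ! i)) As"
        using wt_tsubst[OF _ tsh] gs by (auto simp: typed_def list_all2_conv_all_nth)
      fix i assume "i < length As"
      then show "prv (?Bs @ \<Gamma>) ?body (Eq (map Var (map (upos gs) gs) ! i) (?sh (gs ! i)))"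
        using eq[OF uterms_self[OF nth_mem[of i gs]]] lg by simp
    qed
  qed
  ultimately show ?thesis unfolding equivalent_def tr_atom_eq untr_exs body by blast
qed

theorem untr_tr: "wf_ctx \<Sigma> \<Gamma> \<Longrightarrow> wff \<Sigma> \<Gamma> \<phi> \<Longrightarrow> equivalent \<Sigma> T \<Gamma> (untr (tr \<Sigma> \<Gamma> \<phi>)) \<phi>"
proof (induction \<phi> arbitrary: \<Gamma>)
  case (Eq s t)
  then obtain A where A: "list_all2 (wt \<Sigma> \<Gamma>) [s, t] [A, A]" by auto
  have "equivalent \<Sigma> T \<Gamma> (untr (tr \<Sigma> \<Gamma> (Eq s t))) (inst (Eq (Var 0) (Var 1)) [s, t])"
    unfolding tr.simps
    by (rule untr_tr_atom[OF Eq.prems(1) A]) (auto simp: inst_def intro!: wff_Eq_ren[simplified])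
  then show ?case by (simp add: inst_def)
next
  case (Rel q ts)
  then have R: "q \<in> rels \<Sigma>" "list_all2 (wt \<Sigma> \<Gamma>) ts (rdom \<Sigma> q)" by auto
  let ?\<alpha> = "Rel q (map Var [0..<length (rdom \<Sigma> q)]) :: ('s, 'f, 'r, 'i) fm"
  have i: "inst ?\<alpha> zs = Rel q zs" if "length zs = length (rdom \<Sigma> q)" for zs
    unfolding inst_def fsubst.simps fm.inject
    by (rule conjI[OF refl], rule nth_equalityI) (use that in simp_all)
  have "equivalent \<Sigma> T \<Gamma> (untr (tr \<Sigma> \<Gamma> (Rel q ts))) (inst ?\<alpha> ts)"
    unfolding tr.simps
  proof (rule untr_tr_atom[OF Rel.prems(1) R(2)])
    show "wff \<Sigma> (rdom \<Sigma> q) ?\<alpha>" using R by (auto simp: list_all2_conv_all_nth)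
    show "wff (rel_sig \<Sigma>) \<Delta> (Rel (Inl q) (map Var ks))" if "var_tuple \<Delta> ks (rdom \<Sigma> q)" for \<Delta> ks
      by (rule wff_Rel_ren) (use R that in simp_all)
  qed (simp add: i)
  then show ?case using i R(2) by (simp add: list_all2_lengthD)
next
  case (Disj I F)
  then show ?case by (auto simp: equivalent_def intro!: prv_Disj_mono)
next
  case (Ex A \<phi>)
  then show ?case by (auto simp: equivalent_def intro!: prv_Ex_mono)
qed (auto simp: equivalent_def intro: prv_And_mono prv_Or_mono provable.Identity)

end

section \<open>The two translations are mutually inverse\<close>

context rel_geo
begin

text \<open>Only the atoms \<open>R\<^sub>f(x, y)\<close> need an argument: they come back as the translation of \<open>f(x) = y\<close>,
  whose meaning in a model is that \<open>y\<close> is the value of \<open>f\<close> at \<open>x\<close>.\<close>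
theorem tr_untr: "wf_ctx \<Sigma> \<Gamma> \<Longrightarrow> wff (rel_sig \<Sigma>) \<Gamma> \<phi> \<Longrightarrow> equivalent (rel_sig \<Sigma>) U \<Gamma> (tr \<Sigma> \<Gamma> (untr \<phi>)) \<phi>"
proof (induction \<phi> arbitrary: \<Gamma>)
  case (Eq s t)
  then obtain i j where st: "s = Var i" "t = Var j" "i < length \<Gamma>" "j < length \<Gamma>" "\<Gamma> ! i = \<Gamma> ! j"
    by (auto simp: wt_rel_sig)
  have w: "wff \<Sigma> \<Gamma> (Eq s t :: ('s, 'f, 'r, 'i) fm)" using st by simp
  show ?case unfolding untr.simps
  proof (rule equivalent_complete[where S = "eq_tasks \<Sigma> \<Gamma> s t"])
    show "wff (rel_sig \<Sigma>) \<Gamma> (tr \<Sigma> \<Gamma> (Eq s t :: ('s, 'f, 'r, 'i) fm))" by (rule wff_tr[OF wf Eq.prems(1) w])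
    fix D H xs assume m: "geo_model (rel_sig \<Sigma>) U (eq_tasks \<Sigma> \<Gamma> s t) D H" and x: "tuple D \<Gamma> xs"
    interpret m: rel_model \<Sigma> U "eq_tasks \<Sigma> \<Gamma> s t" D H by (rule rel_modelI[OF m])
    show "H (tr \<Sigma> \<Gamma> (Eq s t)) xs \<longleftrightarrow> H (Eq s t) xs"
      using m.H_tr_Eq[OF w x] m.H_Eq[OF x st(3-5)] st(1,2) by (simp only: eq_tasks_def order_refl tval.simps)
  qed (use Eq.prems in simp_all)
next
  case (Rel q ts)
  then obtain ks where k: "ts = map Var ks" "var_tuple \<Gamma> ks (rdom (rel_sig \<Sigma>) q)" and q: "q \<in> rels (rel_sig \<Sigma>)"
    by (auto simp: wts_rel_sig)
  have w: "wff \<Sigma> \<Gamma> (untr (Rel q ts :: ('s, 'f, 'r + 'f, 'i) fm))" by (rule wff_untr[OF Rel.prems(2)])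
  show ?case
  proof (cases q)
    case (Inl p)
    let ?S = "atom_tasks \<Sigma> \<Gamma> ts (\<lambda>zs. Rel (Inl p) zs)"
    show ?thesis
    proof (rule equivalent_complete[where S = ?S])
      show "wff (rel_sig \<Sigma>) \<Gamma> (tr \<Sigma> \<Gamma> (untr (Rel q ts :: ('s, 'f, 'r + 'f, 'i) fm)))" by (rule wff_tr[OF wf Rel.prems(1) w])
      fix D H xs assume m: "geo_model (rel_sig \<Sigma>) U ?S D H" and x: "tuple D \<Gamma> xs"
      interpret m: rel_model \<Sigma> U ?S D H by (rule rel_modelI[OF m])
      have w': "wff \<Sigma> \<Gamma> (Rel p ts :: ('s, 'f, 'r, 'i) fm)" using w by (simp add: Inl)
      have "H (tr \<Sigma> \<Gamma> (Rel p ts)) xs \<longleftrightarrow> m.R (Inl p) (map (m.val xs) ts)"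
        by (rule m.H_tr_Rel[OF w' x order_refl])
      also have "map (m.val xs) ts = map ((!) xs) ks" by (simp add: k(1))
      also have "m.R (Inl p) (map ((!) xs) ks) \<longleftrightarrow> H (Rel q ts) xs"
        using m.H_Rel[OF q k(2) x] by (simp add: Inl k(1))
      finally show "H (tr \<Sigma> \<Gamma> (untr (Rel q ts))) xs \<longleftrightarrow> H (Rel q ts) xs" by (simp only: untr.simps untr_rel.simps Inl)
    qed (use Rel.prems in simp_all)
  next
    case (Inr f)
    let ?s = "Fn f (butlast ts)" let ?t = "last ts"
    let ?S = "eq_tasks \<Sigma> \<Gamma> ?s ?t"
    have v: "var_tuple \<Gamma> ks (fdom \<Sigma> f @ [fcod \<Sigma> f])" and f: "f \<in> funs \<Sigma>" using k(2) q Inr by simp_all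
    then have wts: "list_all2 (wt \<Sigma> \<Gamma>) ts (fdom \<Sigma> f @ [fcod \<Sigma> f])" using var_tuple_wt k(1) by blast
    then have ne: "ts \<noteq> []" and wb: "list_all2 (wt \<Sigma> \<Gamma>) (butlast ts) (fdom \<Sigma> f)" and wl: "wt \<Sigma> \<Gamma> (last ts) (fcod \<Sigma> f)"
      by (simp_all add: wts_Fn_iff)
    have u: "untr (Rel q ts :: ('s, 'f, 'r + 'f, 'i) fm) = Eq ?s ?t" using ne by (simp add: Inr)
    have we: "wff \<Sigma> \<Gamma> (Eq ?s ?t :: ('s, 'f, 'r, 'i) fm)" using w u by metis
    show ?thesis unfolding u
    proof (rule equivalent_complete[where S = ?S])
      show "wff (rel_sig \<Sigma>) \<Gamma> (tr \<Sigma> \<Gamma> (Eq ?s ?t :: ('s, 'f, 'r, 'i) fm))" by (rule wff_tr[OF wf Rel.prems(1) we])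
      fix D H xs assume m: "geo_model (rel_sig \<Sigma>) U ?S D H" and x: "tuple D \<Gamma> xs"
      interpret m: rel_model \<Sigma> U ?S D H by (rule rel_modelI[OF m])
      have tot: "total_task \<Sigma> f \<in> ?S" by (simp add: eq_tasks_def atom_tasks_def)
      have valk: "map (m.val xs) ts = map ((!) xs) ks" by (simp add: k(1))
      have sub: "total_task \<Sigma> ` (\<Union>t\<in>set ts'. set_trm t) \<subseteq> ?S" if "set ts' \<subseteq> set ts" for ts'
        using that by (auto simp: k(1))
      have bt: "tuple D (fdom \<Sigma> f) (map (m.val xs) (butlast ts))"
        by (rule m.vals_in[OF wb x sub]) (auto dest: in_set_butlastD)
      have lt: "m.val xs (last ts) \<in> D (fcod \<Sigma> f)"
        by (rule m.val_in[OF wl x]) (use sub[of "[last ts]"] ne in auto)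
      have "H (tr \<Sigma> \<Gamma> (Eq ?s ?t)) xs \<longleftrightarrow> m.app f (map (m.val xs) (butlast ts)) = m.val xs (last ts)"
        using m.H_tr_Eq[OF we x] by (simp only: eq_tasks_def order_refl tval.simps)
      also have "\<dots> \<longleftrightarrow> m.R (Inr f) (map (m.val xs) (butlast ts) @ [m.val xs (last ts)])"
        using m.app(2)[OF f bt tot lt] by auto
      also have "map (m.val xs) (butlast ts) @ [m.val xs (last ts)] = map ((!) xs) ks"
        using ne valk by (metis append_butlast_last_id list.simps(8) list.simps(9) map_append)
      also have "m.R (Inr f) (map ((!) xs) ks) \<longleftrightarrow> H (Rel q ts) xs"
        using m.H_Rel[OF q k(2) x] by (simp add: Inr k(1))
      finally show "H (tr \<Sigma> \<Gamma> (Eq ?s ?t)) xs \<longleftrightarrow> H (Rel q ts) xs" .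
    qed (use Rel.prems in simp_all)
  qed
next
  case (Disj I F)
  then show ?case by (auto simp: equivalent_def intro!: prv_Disj_mono)
next
  case (Ex A \<phi>)
  then show ?case by (auto simp: equivalent_def intro!: prv_Ex_mono)
qed (auto simp: equivalent_def intro: prv_And_mono prv_Or_mono provable.Identity)

end

locale tr_equiv = tr_sound \<Sigma> T U
  for \<Sigma> :: "('s, 'f, 'r) signature" and T :: "('s, 'f, 'r, 'i) sequent set" and U :: "('s, 'f, 'r + 'f, 'i) sequent set" +
  assumes untr_axiom: "(\<Gamma>, \<phi>, \<psi>) \<in> U \<Longrightarrow> A.prv \<Gamma> (untr \<phi>) (untr \<psi>)"
begin

theorem untr_prv: "prv \<Gamma> \<phi> \<psi> \<Longrightarrow> A.prv \<Gamma> (untr \<phi>) (untr \<psi>)"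
proof (induction rule: provable.induct)
  case (Axiom \<Gamma> \<phi> \<psi>)
  then show ?case by (rule untr_axiom)
next
  case (Identity \<Gamma> \<phi>)
  then show ?case by (auto intro: provable.Identity wff_untr)
next
  case (Substitution \<Gamma> \<phi> \<psi> \<Delta> ts)
  obtain ks where "ts = map Var ks" "var_tuple \<Delta> ks \<Gamma>" using Substitution.hyps by (auto simp: wts_rel_sig)
  then have "list_all2 (wt \<Sigma> \<Delta>) ts \<Gamma>" by (simp add: var_tuple_wt)
  then show ?case unfolding untr_inst using Substitution by (auto intro: provable.Substitution)
next
  case (Cut \<Gamma> \<phi> \<psi> \<chi>)
  then show ?case by (blast intro: provable.Cut)
next
  case (EqRefl \<Gamma> i)
  then show ?case by (auto intro: provable.EqRefl)
next
  case (EqSubst \<Gamma> i j \<phi>)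
  then show ?case unfolding untr.simps untr_fsubst by (auto intro: provable.EqSubst wff_untr)
next
  case (TopI \<Gamma> \<phi>)
  then show ?case by (auto intro: provable.TopI wff_untr)
next
  case (AndE1 \<Gamma> \<phi> \<psi>)
  then show ?case by (auto intro: provable.AndE1 wff_untr)
next
  case (AndE2 \<Gamma> \<phi> \<psi>)
  then show ?case by (auto intro: provable.AndE2 wff_untr)
next
  case (AndI \<Gamma> \<phi> \<psi> \<chi>)
  then show ?case by (auto intro: provable.AndI)
next
  case (BotE \<Gamma> \<phi>)
  then show ?case by (auto intro: provable.BotE wff_untr)
next
  case (OrI1 \<Gamma> \<phi> \<psi>)
  then show ?case by (auto intro: provable.OrI1 wff_untr)
next
  case (OrI2 \<Gamma> \<phi> \<psi>)
  then show ?case by (auto intro: provable.OrI2 wff_untr)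
next
  case (OrE \<Gamma> \<phi> \<chi> \<psi>)
  then show ?case by (auto intro: provable.OrE)
next
  case (DisjI \<Gamma> I F i)
  then have "wff \<Sigma> \<Gamma> (Disj I (\<lambda>i. untr (F i)))" by (auto intro: wff_untr)
  with DisjI show ?case unfolding untr.simps by (intro provable.DisjI[where F = "\<lambda>i. untr (F i)"]) simp_all
next
  case (DisjE \<Gamma> \<chi> I F)
  then show ?case unfolding untr.simps by (intro provable.DisjE) (auto intro: wff_untr)
next
  case (ExE \<Gamma> \<psi> A \<phi>)
  then show ?case unfolding untr.simps by (intro provable.ExE) (auto intro: wff_untr simp: untr_weaken)
next
  case (ExI \<Gamma> A \<phi> \<psi>)
  then show ?case unfolding untr_weaken by (intro provable.ExI) simp
next
  case (DistribOr \<Gamma> \<phi> \<psi> \<chi>)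
  then show ?case by (auto intro!: provable.DistribOr wff_untr)
next
  case (DistribDisj \<Gamma> \<phi> I F)
  then show ?case unfolding untr.simps by (intro provable.DistribDisj) (auto intro: wff_untr)
next
  case (Frobenius \<Gamma> \<phi> A \<psi>)
  then show ?case unfolding untr.simps untr_weaken by (intro provable.Frobenius) (auto intro: wff_untr)
qed

lemma untr_interp: "interp (rel_sig \<Sigma>) U \<Sigma> T (\<lambda>\<Gamma>. untr)"
proof unfold_locales
  show "equivalent \<Sigma> T \<Gamma> (untr (eqs (map Var ks) (map Var ls))) (eqs (map Var ks) (map Var ls))"
    if "wf_ctx (rel_sig \<Sigma>) \<Gamma>" "var_tuple \<Gamma> ks \<Delta>" "var_tuple \<Gamma> ls \<Delta>" for \<Gamma> ks \<Delta> ls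
    unfolding untr_eqs using that by (intro A.equivalent_refl wff_eqs_ren) simp_all
  show "equivalent \<Sigma> T \<Delta> (untr (inst \<phi> (map Var ks))) (inst (untr \<phi>) (map Var ks))"
    if "wf_ctx (rel_sig \<Sigma>) \<Delta>" "wf_ctx (rel_sig \<Sigma>) \<Gamma>" "wff (rel_sig \<Sigma>) \<Gamma> \<phi>" "var_tuple \<Delta> ks \<Gamma>" for \<Delta> \<Gamma> \<phi> ks
    unfolding untr_inst using that by (intro A.equivalent_refl wff_ren[OF wff_untr]) simp_all
qed (use wff_untr untr_prv in simp_all)

text \<open>The inverse functor uses \<open>untr\<close>, which maps formulas of the fragment \<open>P'\<close> literally to formulas
  of \<open>P\<close>.\<close>
theorem tr_is_equivalence:
  assumes PA: "fragment \<Sigma> T P" and PB: "fragment (rel_sig \<Sigma>) U P'"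
    and tr: "\<And>\<Gamma> \<phi>. wf_ctx \<Sigma> \<Gamma> \<Longrightarrow> wff \<Sigma> \<Gamma> \<phi> \<Longrightarrow> P \<Gamma> \<phi> \<Longrightarrow> \<exists>\<phi>'. P' \<Gamma> \<phi>' \<and> equivalent (rel_sig \<Sigma>) U \<Gamma> (tr \<Sigma> \<Gamma> \<phi>) \<phi>'"
    and untr: "\<And>\<Gamma> \<phi>. wf_ctx \<Sigma> \<Gamma> \<Longrightarrow> wff (rel_sig \<Sigma>) \<Gamma> \<phi> \<Longrightarrow> P' \<Gamma> \<phi> \<Longrightarrow> P \<Gamma> (untr \<phi>)"
    and Fo: "\<And>X. X \<in> Ob (syn_cat \<Sigma> T P) \<Longrightarrow> fst (Fo X) = fst X \<and> P' (fst X) (snd (Fo X)) \<and>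
      equivalent (rel_sig \<Sigma>) U (fst X) (tr \<Sigma> (fst X) (snd X)) (snd (Fo X))"
  shows "is_equivalence (syn_cat \<Sigma> T P) (syn_cat (rel_sig \<Sigma>) U P') Fo (class_map (rel_sig \<Sigma>) U (tr \<Sigma>))"
proof (rule mutually_inverse_interps[where G = "\<lambda>\<Gamma>. untr" and Go = "\<lambda>X. (fst X, untr (snd X))"])
  interpret PA: fragment \<Sigma> T P by fact
  interpret PB: fragment "rel_sig \<Sigma>" U P' by fact
  show "interp_fragments \<Sigma> T (rel_sig \<Sigma>) U (tr \<Sigma>) P P' Fo"
    by (intro interp_fragments.intro interp_fragments_axioms.intro tr.interp_axioms PA PB tr Fo)
  have r: "equivalent \<Sigma> T \<Gamma> (untr \<phi>) (untr \<phi>)" if "wf_ctx \<Sigma> \<Gamma>" "wff (rel_sig \<Sigma>) \<Gamma> \<phi>" for \<Gamma> \<phi>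
    using that by (intro A.equivalent_refl wff_untr) simp_all
  show "interp_fragments (rel_sig \<Sigma>) U \<Sigma> T (\<lambda>\<Gamma>. untr) P' P (\<lambda>X. (fst X, untr (snd X)))"
  proof (intro interp_fragments.intro interp_fragments_axioms.intro untr_interp PA PB)
    show "\<exists>\<phi>'. P \<Gamma> \<phi>' \<and> equivalent \<Sigma> T \<Gamma> (untr \<phi>) \<phi>'"
      if "wf_ctx (rel_sig \<Sigma>) \<Gamma>" "wff (rel_sig \<Sigma>) \<Gamma> \<phi>" "P' \<Gamma> \<phi>" for \<Gamma> \<phi>
      using that by (intro exI[of _ "untr \<phi>"] conjI untr r) simp_all
    show "fst (fst X, untr (snd X)) = fst X \<and> P (fst X) (snd (fst X, untr (snd X))) \<and>
        equivalent \<Sigma> T (fst X) (untr (snd X)) (snd (fst X, untr (snd X)))"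
      if "X \<in> Ob (syn_cat (rel_sig \<Sigma>) U P')" for X
      using that r untr by (cases X) (auto simp: PB.Ob_iff)
  qed
qed (use A.untr_tr tr_untr in simp_all)

end

section \<open>Fragments closed under the constructions of regular logic\<close>

text \<open>The closure properties that geometric, coherent and regular formulas share. They suffice for
  identities and composites in the syntactic category.\<close>
definition regular_closed :: "(('s, 'f, 'r, 'i) fm \<Rightarrow> bool) \<Rightarrow> bool" where
  "regular_closed C \<longleftrightarrow> C Top \<and> (\<forall>s t. C (Eq s t)) \<and> (\<forall>\<phi> \<psi>. C \<phi> \<longrightarrow> C \<psi> \<longrightarrow> C (And \<phi> \<psi>)) \<and>
     (\<forall>A \<phi>. C \<phi> \<longrightarrow> C (Ex A \<phi>)) \<and> (\<forall>\<sigma> \<phi>. C \<phi> \<longrightarrow> C (fsubst \<sigma> \<phi>))"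

lemma regular_closed_exs: "regular_closed C \<Longrightarrow> C \<phi> \<Longrightarrow> C (exs As \<phi>)"
proof (induction As arbitrary: \<phi>)
  case (Cons A As)
  then show ?case using Cons.IH[of "Ex A \<phi>"] by (simp add: exs_def regular_closed_def)
qed (simp add: exs_def)

lemma regular_closed_conjs: "regular_closed C \<Longrightarrow> (\<And>\<phi>. \<phi> \<in> set \<phi>s \<Longrightarrow> C \<phi>) \<Longrightarrow> C (conjs \<phi>s)"
  by (induction \<phi>s) (auto simp: conjs_def regular_closed_def)

lemma (in geo) fragment_regular_closed:
  assumes C: "regular_closed C"
  shows "fragment \<Sigma> T (\<lambda>\<Gamma> \<phi>. C \<phi>)"
proof
  have inst: "C \<phi> \<Longrightarrow> C (inst \<phi> ts)" for \<phi> ts using C by (simp add: inst_def regular_closed_def)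
  have And: "C \<phi> \<Longrightarrow> C \<psi> \<Longrightarrow> C (And \<phi> \<psi>)" for \<phi> \<psi> using C by (simp add: regular_closed_def)
  have eqs: "C (eqs ts us)" for ts us
    unfolding eqs_def by (rule regular_closed_conjs[OF C]) (use C in \<open>auto simp: regular_closed_def\<close>)
  show "\<exists>\<kappa>. C \<kappa> \<and> equivalent \<Sigma> T (\<Gamma> @ \<Gamma>) (id_fm (\<Gamma>, \<phi>)) \<kappa>"
    if w: "wf_ctx \<Sigma> \<Gamma>" "wff \<Sigma> \<Gamma> \<phi>" "C \<phi>" for \<Gamma> \<phi>
  proof (intro exI conjI)
    show "C (id_fm (\<Gamma>, \<phi>))" unfolding id_fm_eq by (intro And inst eqs w)
    show "equivalent \<Sigma> T (\<Gamma> @ \<Gamma>) (id_fm (\<Gamma>, \<phi>)) (id_fm (\<Gamma>, \<phi>))"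
      by (rule equivalent_refl[OF _ wff_id[OF w(2)]]) (use w in simp)
  qed
  fix \<Gamma> \<Delta> \<Lambda> \<phi> \<psi> \<chi> \<theta> \<theta>'
  assume w: "wf_ctx \<Sigma> \<Gamma>" "wf_ctx \<Sigma> \<Delta>" "wf_ctx \<Sigma> \<Lambda>" "wff \<Sigma> (\<Gamma> @ \<Delta>) \<theta>" "wff \<Sigma> (\<Delta> @ \<Lambda>) \<theta>'" "C \<theta>" "C \<theta>'"
  show "\<exists>\<kappa>. C \<kappa> \<and> equivalent \<Sigma> T (\<Gamma> @ \<Lambda>) (comp_fm (\<Gamma>, \<phi>) (\<Delta>, \<psi>) (\<Lambda>, \<chi>) \<theta> \<theta>') \<kappa>"
  proof (intro exI conjI)
    show "C (comp_fm (\<Gamma>, \<phi>) (\<Delta>, \<psi>) (\<Lambda>, \<chi>) \<theta> \<theta>')"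
      unfolding comp_fm_eq comp_body_def by (intro regular_closed_exs[OF C] And inst w)
    show "equivalent \<Sigma> T (\<Gamma> @ \<Lambda>) (comp_fm (\<Gamma>, \<phi>) (\<Delta>, \<psi>) (\<Lambda>, \<chi>) \<theta> \<theta>') (comp_fm (\<Gamma>, \<phi>) (\<Delta>, \<psi>) (\<Lambda>, \<chi>) \<theta> \<theta>')"
      by (rule equivalent_refl[OF _ wff_comp[OF w(4,5,2)]]) (use w in simp)
  qed
qed

lemma coherent_fsubst [simp]: "coherent (fsubst \<sigma> \<phi>) = coherent \<phi>"
  by (induction \<phi> arbitrary: \<sigma>) auto

lemma regular_fsubst [simp]: "regular (fsubst \<sigma> \<phi>) = regular \<phi>"
  by (induction \<phi> arbitrary: \<sigma>) auto

lemma regular_closed_coherent: "regular_closed coherent"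
  by (simp add: regular_closed_def)

lemma regular_closed_regular: "regular_closed regular"
  by (simp add: regular_closed_def)

lemma regular_closed_tr_atom:
  assumes C: "regular_closed C" and R: "\<And>q ts. C (Rel q ts)" and a: "C (atom (map Var (map (upos gs) gs)))"
  shows "C (tr_atom \<Sigma> \<Gamma> gs atom)"
proof -
  have "C (ugraph gs g)" for g
    using C R by (cases g) (auto simp: ugraph_def regular_closed_def)
  then have "C (conjs (map (ugraph gs) (uterms gs)))" by (intro regular_closed_conjs[OF C]) auto
  then have "C (ubody gs atom)"
    unfolding ubody_def using C a unfolding regular_closed_def by blast
  then show ?thesis unfolding tr_atom_eq by (rule regular_closed_exs[OF C])
qed

lemma coherent_tr: "coherent \<phi> \<Longrightarrow> coherent (tr \<Sigma> \<Gamma> \<phi>)"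
  by (induction \<phi> arbitrary: \<Gamma>) (auto intro!: regular_closed_tr_atom[OF regular_closed_coherent])

lemma regular_tr: "regular \<phi> \<Longrightarrow> regular (tr \<Sigma> \<Gamma> \<phi>)"
  by (induction \<phi> arbitrary: \<Gamma>) (auto intro!: regular_closed_tr_atom[OF regular_closed_regular])

lemma coherent_untr: "coherent \<phi> \<Longrightarrow> coherent (untr \<phi>)"
proof (induction \<phi>)
  case (Rel q ts)
  then show ?case by (cases q) auto
qed auto

lemma horn_untr: "wff (rel_sig \<Sigma>) \<Gamma> \<phi> \<Longrightarrow> horn \<phi> \<Longrightarrow> horn (untr \<phi>)"
proof (induction \<phi> arbitrary: \<Gamma>)
  case (Rel q ts)
  then show ?case by (cases q) (auto simp: wts_Fn_iff)
qed auto

lemma regular_untr: "wff (rel_sig \<Sigma>) \<Gamma> \<phi> \<Longrightarrow> regular \<phi> \<Longrightarrow> regular (untr \<phi>)"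
proof (induction \<phi> arbitrary: \<Gamma>)
  case (Rel q ts)
  then show ?case by (cases q) (auto simp: wts_Fn_iff)
qed auto

section \<open>The relational theory\<close>

lemma rel_theory0_cases:
  assumes "(\<Gamma>, \<phi>, \<psi>) \<in> rel_theory0 \<Sigma>"
  obtains (unique) f where "f \<in> funs \<Sigma>" "\<Gamma> = fdom \<Sigma> f @ [fcod \<Sigma> f, fcod \<Sigma> f]"
      "\<phi> = And (Rel (Inr f) (map Var [0..<length (fdom \<Sigma> f)] @ [Var (length (fdom \<Sigma> f))]))
        (Rel (Inr f) (map Var [0..<length (fdom \<Sigma> f)] @ [Var (length (fdom \<Sigma> f) + 1)]))"
      "\<psi> = Eq (Var (length (fdom \<Sigma> f))) (Var (length (fdom \<Sigma> f) + 1))"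
    | (total) f where "f \<in> funs \<Sigma>" "\<Gamma> = fdom \<Sigma> f" "\<phi> = Top"
      "\<psi> = Ex (fcod \<Sigma> f) (Rel (Inr f) (map Var [1..<1 + length (fdom \<Sigma> f)] @ [Var 0]))"
  using assms unfolding rel_theory0_def Let_def vars_def add_0 by blast

lemma wts_upt: "a + length As \<le> length \<Gamma> \<Longrightarrow> take (length As) (drop a \<Gamma>) = As \<Longrightarrow>
    list_all2 (wt \<Sigma> \<Gamma>) (map Var [a..<a + length As]) As"
  by (rule var_tuple_wt[OF var_tuple_upt])

lemma rel_theory0_geometric:
  assumes "wf_signature \<Sigma>"
  shows "geometric_theory (rel_sig \<Sigma>) (rel_theory0 \<Sigma>)"
  unfolding geometric_theory_def
proof (intro ballI, clarify)
  fix \<Gamma> \<phi> \<psi> assume "(\<Gamma>, \<phi>, \<psi>) \<in> rel_theory0 \<Sigma>"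
  then show "wf_ctx (rel_sig \<Sigma>) \<Gamma> \<and> wff (rel_sig \<Sigma>) \<Gamma> \<phi> \<and> wff (rel_sig \<Sigma>) \<Gamma> \<psi>"
  proof (cases rule: rel_theory0_cases)
    case (unique f)
    have "list_all2 (wt (rel_sig \<Sigma>) \<Gamma>) (map Var [0..<0 + length (fdom \<Sigma> f)]) (fdom \<Sigma> f)"
      by (rule wts_upt) (simp_all add: unique)
    then show ?thesis using assms unique(1)
      by (auto simp: wf_signature_def wf_ctx_def unique nth_append intro!: list_all2_appendI)
  next
    case (total f)
    have "list_all2 (wt (rel_sig \<Sigma>) (fcod \<Sigma> f # \<Gamma>)) (map Var [1..<1 + length (fdom \<Sigma> f)]) (fdom \<Sigma> f)"
      by (rule wts_upt) (simp_all add: total)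
    then show ?thesis using assms total(1)
      by (auto simp: wf_signature_def wf_ctx_def total simp del: upt_Suc intro!: list_all2_appendI)
  qed
qed

lemma rel_theory_geometric:
  assumes "wf_signature \<Sigma>" "geometric_theory \<Sigma> T"
  shows "geometric_theory (rel_sig \<Sigma>) (rel_theory \<Sigma> T)"
  using rel_theory0_geometric[OF assms(1)] assms(2) wff_tr[OF assms(1)]
  unfolding geometric_theory_def rel_theory_def by fastforce

lemma (in geo) untr_rel_theory0:
  assumes "(\<Gamma>, \<phi>, \<psi>) \<in> rel_theory0 \<Sigma>"
  shows "prv \<Gamma> (untr \<phi>) (untr \<psi>)"
proof -
  have w: "wf_ctx \<Sigma> \<Gamma>" "wff \<Sigma> \<Gamma> (untr \<phi>)" "wff \<Sigma> \<Gamma> (untr \<psi>)"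
    using rel_theory0_geometric[OF wf_sig] assms wff_untr by (fastforce simp: geometric_theory_def)+
  show ?thesis
    using assms
  proof (cases rule: rel_theory0_cases)
    case (unique f)
    let ?t = "Fn f (map Var [0..<length (fdom \<Sigma> f)]) :: 'f trm" and ?n = "length (fdom \<Sigma> f)"
    have u: "untr \<phi> = And (Eq ?t (Var ?n)) (Eq ?t (Var (?n + 1)))" by (simp add: unique)
    note wu = w(2)[unfolded u wff.simps(4)]
    have "prv \<Gamma> (untr \<phi>) (Eq (Var ?n) (Var (?n + 1)))"
      unfolding u
      by (rule eq_trans[OF eq_sym[OF provable.AndE1[OF w(1)]] provable.AndE2[OF w(1)]]) (use wu in blast)+
    then show ?thesis by (simp add: unique)
  next
    case (total f)
    let ?n = "length (fdom \<Sigma> f)"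
    let ?t = "Fn f (map Var [0..<0 + ?n]) :: 'f trm"
    have t: "wt \<Sigma> \<Gamma> ?t (fcod \<Sigma> f)"
      unfolding wt_Fn_iff using wts_upt[of 0 "fdom \<Sigma> f" \<Gamma> \<Sigma>] total by simp
    have u: "untr \<psi> = Ex (fcod \<Sigma> f) (Eq (Fn f (map Var [1..<1 + ?n])) (Var 0))" by (simp add: total)
    have m: "map (tsubst (case_nat ?t Var)) (map Var [1..<1 + ?n]) = map Var [0..<0 + ?n]"
      by (rule nth_equalityI) (simp_all del: upt_Suc)
    have "prv \<Gamma> Top (fsubst Var (untr \<psi>))"
      unfolding u
    proof (rule ex_intro[OF w(3)[unfolded u] w(1) _ t])
      show "typed \<Sigma> \<Gamma> Var \<Gamma>" by (simp add: typed_def)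
      have "prv \<Gamma> Top (Eq ?t ?t)" by (rule eq_refl[OF w(1) t]) simp
      then show "prv \<Gamma> Top (fsubst (case_nat ?t Var) (Eq (Fn f (map Var [1..<1 + ?n])) (Var 0)))"
        unfolding fsubst.simps tsubst.simps m by simp
    qed
    then show ?thesis by (simp only: fsubst_Var total(3) untr.simps)
  qed
qed

text \<open>For the translated axioms of \<open>T\<close>, this uses that \<open>untr (tr \<Sigma> \<Gamma> \<phi>)\<close> is equivalent to \<open>\<phi>\<close>.\<close>
lemma tr_equiv_rel_theory:
  assumes "wf_signature \<Sigma>" "geometric_theory \<Sigma> T"
  shows "tr_equiv \<Sigma> T (rel_theory \<Sigma> T)"
proof -
  interpret A: geo \<Sigma> T by unfold_locales fact+
  interpret B: geo "rel_sig \<Sigma>" "rel_theory \<Sigma> T"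
    by unfold_locales (rule wf_rel_sig rel_theory_geometric; fact)+
  interpret rel_geo \<Sigma> "rel_theory \<Sigma> T"
    by unfold_locales (use assms in \<open>auto simp: rel_theory_def\<close>)
  interpret tr_sound \<Sigma> T "rel_theory \<Sigma> T"
  proof unfold_locales
    show "B.prv \<Gamma> (tr \<Sigma> \<Gamma> \<phi>) (tr \<Sigma> \<Gamma> \<psi>)" if "(\<Gamma>, \<phi>, \<psi>) \<in> T" for \<Gamma> \<phi> \<psi>
      by (rule provable.Axiom) (use that in \<open>auto simp: rel_theory_def\<close>)
  qed
  show ?thesis
  proof unfold_locales
    fix \<Gamma> \<phi> \<psi> assume "(\<Gamma>, \<phi>, \<psi>) \<in> rel_theory \<Sigma> T"
    then consider "(\<Gamma>, \<phi>, \<psi>) \<in> rel_theory0 \<Sigma>"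
      | \<phi>' \<psi>' where "\<phi> = tr \<Sigma> \<Gamma> \<phi>'" "\<psi> = tr \<Sigma> \<Gamma> \<psi>'" "(\<Gamma>, \<phi>', \<psi>') \<in> T"
      by (auto simp: rel_theory_def)
    then show "A.prv \<Gamma> (untr \<phi>) (untr \<psi>)"
    proof cases
      case 1
      then show ?thesis by (rule A.untr_rel_theory0)
    next
      case 2
      have p: "A.prv \<Gamma> \<phi>' \<psi>'" by (rule provable.Axiom[OF 2(3)])
      note w = A.prvD[OF p]
      show ?thesis
        using p A.untr_tr[of \<Gamma> \<phi>'] A.untr_tr[of \<Gamma> \<psi>'] w unfolding 2(1,2) equivalent_def
        by (blast intro: provable.Cut)
    qed
  qed
qed

lemma tr_mor_eq: "tr_mor \<Sigma> T = class_map (rel_sig \<Sigma>) (rel_theory \<Sigma> T) (tr \<Sigma>)"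
  by (simp add: fun_eq_iff tr_mor_def class_map_def)

theorem regular_closed_equivalence:
  assumes "wf_signature \<Sigma>" "geometric_theory \<Sigma> T" and C: "regular_closed C" "regular_closed C'"
    and tr: "\<And>\<Gamma> \<phi>. C \<phi> \<Longrightarrow> C' (tr \<Sigma> \<Gamma> \<phi>)" and untr: "\<And>\<Gamma> \<phi>. wff (rel_sig \<Sigma>) \<Gamma> \<phi> \<Longrightarrow> C' \<phi> \<Longrightarrow> C (untr \<phi>)"
  shows "is_equivalence (syn_cat \<Sigma> T (\<lambda>\<Gamma>. C)) (syn_cat (rel_sig \<Sigma>) (rel_theory \<Sigma> T) (\<lambda>\<Gamma>. C')) (tr_ob \<Sigma>) (tr_mor \<Sigma> T)"
proof -
  interpret tr_equiv \<Sigma> T "rel_theory \<Sigma> T" by (rule tr_equiv_rel_theory[OF assms(1,2)])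
  interpret PA: fragment \<Sigma> T "\<lambda>\<Gamma>. C" by (rule A.fragment_regular_closed[OF C(1)])
  have r: "equivalent (rel_sig \<Sigma>) (rel_theory \<Sigma> T) \<Gamma> (tr \<Sigma> \<Gamma> \<phi>) (tr \<Sigma> \<Gamma> \<phi>)" if "wf_ctx \<Sigma> \<Gamma>" "wff \<Sigma> \<Gamma> \<phi>" for \<Gamma> \<phi>
    using that by (intro equivalent_refl wff_tr[OF wf]) simp_all
  show ?thesis unfolding tr_mor_eq
  proof (rule tr_is_equivalence)
    show "fragment \<Sigma> T (\<lambda>\<Gamma>. C)" by (rule PA.fragment_axioms)
    show "fragment (rel_sig \<Sigma>) (rel_theory \<Sigma> T) (\<lambda>\<Gamma>. C')" by (rule fragment_regular_closed[OF C(2)])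
    show "fst (tr_ob \<Sigma> X) = fst X \<and> C' (snd (tr_ob \<Sigma> X)) \<and>
        equivalent (rel_sig \<Sigma>) (rel_theory \<Sigma> T) (fst X) (tr \<Sigma> (fst X) (snd X)) (snd (tr_ob \<Sigma> X))"
      if "X \<in> Ob PA.\<C>" for X
      using that r tr by (cases X) (auto simp: PA.Ob_iff tr_ob_def)
  qed (use tr untr r in blast)+
qed

section \<open>Cartesian formulas\<close>

text \<open>Provability depends on the axioms only through what they prove.\<close>
lemma provable_from_axioms:
  assumes "provable \<Sigma> T \<Gamma> \<phi> \<psi>" "\<And>\<Gamma> \<phi> \<psi>. (\<Gamma>, \<phi>, \<psi>) \<in> T \<Longrightarrow> provable \<Sigma> T' \<Gamma> \<phi> \<psi>"
  shows "provable \<Sigma> T' \<Gamma> \<phi> \<psi>"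
  using assms(1)
proof (induction rule: provable.induct)
  case (Axiom \<Gamma> \<phi> \<psi>)
  then show ?case by (rule assms(2))
qed (rule provable.intros; assumption)+

lemma equivalent_mono: "equivalent \<Sigma> T \<Gamma> \<phi> \<psi> \<Longrightarrow> T \<subseteq> T' \<Longrightarrow> equivalent \<Sigma> T' \<Gamma> \<phi> \<psi>"
  unfolding equivalent_def by (blast intro: provable_from_axioms provable.Axiom)

lemma horn_fsubst [simp]: "horn (fsubst \<sigma> \<phi>) = horn \<phi>"
  by (induction \<phi> arbitrary: \<sigma>) auto

lemma horn_inst [simp]: "horn (inst \<phi> ts) = horn \<phi>"
  by (simp add: inst_def)

lemma horn_conjs [simp]: "horn (conjs \<phi>s) \<longleftrightarrow> (\<forall>\<phi> \<in> set \<phi>s. horn \<phi>)"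
  by (induction \<phi>s) (auto simp: conjs_def)

lemma horn_eqs [simp]: "horn (eqs ts us)"
  by (auto simp: eqs_def)

lemma exs_append: "exs (As @ Bs) \<phi> = exs Bs (exs As \<phi>)"
  by (simp add: exs_def)

context geo
begin

text \<open>Uniqueness of the block \<open>As\<close>, as it occurs in the definition of cartesian formulas.\<close>
definition unique_fm :: "'s list \<Rightarrow> 's list \<Rightarrow> ('s, 'f, 'r, 'i) fm \<Rightarrow> bool" where
  "unique_fm As \<Gamma> \<chi> \<longleftrightarrow> (let k = length As; n = length \<Gamma> in
     prv (As @ As @ \<Gamma>) (And (inst \<chi> (map Var ([0..<0 + k] @ [2 * k..<2 * k + n]))) (inst \<chi> (map Var ([k..<k + k] @ [2 * k..<2 * k + n]))))
       (eqs (map Var [0..<0 + k]) (map Var [k..<k + k])))"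

lemma cartesian_iff:
  "cartesian \<Sigma> T \<Gamma> \<phi> \<longleftrightarrow> wff \<Sigma> \<Gamma> \<phi> \<and> (\<exists>As \<chi>. \<phi> = exs As \<chi> \<and> horn \<chi> \<and> unique_fm As \<Gamma> \<chi>)"
  unfolding cartesian_def unique_fm_def Let_def vars_def map_append ..

lemma unique_model:
  assumes u: "unique_fm As \<Gamma> \<chi>" and w: "wff \<Sigma> (As @ \<Gamma>) \<chi>" and m: "geo_model \<Sigma> T S D H"
    and t: "tuple D \<Gamma> xs" "tuple D As as" "tuple D As bs" and h: "H \<chi> (as @ xs)" "H \<chi> (bs @ xs)"
  shows "as = bs"
proof -
  interpret m: geo_model \<Sigma> T S D H by fact
  let ?k = "length As" and ?n = "length \<Gamma>"
  let ?a = "inst \<chi> (map Var ([0..<0 + ?k] @ [2 * ?k..<2 * ?k + ?n]))"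
  let ?b = "inst \<chi> (map Var ([?k..<?k + ?k] @ [2 * ?k..<2 * ?k + ?n]))"
  have p: "prv (As @ As @ \<Gamma>) (And ?a ?b) (eqs (map Var [0..<0 + ?k]) (map Var [?k..<?k + ?k]))"
    using u unfolding unique_fm_def Let_def .
  have T: "tuple D (As @ As @ \<Gamma>) (as @ bs @ xs)" using t by simp
  have l: "length as = ?k" "length bs = ?k" "length xs = ?n" using tuple_length t by auto
  have "H ?a (as @ bs @ xs)"
    using m.H_inst_upt2[OF _ T, of ?k 0 ?n "2 * ?k" \<chi>] w h(1) l by simp
  moreover have "H ?b (as @ bs @ xs)"
    using m.H_inst_upt2[OF _ T, of ?k ?k ?n "2 * ?k" \<chi>] w h(2) l by simp
  moreover have "wff \<Sigma> (As @ As @ \<Gamma>) ?a" "wff \<Sigma> (As @ As @ \<Gamma>) ?b" using prvD[OF p] by (simp_all only: wff.simps)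
  ultimately have "H (And ?a ?b) (as @ bs @ xs)" using m.H_And[OF _ _ T] by blast
  from m.H_prv[OF p T this] show ?thesis using m.H_eqs_upt[OF T, of 0 ?k ?k] l by simp
qed

lemma unique_fmI:
  assumes S: "countable S" and wc: "wf_ctx \<Sigma> (As @ \<Gamma>)" and w: "wff \<Sigma> (As @ \<Gamma>) \<chi>"
    and h: "\<And>D H xs as bs. geo_model \<Sigma> T S D H \<Longrightarrow> tuple D \<Gamma> xs \<Longrightarrow> tuple D As as \<Longrightarrow> tuple D As bs \<Longrightarrow>
      H \<chi> (as @ xs) \<Longrightarrow> H \<chi> (bs @ xs) \<Longrightarrow> as = bs"
  shows "unique_fm As \<Gamma> \<chi>"
  unfolding unique_fm_def Let_def
proof (rule complete[OF S])
  let ?k = "length As" and ?n = "length \<Gamma>"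
  let ?a = "inst \<chi> (map Var ([0..<0 + ?k] @ [2 * ?k..<2 * ?k + ?n]))"
  let ?b = "inst \<chi> (map Var ([?k..<?k + ?k] @ [2 * ?k..<2 * ?k + ?n]))"
  have wa: "wff \<Sigma> (As @ As @ \<Gamma>) ?a" by (rule wff_ren[OF w]; intro vt_simps; simp)
  have wb: "wff \<Sigma> (As @ As @ \<Gamma>) ?b" by (rule wff_ren[OF w]; intro vt_simps; simp)
  show "wff \<Sigma> (As @ As @ \<Gamma>) (And ?a ?b)" using wa wb by simp
  show "wff \<Sigma> (As @ As @ \<Gamma>) (eqs (map Var [0..<0 + ?k]) (map Var [?k..<?k + ?k]))"
    by (rule wff_eqs_ren[where \<Gamma> = As]; intro vt_simps; simp)
  fix D H zs assume m: "geo_model \<Sigma> T S D H" and T: "tuple D (As @ As @ \<Gamma>) zs" and hh: "H (And ?a ?b) zs"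
  interpret m: geo_model \<Sigma> T S D H by fact
  obtain as us where z1: "zs = as @ us" "tuple D As as" "tuple D (As @ \<Gamma>) us" using T by (rule tuple_appendE)
  obtain bs xs where z2: "us = bs @ xs" "tuple D As bs" "tuple D \<Gamma> xs" using z1(3) by (rule tuple_appendE)
  have l: "length as = ?k" "length bs = ?k" "length xs = ?n" using tuple_length z1 z2 by auto
  have "H ?a zs" "H ?b zs" using m.H_And[OF wa wb T] hh by auto
  then have "H \<chi> (as @ xs)" "H \<chi> (bs @ xs)"
    using m.H_inst_upt2[OF _ T, of ?k 0 ?n "2 * ?k" \<chi>] m.H_inst_upt2[OF _ T, of ?k ?k ?n "2 * ?k" \<chi>] w l
    by (simp_all add: z1(1) z2(1))
  then have "as = bs" using h[OF m z2(3) z1(2) z2(2)] by blast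
  then show "H (eqs (map Var [0..<0 + ?k]) (map Var [?k..<?k + ?k])) zs"
    using m.H_eqs_upt[OF T, of 0 ?k ?k] l by (simp add: z1(1) z2(1))
qed (use wc in simp)

lemma cartesian_horn:
  assumes "wf_ctx \<Sigma> \<Gamma>" "wff \<Sigma> \<Gamma> \<chi>" "horn \<chi>"
  shows "cartesian \<Sigma> T \<Gamma> \<chi>"
  unfolding cartesian_iff
proof (intro conjI exI[of _ "[]"] exI[of _ \<chi>])
  show "unique_fm [] \<Gamma> \<chi>" by (rule unique_fmI[where S = "{}"]) (use assms in simp_all)
qed (use assms in \<open>simp_all add: exs_def\<close>)

end

text \<open>Two theories are needed: a formula of the form \<open>exs As \<chi>\<close>, with \<open>\<chi>\<close> Horn, is equivalent to the given
  one already in the small theory \<open>U\<close>, but uniqueness of \<open>As\<close> is provable only in \<open>T\<close>. For the translation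
  \<open>U\<close> consists of the axioms on function symbols; this is used to recognize a cartesian axiomatization
  before it is known to prove the remaining axioms.\<close>
locale geo_ext = geo \<Sigma> T + U: geo \<Sigma> U
  for \<Sigma> :: "('s, 'f, 'r) signature" and T U :: "('s, 'f, 'r, 'i) sequent set" +
  assumes sub: "U \<subseteq> T"
begin

definition cart :: "'s list \<Rightarrow> ('s, 'f, 'r, 'i) fm \<Rightarrow> bool" where
  "cart \<Gamma> \<phi> \<longleftrightarrow> (\<exists>\<phi>'. cartesian \<Sigma> T \<Gamma> \<phi>' \<and> equivalent \<Sigma> U \<Gamma> \<phi> \<phi>')"

lemma cartE:
  assumes "cart \<Gamma> \<phi>"
  obtains As \<chi> where "equivalent \<Sigma> U \<Gamma> \<phi> (exs As \<chi>)" "wff \<Sigma> \<Gamma> \<phi>" "wff \<Sigma> \<Gamma> (exs As \<chi>)" "horn \<chi>" "unique_fm As \<Gamma> \<chi>"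
    "wf_ctx \<Sigma> (As @ \<Gamma>)" "wff \<Sigma> (As @ \<Gamma>) \<chi>"
proof -
  obtain As \<chi> where e: "equivalent \<Sigma> U \<Gamma> \<phi> (exs As \<chi>)" "wff \<Sigma> \<Gamma> (exs As \<chi>)" "horn \<chi>" "unique_fm As \<Gamma> \<chi>"
    using assms by (auto simp: cart_def cartesian_iff)
  note w = U.equivalentD[OF e(1)]
  show ?thesis by (rule that[OF e(1) _ e(2-4)]) (use w e(2) in \<open>auto simp: wf_ctx_def\<close>)
qed

lemma cartI:
  assumes e: "equivalent \<Sigma> U \<Gamma> \<phi> (exs As \<chi>)" and h: "horn \<chi>" and S: "countable S"
    and u: "\<And>D H xs as bs. geo_model \<Sigma> T S D H \<Longrightarrow> tuple D \<Gamma> xs \<Longrightarrow> tuple D As as \<Longrightarrow> tuple D As bs \<Longrightarrow>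
      H \<chi> (as @ xs) \<Longrightarrow> H \<chi> (bs @ xs) \<Longrightarrow> as = bs"
  shows "cart \<Gamma> \<phi>"
proof -
  note w = U.equivalentD[OF e]
  have w2: "wf_ctx \<Sigma> (As @ \<Gamma>)" "wff \<Sigma> (As @ \<Gamma>) \<chi>" using w by (auto simp: wf_ctx_def)
  have "unique_fm As \<Gamma> \<chi>" by (rule unique_fmI[OF S w2 u])
  then have "cartesian \<Sigma> T \<Gamma> (exs As \<chi>)" using w h by (auto simp: cartesian_iff)
  then show ?thesis using e by (auto simp: cart_def)
qed

lemma cart_cartesian: "cartesian \<Sigma> T \<Gamma> \<phi> \<Longrightarrow> wf_ctx \<Sigma> \<Gamma> \<Longrightarrow> cart \<Gamma> \<phi>"
  unfolding cart_def using U.equivalent_refl by (auto simp: cartesian_def)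

lemma cart_horn: "wf_ctx \<Sigma> \<Gamma> \<Longrightarrow> wff \<Sigma> \<Gamma> \<chi> \<Longrightarrow> horn \<chi> \<Longrightarrow> cart \<Gamma> \<chi>"
  by (intro cart_cartesian cartesian_horn)

lemma cart_And:
  assumes "cart \<Gamma> \<phi>" "cart \<Gamma> \<psi>"
  shows "cart \<Gamma> (And \<phi> \<psi>)"
proof -
  obtain As \<chi> where a: "equivalent \<Sigma> U \<Gamma> \<phi> (exs As \<chi>)" "wff \<Sigma> \<Gamma> \<phi>" "wff \<Sigma> \<Gamma> (exs As \<chi>)" "horn \<chi>" "unique_fm As \<Gamma> \<chi>"
    "wf_ctx \<Sigma> (As @ \<Gamma>)" "wff \<Sigma> (As @ \<Gamma>) \<chi>" by (rule cartE[OF assms(1)])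
  obtain Bs \<xi> where b: "equivalent \<Sigma> U \<Gamma> \<psi> (exs Bs \<xi>)" "wff \<Sigma> \<Gamma> \<psi>" "wff \<Sigma> \<Gamma> (exs Bs \<xi>)" "horn \<xi>" "unique_fm Bs \<Gamma> \<xi>"
    "wf_ctx \<Sigma> (Bs @ \<Gamma>)" "wff \<Sigma> (Bs @ \<Gamma>) \<xi>" by (rule cartE[OF assms(2)])
  let ?k = "length As" and ?l = "length Bs" and ?n = "length \<Gamma>"
  let ?a = "inst \<chi> (map Var ([0..<0 + ?k] @ [?k + ?l..<?k + ?l + ?n]))"
  let ?b = "inst \<xi> (map Var ([?k..<?k + ?l] @ [?k + ?l..<?k + ?l + ?n]))"
  have wa: "wff \<Sigma> ((As @ Bs) @ \<Gamma>) ?a" by (rule wff_ren[OF a(7)]; intro vt_simps; simp)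
  have wb: "wff \<Sigma> ((As @ Bs) @ \<Gamma>) ?b" by (rule wff_ren[OF b(7)]; intro vt_simps; simp)
  have wex: "wff \<Sigma> \<Gamma> (exs (As @ Bs) (And ?a ?b))" using wa wb a(3) b(3) by simp
  have ab: "H (And ?a ?b) ((as @ bs) @ xs) \<longleftrightarrow> H \<chi> (as @ xs) \<and> H \<xi> (bs @ xs)"
    if m: "geo_model \<Sigma> W S D H" and t: "tuple D As as" "tuple D Bs bs" "tuple D \<Gamma> xs" for W S D H as bs xs
  proof -
    interpret m: geo_model \<Sigma> W S D H by fact
    have T: "tuple D ((As @ Bs) @ \<Gamma>) ((as @ bs) @ xs)" using t by simp
    have l: "length as = ?k" "length bs = ?l" "length xs = ?n" using tuple_length t by auto
    show ?thesis
      using m.H_And[OF wa wb T] m.H_inst_upt2[OF _ T, of ?k 0 ?n "?k + ?l" \<chi>]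
        m.H_inst_upt2[OF _ T, of ?l ?k ?n "?k + ?l" \<xi>] a(7) b(7) l by simp
  qed
  show ?thesis
  proof (rule cartI[where S = "{}"])
    let ?S = "ex_tasks As \<chi> \<union> ex_tasks Bs \<xi> \<union> ex_tasks (As @ Bs) (And ?a ?b)"
    show "equivalent \<Sigma> U \<Gamma> (And \<phi> \<psi>) (exs (As @ Bs) (And ?a ?b))"
    proof (rule U.equivalent_complete[where S = ?S])
      fix D H xs assume m: "geo_model \<Sigma> U ?S D H" and x: "tuple D \<Gamma> xs"
      interpret m: geo_model \<Sigma> U ?S D H by fact
      have "H (exs (As @ Bs) (And ?a ?b)) xs \<longleftrightarrow> (\<exists>cs. tuple D (As @ Bs) cs \<and> H (And ?a ?b) (cs @ xs))"
        by (rule m.H_exs[OF wex x]) blast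
      also have "\<dots> \<longleftrightarrow> (\<exists>as bs. tuple D As as \<and> tuple D Bs bs \<and> H \<chi> (as @ xs) \<and> H \<xi> (bs @ xs))"
        using ab[OF m _ _ x] by (metis tuple_append tuple_appendE)
      also have "\<dots> \<longleftrightarrow> H (exs As \<chi>) xs \<and> H (exs Bs \<xi>) xs"
        using m.H_exs[OF a(3) x] m.H_exs[OF b(3) x] by auto
      also have "\<dots> \<longleftrightarrow> H (And \<phi> \<psi>) xs"
        using m.H_equivalent[OF a(1) x] m.H_equivalent[OF b(1) x] m.H_And[OF a(2) b(2) x] by blast
      finally show "H (And \<phi> \<psi>) xs \<longleftrightarrow> H (exs (As @ Bs) (And ?a ?b)) xs" by blast
    qed (use a b wex in simp_all)
    fix D H xs cs ds assume m: "geo_model \<Sigma> T {} D H" and x: "tuple D \<Gamma> xs"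
      and c: "tuple D (As @ Bs) cs" "tuple D (As @ Bs) ds" "H (And ?a ?b) (cs @ xs)" "H (And ?a ?b) (ds @ xs)"
    obtain as bs where cs: "cs = as @ bs" "tuple D As as" "tuple D Bs bs" using c(1) by (rule tuple_appendE)
    obtain as' bs' where ds: "ds = as' @ bs'" "tuple D As as'" "tuple D Bs bs'" using c(2) by (rule tuple_appendE)
    have "H \<chi> (as @ xs) \<and> H \<xi> (bs @ xs)" "H \<chi> (as' @ xs) \<and> H \<xi> (bs' @ xs)"
      using c(3,4) ab[OF m cs(2,3) x] ab[OF m ds(2,3) x] unfolding cs(1) ds(1) by blast+
    then show "cs = ds"
      using unique_model[OF a(5,7) m x cs(2) ds(2)] unique_model[OF b(5,7) m x cs(3) ds(3)] cs(1) ds(1) by blast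
  qed (use a(4) b(4) in simp_all)
qed

lemma cart_ren:
  assumes "cart \<Gamma> \<phi>" "wf_ctx \<Sigma> \<Delta>" and v: "var_tuple \<Delta> ks \<Gamma>"
  shows "cart \<Delta> (inst \<phi> (map Var ks))"
proof -
  obtain As \<chi> where a: "equivalent \<Sigma> U \<Gamma> \<phi> (exs As \<chi>)" "wff \<Sigma> \<Gamma> \<phi>" "wff \<Sigma> \<Gamma> (exs As \<chi>)" "horn \<chi>" "unique_fm As \<Gamma> \<chi>"
    "wf_ctx \<Sigma> (As @ \<Gamma>)" "wff \<Sigma> (As @ \<Gamma>) \<chi>" by (rule cartE[OF assms(1)])
  let ?k = "length As"
  let ?a = "inst \<chi> (map Var ([0..<0 + ?k] @ map (\<lambda>i. ?k + i) ks))"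
  have v': "var_tuple (As @ \<Delta>) ([0..<0 + ?k] @ map (\<lambda>i. ?k + i) ks) (As @ \<Gamma>)"
    by (rule var_tuple_app[OF var_tuple_upt]) (use v in \<open>auto simp: var_tuple_def list_all2_conv_all_nth nth_append\<close>)
  have wa: "wff \<Sigma> (As @ \<Delta>) ?a" by (rule wff_ren[OF a(7) v'])
  have wex: "wff \<Sigma> \<Delta> (exs As ?a)" using wa a(3) by simp
  have lk: "map ((!) xs) ks = map ((!) (as @ xs)) (map (\<lambda>i. ?k + i) ks)" if "length as = ?k" for as xs :: "nat list"
    using that by (simp add: nth_append)
  have tk: "tuple D \<Gamma> (map ((!) xs) ks)" if "tuple D \<Delta> xs" for D xs
    using that v by (simp add: tuple_def var_tuple_def list_all2_conv_all_nth) metis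
  have ha: "H ?a (as @ xs) \<longleftrightarrow> H \<chi> (as @ map ((!) xs) ks)"
    if m: "geo_model \<Sigma> W S D H" and t: "tuple D As as" "tuple D \<Delta> xs" for W S D H as xs
  proof -
    interpret m: geo_model \<Sigma> W S D H by fact
    have T: "tuple D (As @ \<Delta>) (as @ xs)" using t by simp
    have l: "length as = ?k" using tuple_length t by auto
    have e: "map ((!) (as @ xs)) ([0..<0 + ?k] @ map (\<lambda>i. ?k + i) ks) = as @ map ((!) xs) ks"
      unfolding map_append using l map_nth_upt[of 0 ?k "as @ xs"] lk[OF l] by simp
    show ?thesis using m.H_ren[OF a(7) v' T, unfolded e] .
  qed
  show ?thesis
  proof (rule cartI[where S = "{}"])
    let ?S = "ex_tasks As \<chi> \<union> ex_tasks As ?a"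
    show "equivalent \<Sigma> U \<Delta> (inst \<phi> (map Var ks)) (exs As ?a)"
    proof (rule U.equivalent_complete[where S = ?S])
      show "wff \<Sigma> \<Delta> (inst \<phi> (map Var ks))" by (rule wff_ren[OF a(2) v])
      fix D H xs assume m: "geo_model \<Sigma> U ?S D H" and x: "tuple D \<Delta> xs"
      interpret m: geo_model \<Sigma> U ?S D H by fact
      have "H (inst \<phi> (map Var ks)) xs \<longleftrightarrow> H (exs As \<chi>) (map ((!) xs) ks)"
        using m.H_ren[OF a(2) v x] m.H_equivalent[OF a(1) tk[OF x]] by blast
      also have "\<dots> \<longleftrightarrow> (\<exists>as. tuple D As as \<and> H \<chi> (as @ map ((!) xs) ks))"
        by (rule m.H_exs[OF a(3) tk[OF x]]) blast
      also have "\<dots> \<longleftrightarrow> H (exs As ?a) xs"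
        using m.H_exs[OF wex x] ha[OF m _ x] by auto
      finally show "H (inst \<phi> (map Var ks)) xs \<longleftrightarrow> H (exs As ?a) xs" .
    qed (use wex assms in simp_all)
    fix D H xs as bs assume m: "geo_model \<Sigma> T {} D H" and x: "tuple D \<Delta> xs" and t: "tuple D As as" "tuple D As bs"
      and h: "H ?a (as @ xs)" "H ?a (bs @ xs)"
    show "as = bs"
      by (rule unique_model[OF a(5,7) m tk[OF x] t]) (use h ha[OF m t(1) x] ha[OF m t(2) x] in blast)+
  qed (use a(4) in simp_all)
qed

text \<open>Quantifiers over variables that are determined by the rest of the formula may be prefixed: both
  blocks together are again determined, first \<open>As\<close>, then the block of \<open>\<phi>\<close>.\<close>
lemma cart_exs:
  assumes c: "cart (As @ \<Gamma>) \<phi>" and S: "countable S"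
    and u: "\<And>D H xs as bs. geo_model \<Sigma> T S D H \<Longrightarrow> tuple D \<Gamma> xs \<Longrightarrow> tuple D As as \<Longrightarrow> tuple D As bs \<Longrightarrow>
      H \<phi> (as @ xs) \<Longrightarrow> H \<phi> (bs @ xs) \<Longrightarrow> as = bs"
  shows "cart \<Gamma> (exs As \<phi>)"
proof -
  obtain Bs \<chi> where a: "equivalent \<Sigma> U (As @ \<Gamma>) \<phi> (exs Bs \<chi>)" "wff \<Sigma> (As @ \<Gamma>) \<phi>" "wff \<Sigma> (As @ \<Gamma>) (exs Bs \<chi>)"
    "horn \<chi>" "unique_fm Bs (As @ \<Gamma>) \<chi>" "wf_ctx \<Sigma> (Bs @ As @ \<Gamma>)" "wff \<Sigma> (Bs @ As @ \<Gamma>) \<chi>" by (rule cartE[OF c])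
  show ?thesis
  proof (rule cartI[OF _ a(4) S])
    show "equivalent \<Sigma> U \<Gamma> (exs As \<phi>) (exs (Bs @ As) \<chi>)"
      unfolding exs_append using a(1) by (auto simp: equivalent_def intro: U.exs_mono)
    fix D H xs cs ds assume m: "geo_model \<Sigma> T S D H" and x: "tuple D \<Gamma> xs"
      and t: "tuple D (Bs @ As) cs" "tuple D (Bs @ As) ds" and h: "H \<chi> (cs @ xs)" "H \<chi> (ds @ xs)"
    interpret m: geo_model \<Sigma> T S D H by fact
    obtain bs as where cs: "cs = bs @ as" "tuple D Bs bs" "tuple D As as" using t(1) by (rule tuple_appendE)
    obtain bs' as' where ds: "ds = bs' @ as'" "tuple D Bs bs'" "tuple D As as'" using t(2) by (rule tuple_appendE)
    have T: "tuple D (As @ \<Gamma>) (as @ xs)" "tuple D (As @ \<Gamma>) (as' @ xs)" using cs ds x by simp_all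
    note e = equivalent_mono[OF a(1) sub]
    have "H \<phi> (as @ xs)"
      using m.H_exsI[OF a(3) T(1) cs(2)] h(1) m.H_equivalent[OF e T(1)] by (simp add: cs(1))
    moreover have "H \<phi> (as' @ xs)"
      using m.H_exsI[OF a(3) T(2) ds(2)] h(2) m.H_equivalent[OF e T(2)] by (simp add: ds(1))
    ultimately have "as = as'" using u[OF m x cs(3) ds(3)] by blast
    moreover from this have "bs = bs'"
      using unique_model[OF a(5,7) m T(1) cs(2) ds(2)] h by (simp add: cs(1) ds(1))
    ultimately show "cs = ds" by (simp add: cs(1) ds(1))
  qed
qed

end

text \<open>In a composite the quantified intermediate variables are unique because the first factor is
  functional.\<close>
lemma (in geo) fragment_cartesian: "fragment \<Sigma> T (cartesian \<Sigma> T)"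
proof -
  interpret E: geo_ext \<Sigma> T T by unfold_locales simp
  show ?thesis
  proof
    fix \<Gamma> \<phi> assume w: "wf_ctx \<Sigma> \<Gamma>" "wff \<Sigma> \<Gamma> \<phi>" "cartesian \<Sigma> T \<Gamma> \<phi>"
    have v: "var_tuple (\<Gamma> @ \<Gamma>) [0..<0 + length \<Gamma>] \<Gamma>" "var_tuple (\<Gamma> @ \<Gamma>) [length \<Gamma>..<length \<Gamma> + length \<Gamma>] \<Gamma>"
      by (intro vt_simps; simp)+
    have wc: "wf_ctx \<Sigma> (\<Gamma> @ \<Gamma>)" using w by simp
    have "E.cart (\<Gamma> @ \<Gamma>) (id_fm (\<Gamma>, \<phi>))"
      unfolding id_fm_eq
      by (rule E.cart_And[OF E.cart_ren[OF E.cart_cartesian[OF w(3,1)] wc v(1)] E.cart_horn[OF wc wff_eqs_ren[OF v] horn_eqs]])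
    then show "\<exists>\<kappa>. cartesian \<Sigma> T (\<Gamma> @ \<Gamma>) \<kappa> \<and> equivalent \<Sigma> T (\<Gamma> @ \<Gamma>) (id_fm (\<Gamma>, \<phi>)) \<kappa>"
      unfolding E.cart_def .
  next
    fix \<Gamma> \<Delta> \<Lambda> and \<phi> \<psi> \<chi> \<theta> \<theta>' :: "('s, 'f, 'r, 'i) fm"
    assume w: "wf_ctx \<Sigma> \<Gamma>" "wf_ctx \<Sigma> \<Delta>" "wf_ctx \<Sigma> \<Lambda>" "wff \<Sigma> \<Delta> \<psi>" "wff \<Sigma> \<Lambda> \<chi>" "wff \<Sigma> (\<Gamma> @ \<Delta>) \<theta>" "wff \<Sigma> (\<Delta> @ \<Lambda>) \<theta>'"
      and c: "cartesian \<Sigma> T (\<Gamma> @ \<Delta>) \<theta>" "cartesian \<Sigma> T (\<Delta> @ \<Lambda>) \<theta>'"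
      and f: "functional \<Sigma> T (\<Gamma>, \<phi>) (\<Delta>, \<psi>) \<theta>"
    let ?m = "length \<Gamma>" and ?n = "length \<Delta>" and ?p = "length \<Lambda>"
    have wc: "wf_ctx \<Sigma> (\<Delta> @ \<Gamma> @ \<Lambda>)" "wf_ctx \<Sigma> (\<Gamma> @ \<Delta>)" "wf_ctx \<Sigma> (\<Delta> @ \<Lambda>)" using w by simp_all
    have v: "var_tuple (\<Delta> @ \<Gamma> @ \<Lambda>) ([?n..<?n + ?m] @ [0..<0 + ?n]) (\<Gamma> @ \<Delta>)"
      "var_tuple (\<Delta> @ \<Gamma> @ \<Lambda>) ([0..<0 + ?n] @ [?n + ?m..<(?n + ?m) + ?p]) (\<Delta> @ \<Lambda>)"
      by (intro vt_simps; simp)+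
    have cb: "E.cart (\<Delta> @ \<Gamma> @ \<Lambda>) (comp_body ?m ?n ?p \<theta> \<theta>')"
      unfolding comp_body_def
      by (rule E.cart_And[OF E.cart_ren[OF E.cart_cartesian[OF c(1) wc(2)] wc(1) v(1)]
            E.cart_ren[OF E.cart_cartesian[OF c(2) wc(3)] wc(1) v(2)]])
    have "E.cart (\<Gamma> @ \<Lambda>) (comp_fm (\<Gamma>, \<phi>) (\<Delta>, \<psi>) (\<Lambda>, \<chi>) \<theta> \<theta>')"
      unfolding comp_fm_eq
    proof (rule E.cart_exs[OF cb, where S = "{}"])
      fix D H us ys ys' assume m: "geo_model \<Sigma> T {} D H" and t: "tuple D (\<Gamma> @ \<Lambda>) us" "tuple D \<Delta> ys" "tuple D \<Delta> ys'"
        and h: "H (comp_body ?m ?n ?p \<theta> \<theta>') (ys @ us)" "H (comp_body ?m ?n ?p \<theta> \<theta>') (ys' @ us)"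
      interpret m: geo_model \<Sigma> T "{}" D H by fact
      obtain xs zs where us: "us = xs @ zs" "tuple D \<Gamma> xs" "tuple D \<Lambda> zs" using t(1) by (rule tuple_appendE)
      have "H \<theta> (xs @ ys)" if y: "tuple D \<Delta> ys" and h: "H (comp_body ?m ?n ?p \<theta> \<theta>') (ys @ us)" for ys
      proof -
        have T: "tuple D (\<Delta> @ \<Gamma> @ \<Lambda>) (ys @ us)" using y us by simp
        note wb = wff_comp_body[OF w(6,7), unfolded comp_body_def wff.simps]
        show ?thesis
          using h m.H_And[OF conjunct1[OF wb] conjunct2[OF wb] T] m.H_inst_upt2[OF _ T, of ?m ?n ?n 0 \<theta>] w(6)
            tuple_length[OF y] tuple_length[OF us(2)] unfolding comp_body_def us(1) by simp
      qed
      then show "ys = ys'" using m.functional_model(2)[OF f us(2) w(4) t(2,3)] h t by blast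
    qed simp
    then show "\<exists>\<kappa>. cartesian \<Sigma> T (\<Gamma> @ \<Lambda>) \<kappa> \<and> equivalent \<Sigma> T (\<Gamma> @ \<Lambda>) (comp_fm (\<Gamma>, \<phi>) (\<Delta>, \<psi>) (\<Lambda>, \<chi>) \<theta> \<theta>') \<kappa>"
      unfolding E.cart_def .
  qed
qed

section \<open>Translating cartesian formulas\<close>

lemma horn_ubody: "horn (atom (map Var (map (upos gs) gs))) \<Longrightarrow> horn (ubody gs atom)"
  unfolding ubody_def horn.simps horn_conjs by (auto simp: ugraph_def split: trm.split)

locale rel_geo_ext = rel_geo \<Sigma> V + E: geo_ext "rel_sig \<Sigma>" V U
  for \<Sigma> :: "('s, 'f, 'r) signature" and V U :: "('s, 'f, 'r + 'f, 'i) sequent set"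
begin

lemma cart_tr_atom:
  assumes wc: "wf_ctx \<Sigma> \<Gamma>" and gs: "list_all2 (wt \<Sigma> \<Gamma>) gs As"
    and h: "horn (atom (map Var (map (upos gs) gs)))"
    and w: "\<And>\<Delta> ks. var_tuple \<Delta> ks As \<Longrightarrow> wff (rel_sig \<Sigma>) \<Delta> (atom (map Var ks))"
  shows "E.cart \<Gamma> (tr_atom \<Sigma> \<Gamma> gs atom)"
  unfolding tr_atom_eq
proof (rule E.cart_exs[where S = "atom_tasks \<Sigma> \<Gamma> gs atom"])
  have wb: "wff (rel_sig \<Sigma>) (usorts \<Sigma> \<Gamma> gs @ \<Gamma>) (ubody gs atom)"
    by (rule wff_tr_atom(1)[OF wf wc gs], erule w)
  show "E.cart (usorts \<Sigma> \<Gamma> gs @ \<Gamma>) (ubody gs atom)"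
  proof (rule E.cart_horn[OF _ wb])
    show "wf_ctx (rel_sig \<Sigma>) (usorts \<Sigma> \<Gamma> gs @ \<Gamma>)" using wc usorts_sorts[OF wf wc gs] by (simp add: wf_ctx_def)
    show "horn (ubody gs atom)" by (rule horn_ubody) (rule h)
  qed
  fix D H xs zs zs' assume m: "geo_model (rel_sig \<Sigma>) V (atom_tasks \<Sigma> \<Gamma> gs atom) D H" and x: "tuple D \<Gamma> xs"
    and z: "tuple D (usorts \<Sigma> \<Gamma> gs) zs" "tuple D (usorts \<Sigma> \<Gamma> gs) zs'"
    and hz: "H (ubody gs atom) (zs @ xs)" "H (ubody gs atom) (zs' @ xs)"
  interpret m: rel_model \<Sigma> V "atom_tasks \<Sigma> \<Gamma> gs atom" D H by (rule rel_modelI[OF m])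
  have S: "total_task \<Sigma> ` (\<Union>t\<in>set gs. set_trm t) \<subseteq> atom_tasks \<Sigma> \<Gamma> gs atom" by (simp add: atom_tasks_def)
  have "us = map (m.val xs) (uterms gs)" if u: "tuple D (usorts \<Sigma> \<Gamma> gs) us" "H (ubody gs atom) (us @ xs)" for us
  proof -
    have T: "tuple D (usorts \<Sigma> \<Gamma> gs @ \<Gamma>) (us @ xs)" using u x by simp
    note wb' = wb[unfolded ubody_def wff.simps]
    have "H (conjs (map (ugraph gs) (uterms gs))) (us @ xs)"
      using u(2) m.H_And[OF conjunct1[OF wb'] conjunct2[OF wb'] T] unfolding ubody_def by blast
    then have "\<forall>g \<in> set (uterms gs). H (ugraph gs g) (us @ xs)"
      using m.H_conjs[OF _ T, of "map (ugraph gs) (uterms gs)"] ugraph_wff[OF gs] by auto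
    then show ?thesis using m.H_ugraphs[OF gs x u(1) S] by blast
  qed
  then show "zs = zs'" using z hz by blast
qed simp

lemma cart_tr_horn:
  "wf_ctx \<Sigma> \<Gamma> \<Longrightarrow> wff \<Sigma> \<Gamma> \<chi> \<Longrightarrow> horn \<chi> \<Longrightarrow> E.cart \<Gamma> (tr \<Sigma> \<Gamma> \<chi>)"
proof (induction \<chi>)
  case (Eq s t)
  then obtain A where A: "list_all2 (wt \<Sigma> \<Gamma>) [s, t] [A, A]" by auto
  show ?case unfolding tr.simps
    by (rule cart_tr_atom[OF Eq.prems(1) A]) (simp_all add: wff_Eq_ren[simplified])
next
  case (Rel q ts)
  then have R: "q \<in> rels \<Sigma>" "list_all2 (wt \<Sigma> \<Gamma>) ts (rdom \<Sigma> q)" by auto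
  show ?case unfolding tr.simps
    by (rule cart_tr_atom[OF Rel.prems(1) R(2)]) (use R in \<open>auto intro!: wff_Rel_ren simp del: wff.simps\<close>)
next
  case Top
  then show ?case by (simp add: E.cart_horn)
next
  case (And \<phi> \<psi>)
  then show ?case by (simp add: E.cart_And)
qed simp_all

end

locale tr_sound_ext = tr_sound \<Sigma> T V + E: geo_ext "rel_sig \<Sigma>" V U
  for \<Sigma> :: "('s, 'f, 'r) signature" and T :: "('s, 'f, 'r, 'i) sequent set" and V U :: "('s, 'f, 'r + 'f, 'i) sequent set"
begin

sublocale rel_geo_ext \<Sigma> V U by unfold_locales

lemma tr_unique:
  assumes u: "A.unique_fm As \<Gamma> \<chi>" and w: "wff \<Sigma> (As @ \<Gamma>) \<chi>"
  shows "unique_fm As \<Gamma> (tr \<Sigma> (As @ \<Gamma>) \<chi>)"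
proof -
  let ?k = "length As" and ?n = "length \<Gamma>"
  note u = u[unfolded A.unique_fm_def Let_def]
  have wc: "wf_ctx \<Sigma> (As @ As @ \<Gamma>)" "wf_ctx \<Sigma> (As @ \<Gamma>)" using A.prvD[OF u] by simp_all
  have v: "var_tuple (As @ As @ \<Gamma>) [0..<0 + ?k] As" "var_tuple (As @ As @ \<Gamma>) [?k..<?k + ?k] As"
    "var_tuple (As @ As @ \<Gamma>) [2 * ?k..<2 * ?k + ?n] \<Gamma>" by (rule var_tuple_upt; simp)+
  note r = tr.F_ren[OF wc w var_tuple_app[OF v(1,3)]] tr.F_ren[OF wc w var_tuple_app[OF v(2,3)]]
  show ?thesis
    unfolding unique_fm_def Let_def
    by (rule tr.prv_equivalent[OF tr.F_prv[OF u, unfolded tr.F_And] tr.And_equivalent[OF r] tr.F_eqs[OF wc(1) v(1,2)]])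
qed

text \<open>The matrix of a cartesian formula is a conjunction of atoms, whose translations are cartesian.
  Uniqueness of the outer block is a sequent of \<open>T\<close>, and its translation is provable.\<close>
theorem cart_tr:
  assumes wc: "wf_ctx \<Sigma> \<Gamma>" and c: "cartesian \<Sigma> T \<Gamma> \<phi>"
  shows "E.cart \<Gamma> (tr \<Sigma> \<Gamma> \<phi>)"
proof -
  obtain As \<chi> where a: "\<phi> = exs As \<chi>" "horn \<chi>" "A.unique_fm As \<Gamma> \<chi>" "wff \<Sigma> \<Gamma> (exs As \<chi>)"
    using c by (auto simp: A.cartesian_iff)
  have w: "wff \<Sigma> (As @ \<Gamma>) \<chi>" "wf_ctx \<Sigma> (As @ \<Gamma>)" using a(4) wc by (auto simp: wf_ctx_def)
  have wt: "wff (rel_sig \<Sigma>) (As @ \<Gamma>) (tr \<Sigma> (As @ \<Gamma>) \<chi>)" by (rule wff_tr[OF wf w(2,1)])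
  show ?thesis unfolding a(1) tr.F_exs
    by (rule E.cart_exs[OF cart_tr_horn[OF w(2,1) a(2)], where S = "{}"])
      (simp, rule unique_model[OF tr_unique[OF a(3) w(1)] wt])
qed

end

context tr_equiv
begin

lemma untr_cartesian: "cartesian (rel_sig \<Sigma>) U \<Gamma> \<phi> \<Longrightarrow> cartesian \<Sigma> T \<Gamma> (untr \<phi>)"
proof -
  assume "cartesian (rel_sig \<Sigma>) U \<Gamma> \<phi>"
  then obtain As \<chi> where a: "wff (rel_sig \<Sigma>) \<Gamma> \<phi>" "\<phi> = exs As \<chi>" "horn \<chi>" "unique_fm As \<Gamma> \<chi>"
    unfolding cartesian_iff by blast
  have "wff (rel_sig \<Sigma>) (As @ \<Gamma>) \<chi>" using a(1,2) by simp
  then have "horn (untr \<chi>)" using a(3) by (rule horn_untr)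
  moreover have "A.unique_fm As \<Gamma> (untr \<chi>)"
    using untr_prv[OF a(4)[unfolded unique_fm_def Let_def]]
    unfolding A.unique_fm_def Let_def untr.simps untr_inst untr_eqs .
  moreover have "untr \<phi> = exs As (untr \<chi>)" by (simp add: a(2) untr_exs)
  ultimately show ?thesis unfolding A.cartesian_iff using wff_untr[OF a(1)] by blast
qed

theorem tr_cartesian_equivalence:
  "\<exists>G. (\<forall>X \<in> Ob (C_car \<Sigma> T). fst (G X) = fst (tr_ob \<Sigma> X) \<and>
          equivalent (rel_sig \<Sigma>) U (fst X) (snd (G X)) (snd (tr_ob \<Sigma> X))) \<and>
      is_equivalence (C_car \<Sigma> T) (C_car (rel_sig \<Sigma>) U) G (class_map (rel_sig \<Sigma>) U (tr \<Sigma>))"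
proof -
  interpret E: tr_sound_ext \<Sigma> T U U by unfold_locales simp
  interpret PA: fragment \<Sigma> T "cartesian \<Sigma> T" by (rule A.fragment_cartesian)
  have tr: "\<exists>\<phi>'. cartesian (rel_sig \<Sigma>) U \<Gamma> \<phi>' \<and> equivalent (rel_sig \<Sigma>) U \<Gamma> (tr \<Sigma> \<Gamma> \<phi>) \<phi>'"
    if "wf_ctx \<Sigma> \<Gamma>" "cartesian \<Sigma> T \<Gamma> \<phi>" for \<Gamma> \<phi>
    using E.cart_tr[OF that] unfolding E.E.cart_def .
  define g where "g X = (SOME \<phi>'. cartesian (rel_sig \<Sigma>) U (fst X) \<phi>' \<and> equivalent (rel_sig \<Sigma>) U (fst X) (tr \<Sigma> (fst X) (snd X)) \<phi>')" for X
  have g: "cartesian (rel_sig \<Sigma>) U (fst X) (g X) \<and> equivalent (rel_sig \<Sigma>) U (fst X) (tr \<Sigma> (fst X) (snd X)) (g X)"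
    if "X \<in> Ob PA.\<C>" for X
  proof -
    have "wf_ctx \<Sigma> (fst X)" "cartesian \<Sigma> T (fst X) (snd X)" using that by (cases X; simp add: PA.Ob_iff)+
    from someI_ex[OF tr[OF this]] show ?thesis unfolding g_def .
  qed
  have "is_equivalence PA.\<C> (syn_cat (rel_sig \<Sigma>) U (cartesian (rel_sig \<Sigma>) U)) (\<lambda>X. (fst X, g X)) (class_map (rel_sig \<Sigma>) U (tr \<Sigma>))"
    by (rule tr_is_equivalence[OF A.fragment_cartesian fragment_cartesian tr untr_cartesian]) (use g in simp_all)
  then show ?thesis
    unfolding C_car_def
    by (intro exI[of _ "\<lambda>X. (fst X, g X)"] conjI) (use g equivalent_sym in \<open>auto simp: tr_ob_def\<close>)
qed

end

lemma rel_theory0_cartesian: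
  fixes \<Sigma> :: "('s, 'f, 'r) signature" and V :: "('s, 'f, 'r + 'f, 'i) sequent set"
  assumes "rel_geo \<Sigma> V" "(\<Gamma>, \<phi>, \<psi>) \<in> rel_theory0 \<Sigma>"
  shows "cartesian (rel_sig \<Sigma>) V \<Gamma> \<phi> \<and> cartesian (rel_sig \<Sigma>) V \<Gamma> \<psi>"
proof -
  interpret rel_geo \<Sigma> V by fact
  have w: "wf_ctx (rel_sig \<Sigma>) \<Gamma>" "wff (rel_sig \<Sigma>) \<Gamma> \<phi>" "wff (rel_sig \<Sigma>) \<Gamma> \<psi>"
    using rel_theory0_geometric[OF wf] assms(2) unfolding geometric_theory_def by fastforce+
  show ?thesis
    using assms(2)
  proof (cases rule: rel_theory0_cases)
    case (unique f)
    have "horn \<phi>" "horn \<psi>" by (simp_all add: unique)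
    then show ?thesis using cartesian_horn w by blast
  next
    case (total f)
    let ?n = "length (fdom \<Sigma> f)"
    let ?\<chi> = "Rel (Inr f) (map Var ([1..<1 + ?n] @ [0])) :: ('s, 'f, 'r + 'f, 'i) fm"
    have e: "\<psi> = exs [fcod \<Sigma> f] ?\<chi>" by (simp add: total exs_def)
    have "unique_fm [fcod \<Sigma> f] \<Gamma> ?\<chi>"
    proof (rule unique_fmI[where S = "{}"])
      show wc: "wf_ctx (rel_sig \<Sigma>) ([fcod \<Sigma> f] @ \<Gamma>)" and wx: "wff (rel_sig \<Sigma>) ([fcod \<Sigma> f] @ \<Gamma>) ?\<chi>"
        using w(1,3) by (auto simp: e wf_ctx_def simp del: upt_Suc)
      fix D H xs as bs assume m: "geo_model (rel_sig \<Sigma>) V {} D H" and x: "tuple D \<Gamma> xs"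
        and t: "tuple D [fcod \<Sigma> f] as" "tuple D [fcod \<Sigma> f] bs" and h: "H ?\<chi> (as @ xs)" "H ?\<chi> (bs @ xs)"
      interpret m: rel_model \<Sigma> V "{}" D H by (rule rel_modelI[OF m])
      obtain a where a: "as = [a]" "a \<in> D (fcod \<Sigma> f)" using t(1) by (auto elim: tuple_ConsE)
      obtain b where b: "bs = [b]" "b \<in> D (fcod \<Sigma> f)" using t(2) by (auto elim: tuple_ConsE)
      have x': "tuple D (fdom \<Sigma> f) xs" using x total(2) by simp
      have v: "var_tuple (fcod \<Sigma> f # fdom \<Sigma> f) ([1..<1 + ?n] @ [0]) (rdom (rel_sig \<Sigma>) (Inr f))"
        unfolding rel_sig_simps by (rule var_tuple_app[OF var_tuple_upt]; simp add: var_tuple_def)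
      have q: "Inr f \<in> rels (rel_sig \<Sigma>)" using total(1) by simp
      have "m.R (Inr f) (xs @ [c])" if c: "c \<in> D (fcod \<Sigma> f)" "H ?\<chi> (c # xs)" for c
      proof -
        have "tuple D (fcod \<Sigma> f # fdom \<Sigma> f) (c # xs)" using c x' by simp
        from m.H_Rel[OF q v this] c(2) have "m.R (Inr f) (map ((!) (c # xs)) ([1..<1 + ?n] @ [0]))" by blast
        also have "map ((!) (c # xs)) ([1..<1 + ?n] @ [0]) = xs @ [c]"
          unfolding map_append using tuple_length[OF x'] by (subst map_nth_upt) auto
        finally show ?thesis .
      qed
      then show "as = bs" using m.app_unique[OF total(1) x' a(2) b(2)] a b h by simp
    qed simp
    then have "cartesian (rel_sig \<Sigma>) V \<Gamma> \<psi>" unfolding cartesian_iff using w(3) e by force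
    moreover have "cartesian (rel_sig \<Sigma>) V \<Gamma> \<phi>" by (rule cartesian_horn[OF w(1,2)]) (simp add: total)
    ultimately show ?thesis by blast
  qed
qed

text \<open>The translated axioms are in general not between cartesian formulas, only between formulas equivalent to such.
  The set \<open>W\<close> of all theorems of \<open>rel_theory \<Sigma> T\<close> between cartesian formulas is an axiomatization: it contains
  the axioms on function symbols, which prove the equivalence of a translated axiom of \<open>T'\<close> with an element
  of \<open>W\<close>. Hence \<open>W\<close> proves the translations of all theorems of \<open>T'\<close>, in particular those of the axioms of \<open>T\<close>.\<close>
theorem rel_theory_cartesian:
  fixes \<Sigma> :: "('s, 'f, 'r) signature" and T :: "('s, 'f, 'r, 'i) sequent set"
  assumes wf: "wf_signature \<Sigma>" and c: "cartesian_theory \<Sigma> T"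
  shows "cartesian_theory (rel_sig \<Sigma>) (rel_theory \<Sigma> T)"
proof -
  have g: "geometric_theory \<Sigma> T" using c by (simp add: cartesian_theory_def)
  obtain T' where g': "geometric_theory \<Sigma> T'"
    and c': "\<And>\<Gamma> \<phi> \<psi>. (\<Gamma>, \<phi>, \<psi>) \<in> T' \<Longrightarrow> cartesian \<Sigma> T \<Gamma> \<phi> \<and> cartesian \<Sigma> T \<Gamma> \<psi>"
    and e: "\<And>\<Gamma> \<phi> \<psi>. provable \<Sigma> T' \<Gamma> \<phi> \<psi> \<longleftrightarrow> provable \<Sigma> T \<Gamma> \<phi> \<psi>"
    using c unfolding cartesian_theory_def by fast
  let ?V = "rel_theory \<Sigma> T" and ?U = "rel_theory0 \<Sigma> :: ('s, 'f, 'r + 'f, 'i) sequent set"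
  interpret V: tr_equiv \<Sigma> T ?V by (rule tr_equiv_rel_theory[OF wf g])
  interpret T': geo \<Sigma> T' by unfold_locales (rule wf g')+
  have UV: "?U \<subseteq> ?V" by (auto simp: rel_theory_def)
  interpret E: tr_sound_ext \<Sigma> T ?V ?U
    by unfold_locales (use wf_rel_sig[OF wf] rel_theory0_geometric[OF wf] UV in auto)
  define W where "W = {(\<Gamma>, \<phi>, \<psi>). V.prv \<Gamma> \<phi> \<psi> \<and> cartesian (rel_sig \<Sigma>) ?V \<Gamma> \<phi> \<and> cartesian (rel_sig \<Sigma>) ?V \<Gamma> \<psi>}"
  have gW: "geometric_theory (rel_sig \<Sigma>) W" unfolding geometric_theory_def W_def using V.prvD by blast
  have UW: "?U \<subseteq> W"
  proof clarify
    fix \<Gamma> \<phi> \<psi> assume a: "(\<Gamma>, \<phi>, \<psi>) \<in> ?U"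
    then have "V.prv \<Gamma> \<phi> \<psi>" using UV by (blast intro: provable.Axiom)
    then show "(\<Gamma>, \<phi>, \<psi>) \<in> W" using rel_theory0_cartesian[OF V.rel_geo_axioms a] by (simp add: W_def)
  qed
  interpret W: geo "rel_sig \<Sigma>" W by unfold_locales (rule wf_rel_sig[OF wf] gW)+
  interpret W: rel_geo \<Sigma> W by unfold_locales (rule wf UW)+
  interpret W: tr_sound \<Sigma> T' W
  proof unfold_locales
    fix \<Gamma> \<phi> \<psi> assume a: "(\<Gamma>, \<phi>, \<psi>) \<in> T'"
    have p: "V.prv \<Gamma> (tr \<Sigma> \<Gamma> \<phi>) (tr \<Sigma> \<Gamma> \<psi>)" using V.tr_prv e provable.Axiom[OF a] by blast
    have wc: "wf_ctx \<Sigma> \<Gamma>" using V.prvD[OF p] by simp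
    obtain \<phi>' where 1: "cartesian (rel_sig \<Sigma>) ?V \<Gamma> \<phi>'" "equivalent (rel_sig \<Sigma>) ?U \<Gamma> (tr \<Sigma> \<Gamma> \<phi>) \<phi>'"
      using E.cart_tr[OF wc] c'[OF a] unfolding E.E.cart_def by blast
    obtain \<psi>' where 2: "cartesian (rel_sig \<Sigma>) ?V \<Gamma> \<psi>'" "equivalent (rel_sig \<Sigma>) ?U \<Gamma> (tr \<Sigma> \<Gamma> \<psi>) \<psi>'"
      using E.cart_tr[OF wc] c'[OF a] unfolding E.E.cart_def by blast
    have "V.prv \<Gamma> \<phi>' \<psi>'" by (rule V.tr.prv_equivalent[OF p equivalent_mono[OF 1(2) UV] equivalent_mono[OF 2(2) UV]])
    then have "W.prv \<Gamma> \<phi>' \<psi>'" using 1(1) 2(1) by (intro provable.Axiom) (simp add: W_def)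
    then show "W.prv \<Gamma> (tr \<Sigma> \<Gamma> \<phi>) (tr \<Sigma> \<Gamma> \<psi>)"
      using equivalent_mono[OF 1(2) UW] equivalent_mono[OF 2(2) UW] unfolding equivalent_def by (meson provable.Cut)
  qed
  have "W.prv \<Gamma> \<phi> \<psi> \<longleftrightarrow> V.prv \<Gamma> \<phi> \<psi>" for \<Gamma> \<phi> \<psi>
  proof
    assume "W.prv \<Gamma> \<phi> \<psi>"
    then show "V.prv \<Gamma> \<phi> \<psi>" by (rule provable_from_axioms) (simp add: W_def)
  next
    assume "V.prv \<Gamma> \<phi> \<psi>"
    then show "W.prv \<Gamma> \<phi> \<psi>"
    proof (rule provable_from_axioms)
      fix \<Gamma> \<phi> \<psi> assume "(\<Gamma>, \<phi>, \<psi>) \<in> ?V"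
      then consider "(\<Gamma>, \<phi>, \<psi>) \<in> ?U" | \<phi>' \<psi>' where "\<phi> = tr \<Sigma> \<Gamma> \<phi>'" "\<psi> = tr \<Sigma> \<Gamma> \<psi>'" "(\<Gamma>, \<phi>', \<psi>') \<in> T"
        by (auto simp: rel_theory_def)
      then show "W.prv \<Gamma> \<phi> \<psi>"
      proof cases
        case 1
        then show ?thesis using UW by (blast intro: provable.Axiom)
      next
        case 2
        then have "T'.prv \<Gamma> \<phi>' \<psi>'" unfolding e by (blast intro: provable.Axiom)
        then show ?thesis unfolding 2(1,2) by (rule W.tr_prv)
      qed
    qed
  qed
  then show ?thesis
    unfolding cartesian_theory_def using rel_theory_geometric[OF wf g] gW
    by (intro conjI exI[of _ W]) (auto simp: W_def)
qed

section \<open>The theorem\<close>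

lemma rel_theory0_regular:
  assumes "(\<Gamma>, \<phi>, \<psi>) \<in> rel_theory0 \<Sigma>"
  shows "regular \<phi> \<and> regular \<psi> \<and> coherent \<phi> \<and> coherent \<psi>"
  using assms by (cases rule: rel_theory0_cases) simp_all

theorem mainTheorem17:
  fixes \<Sigma> :: "('s, 'f, 'r) signature"
    and T :: "('s, 'f, 'r, 'i) sequent set"
  assumes "wf_signature \<Sigma>"
    and "geometric_theory \<Sigma> T"
  shows "is_equivalence (C_geo \<Sigma> T) (C_geo (rel_sig \<Sigma>) (rel_theory \<Sigma> T)) (tr_ob \<Sigma>) (tr_mor \<Sigma> T)
    \<and> (coherent_theory \<Sigma> T \<longrightarrow>
         coherent_theory (rel_sig \<Sigma>) (rel_theory \<Sigma> T) \<and>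
         is_equivalence (C_coh \<Sigma> T) (C_coh (rel_sig \<Sigma>) (rel_theory \<Sigma> T)) (tr_ob \<Sigma>) (tr_mor \<Sigma> T))
    \<and> (regular_theory \<Sigma> T \<longrightarrow>
         regular_theory (rel_sig \<Sigma>) (rel_theory \<Sigma> T) \<and>
         is_equivalence (C_reg \<Sigma> T) (C_reg (rel_sig \<Sigma>) (rel_theory \<Sigma> T)) (tr_ob \<Sigma>) (tr_mor \<Sigma> T))
    \<and> (cartesian_theory \<Sigma> T \<longrightarrow>
         cartesian_theory (rel_sig \<Sigma>) (rel_theory \<Sigma> T) \<and>
         restricts_to_cartesian_equivalence \<Sigma> T)"
proof (intro conjI impI)
  interpret tr_equiv \<Sigma> T "rel_theory \<Sigma> T" by (rule tr_equiv_rel_theory[OF assms])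
  have rc: "regular_closed (\<lambda>\<phi>. True)" by (simp add: regular_closed_def)
  show "is_equivalence (C_geo \<Sigma> T) (C_geo (rel_sig \<Sigma>) (rel_theory \<Sigma> T)) (tr_ob \<Sigma>) (tr_mor \<Sigma> T)"
    unfolding C_geo_def by (rule regular_closed_equivalence[OF assms rc rc]) simp_all
  show "is_equivalence (C_coh \<Sigma> T) (C_coh (rel_sig \<Sigma>) (rel_theory \<Sigma> T)) (tr_ob \<Sigma>) (tr_mor \<Sigma> T)"
    unfolding C_coh_def
    by (rule regular_closed_equivalence[OF assms regular_closed_coherent regular_closed_coherent coherent_tr coherent_untr])
  show "is_equivalence (C_reg \<Sigma> T) (C_reg (rel_sig \<Sigma>) (rel_theory \<Sigma> T)) (tr_ob \<Sigma>) (tr_mor \<Sigma> T)"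
    unfolding C_reg_def
    by (rule regular_closed_equivalence[OF assms regular_closed_regular regular_closed_regular regular_tr regular_untr])
  show "restricts_to_cartesian_equivalence \<Sigma> T"
    unfolding restricts_to_cartesian_equivalence_def tr_mor_eq by (rule tr_cartesian_equivalence)
  show "coherent_theory (rel_sig \<Sigma>) (rel_theory \<Sigma> T)" if "coherent_theory \<Sigma> T"
    using that rel_theory_geometric[OF assms] rel_theory0_regular coherent_tr
    unfolding coherent_theory_def rel_theory_def by fast
  show "regular_theory (rel_sig \<Sigma>) (rel_theory \<Sigma> T)" if "regular_theory \<Sigma> T"
    using that rel_theory_geometric[OF assms] rel_theory0_regular regular_tr
    unfolding regular_theory_def rel_theory_def by fast
  show "cartesian_theory (rel_sig \<Sigma>) (rel_theory \<Sigma> T)" if "cartesian_theory \<Sigma> T"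
    by (rule rel_theory_cartesian[OF assms(1) that])
qed

end
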